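(* Let $(K,\mu)$ be a Markov system on a compact metric space $\Sigma$ and $A\in\mathscr{B}^\infty_m(K)$. Assume (1) $(K,\mu)$ is strongly mixing, (2) $A$ is irreducible, (3) $L_1(A)>L_2(A)$. Then there exist a neighborhood $\mathscr{V}$ of $A$ in $\mathscr{B}^\infty_m(K)$ and constants $C>0$, $k>0$, $\varepsilon_0>0$ such that for all $0<\varepsilon<\varepsilon_0$, $B\in\mathscr{V}$ and $n\in\mathbb{N}$, $$\mathbb{P}_\mu\left[\left|\frac1n\log\|B^{(n)}\|-L_1(B)\right|>\varepsilon\right]\le C\,e^{-k\,\varepsilon^2\,n}.$$
   Context: $\Sigma$ is a compact metric space with Borel $\sigma$-field $\mathscr{F}$. A Markov kernel is $K:\Sigma\times\mathscr{F}\to[0,1]$ with $K(x,\cdot)$ a probability measure for every $x$ and $K(\cdot,A)$ measurable for every $A$; $K^1=K$, $K^{n+1}(x,A)=\int_\Sigma K^n(y,A)K(x,dy)$. A probability $\mu$ is $K$-stationary if $\mu(A)=\int K(x,A)\mu(dx)$ for all $A$; a Markov system is a pair $(K,\mu)$ with $\mu$ $K$-stationary. It is strongly mixing if there are $C>0$, $0<\rho<1$ with $|\int f(y)K^n(x,dy)-\int f\,d\mu|\le C\rho^n\|f\|_\infty$ for all bounded measurable $f:\Sigma\to\mathbb{C}$, $x\in\Sigma$, $n\in\mathbb{N}$ (sup norm). $X=\Sigma^{\mathbb{Z}}$, $T$ is the shift, $\mathbb{P}_\mu$ is the $T$-invariant Borel probability on $X$ which is the law of the stationary Markov chain with kernel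 $K$ and marginal $\mu$. $\mathscr{B}^\infty_m(K)$ is the set of measurable $A:\Sigma\times\Sigma\to GL(m,\mathbb{R})$ with $A$, $A^{-1}$ uniformly bounded, with metric $d_\infty(A,B)=\|A-B\|_\infty=\sup_{x,y}\|A(x,y)-B(x,y)\|$. For $x\in X$, $A^{(n)}(x)=A(x_{n-1},x_n)\cdots A(x_1,x_2)A(x_0,x_1)$. Lyapunov exponents: $\Lambda_0(A)=0$, $\Lambda_j(A)=\lim_n\frac1n\log\|\wedge_jA^{(n)}(x)\|$ for $\mathbb{P}_\mu$-a.e. $x$, $L_j(A)=\Lambda_j(A)-\Lambda_{j-1}(A)$. A measurable $V:\Sigma\to\mathrm{Gr}(\mathbb{R}^m)$ (Grassmannian of linear subspaces) is $A$-invariant if $A(x_{n-1},x_n)V(x_{n-1})=V(x_n)$ for $\mathbb{P}_\mu$-a.e. $x$ (all $n$); its dimension is $\mu$-a.e. constant under strong mixing and it is proper if $0<\dim V<m$. $A$ is irreducible if it admits no measurable proper $A$-invariant section. *)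

theory Defs
  imports "HOL-Probability.Probability"
begin

section \<open>Markov systems\<close>

text \<open>
  The state space is a type \<open>'a\<close> of class \<open>polish_space\<close> with \<open>compact (UNIV :: 'a set)\<close>.
  Every compact metric space is complete and separable, so this class is no restriction.
  A Markov kernel is an element of \<open>borel \<rightarrow>\<^sub>M prob_algebra borel\<close>.
\<close>

primrec kernel_pow :: "('a::topological_space \<Rightarrow> 'a measure) \<Rightarrow> nat \<Rightarrow> 'a \<Rightarrow> 'a measure" where
  "kernel_pow K 0 = (\<lambda>x. return borel x)"
| "kernel_pow K (Suc n) = (\<lambda>x. K x \<bind> kernel_pow K n)"

definition markov_system :: "('a::topological_space \<Rightarrow> 'a measure) \<Rightarrow> 'a measure \<Rightarrow> bool" where
  "markov_system K \<mu> \<longleftrightarrow>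
     K \<in> borel \<rightarrow>\<^sub>M prob_algebra borel \<and>
     \<mu> \<in> space (prob_algebra borel) \<and>
     (\<forall>S\<in>sets borel. emeasure \<mu> S = (\<integral>\<^sup>+ x. emeasure (K x) S \<partial>\<mu>))"

definition strongly_mixing :: "('a::topological_space \<Rightarrow> 'a measure) \<Rightarrow> 'a measure \<Rightarrow> bool" where
  "strongly_mixing K \<mu> \<longleftrightarrow>
     (\<exists>C>0. \<exists>\<rho>. 0 < \<rho> \<and> \<rho> < 1 \<and>
       (\<forall>f::'a \<Rightarrow> complex. f \<in> borel_measurable borel \<longrightarrow> bounded (range f) \<longrightarrow>
         (\<forall>x. \<forall>n\<ge>1. cmod ((LINT y|kernel_pow K n x. f y) - (LINT y|\<mu>. f y))
                    \<le> C * \<rho> ^ n * (SUP y. cmod (f y)))))"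

text \<open>
  \<open>path_prob K [S\<^sub>0, \<dots>, S\<^sub>n] x\<close> is the probability that the chain started at \<open>x\<close> is in
  \<open>S\<^sub>i\<close> at time \<open>i\<close> for \<open>i = 0, \<dots>, n\<close>.
\<close>

primrec path_prob :: "('a \<Rightarrow> 'a measure) \<Rightarrow> 'a set list \<Rightarrow> 'a \<Rightarrow> ennreal" where
  "path_prob K [] x = 1"
| "path_prob K (S # Ss) x = indicator S x * (\<integral>\<^sup>+ y. path_prob K Ss y \<partial>K x)"

text \<open>
  The law on \<open>\<Sigma>\<^sup>\<int>\<close> of the two-sided stationary chain, given by its values on all cylinders. The
  cylinders form a generating \<open>\<pi>\<close>-system, so at most one measure satisfies this, and
  Kolmogorov's extension theorem provides it. As the starting time \<open>s\<close> is arbitrary, the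
  measure is shift-invariant.
\<close>

definition stationary_chain_law ::
    "('a::topological_space \<Rightarrow> 'a measure) \<Rightarrow> 'a measure \<Rightarrow> (int \<Rightarrow> 'a) measure \<Rightarrow> bool" where
  "stationary_chain_law K \<mu> P \<longleftrightarrow>
     prob_space P \<and>
     sets P = sets (Pi\<^sub>M UNIV (\<lambda>_::int. borel)) \<and>
     (\<forall>(s::int) Ss. set Ss \<subseteq> sets borel \<longrightarrow>
        emeasure P {x \<in> space P. \<forall>i<length Ss. x (s + int i) \<in> Ss ! i}
          = (\<integral>\<^sup>+ x. path_prob K Ss x \<partial>\<mu>))"

section \<open>Linear cocycles\<close>

abbreviation opnorm :: "real^'n^'m \<Rightarrow> real" where
  "opnorm M \<equiv> onorm ((*v) M)"

definition cocycles :: "('a::topological_space \<times> 'a \<Rightarrow> real^'m^'m) set" where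
  "cocycles = {A. A \<in> borel_measurable borel \<and> (\<forall>z. invertible (A z)) \<and>
                  bounded (range A) \<and> bounded (range (\<lambda>z. matrix_inv (A z)))}"

definition d_inf :: "('b \<Rightarrow> real^'m^'m) \<Rightarrow> ('b \<Rightarrow> real^'m^'m) \<Rightarrow> real" where
  "d_inf A B = (SUP z. opnorm (A z - B z))"

definition cocycle_nhd ::
    "('a::topological_space \<times> 'a \<Rightarrow> real^'m^'m) \<Rightarrow> ('a \<times> 'a \<Rightarrow> real^'m^'m) set \<Rightarrow> bool" where
  "cocycle_nhd A V \<longleftrightarrow> V \<subseteq> cocycles \<and> (\<exists>\<delta>>0. {B \<in> cocycles. d_inf A B < \<delta>} \<subseteq> V)"

primrec iterate :: "('a \<times> 'a \<Rightarrow> real^'m^'m) \<Rightarrow> nat \<Rightarrow> (int \<Rightarrow> 'a) \<Rightarrow> real^'m^'m" where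
  "iterate A 0 x = mat 1"
| "iterate A (Suc n) x = A (x (int n), x (int n + 1)) ** iterate A n x"

section \<open>Lyapunov exponents\<close>

text \<open>
  For a \<open>j\<close>-element set \<open>I = {i\<^sub>1 < \<dots> < i\<^sub>j}\<close> put \<open>e\<^sub>I = e\<^bsub>i\<^sub>1\<^esub> \<and> \<dots> \<and> e\<^bsub>i\<^sub>j\<^esub>\<close>; these vectors are the
  standard orthonormal basis of the \<open>j\<close>-th exterior power of \<open>\<real>\<^sup>m\<close>. The matrix of the \<open>j\<close>-th
  exterior power of \<open>g\<close> in this basis consists of the \<open>j \<times> j\<close> minors of \<open>g\<close>. We index it by all
  subsets of the index type and fill the remaining entries with zeros, which does not change the
  operator norm. The linear order on the index type only fixes the signs of the \<open>e\<^sub>I\<close>.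
\<close>

definition minor :: "real^('m::{finite,linorder})^('m::{finite,linorder}) \<Rightarrow> 'm set \<Rightarrow> 'm set \<Rightarrow> real" where
  "minor g I J = (\<Sum>p | p permutes {..<card I}. of_int (sign p) *
     (\<Prod>k<card I. g $ (sorted_list_of_set I ! k) $ (sorted_list_of_set J ! p k)))"

definition ext_power :: "nat \<Rightarrow> real^('m::{finite,linorder})^('m::{finite,linorder}) \<Rightarrow> real^('m set)^('m set)" where
  "ext_power j g = (\<chi> I J. if card I = j \<and> card J = j then minor g I J else 0)"

text \<open>
  With \<open>log 0 = -\<infinity>\<close> the exponents \<open>\<Lambda>\<^sub>j\<close> have their usual meaning for every \<open>j\<close>; they are finite for
  \<open>j \<le> m\<close> and equal to \<open>-\<infinity>\<close> for \<open>j > m\<close>. In particular \<open>L\<^sub>2 = -\<infinity>\<close> for \<open>m = 1\<close>.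
  (\<open>L\<^sub>j\<close> is meaningless for \<open>j > m + 1\<close>.)
\<close>

definition elog :: "real \<Rightarrow> ereal" where
  "elog t = (if t = 0 then -\<infinity> else ereal (ln t))"

definition Lyap_Lambda ::
    "(int \<Rightarrow> 'a) measure \<Rightarrow> ('a \<times> 'a \<Rightarrow> real^('m::{finite,linorder})^('m::{finite,linorder})) \<Rightarrow> nat \<Rightarrow> ereal" where
  "Lyap_Lambda P A j =
     (THE l. AE x in P. (\<lambda>n. elog (opnorm (ext_power j (iterate A n x))) / ereal (real n)) \<longlonglongrightarrow> l)"

text \<open>Only used for \<open>j \<ge> 1\<close>.\<close>

definition Lyap ::
    "(int \<Rightarrow> 'a) measure \<Rightarrow> ('a \<times> 'a \<Rightarrow> real^('m::{finite,linorder})^('m::{finite,linorder})) \<Rightarrow> nat \<Rightarrow> ereal" where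
  "Lyap P A j = Lyap_Lambda P A j - Lyap_Lambda P A (j - 1)"

section \<open>Invariant sections and irreducibility\<close>

text \<open>
  The Grassmannian of all linear subspaces with the Borel \<open>\<sigma>\<close>-algebra of the metric
  \<open>d(V, W) = \<parallel>P\<^sub>V - P\<^sub>W\<parallel>\<close>, where \<open>P\<^sub>V\<close> is the orthogonal projection onto \<open>V\<close>, that is, the map to the
  closest point of \<open>V\<close>. Since \<open>V \<mapsto> P\<^sub>V\<close> is an isometric embedding for this metric, the
  \<open>\<sigma>\<close>-algebra is the pullback of the Borel sets of matrices.
\<close>

definition proj_matrix :: "(real^'m) set \<Rightarrow> real^'m^'m" where
  "proj_matrix V = matrix (closest_point V)"

definition grassmannian :: "(real^'m) set measure" where
  "grassmannian = vimage_algebra {V. subspace V} proj_matrix borel"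

definition invariant_section ::
    "(int \<Rightarrow> 'a) measure \<Rightarrow> ('a::topological_space \<times> 'a \<Rightarrow> real^'m^'m) \<Rightarrow> ('a \<Rightarrow> (real^'m) set) \<Rightarrow> bool" where
  "invariant_section P A V \<longleftrightarrow>
     V \<in> borel \<rightarrow>\<^sub>M grassmannian \<and>
     (AE x in P. \<forall>n::int. (*v) (A (x (n - 1), x n)) ` V (x (n - 1)) = V (x n))"

definition proper_section :: "'a measure \<Rightarrow> ('a \<Rightarrow> (real^'m) set) \<Rightarrow> bool" where
  "proper_section \<mu> V \<longleftrightarrow> (\<exists>d. 0 < d \<and> d < CARD('m) \<and> (AE x in \<mu>. dim (V x) = d))"

definition irreducible_cocycle ::
    "'a measure \<Rightarrow> (int \<Rightarrow> 'a) measure \<Rightarrow> ('a::topological_space \<times> 'a \<Rightarrow> real^'m^'m) \<Rightarrow> bool" where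
  "irreducible_cocycle \<mu> P A \<longleftrightarrow> \<not> (\<exists>V. invariant_section P A V \<and> proper_section \<mu> V)"

end

theory Submission
  imports Defs
begin

text \<open>
  The vectors that grow slower than \<open>\<parallel>A\<^sup>n\<parallel>\<close> with probability one form a subspace depending on the
  starting point. By a zero-one law for the chain, either these subspaces form a proper invariant
  section or no vector grows slower with positive probability. Irreducibility leaves the second case,
  in which the expectation of \<open>ln \<parallel>A\<^sup>n v\<parallel> / n\<close> converges to \<open>L\<^sub>1\<close>, uniformly in the direction \<open>v\<close> and in the
  starting point. Combined with \<open>L\<^sub>1 > L\<^sub>2\<close>, it follows that for some \<open>N\<close> and \<open>\<alpha> > 0\<close> the expectation of
  \<open>d(A\<^sup>N v, A\<^sup>N w)\<^sup>\<alpha>\<close> is at most \<open>\<kappa> d(v, w)\<^sup>\<alpha>\<close> on projective space, with \<open>\<kappa> < 1\<close>. This strict inequality persists,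
  with the same constants, for all cocycles \<open>B\<close> near \<open>A\<close>.

  For such \<open>B\<close>, contraction and mixing imply that the expectation of \<open>ln \<parallel>B\<^sup>n v\<parallel>\<close> differs from \<open>n L\<^sub>1(B)\<close> by a
  bounded amount, whatever the direction and the starting point. So \<open>ln \<parallel>B\<^sup>n v\<parallel> - n L\<^sub>1(B)\<close> is a
  martingale with bounded increments up to a bounded error. Hoeffding's bound on the exponential
  moments, with constants that do not depend on \<open>B\<close>, gives the estimate for \<open>\<parallel>B\<^sup>n v\<parallel>\<close>, and applying it to the
  basis vectors gives the one for \<open>\<parallel>B\<^sup>n\<parallel>\<close>.
\<close>

section \<open>Paths of a Markov chain\<close>

text \<open>Two obstacles shape the proof. The cocycle is only measurable in the base, so uniformity
  in the starting point cannot come from continuity. Quantities are therefore optimised over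
  directions first, where compactness of the sphere and a countable dense set yield a measurable
  function of the state, and mixing then replaces the value at a point by the mean over
  \<open>\<mu>\<close>. Moreover the constants must be common to all nearby cocycles, whereas
  Lyapunov exponents are limits and need not survive a perturbation. The gap is thus turned into a
  drift inequality at one finite time \<open>N\<close>: comparing \<open>A\<close> and
  \<open>B\<close> at time \<open>N\<close> costs a constant that does not depend on
  \<open>N\<close>, so \<open>N\<close> is chosen to make the drift of \<open>A\<close> more
  negative than this constant, and only then is the distance between \<open>A\<close> and
  \<open>B\<close> limited. After that every constant is an explicit function of the bound
  \<open>b\<close>, of \<open>N\<close>, of the contraction factor, of a mixing time and of the
  dimension. The exponent of \<open>B\<close> is identified last: the deviation estimate holds about
  some centre \<open>L\<close>, and Kingman's theorem forces \<open>L\<close> to be the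
  exponent.\<close>

abbreviation path_space :: "(nat \<Rightarrow> 'a::topological_space) measure" where
  "path_space \<equiv> Pi\<^sub>M UNIV (\<lambda>_. borel)"

lemma space_path_space [simp]: "space path_space = UNIV"
  by (simp add: space_PiM)

lemma prod_emb_path:
  fixes A :: "nat \<Rightarrow> 'a::topological_space set"
  shows "prod_emb UNIV (\<lambda>_. borel) J (Pi\<^sub>E J A) = {\<omega>. \<forall>i\<in>J. \<omega> i \<in> A i}"
  by (auto simp: prod_emb_def PiE_iff extensional_def)

lemma finite_cylinder_conv:
  fixes A :: "nat \<Rightarrow> 'a::topological_space set"
  assumes "finite J" and "\<And>i. i \<in> J \<Longrightarrow> A i \<in> sets borel"
  obtains n E where "\<And>i. E i \<in> sets borel"
    and "{\<omega>. \<forall>i\<in>J. \<omega> i \<in> A i} = {\<omega>. \<forall>i<Suc n. \<omega> i \<in> E i}"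
proof -
  obtain n where n: "J \<subseteq> {..<n}"
    using assms(1) by (auto simp: finite_nat_iff_bounded)
  show ?thesis
    by (rule that[of "\<lambda>i. if i \<in> J then A i else UNIV" n])
       (use n assms(2) in \<open>auto simp: less_Suc_eq split: if_splits\<close>)
qed

lemma path_measure_eqI:
  fixes M N :: "(nat \<Rightarrow> 'a::topological_space) measure"
  assumes "sets M = sets path_space" "sets N = sets path_space" "finite_measure M"
    and eq: "\<And>n E. (\<And>i. E i \<in> sets borel) \<Longrightarrow>
      emeasure M {\<omega>. \<forall>i<Suc n. \<omega> i \<in> E i} = emeasure N {\<omega>. \<forall>i<Suc n. \<omega> i \<in> E i}"
  shows "M = N"
proof (rule measure_eqI_PiM_infinite[OF assms(1,2) _ assms(3)])
  fix A :: "nat \<Rightarrow> 'a set" and J assume J: "finite J" "\<And>i. i \<in> J \<Longrightarrow> A i \<in> sets borel"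
  show "emeasure M (prod_emb UNIV (\<lambda>_. borel) J (Pi\<^sub>E J A))
      = emeasure N (prod_emb UNIV (\<lambda>_. borel) J (Pi\<^sub>E J A))"
    unfolding prod_emb_path by (rule finite_cylinder_conv[OF J]) (auto simp: eq)
qed

lemma cylinder_measurable [measurable]:
  fixes E :: "nat \<Rightarrow> 'a::topological_space set"
  assumes "\<And>i. E i \<in> sets borel"
  shows "{\<omega>. \<forall>i<n. \<omega> i \<in> E i} \<in> sets path_space"
proof -
  have "{\<omega> \<in> space path_space. \<forall>i<n. \<omega> i \<in> E i} \<in> sets path_space"
    using assms by measurable
  then show ?thesis by simp
qed

definition path_shift :: "nat \<Rightarrow> (nat \<Rightarrow> 'a) \<Rightarrow> nat \<Rightarrow> 'a" where
  "path_shift n \<omega> = (\<lambda>i. \<omega> (n + i))"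

lemma path_shift_apply [simp]: "path_shift n \<omega> i = \<omega> (n + i)"
  by (simp add: path_shift_def)

lemma path_shift_0 [simp]: "path_shift 0 \<omega> = \<omega>"
  by (simp add: path_shift_def)

lemma path_shift_path_shift [simp]: "path_shift n (path_shift m \<omega>) = path_shift (m + n) \<omega>"
  by (simp add: path_shift_def add.assoc)

lemma path_shift_comb_seq [simp]: "path_shift n (comb_seq n \<omega> \<omega>') = \<omega>'"
  by (auto simp: path_shift_def comb_seq_def)

lemma path_shift_case_nat [simp]: "path_shift (Suc n) (case_nat x \<omega>) = path_shift n \<omega>"
  by (auto simp: path_shift_def)

lemma measurable_path_shift [measurable]: "path_shift n \<in> path_space \<rightarrow>\<^sub>M path_space"
  unfolding path_shift_def by (rule measurable_PiM_single') auto

section \<open>Path measures of the chain by the Ionescu-Tulcea theorem\<close>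

locale markov_kernel =
  fixes K :: "'a::polish_space \<Rightarrow> 'a measure"
  assumes K [measurable]: "K \<in> borel \<rightarrow>\<^sub>M prob_algebra borel"
begin

lemma K_subprob [measurable]: "K \<in> borel \<rightarrow>\<^sub>M subprob_algebra borel"
  by (rule measurable_prob_algebraD) measurable

lemma prob_space_K: "prob_space (K x)"
  using measurable_space[OF K, of x] by (simp add: space_prob_algebra)

lemma sets_K [measurable_cong, simp]: "sets (K x) = sets borel"
  using measurable_space[OF K, of x] by (simp add: space_prob_algebra)

lemma space_K [simp]: "space (K x) = UNIV"
  using sets_eq_imp_space_eq[OF sets_K] by simp

lemma measurable_K_eq [simp]: "measurable (K x) N = measurable borel N"
  by (rule measurable_cong_sets) auto

text \<open>Coordinate 0 is drawn from a point mass at \<open>x\<close>, so the starting point is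
  itself an entry of the path.\<close>

definition step_kernel :: "'a \<Rightarrow> nat \<Rightarrow> (nat \<Rightarrow> 'a) \<Rightarrow> 'a measure" where
  "step_kernel x i = (\<lambda>\<omega>. case i of 0 \<Rightarrow> return borel x | Suc j \<Rightarrow> K (\<omega> j))"

lemma Ionescu_Tulcea_step_kernel: "Ionescu_Tulcea (step_kernel x) (\<lambda>_. borel)"
proof (rule Ionescu_Tulcea.intro)
  show "step_kernel x i \<in> Pi\<^sub>M {0..<i} (\<lambda>_. borel) \<rightarrow>\<^sub>M subprob_algebra borel" for i
  proof (cases i)
    case 0
    have "return borel x \<in> space (subprob_algebra borel)"
      by (simp add: space_subprob_algebra prob_space_imp_subprob_space prob_space_return)
    then show ?thesis by (simp add: 0 step_kernel_def)
  next
    case (Suc j)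
    then show ?thesis
      by (auto simp: step_kernel_def intro!: measurable_compose[OF _ K_subprob] measurable_component_singleton)
  qed
  show "prob_space (step_kernel x i \<omega>)" for i \<omega>
    unfolding step_kernel_def by (cases i) (auto intro: prob_space_return prob_space_K)
qed

interpretation IT: Ionescu_Tulcea "step_kernel x" "\<lambda>_. borel" for x
  by (rule Ionescu_Tulcea_step_kernel)

definition path_law :: "'a \<Rightarrow> (nat \<Rightarrow> 'a) measure" where
  "path_law x = IT.PF.lim x"

lemma sets_path_law [measurable_cong, simp]: "sets (path_law x) = sets path_space"
  unfolding path_law_def by (rule IT.PF.sets_lim)

lemma space_path_law [simp]: "space (path_law x) = UNIV"
  using sets_eq_imp_space_eq[OF sets_path_law] by simp

lemma measurable_path_law_eq [simp]: "measurable (path_law x) N = measurable path_space N"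
  by (rule measurable_cong_sets) auto

text \<open>\<open>path_prob\<close> peels off the first coordinate, whereas the Ionescu-Tulcea
  construction appends a last one. The extra weight \<open>f\<close> at the final coordinate
  reconciles the two: appending a coordinate only changes \<open>f\<close>.\<close>

primrec cylinder_weight :: "nat \<Rightarrow> (nat \<Rightarrow> 'a set) \<Rightarrow> ('a \<Rightarrow> ennreal) \<Rightarrow> 'a \<Rightarrow> ennreal" where
  "cylinder_weight 0 E f x = indicator (E 0) x * f x"
| "cylinder_weight (Suc n) E f x
    = indicator (E 0) x * (\<integral>\<^sup>+y. cylinder_weight n (\<lambda>i. E (Suc i)) f y \<partial>K x)"

lemma cylinder_weight_append:
  "cylinder_weight n E (\<lambda>z. \<integral>\<^sup>+y. indicator (E (Suc n)) y * f y \<partial>K z) = cylinder_weight (Suc n) E f"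
proof (induction n arbitrary: E)
  case (Suc n)
  show ?case
  proof
    fix x
    show "cylinder_weight (Suc n) E (\<lambda>z. \<integral>\<^sup>+y. indicator (E (Suc (Suc n))) y * f y \<partial>K z) x
        = cylinder_weight (Suc (Suc n)) E f x"
      by (subst (1 2) cylinder_weight.simps(2)) (simp only: Suc.IH[of "\<lambda>i. E (Suc i)"])
  qed
qed (simp add: fun_eq_iff)

lemma cylinder_weight_measurable [measurable]:
  assumes [measurable]: "\<And>i. E i \<in> sets borel" "f \<in> borel_measurable borel"
  shows "cylinder_weight n E f \<in> borel_measurable borel"
  using assms(1)
proof (induction n arbitrary: E)
  case 0
  note [measurable] = 0
  show ?case by (simp add: measurable_If cong: measurable_cong)
next
  case (Suc n)
  note [measurable] = Suc.prems Suc.IH[of "\<lambda>i. E (Suc i)", OF Suc.prems]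
  have [measurable]: "(\<lambda>x. \<integral>\<^sup>+y. cylinder_weight n (\<lambda>i. E (Suc i)) f y \<partial>K x) \<in> borel_measurable borel"
    by (rule nn_integral_measurable_subprob_algebra2[OF _ K_subprob]) measurable
  show ?case unfolding cylinder_weight.simps by measurable
qed

lemma nn_integral_finite_path:
  assumes [measurable]: "\<And>i. E i \<in> sets borel" and "f \<in> borel_measurable borel"
  shows "(\<integral>\<^sup>+\<omega>. (\<Prod>i<Suc n. indicator (E i) (\<omega> i)) * f (\<omega> n) \<partial>IT.C x 0 (Suc n) (\<lambda>_. undefined))
    = cylinder_weight n E f x"
  using assms(2)
proof (induction n arbitrary: f)
  case 0
  note [measurable] = 0
  have u: "(\<lambda>_. undefined) \<in> space (Pi\<^sub>M {0..<0} (\<lambda>_::nat. borel :: 'a measure))"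
    by (simp add: space_PiM)
  have [measurable]: "(\<lambda>\<omega>. \<omega> (0::nat)) \<in> Pi\<^sub>M {0..<Suc 0} (\<lambda>_. borel) \<rightarrow>\<^sub>M (borel :: 'a measure)"
    by (rule measurable_component_singleton) auto
  have C: "IT.C x 0 (Suc 0) (\<lambda>_. undefined) = IT.eP x 0 (\<lambda>_. undefined)"
    by (simp only: IT.C.simps add_0 bind_return[OF IT.measurable_eP u])
  show ?case
    unfolding C by (subst IT.nn_integral_eP[OF u]) (simp_all add: step_kernel_def nn_integral_return)
next
  case (Suc n)
  note [measurable] = Suc.prems
  have u: "(\<lambda>_. undefined) \<in> space (Pi\<^sub>M {0..<0} (\<lambda>_::nat. borel :: 'a measure))"
    by (simp add: space_PiM)
  have [measurable]: "(\<lambda>\<omega>. \<omega> i) \<in> Pi\<^sub>M {0..<m} (\<lambda>_. borel) \<rightarrow>\<^sub>M (borel :: 'a measure)" if "i < m" for i m :: nat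
    by (rule measurable_component_singleton) (use that in auto)
  let ?f = "\<lambda>z. \<integral>\<^sup>+y. indicator (E (Suc n)) y * f y \<partial>K z"
  have [measurable]: "?f \<in> borel_measurable borel"
    by (rule nn_integral_measurable_subprob_algebra2[OF _ K_subprob]) measurable
  have "(\<integral>\<^sup>+\<omega>. (\<Prod>i<Suc (Suc n). indicator (E i) (\<omega> i)) * f (\<omega> (Suc n)) \<partial>IT.C x 0 (Suc (Suc n)) (\<lambda>_. undefined))
    = (\<integral>\<^sup>+\<omega>. \<integral>\<^sup>+\<omega>'. (\<Prod>i<Suc (Suc n). indicator (E i) (\<omega>' i)) * f (\<omega>' (Suc n)) \<partial>IT.eP x (Suc n) \<omega>
         \<partial>IT.C x 0 (Suc n) (\<lambda>_. undefined))"
  proof -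
    have C: "IT.C x 0 (Suc (Suc n)) (\<lambda>_. undefined) = IT.C x 0 (Suc n) (\<lambda>_. undefined) \<bind> IT.eP x (Suc n)"
      by (simp only: IT.C.simps add_0)
    have eP: "IT.eP x (Suc n) \<in> IT.C x 0 (Suc n) (\<lambda>_. undefined) \<rightarrow>\<^sub>M subprob_algebra (Pi\<^sub>M {0..<Suc (Suc n)} (\<lambda>_. borel))"
      using IT.measurable_eP[of x "Suc n"]
      by (simp only: measurable_cong_sets[OF IT.sets_C[OF u, of x "Suc n"] refl] add_0)
    show ?thesis
      unfolding C by (rule nn_integral_bind[OF _ eP]) measurable
  qed
  also have "\<dots> = (\<integral>\<^sup>+\<omega>. (\<Prod>i<Suc n. indicator (E i) (\<omega> i)) * ?f (\<omega> n) \<partial>IT.C x 0 (Suc n) (\<lambda>_. undefined))"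
  proof (rule nn_integral_cong)
    fix \<omega> assume "\<omega> \<in> space (IT.C x 0 (Suc n) (\<lambda>_. undefined))"
    then have \<omega>: "\<omega> \<in> space (Pi\<^sub>M {0..<Suc n} (\<lambda>_. borel :: 'a measure))"
      using IT.space_C[OF u, of x "Suc n"] by simp
    have "(\<integral>\<^sup>+\<omega>'. (\<Prod>i<Suc (Suc n). indicator (E i) (\<omega>' i)) * f (\<omega>' (Suc n)) \<partial>IT.eP x (Suc n) \<omega>)
      = (\<integral>\<^sup>+y. (\<Prod>i<Suc n. indicator (E i) (\<omega> i)) * (indicator (E (Suc n)) y * f y) \<partial>K (\<omega> n))"
      by (subst IT.nn_integral_eP[OF \<omega>])
         (measurable, auto simp: step_kernel_def ac_simps intro!: nn_integral_cong prod.cong arg_cong2[where f="(*)"])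
    also have "\<dots> = (\<Prod>i<Suc n. indicator (E i) (\<omega> i)) * ?f (\<omega> n)"
      by (rule nn_integral_cmult) (simp, measurable)
    finally show "(\<integral>\<^sup>+\<omega>'. (\<Prod>i<Suc (Suc n). indicator (E i) (\<omega>' i)) * f (\<omega>' (Suc n)) \<partial>IT.eP x (Suc n) \<omega>)
      = (\<Prod>i<Suc n. indicator (E i) (\<omega> i)) * ?f (\<omega> n)" .
  qed
  also have "\<dots> = cylinder_weight n E ?f x"
    by (rule Suc.IH) measurable
  also have "\<dots> = cylinder_weight (Suc n) E f x"
    by (simp only: cylinder_weight_append)
  finally show ?case .
qed

lemma emeasure_path_law_cylinder:
  assumes E: "\<And>i. E i \<in> sets borel"
  shows "emeasure (path_law x) {\<omega>. \<forall>i<Suc n. \<omega> i \<in> E i} = cylinder_weight n E (\<lambda>_. 1) x"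
proof -
  note [measurable] = E
  let ?J = "{0..<Suc n}"
  have sets: "Pi\<^sub>E ?J E \<in> sets (Pi\<^sub>M ?J (\<lambda>_. borel))"
    by (rule sets_PiM_I_finite) auto
  have u: "(\<lambda>_. undefined) \<in> space (Pi\<^sub>M {0..<0} (\<lambda>_::nat. borel :: 'a measure))"
    by (simp add: space_PiM)
  have emb: "prod_emb ?J (\<lambda>_. borel) ?J (Pi\<^sub>E ?J E) = Pi\<^sub>E ?J E"
    by (rule prod_emb_id) (auto simp: PiE_mono)
  have "{\<omega>. \<forall>i<Suc n. \<omega> i \<in> E i} = prod_emb UNIV (\<lambda>_. borel) ?J (Pi\<^sub>E ?J E)"
    by (auto simp: prod_emb_path)
  then have "emeasure (path_law x) {\<omega>. \<forall>i<Suc n. \<omega> i \<in> E i} = emeasure (IT.CI x ?J) (Pi\<^sub>E ?J E)"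
    unfolding path_law_def using IT.lim[of ?J "Pi\<^sub>E ?J E" x] sets by simp
  also have "\<dots> = emeasure (IT.C x 0 (Suc n) (\<lambda>_. undefined)) (Pi\<^sub>E ?J E)"
    using IT.emeasure_CI[of ?J "Suc n" "Pi\<^sub>E ?J E" x] sets emb by simp
  also have "\<dots> = (\<integral>\<^sup>+\<omega>. indicator (Pi\<^sub>E ?J E) \<omega> \<partial>IT.C x 0 (Suc n) (\<lambda>_. undefined))"
    using sets IT.sets_C[OF u, of x "Suc n"] by simp
  also have "\<dots> = (\<integral>\<^sup>+\<omega>. (\<Prod>i<Suc n. indicator (E i) (\<omega> i)) * 1 \<partial>IT.C x 0 (Suc n) (\<lambda>_. undefined))"
  proof (rule nn_integral_cong)
    fix \<omega> assume "\<omega> \<in> space (IT.C x 0 (Suc n) (\<lambda>_. undefined))"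
    then have "\<omega> \<in> extensional ?J"
      using IT.space_C[OF u, of x "Suc n"] by (auto simp: space_PiM PiE_iff)
    then show "indicator (Pi\<^sub>E ?J E) \<omega> = (\<Prod>i<Suc n. indicator (E i) (\<omega> i)) * (1::ennreal)"
      by (cases "\<forall>i<Suc n. \<omega> i \<in> E i")
         (auto simp: indicator_def PiE_iff prod_zero_iff simp del: prod.lessThan_Suc)
  qed
  also have "\<dots> = cylinder_weight n E (\<lambda>_. 1) x"
    by (rule nn_integral_finite_path) auto
  finally show ?thesis .
qed

lemma prob_space_path_law: "prob_space (path_law x)"
proof
  show "emeasure (path_law x) (space (path_law x)) = 1"
    using emeasure_path_law_cylinder[of "\<lambda>_. UNIV" x 0] by simp
qed

lemma path_law_prob [measurable]: "path_law \<in> borel \<rightarrow>\<^sub>M prob_algebra path_space"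
proof (rule measurable_prob_algebra_generated[OF sets_PiM Int_stable_prod_algebra prod_algebra_sets_into_space])
  fix A assume "A \<in> prod_algebra UNIV (\<lambda>_::nat. borel :: 'a measure)"
  then obtain J E where J: "finite J" "\<And>i. i \<in> J \<Longrightarrow> E i \<in> sets borel"
    and A: "A = prod_emb UNIV (\<lambda>_. borel) J (Pi\<^sub>E J E)"
    by (elim prod_algebraE) (rule that)
  show "(\<lambda>x. emeasure (path_law x) A) \<in> borel_measurable borel"
    unfolding A prod_emb_path
    by (rule finite_cylinder_conv[OF J]) (auto simp: emeasure_path_law_cylinder)
qed (auto simp: prob_space_path_law)

lemma path_law_subprob [measurable]: "path_law \<in> borel \<rightarrow>\<^sub>M subprob_algebra path_space"
  by (rule measurable_prob_algebraD) measurable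

text \<open>The recursion of \<open>cylinder_weight\<close> is exactly a first step under
  \<open>K x\<close> followed by a path from the new state, so both measures agree on cylinders.
  Inductions on time start from this decomposition.\<close>

lemma path_law_unfold: "path_law x = K x \<bind> (\<lambda>y. distr (path_law y) path_space (case_nat x))"
proof (rule path_measure_eqI)
  have meas [measurable]: "(\<lambda>y. distr (path_law y) path_space (case_nat x)) \<in> borel \<rightarrow>\<^sub>M subprob_algebra path_space"
    by (rule measurable_prob_algebraD) measurable
  show "sets (path_law x) = sets path_space"
    by (rule sets_path_law)
  show "sets (K x \<bind> (\<lambda>y. distr (path_law y) path_space (case_nat x))) = sets path_space"
    by (rule sets_bind) auto
  show "finite_measure (path_law x)"
    using prob_space_path_law by (rule prob_space.finite_measure)
  fix n and E :: "nat \<Rightarrow> 'a set" assume E: "\<And>i. E i \<in> sets borel"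
  have cyl: "{\<omega>. \<forall>i<n. \<omega> i \<in> E i} \<in> sets path_space" "{\<omega>. \<forall>i<n. \<omega> i \<in> E (Suc i)} \<in> sets path_space" for n
    by (rule cylinder_measurable, rule E)+
  have step: "emeasure (distr (path_law y) path_space (case_nat x)) {\<omega>. \<forall>i<Suc n. \<omega> i \<in> E i}
      = indicator (E 0) x * emeasure (path_law y) {\<omega>. \<forall>i<n. \<omega> i \<in> E (Suc i)}" for y
  proof -
    have "case_nat x -` {\<omega>. \<forall>i<Suc n. \<omega> i \<in> E i} =
        (if x \<in> E 0 then {\<omega>. \<forall>i<n. \<omega> i \<in> E (Suc i)} else {})"
      by (auto simp: All_less_Suc2)
    then show ?thesis
      by (subst emeasure_distr[OF _ cyl(1)]) auto
  qed
  have "emeasure (K x \<bind> (\<lambda>y. distr (path_law y) path_space (case_nat x))) {\<omega>. \<forall>i<Suc n. \<omega> i \<in> E i}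
     = (\<integral>\<^sup>+y. indicator (E 0) x * emeasure (path_law y) {\<omega>. \<forall>i<n. \<omega> i \<in> E (Suc i)} \<partial>K x)"
    by (subst emeasure_bind[OF _ _ cyl(1)]) (simp_all only: step space_K measurable_K_eq meas, simp)
  also have "\<dots> = indicator (E 0) x * (\<integral>\<^sup>+y. emeasure (path_law y) {\<omega>. \<forall>i<n. \<omega> i \<in> E (Suc i)} \<partial>K x)"
    by (rule nn_integral_cmult)
       (simp add: measurable_emeasure_kernel[OF path_law_subprob cyl(2)])
  also have "\<dots> = cylinder_weight n E (\<lambda>_. 1) x"
  proof (cases n)
    case 0
    then show ?thesis
      using prob_space.emeasure_space_1[OF prob_space_path_law] prob_space.emeasure_space_1[OF prob_space_K[of x]]
      by simp
  next
    case (Suc m)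
    have "emeasure (path_law y) {\<omega>. \<forall>i<n. \<omega> i \<in> E (Suc i)} = cylinder_weight m (\<lambda>i. E (Suc i)) (\<lambda>_. 1) y" for y
      unfolding Suc by (rule emeasure_path_law_cylinder[OF E])
    then show ?thesis by (simp only: Suc cylinder_weight.simps)
  qed
  also have "\<dots> = emeasure (path_law x) {\<omega>. \<forall>i<Suc n. \<omega> i \<in> E i}"
    using E by (rule emeasure_path_law_cylinder[symmetric])
  finally show "emeasure (path_law x) {\<omega>. \<forall>i<Suc n. \<omega> i \<in> E i}
     = emeasure (K x \<bind> (\<lambda>y. distr (path_law y) path_space (case_nat x))) {\<omega>. \<forall>i<Suc n. \<omega> i \<in> E i}" ..
qed

lemma nn_integral_path_law_unfold:
  assumes [measurable]: "f \<in> borel_measurable path_space"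
  shows "(\<integral>\<^sup>+\<omega>. f \<omega> \<partial>path_law x) = (\<integral>\<^sup>+y. \<integral>\<^sup>+\<omega>. f (case_nat x \<omega>) \<partial>path_law y \<partial>K x)"
proof -
  have [measurable]: "(\<lambda>y. distr (path_law y) path_space (case_nat x)) \<in> borel \<rightarrow>\<^sub>M subprob_algebra path_space"
    by (rule measurable_prob_algebraD) measurable
  show ?thesis
    by (subst path_law_unfold, subst nn_integral_bind[where B=path_space])
       (auto simp: nn_integral_distr)
qed

end

lemma integral_measurable_subprob_algebra2:
  fixes f :: "'a \<Rightarrow> 'b \<Rightarrow> real"
  assumes f [measurable]: "(\<lambda>(x, y). f x y) \<in> borel_measurable (M \<Otimes>\<^sub>M N)"
    and L [measurable]: "L \<in> M \<rightarrow>\<^sub>M subprob_algebra N"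
  shows "(\<lambda>x. \<integral>y. f x y \<partial>L x) \<in> borel_measurable M"
proof -
  have *: "(\<lambda>x. distr (L x) (M \<Otimes>\<^sub>M N) (\<lambda>y. (x, y))) \<in> M \<rightarrow>\<^sub>M subprob_algebra (M \<Otimes>\<^sub>M N)"
    by (rule measurable_distr2[where M=N]) auto
  have "(\<lambda>x. \<integral>z. (\<lambda>(x, y). f x y) z \<partial>distr (L x) (M \<Otimes>\<^sub>M N) (\<lambda>y. (x, y))) \<in> borel_measurable M"
    using measurable_compose[OF * integral_measurable_subprob_algebra[OF f]] .
  then show ?thesis
    by (rule measurable_cong[THEN iffD1, rotated]) (simp add: integral_distr)
qed

lemma UNIV_path_space [simp]: "UNIV \<in> sets path_space"
  using sets.top[of path_space] by simp

lemma (in prob_space) abs_integral_le: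
  fixes f :: "'a \<Rightarrow> real"
  assumes "f \<in> borel_measurable M" "\<And>x. \<bar>f x\<bar> \<le> b"
  shows "integrable M f" and "\<bar>\<integral>x. f x \<partial>M\<bar> \<le> b"
proof -
  show int: "integrable M f"
    using assms by (intro integrable_const_bound[of _ b]) auto
  have "(\<integral>x. f x \<partial>M) \<le> b" "- b \<le> (\<integral>x. f x \<partial>M)"
    using assms(2) int by (auto intro!: integral_le_const integral_ge_const AE_I2 simp: abs_le_iff minus_le_iff)
  then show "\<bar>\<integral>x. f x \<partial>M\<bar> \<le> b" by simp
qed

lemma nn_integral_AE_const:
  assumes "prob_space M" "AE x in M. f x = (c::ennreal)"
  shows "(\<integral>\<^sup>+x. f x \<partial>M) = c"
  using nn_integral_cong_AE[OF assms(2)] prob_space.emeasure_space_1[OF assms(1)] by simp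

section \<open>The Markov property and a zero-one criterion\<close>

context markov_kernel
begin

lemma AE_path_law_unfold:
  assumes [measurable]: "Measurable.pred path_space P"
  shows "(AE \<omega> in path_law x. P \<omega>) \<longleftrightarrow> (AE y in K x. AE \<omega> in path_law y. P (case_nat x \<omega>))"
proof -
  have [measurable]: "(\<lambda>y. distr (path_law y) path_space (case_nat x)) \<in> K x \<rightarrow>\<^sub>M subprob_algebra path_space"
    unfolding measurable_K_eq by (rule measurable_prob_algebraD) measurable
  have "(AE \<omega> in distr (path_law y) path_space (case_nat x). P \<omega>)
      \<longleftrightarrow> (AE \<omega> in path_law y. P (case_nat x \<omega>))" for y
    by (rule AE_distr_iff) measurable
  then show ?thesis
    by (subst path_law_unfold, subst AE_bind[where B=path_space]) simp_all
qed

lemma AE_path_law_0: "AE \<omega> in path_law x. \<omega> 0 = x"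
  by (subst AE_path_law_unfold) auto

text \<open>\<open>comb_seq n \<omega> \<omega>'\<close> takes its first \<open>n\<close> entries
  from \<open>\<omega>\<close> and continues with \<open>\<omega>'\<close>. Its entry at time
  \<open>n\<close> is thus \<open>\<omega>' 0\<close>, which equals \<open>\<omega> n\<close> only
  almost surely under \<open>path_law (\<omega> n)\<close>; this is why applications appeal to
  \<open>AE_path_law_0\<close>.\<close>

lemma nn_integral_markov:
  assumes [measurable]: "f \<in> borel_measurable path_space"
  shows "(\<integral>\<^sup>+\<omega>. f \<omega> \<partial>path_law x)
    = (\<integral>\<^sup>+\<omega>. \<integral>\<^sup>+\<omega>'. f (comb_seq n \<omega> \<omega>') \<partial>path_law (\<omega> n) \<partial>path_law x)"
  using assms
proof (induction n arbitrary: f x)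
  case 0
  have "(\<integral>\<^sup>+\<omega>. \<integral>\<^sup>+\<omega>'. f \<omega>' \<partial>path_law (\<omega> 0) \<partial>path_law x) = (\<integral>\<^sup>+\<omega>'. f \<omega>' \<partial>path_law x)"
  proof (rule nn_integral_AE_const[OF prob_space_path_law])
    show "AE \<omega> in path_law x. integral\<^sup>N (path_law (\<omega> 0)) f = integral\<^sup>N (path_law x) f"
      using AE_path_law_0 by eventually_elim simp
  qed
  then show ?case by (simp add: comb_seq_0)
next
  case (Suc n)
  note [measurable] = Suc.prems
  have [measurable]: "(\<lambda>\<omega>. \<integral>\<^sup>+\<omega>'. f (comb_seq (Suc n) \<omega> \<omega>') \<partial>path_law (\<omega> (Suc n))) \<in> borel_measurable path_space"
    by (rule nn_integral_measurable_subprob_algebra2[where N=path_space]) measurable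
  have "(\<integral>\<^sup>+\<omega>. f \<omega> \<partial>path_law x) = (\<integral>\<^sup>+y. \<integral>\<^sup>+\<omega>. f (case_nat x \<omega>) \<partial>path_law y \<partial>K x)"
    by (rule nn_integral_path_law_unfold) measurable
  also have "\<dots> = (\<integral>\<^sup>+y. \<integral>\<^sup>+\<omega>. \<integral>\<^sup>+\<omega>'. f (case_nat x (comb_seq n \<omega> \<omega>')) \<partial>path_law (\<omega> n) \<partial>path_law y \<partial>K x)"
    by (intro nn_integral_cong Suc.IH) measurable
  also have "\<dots> = (\<integral>\<^sup>+\<omega>. \<integral>\<^sup>+\<omega>'. f (comb_seq (Suc n) \<omega> \<omega>') \<partial>path_law (\<omega> (Suc n)) \<partial>path_law x)"
    by (subst nn_integral_path_law_unfold) (simp_all add: case_nat_comb_seq')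
  finally show ?case .
qed

lemma path_law_markov:
  "path_law x = path_law x \<bind> (\<lambda>\<omega>. distr (path_law (\<omega> n)) path_space (comb_seq n \<omega>))"
proof (rule measure_eqI)
  have m [measurable]: "(\<lambda>\<omega>. distr (path_law (\<omega> n)) path_space (comb_seq n \<omega>)) \<in> path_space \<rightarrow>\<^sub>M subprob_algebra path_space"
    by (rule measurable_prob_algebraD) measurable
  show "sets (path_law x) = sets (path_law x \<bind> (\<lambda>\<omega>. distr (path_law (\<omega> n)) path_space (comb_seq n \<omega>)))"
    by (subst sets_bind[where N=path_space]) auto
  fix X assume "X \<in> sets (path_law x)"
  then have X [measurable]: "X \<in> sets path_space" by simp
  have "emeasure (path_law x) X = (\<integral>\<^sup>+\<omega>. indicator X \<omega> \<partial>path_law x)"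
    by simp
  also have "\<dots> = (\<integral>\<^sup>+\<omega>. \<integral>\<^sup>+\<omega>'. indicator X (comb_seq n \<omega> \<omega>') \<partial>path_law (\<omega> n) \<partial>path_law x)"
    by (rule nn_integral_markov) measurable
  also have "\<dots> = (\<integral>\<^sup>+\<omega>. \<integral>\<^sup>+\<omega>'. indicator X \<omega>' \<partial>distr (path_law (\<omega> n)) path_space (comb_seq n \<omega>) \<partial>path_law x)"
    by (intro nn_integral_cong, subst nn_integral_distr) auto
  also have "\<dots> = (\<integral>\<^sup>+\<omega>. indicator X \<omega> \<partial>(path_law x \<bind> (\<lambda>\<omega>. distr (path_law (\<omega> n)) path_space (comb_seq n \<omega>))))"
    by (rule nn_integral_bind[symmetric, where B=path_space]) auto
  also have "\<dots> = emeasure (path_law x \<bind> (\<lambda>\<omega>. distr (path_law (\<omega> n)) path_space (comb_seq n \<omega>))) X"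
    using X by (subst nn_integral_indicator) (auto simp: sets_bind[where N=path_space])
  finally show "emeasure (path_law x) X
      = emeasure (path_law x \<bind> (\<lambda>\<omega>. distr (path_law (\<omega> n)) path_space (comb_seq n \<omega>))) X" .
qed

lemma integral_markov:
  fixes f :: "(nat \<Rightarrow> 'a) \<Rightarrow> real"
  assumes [measurable]: "f \<in> borel_measurable path_space" and "\<And>\<omega>. \<bar>f \<omega>\<bar> \<le> b"
  shows "(\<integral>\<omega>. f \<omega> \<partial>path_law x) = (\<integral>\<omega>. \<integral>\<omega>'. f (comb_seq n \<omega> \<omega>') \<partial>path_law (\<omega> n) \<partial>path_law x)"
proof -
  have m [measurable]: "(\<lambda>\<omega>. distr (path_law (\<omega> n)) path_space (comb_seq n \<omega>)) \<in> path_space \<rightarrow>\<^sub>M subprob_algebra path_space"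
    by (rule measurable_prob_algebraD) measurable
  have "(\<integral>\<omega>. f \<omega> \<partial>path_law x) = (\<integral>\<omega>. \<integral>\<omega>'. f \<omega>' \<partial>distr (path_law (\<omega> n)) path_space (comb_seq n \<omega>) \<partial>path_law x)"
  proof (subst path_law_markov[of x n], rule integral_bind[where K=path_space and B=b and B'=1])
    show "AE \<omega> in path_law x. emeasure (distr (path_law (\<omega> n)) path_space (comb_seq n \<omega>))
        (space (distr (path_law (\<omega> n)) path_space (comb_seq n \<omega>))) \<le> ennreal 1"
      by (auto intro!: AE_I2 prob_space.measure_le_1 prob_space.prob_space_distr prob_space_path_law)
  qed (use assms in \<open>auto intro: prob_space.finite_measure prob_space_path_law\<close>)
  also have "\<dots> = (\<integral>\<omega>. \<integral>\<omega>'. f (comb_seq n \<omega> \<omega>') \<partial>path_law (\<omega> n) \<partial>path_law x)"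
    by (rule Bochner_Integration.integral_cong[OF refl], rule integral_distr) auto
  finally show ?thesis .
qed

lemma nn_integral_shift_Suc:
  assumes [measurable]: "f \<in> borel_measurable path_space"
  shows "(\<integral>\<^sup>+\<omega>. f (path_shift (Suc n) \<omega>) \<partial>path_law x) = (\<integral>\<^sup>+y. \<integral>\<^sup>+\<omega>. f (path_shift n \<omega>) \<partial>path_law y \<partial>K x)"
  by (subst nn_integral_path_law_unfold) auto

lemma nn_integral_coordinate_Suc:
  assumes [measurable]: "h \<in> borel_measurable borel"
  shows "(\<integral>\<^sup>+\<omega>. h (\<omega> (Suc n)) \<partial>path_law x) = (\<integral>\<^sup>+y. \<integral>\<^sup>+\<omega>. h (\<omega> n) \<partial>path_law y \<partial>K x)"
  by (subst nn_integral_path_law_unfold) auto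

lemma nn_integral_coordinate_0:
  assumes [measurable]: "h \<in> borel_measurable borel"
  shows "(\<integral>\<^sup>+\<omega>. h (\<omega> 0) \<partial>path_law x) = h x"
proof (rule nn_integral_AE_const[OF prob_space_path_law])
  show "AE \<omega> in path_law x. h (\<omega> 0) = h x"
    using AE_path_law_0 by eventually_elim simp
qed

lemma kernel_pow_prob: "kernel_pow K n \<in> borel \<rightarrow>\<^sub>M prob_algebra borel"
proof (induction n)
  case (Suc n)
  show ?case unfolding kernel_pow.simps by (rule measurable_bind_prob_space[OF K Suc])
qed simp

lemma emeasure_distr_coordinate:
  assumes [measurable]: "X \<in> sets borel"
  shows "emeasure (distr (path_law x) borel (\<lambda>\<omega>. \<omega> n)) X = (\<integral>\<^sup>+\<omega>. indicator X (\<omega> n) \<partial>path_law x)"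
proof -
  have "emeasure (distr (path_law x) borel (\<lambda>\<omega>. \<omega> n)) X
      = (\<integral>\<^sup>+y. indicator X y \<partial>distr (path_law x) borel (\<lambda>\<omega>. \<omega> n))"
    by simp
  also have "\<dots> = (\<integral>\<^sup>+\<omega>. indicator X (\<omega> n) \<partial>path_law x)"
    by (rule nn_integral_distr) auto
  finally show ?thesis .
qed

lemma kernel_pow_eq: "kernel_pow K n x = distr (path_law x) borel (\<lambda>\<omega>. \<omega> n)"
proof (induction n arbitrary: x)
  case 0
  show ?case
  proof (rule measure_eqI)
    fix X assume X: "X \<in> sets (kernel_pow K 0 x)"
    then have [measurable]: "X \<in> sets borel" by simp
    show "emeasure (kernel_pow K 0 x) X = emeasure (distr (path_law x) borel (\<lambda>\<omega>. \<omega> 0)) X"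
      by (simp add: emeasure_distr_coordinate nn_integral_coordinate_0)
  qed simp
next
  case (Suc n)
  have m: "kernel_pow K n \<in> borel \<rightarrow>\<^sub>M subprob_algebra borel"
    by (rule measurable_prob_algebraD[OF kernel_pow_prob])
  show ?case
  proof (rule measure_eqI)
    show "sets (kernel_pow K (Suc n) x) = sets (distr (path_law x) borel (\<lambda>\<omega>. \<omega> (Suc n)))"
      using m by (simp, intro sets_bind) (auto dest: sets_kernel)
    fix X assume "X \<in> sets (kernel_pow K (Suc n) x)"
    then have [measurable]: "X \<in> sets borel"
      using m by (subst (asm) kernel_pow.simps, subst (asm) sets_bind) (auto dest: sets_kernel)
    have "emeasure (kernel_pow K (Suc n) x) X = (\<integral>\<^sup>+y. emeasure (kernel_pow K n y) X \<partial>K x)"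
      using m by (simp add: emeasure_bind[where N=borel])
    also have "\<dots> = (\<integral>\<^sup>+y. \<integral>\<^sup>+\<omega>. indicator X (\<omega> n) \<partial>path_law y \<partial>K x)"
      by (simp add: Suc.IH emeasure_distr_coordinate)
    also have "\<dots> = (\<integral>\<^sup>+\<omega>. indicator X (\<omega> (Suc n)) \<partial>path_law x)"
      by (rule nn_integral_coordinate_Suc[symmetric]) measurable
    also have "\<dots> = emeasure (distr (path_law x) borel (\<lambda>\<omega>. \<omega> (Suc n))) X"
      by (simp add: emeasure_distr_coordinate)
    finally show "emeasure (kernel_pow K (Suc n) x) X = emeasure (distr (path_law x) borel (\<lambda>\<omega>. \<omega> (Suc n))) X" .
  qed
qed

text \<open>If the conditional probability of \<open>E\<close> given the past up to time
  \<open>n\<close> is the same constant for all \<open>n\<close>, then \<open>E\<close> is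
  independent of every cylinder, hence of itself, and \<open>c = c * c\<close>.\<close>

lemma zero_one_if_independent_of_past:
  assumes E [measurable]: "E \<in> sets path_space"
    and c: "\<And>n. AE \<omega> in path_law x. emeasure (path_law (\<omega> n)) (comb_seq n \<omega> -` E) = c"
  shows "emeasure (path_law x) E = c" and "c = 0 \<or> c = 1"
proof -
  interpret prob_space "path_law x" by (rule prob_space_path_law)
  have pre: "comb_seq n \<omega> -` E \<in> sets path_space" for n \<omega>
    using measurable_sets[of "comb_seq n \<omega>" path_space path_space E] by simp
  have split: "emeasure (path_law x) (E \<inter> X) = c * emeasure (path_law x) X"
    if X: "X = {\<omega>. \<forall>i<n. \<omega> i \<in> A i}" and A: "\<And>i. A i \<in> sets borel" for X n A
  proof -
    have [measurable]: "X \<in> sets path_space" unfolding X by (rule cylinder_measurable[OF A])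
    have "emeasure (path_law x) (E \<inter> X) = (\<integral>\<^sup>+\<omega>. indicator (E \<inter> X) \<omega> \<partial>path_law x)"
      by simp
    also have "\<dots> = (\<integral>\<^sup>+\<omega>. \<integral>\<^sup>+\<omega>'. indicator (E \<inter> X) (comb_seq n \<omega> \<omega>') \<partial>path_law (\<omega> n) \<partial>path_law x)"
      by (rule nn_integral_markov) measurable
    also have "\<dots> = (\<integral>\<^sup>+\<omega>. indicator X \<omega> * c \<partial>path_law x)"
    proof (rule nn_integral_cong_AE)
      show "AE \<omega> in path_law x. (\<integral>\<^sup>+\<omega>'. indicator (E \<inter> X) (comb_seq n \<omega> \<omega>') \<partial>path_law (\<omega> n)) = indicator X \<omega> * c"
        using c[of n]
      proof eventually_elim
        case (elim \<omega>)
        have "(\<integral>\<^sup>+\<omega>'. indicator (E \<inter> X) (comb_seq n \<omega> \<omega>') \<partial>path_law (\<omega> n))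
          = (\<integral>\<^sup>+\<omega>'. indicator X \<omega> * indicator (comb_seq n \<omega> -` E) \<omega>' \<partial>path_law (\<omega> n))"
          by (intro nn_integral_cong) (auto simp: X comb_seq_def split: split_indicator)
        also have "\<dots> = indicator X \<omega> * c"
          using pre by (simp add: nn_integral_cmult elim)
        finally show ?case .
      qed
    qed
    also have "\<dots> = c * emeasure (path_law x) X"
      by (subst nn_integral_multc) (simp_all add: mult.commute)
    finally show ?thesis .
  qed
  from split[of UNIV 0 "\<lambda>_. UNIV"] show Ec: "emeasure (path_law x) E = c"
    using emeasure_space_1 by simp
  \<comment> \<open>Independence from all cylinders, written as equality of two finite measures;
    evaluating both at \<open>E\<close> gives the quadratic equation.\<close>
  have "density (path_law x) (indicator E) = scale_measure c (path_law x)"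
  proof (rule path_measure_eqI)
    show "finite_measure (density (path_law x) (indicator E))"
      using UNIV_path_space emeasure_finite[of E] by (intro finite_measureI) (simp add: emeasure_density)
    fix n and A :: "nat \<Rightarrow> 'a set" assume A: "\<And>i. A i \<in> sets borel"
    show "emeasure (density (path_law x) (indicator E)) {\<omega>. \<forall>i<Suc n. \<omega> i \<in> A i}
        = emeasure (scale_measure c (path_law x)) {\<omega>. \<forall>i<Suc n. \<omega> i \<in> A i}"
      using split[OF refl A, of "Suc n"] cylinder_measurable[OF A, where n="Suc n"]
      by (simp add: emeasure_density flip: indicator_inter_arith)
  qed auto
  from arg_cong[OF this, of "\<lambda>M. emeasure M E"] have "c = c * c"
    using E Ec by (simp add: emeasure_density flip: indicator_inter_arith)
  moreover have "c \<le> 1" using Ec emeasure_le_1 by metis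
  ultimately show "c = 0 \<or> c = 1"
    by (metis ennreal_mult_cancel_left ennreal_one_less_top leD mult.right_neutral top.not_eq_extremum)
qed

end

section \<open>Strongly mixing chains\<close>

text \<open>Strong mixing is restated for real functions, with an explicit bound \<open>b\<close> in
  place of the supremum, in terms of path measures, and from time 0 on.\<close>

locale mixing_chain = markov_kernel K for K :: "'a::polish_space \<Rightarrow> 'a measure" +
  fixes \<mu> :: "'a measure" and C \<rho> :: real
  assumes \<mu>_prob: "\<mu> \<in> space (prob_algebra borel)"
    and stationary: "\<And>S. S \<in> sets borel \<Longrightarrow> emeasure \<mu> S = (\<integral>\<^sup>+x. emeasure (K x) S \<partial>\<mu>)"
    and C_pos: "0 < C" and \<rho>_pos: "0 < \<rho>" and \<rho>_less_1: "\<rho> < 1"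
    and mixing: "\<And>f b x n. f \<in> borel_measurable borel \<Longrightarrow> (\<And>y. \<bar>f y :: real\<bar> \<le> b) \<Longrightarrow>
      \<bar>(\<integral>\<omega>. f (\<omega> n) \<partial>path_law x) - (\<integral>y. f y \<partial>\<mu>)\<bar> \<le> C * \<rho> ^ n * b"

lemma mixing_chain_exists:
  fixes K :: "'a::polish_space \<Rightarrow> 'a measure"
  assumes sys: "markov_system K \<mu>" and mix: "strongly_mixing K \<mu>"
  obtains C \<rho> where "mixing_chain K \<mu> C \<rho>"
proof -
  interpret markov_kernel K
    using sys by (simp add: markov_kernel_def markov_system_def)
  from mix obtain C \<rho> where C: "C > 0" and \<rho>: "0 < \<rho>" "\<rho> < 1" and
    bound: "\<And>f x n. f \<in> borel_measurable borel \<Longrightarrow> bounded (range f) \<Longrightarrow> n \<ge> 1 \<Longrightarrow>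
       cmod ((LINT y|kernel_pow K n x. f y) - (LINT y|\<mu>. f y)) \<le> C * \<rho> ^ n * (SUP y. cmod (f y))"
    unfolding strongly_mixing_def by blast
  have \<mu>: "prob_space \<mu>" "sets \<mu> = sets borel"
    using sys by (auto simp: markov_system_def space_prob_algebra)
  interpret \<mu>: prob_space \<mu> by fact
  have "\<bar>(\<integral>\<omega>. f (\<omega> n) \<partial>path_law x) - (\<integral>y. f y \<partial>\<mu>)\<bar> \<le> max C 2 * \<rho> ^ n * b"
    if [measurable]: "f \<in> borel_measurable borel" and b: "\<And>y. \<bar>f y :: real\<bar> \<le> b" for f b x n
  proof (cases n)
    case 0
    interpret P: prob_space "path_law x" by (rule prob_space_path_law)
    have "\<bar>\<integral>\<omega>. f (\<omega> n) \<partial>path_law x\<bar> \<le> b"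
      using b by (intro P.abs_integral_le) auto
    moreover have "\<bar>\<integral>y. f y \<partial>\<mu>\<bar> \<le> b"
      using b \<mu>(2) by (intro \<mu>.abs_integral_le) (auto cong: measurable_cong_sets)
    moreover have "2 * b \<le> max C 2 * b"
      using b[of undefined] by (intro mult_right_mono) auto
    ultimately show ?thesis using 0 by auto
  next
    case (Suc m)
    have b0: "0 \<le> b" using b[of undefined] by linarith
    have bdd: "bounded (range (\<lambda>y. complex_of_real (f y)))"
      using b by (auto simp: bounded_iff)
    have "(SUP y. cmod (complex_of_real (f y))) \<le> b"
      using b by (intro cSUP_least) auto
    then have "C * \<rho> ^ n * (SUP y. cmod (complex_of_real (f y))) \<le> max C 2 * \<rho> ^ n * b"
      using C \<rho> b0 by (intro mult_mono mult_nonneg_nonneg) (auto intro!: cSUP_upper2 bdd_aboveI2[of _ _ b] b)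
    moreover have "cmod ((LINT y|kernel_pow K n x. complex_of_real (f y)) - (LINT y|\<mu>. complex_of_real (f y)))
      \<le> C * \<rho> ^ n * (SUP y. cmod (complex_of_real (f y)))"
      by (rule bound) (use bdd Suc in auto)
    moreover have "(LINT y|kernel_pow K n x. f y) = (\<integral>\<omega>. f (\<omega> n) \<partial>path_law x)"
      by (simp add: kernel_pow_eq integral_distr)
    ultimately show ?thesis
      by (simp flip: of_real_diff)
  qed
  then have "mixing_chain K \<mu> (max C 2) \<rho>"
    using sys C \<rho> by unfold_locales (auto simp: markov_system_def)
  then show ?thesis by (rule that)
qed

context mixing_chain
begin

lemma prob_space_\<mu>: "prob_space \<mu>"
  using \<mu>_prob by (simp add: space_prob_algebra)

lemma sets_\<mu> [measurable_cong, simp]: "sets \<mu> = sets borel"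
  using \<mu>_prob by (simp add: space_prob_algebra)

lemma space_\<mu> [simp]: "space \<mu> = UNIV"
  using sets_eq_imp_space_eq[OF sets_\<mu>] by simp

lemma measurable_\<mu>_eq [simp]: "measurable \<mu> N = measurable borel N"
  by (rule measurable_cong_sets) auto

lemma nn_integral_stationary:
  assumes [measurable]: "h \<in> borel_measurable borel"
  shows "(\<integral>\<^sup>+x. \<integral>\<^sup>+y. h y \<partial>K x \<partial>\<mu>) = (\<integral>\<^sup>+x. h x \<partial>\<mu>)"
proof -
  have "\<mu> = \<mu> \<bind> K"
  proof (rule measure_eqI)
    show "sets \<mu> = sets (\<mu> \<bind> K)" by (subst sets_bind[where N=borel]) auto
    fix X assume "X \<in> sets \<mu>"
    then show "emeasure \<mu> X = emeasure (\<mu> \<bind> K) X"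
      by (simp add: stationary emeasure_bind[where N=borel])
  qed
  then have "(\<integral>\<^sup>+x. h x \<partial>\<mu>) = (\<integral>\<^sup>+x. h x \<partial>(\<mu> \<bind> K))" by simp
  also have "\<dots> = (\<integral>\<^sup>+x. \<integral>\<^sup>+y. h y \<partial>K x \<partial>\<mu>)"
    by (rule nn_integral_bind[where B=borel]) auto
  finally show ?thesis ..
qed

text \<open>The source of uniformity in the starting point: whatever \<open>x\<close>, the
  expectation at time \<open>n\<close> is controlled by the mean over \<open>\<mu>\<close> up to a
  geometrically small error.\<close>

lemma integral_le_coordinate:
  assumes [measurable]: "h \<in> borel_measurable borel" and b: "\<And>x. h x \<le> (1::ennreal)"
  shows "(\<integral>\<^sup>+\<omega>. h (\<omega> n) \<partial>path_law x) \<le> (\<integral>\<^sup>+y. h y \<partial>\<mu>) + ennreal (C * \<rho> ^ n)"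
proof -
  interpret P: prob_space "path_law x" by (rule prob_space_path_law)
  interpret \<mu>: prob_space \<mu> by (rule prob_space_\<mu>)
  let ?g = "\<lambda>x. enn2real (h x)"
  have g: "0 \<le> ?g y" "?g y \<le> 1" "ennreal (?g y) = h y" for y
  proof -
    have "h y < top" using b[of y] by (rule le_less_trans) simp
    then show "ennreal (?g y) = h y" by simp
    show "?g y \<le> 1" using enn2real_mono[OF b[of y]] by simp
  qed simp
  have "(\<integral>\<^sup>+\<omega>. h (\<omega> n) \<partial>path_law x) = (\<integral>\<^sup>+\<omega>. ennreal (?g (\<omega> n)) \<partial>path_law x)"
    by (simp add: g)
  also have "\<dots> = ennreal (\<integral>\<omega>. ?g (\<omega> n) \<partial>path_law x)"
    by (rule nn_integral_eq_integral) (auto intro!: P.integrable_const_bound[of _ 1] simp: g)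
  also have "\<dots> \<le> ennreal ((\<integral>y. ?g y \<partial>\<mu>) + C * \<rho> ^ n * 1)"
    by (rule ennreal_leI) (use mixing[of ?g 1 x n] g in auto)
  also have "\<dots> = ennreal (\<integral>y. ?g y \<partial>\<mu>) + ennreal (C * \<rho> ^ n)"
    using C_pos \<rho>_pos g by (subst ennreal_plus[symmetric]) (auto intro!: integral_nonneg_AE)
  also have "ennreal (\<integral>y. ?g y \<partial>\<mu>) = (\<integral>\<^sup>+y. ennreal (?g y) \<partial>\<mu>)"
    by (rule nn_integral_eq_integral[symmetric]) (auto intro!: \<mu>.integrable_const_bound[of _ 1] simp: g)
  also have "\<dots> = (\<integral>\<^sup>+y. h y \<partial>\<mu>)" by (simp add: g)
  finally show ?thesis .
qed

text \<open>Iterating the hypothesis bounds \<open>h x\<close> by the expectation of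
  \<open>h\<close> at time \<open>n\<close>, and mixing turns this into the mean as \<open>n\<close>
  grows. The conclusion holds at every point, not merely almost everywhere.\<close>

lemma subharmonic_le_mean:
  assumes [measurable]: "h \<in> borel_measurable borel" and b: "\<And>x. h x \<le> (1::ennreal)"
    and sub: "\<And>x. h x \<le> (\<integral>\<^sup>+y. h y \<partial>K x)"
  shows "h x \<le> (\<integral>\<^sup>+y. h y \<partial>\<mu>)"
proof -
  have iter: "h x \<le> (\<integral>\<^sup>+\<omega>. h (\<omega> n) \<partial>path_law x)" for n x
  proof (induction n arbitrary: x)
    case 0 then show ?case by (simp add: nn_integral_coordinate_0)
  next
    case (Suc n)
    have "h x \<le> (\<integral>\<^sup>+y. h y \<partial>K x)" by (rule sub)
    also have "\<dots> \<le> (\<integral>\<^sup>+y. \<integral>\<^sup>+\<omega>. h (\<omega> n) \<partial>path_law y \<partial>K x)"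
      by (rule nn_integral_mono) (rule Suc)
    finally show ?case by (subst nn_integral_coordinate_Suc) auto
  qed
  have "(\<lambda>n. (\<integral>\<^sup>+y. h y \<partial>\<mu>) + ennreal (C * \<rho> ^ n)) \<longlonglongrightarrow> (\<integral>\<^sup>+y. h y \<partial>\<mu>) + ennreal (C * 0)"
    using \<rho>_pos \<rho>_less_1 by (intro tendsto_intros tendsto_ennrealI LIMSEQ_power_zero) auto
  then have "(\<lambda>n. (\<integral>\<^sup>+y. h y \<partial>\<mu>) + ennreal (C * \<rho> ^ n)) \<longlonglongrightarrow> (\<integral>\<^sup>+y. h y \<partial>\<mu>)"
    by simp
  then show ?thesis
    by (rule LIMSEQ_le_const)
       (use order_trans[OF iter integral_le_coordinate[OF assms(1) b]] in blast)
qed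

text \<open>The probability of an invariant event is harmonic in the starting point. Applying
  \<open>subharmonic_le_mean\<close> to the event and to its complement makes it constant, and then
  it does not depend on the past either.\<close>

lemma zero_one_law:
  assumes E [measurable]: "E \<in> sets path_space" and inv: "\<And>\<omega>. path_shift 1 \<omega> \<in> E \<longleftrightarrow> \<omega> \<in> E"
  shows "(\<forall>x. emeasure (path_law x) E = 0) \<or> (\<forall>x. emeasure (path_law x) E = 1)"
proof -
  have invn: "path_shift n \<omega> \<in> E \<longleftrightarrow> \<omega> \<in> E" for n \<omega>
  proof (induction n)
    case (Suc n)
    have "path_shift (Suc n) \<omega> = path_shift 1 (path_shift n \<omega>)" by simp
    then show ?case using inv[of "path_shift n \<omega>"] Suc by metis
  qed simp
  have pre: "comb_seq n \<omega> -` E = E" for n and \<omega> :: "nat \<Rightarrow> 'a"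
    using invn[of n "comb_seq n \<omega> _"] by auto
  have le: "emeasure (path_law x) X \<le> (\<integral>\<^sup>+y. emeasure (path_law y) X \<partial>\<mu>)"
    if [measurable]: "X \<in> sets path_space" and X: "\<And>\<omega>. path_shift 1 \<omega> \<in> X \<longleftrightarrow> \<omega> \<in> X" for X x
  proof (rule subharmonic_le_mean)
    show "(\<lambda>x. emeasure (path_law x) X) \<in> borel_measurable borel"
      by (rule measurable_emeasure_kernel[OF path_law_subprob that(1)])
    show "emeasure (path_law x) X \<le> 1" for x
      by (rule prob_space.measure_le_1[OF prob_space_path_law])
    fix x
    have "(\<integral>\<^sup>+\<omega>. indicator X (path_shift 1 \<omega>) \<partial>path_law x) = (\<integral>\<^sup>+y. \<integral>\<^sup>+\<omega>. indicator X (path_shift 0 \<omega>) \<partial>path_law y \<partial>K x)"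
      unfolding One_nat_def by (rule nn_integral_shift_Suc) measurable
    moreover have "indicator X (path_shift 1 \<omega>) = (indicator X \<omega> :: ennreal)" for \<omega>
      using X by (simp add: indicator_def)
    ultimately show "emeasure (path_law x) X \<le> (\<integral>\<^sup>+y. emeasure (path_law y) X \<partial>K x)"
      by simp
  qed
  define c where "c = (\<integral>\<^sup>+y. emeasure (path_law y) E \<partial>\<mu>)"
  define c' where "c' = (\<integral>\<^sup>+y. emeasure (path_law y) (- E) \<partial>\<mu>)"
  have cE [measurable]: "- E \<in> sets path_space"
    using sets.compl_sets[OF E] by (simp add: Compl_eq_Diff_UNIV)
  have sum1: "emeasure (path_law x) E + emeasure (path_law x) (- E) = 1" for x
    using prob_space.emeasure_space_1[OF prob_space_path_law[of x]]
    by (subst plus_emeasure) auto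
  have [measurable]: "(\<lambda>x. emeasure (path_law x) E) \<in> borel_measurable borel"
      "(\<lambda>x. emeasure (path_law x) (- E)) \<in> borel_measurable borel"
    by (rule measurable_emeasure_kernel[OF path_law_subprob], simp)+
  have "c + c' = (\<integral>\<^sup>+y. emeasure (path_law y) E + emeasure (path_law y) (- E) \<partial>\<mu>)"
    unfolding c_def c'_def by (rule nn_integral_add[symmetric]) auto
  then have cc: "c + c' = 1"
    using prob_space.emeasure_space_1[OF prob_space_\<mu>] by (simp add: sum1)
  have const: "emeasure (path_law x) E = c" for x
  proof (rule antisym)
    show "emeasure (path_law x) E \<le> c"
      unfolding c_def using inv by (intro le) auto
    have "emeasure (path_law x) (- E) \<le> c'"
      unfolding c'_def using inv by (intro le) auto
    then have "c + emeasure (path_law x) (- E) \<le> emeasure (path_law x) E + emeasure (path_law x) (- E)"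
      using cc sum1 by (metis add_left_mono)
    moreover have "emeasure (path_law x) (- E) \<noteq> top"
      using sum1[of x] by auto
    ultimately show "c \<le> emeasure (path_law x) E"
      by (simp add: ennreal_add_left_cancel_le add.commute)
  qed
  have "c = 0 \<or> c = 1"
    by (rule zero_one_if_independent_of_past(2)[OF E, where x=undefined]) (simp add: pre const)
  then show ?thesis using const by auto
qed

end

declare path_shift_apply [simp del]

section \<open>Subadditive processes\<close>

lemma fekete:
  fixes u :: "nat \<Rightarrow> real"
  assumes sub: "\<And>n m. u (n + m) \<le> u n + u m" and bd: "\<And>n. \<bar>u n\<bar> \<le> c * real n"
  obtains L where "(\<lambda>n. u n / real n) \<longlonglongrightarrow> L" and "\<And>n. n \<ge> 1 \<Longrightarrow> L \<le> u n / real n"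
proof -
  have c: "0 \<le> c" using bd[of 1] by simp
  define L where "L = (INF n\<in>{1..}. u n / real n)"
  have bdd: "bdd_below ((\<lambda>n. u n / real n) ` {1..})"
  proof (rule bdd_belowI2)
    fix n :: nat assume "n \<in> {1..}"
    then show "- c \<le> u n / real n" using bd[of n] by (simp add: field_simps abs_le_iff)
  qed
  have lower: "L \<le> u n / real n" if "n \<ge> 1" for n
    unfolding L_def by (rule cINF_lower[OF bdd]) (use that in simp)
  have mult: "u (q * k) \<le> real q * u k" for q k
  proof (induction q)
    case 0 show ?case using bd[of 0] by simp
  next
    case (Suc q) then show ?case using sub[of k "q * k"] by (simp add: algebra_simps)
  qed
  have upper: "\<forall>\<^sub>F n in sequentially. u n / real n < L + e" if "e > 0" for e
  proof -
    have "\<exists>k\<in>{1..}. u k / real k < L + e / 2"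
      using \<open>e > 0\<close> bdd by (subst cINF_less_iff[symmetric]) (auto simp: L_def)
    then obtain k where k: "k \<ge> 1" "u k / real k < L + e / 2" by auto
    \<comment> \<open>With \<open>n = q * k + r\<close>, the remainder costs \<open>c * r\<close> as
      a final block, and replacing \<open>n - r\<close> by \<open>n\<close> in the main term costs
      another \<open>c * r\<close>; both are at most \<open>c * k\<close>.\<close>
    have est: "u n \<le> real n * (u k / real k) + 2 * c * real k" for n
    proof -
      have "u n \<le> u (n div k * k) + u (n mod k)" using sub[of "n div k * k" "n mod k"] by simp
      also have "\<dots> \<le> real (n div k) * u k + c * real (n mod k)"
        using mult[of "n div k" k] bd[of "n mod k"] by (auto simp: abs_le_iff)
      also have "real (n div k) * u k = (real n - real (n mod k)) * (u k / real k)"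
      proof -
        have "real n - real (n mod k) = real (n div k) * real k"
          using div_mult_mod_eq[of n k] by (metis add_diff_cancel_right' of_nat_add of_nat_mult)
        then show ?thesis using k(1) by simp
      qed
      finally have 1: "u n \<le> (real n - real (n mod k)) * (u k / real k) + c * real (n mod k)" .
      have "- c \<le> u k / real k" using bd[of k] k(1) by (simp add: field_simps abs_le_iff)
      then have 2: "real (n mod k) * (- c) \<le> real (n mod k) * (u k / real k)" by (intro mult_left_mono) auto
      have 3: "c * real (n mod k) \<le> c * real k"
        using c k(1) mod_less_divisor[of k n] by (intro mult_left_mono) auto
      have "(real n - real (n mod k)) * (u k / real k) = real n * (u k / real k) - real (n mod k) * (u k / real k)"
        by (rule left_diff_distrib)
      moreover have "real (n mod k) * (- c) = - (c * real (n mod k))" by simp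
      ultimately show ?thesis using 1 2 3 by linarith
    qed
    have "(\<lambda>n. 2 * c * real k / real n) \<longlonglongrightarrow> 0"
      by (intro tendsto_divide_0[OF tendsto_const] filterlim_real_at_infinity_sequentially)
    then have "\<forall>\<^sub>F n in sequentially. 2 * c * real k / real n < e / 2"
      using \<open>e > 0\<close> by (intro order_tendstoD(2)) auto
    then show ?thesis
      using eventually_ge_at_top[of 1]
    proof eventually_elim
      case (elim n)
      have "u n / real n \<le> u k / real k + 2 * c * real k / real n"
        using est[of n] elim(2) by (simp add: field_simps)
      then show ?case using elim(1) k(2) by linarith
    qed
  qed
  have "(\<lambda>n. u n / real n) \<longlonglongrightarrow> L"
  proof (rule order_tendstoI)
    fix a assume "a < L"
    show "\<forall>\<^sub>F n in sequentially. a < u n / real n"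
      using eventually_ge_at_top[of 1] by eventually_elim (use lower \<open>a < L\<close> in fastforce)
  next
    fix a assume "L < a"
    then show "\<forall>\<^sub>F n in sequentially. u n / real n < a"
      using upper[of "a - L"] by simp
  qed
  then show ?thesis using lower by (rule that)
qed

text \<open>
  Walk from \<open>i\<close> to \<open>i + N\<close>, using a cheap block of length at most \<open>M\<close> at every good position and a
  single step at every bad one.
\<close>

lemma subadditive_covering:
  fixes b :: "nat \<Rightarrow> nat \<Rightarrow> real"
  assumes sub: "\<And>i n m. b i (n + m) \<le> b i n + b (i + n) m"
    and bd: "\<And>i n. \<bar>b i n\<bar> \<le> c * real n" and l: "\<bar>l\<bar> \<le> c"
    and good: "\<And>i. i \<notin> Bad \<Longrightarrow> \<exists>n\<ge>1. n \<le> M \<and> b i n \<le> real n * l"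
  shows "b i N \<le> real N * l + 2 * c * (real M + real (card (Bad \<inter> {i..<i+N})))"
proof (induction N arbitrary: i rule: less_induct)
  case (less N)
  have c: "0 \<le> c" using l by simp
  \<comment> \<open>The crude comparison for a stretch that no cheap block covers:
    \<open>b i n\<close> and \<open>real n * l\<close> both lie within \<open>c * real n\<close> of
    0. It pays for the last piece of length at most \<open>M\<close> and for single bad
    steps.\<close>
  have short: "b i n \<le> real n * l + 2 * c * real n" for i n
  proof -
    have "- c * real n \<le> l * real n" using l by (intro mult_right_mono) auto
    then show ?thesis using bd[of i n] by (simp add: algebra_simps)
  qed
  show ?case
  proof (cases "N \<le> M")
    case True
    have "2 * c * real N \<le> 2 * c * (real M + real (card (Bad \<inter> {i..<i+N})))"
      using c True by (intro mult_left_mono) auto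
    then show ?thesis using short[of i N] by linarith
  next
    case False
    show ?thesis
    proof (cases "i \<in> Bad")
      case True
      have "b i N \<le> b i 1 + b (i + 1) (N - 1)" using sub[of i 1 "N - 1"] False by simp
      also have "b i 1 \<le> l + 2 * c" using short[of i 1] by simp
      also have "b (i + 1) (N - 1) \<le> real (N - 1) * l + 2 * c * (real M + real (card (Bad \<inter> {i+1..<i+1+(N-1)})))"
        using False by (intro less) auto
      also have "Bad \<inter> {i..<i+N} = insert i (Bad \<inter> {i+1..<i+1+(N-1)})"
        using True False by auto
      then have "card (Bad \<inter> {i..<i+N}) = Suc (card (Bad \<inter> {i+1..<i+1+(N-1)}))"
        by simp
      then have "real (card (Bad \<inter> {i+1..<i+1+(N-1)})) = real (card (Bad \<inter> {i..<i+N})) - 1"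
        by simp
      finally show ?thesis using False by (simp add: of_nat_diff algebra_simps)
    next
      case g: False
      obtain n where n: "n \<ge> 1" "n \<le> M" "b i n \<le> real n * l" using good[OF g] by auto
      have "b i N \<le> b i n + b (i + n) (N - n)" using sub[of i n "N - n"] n False by simp
      also have "b (i + n) (N - n) \<le> real (N - n) * l + 2 * c * (real M + real (card (Bad \<inter> {i+n..<i+n+(N-n)})))"
        using False n by (intro less) auto
      finally have 1: "b i N \<le> b i n + (real (N - n) * l + 2 * c * (real M + real (card (Bad \<inter> {i+n..<i+n+(N-n)}))))"
        by simp
      have "real (card (Bad \<inter> {i+n..<i+n+(N-n)})) \<le> real (card (Bad \<inter> {i..<i+N}))"
        unfolding of_nat_le_iff by (rule card_mono) (use n False in auto)
      then have 2: "2 * c * (real M + real (card (Bad \<inter> {i+n..<i+n+(N-n)})))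
          \<le> 2 * c * (real M + real (card (Bad \<inter> {i..<i+N})))"
        using c by (intro mult_left_mono) auto
      have "real (N - n) * l = real N * l - real n * l"
        using n False by (simp add: of_nat_diff left_diff_distrib)
      then show ?thesis using 1 2 n(3) by linarith
    qed
  qed
qed

section \<open>The stationary one-sided chain and processes over it\<close>

context mixing_chain
begin

definition stationary_law :: "(nat \<Rightarrow> 'a) measure" where
  "stationary_law = \<mu> \<bind> path_law"

lemma sets_stationary_law [measurable_cong, simp]: "sets stationary_law = sets path_space"
  unfolding stationary_law_def by (rule sets_bind) auto

lemma space_stationary_law [simp]: "space stationary_law = UNIV"
  using sets_eq_imp_space_eq[OF sets_stationary_law] by simp

lemma prob_space_stationary_law: "prob_space stationary_law"
  unfolding stationary_law_def by (rule prob_space_bind'[OF \<mu>_prob path_law_prob])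

lemma nn_integral_stationary_law:
  "f \<in> borel_measurable path_space \<Longrightarrow>
    (\<integral>\<^sup>+\<omega>. f \<omega> \<partial>stationary_law) = (\<integral>\<^sup>+x. \<integral>\<^sup>+\<omega>. f \<omega> \<partial>path_law x \<partial>\<mu>)"
  unfolding stationary_law_def by (rule nn_integral_bind[where B=path_space]) auto

lemma integral_stationary_law:
  fixes f :: "(nat \<Rightarrow> 'a) \<Rightarrow> real"
  assumes "f \<in> borel_measurable path_space" "\<And>\<omega>. \<bar>f \<omega>\<bar> \<le> b"
  shows "(\<integral>\<omega>. f \<omega> \<partial>stationary_law) = (\<integral>x. \<integral>\<omega>. f \<omega> \<partial>path_law x \<partial>\<mu>)"
  unfolding stationary_law_def
proof (rule integral_bind[where K=path_space and B=b and B'=1])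
  show "AE x in \<mu>. emeasure (path_law x) (space (path_law x)) \<le> ennreal 1"
    by (auto intro!: AE_I2 prob_space.measure_le_1 prob_space_path_law)
qed (use assms prob_space_\<mu> in \<open>auto intro: prob_space.finite_measure\<close>)

lemma AE_stationary_law:
  assumes "Measurable.pred path_space Q"
  shows "(AE \<omega> in stationary_law. Q \<omega>) \<longleftrightarrow> (AE x in \<mu>. AE \<omega> in path_law x. Q \<omega>)"
  unfolding stationary_law_def by (rule AE_bind[where B=path_space]) (use assms in auto)

lemma distr_shift_stationary_law: "distr stationary_law path_space (path_shift n) = stationary_law"
proof (induction n)
  case 0
  show ?case by (simp add: distr_id2)
next
  case (Suc n)
  have one: "distr stationary_law path_space (path_shift 1) = stationary_law"
  proof (rule measure_eqI)
    fix X assume "X \<in> sets (distr stationary_law path_space (path_shift 1))"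
    then have X [measurable]: "X \<in> sets path_space" by simp
    have m [measurable]: "(\<lambda>x. emeasure (path_law x) X) \<in> borel_measurable borel"
      by (rule measurable_emeasure_kernel[OF path_law_subprob X])
    have "emeasure (distr stationary_law path_space (path_shift 1)) X
        = (\<integral>\<^sup>+\<omega>. indicator X \<omega> \<partial>distr stationary_law path_space (path_shift 1))"
      by simp
    also have "\<dots> = (\<integral>\<^sup>+\<omega>. indicator X (path_shift 1 \<omega>) \<partial>stationary_law)"
      by (rule nn_integral_distr) auto
    also have "\<dots> = (\<integral>\<^sup>+x. \<integral>\<^sup>+\<omega>. indicator X (path_shift (Suc 0) \<omega>) \<partial>path_law x \<partial>\<mu>)"
      unfolding One_nat_def by (rule nn_integral_stationary_law) measurable
    also have "\<dots> = (\<integral>\<^sup>+x. \<integral>\<^sup>+y. emeasure (path_law y) X \<partial>K x \<partial>\<mu>)"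
      by (subst nn_integral_shift_Suc) auto
    also have "\<dots> = (\<integral>\<^sup>+x. emeasure (path_law x) X \<partial>\<mu>)"
      by (rule nn_integral_stationary) measurable
    also have "\<dots> = (\<integral>\<^sup>+x. \<integral>\<^sup>+\<omega>. indicator X \<omega> \<partial>path_law x \<partial>\<mu>)"
      by simp
    also have "\<dots> = (\<integral>\<^sup>+\<omega>. indicator X \<omega> \<partial>stationary_law)"
      by (rule nn_integral_stationary_law[symmetric]) measurable
    also have "\<dots> = emeasure stationary_law X" by simp
    finally show "emeasure (distr stationary_law path_space (path_shift 1)) X = emeasure stationary_law X" .
  qed simp
  have "path_shift (Suc n) = path_shift n \<circ> (path_shift 1 :: (nat \<Rightarrow> 'a) \<Rightarrow> _)" by auto
  then have "distr stationary_law path_space (path_shift (Suc n))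
      = distr (distr stationary_law path_space (path_shift 1)) path_space (path_shift n)"
    by (simp only:) (rule distr_distr[symmetric], auto)
  then show ?case by (simp only: one Suc)
qed

lemma integral_shift_stationary_law:
  fixes f :: "(nat \<Rightarrow> 'a) \<Rightarrow> real"
  assumes "f \<in> borel_measurable path_space"
  shows "(\<integral>\<omega>. f (path_shift n \<omega>) \<partial>stationary_law) = (\<integral>\<omega>. f \<omega> \<partial>stationary_law)"
proof -
  have "(\<integral>\<omega>. f \<omega> \<partial>distr stationary_law path_space (path_shift n)) = (\<integral>\<omega>. f (path_shift n \<omega>) \<partial>stationary_law)"
    by (rule integral_distr) (use assms in auto)
  then show ?thesis by (simp only: distr_shift_stationary_law)
qed

lemma measure_shift_stationary_law:
  assumes [measurable]: "X \<in> sets path_space"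
  shows "measure stationary_law (path_shift n -` X) = measure stationary_law X"
proof -
  have "measure stationary_law X = measure (distr stationary_law path_space (path_shift n)) X"
    by (simp only: distr_shift_stationary_law)
  also have "\<dots> = measure stationary_law (path_shift n -` X)"
    by (subst measure_distr) auto
  finally show ?thesis ..
qed

end

text \<open>\<open>a_shift\<close> is a partial converse of subadditivity: dropping the first step
  increases the process by at most a constant. It makes events about asymptotic growth shift
  invariant, so that \<open>zero_one_law\<close> applies; for cocycles it comes from the bounded
  inverse.\<close>

locale subadditive_process = mixing_chain K \<mu> C \<rho>
  for K :: "'a::polish_space \<Rightarrow> 'a measure" and \<mu> C \<rho> +
  fixes a :: "nat \<Rightarrow> (nat \<Rightarrow> 'a) \<Rightarrow> real" and c :: real
  assumes a_measurable [measurable]: "\<And>n. a n \<in> borel_measurable path_space"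
    and a_bound: "\<And>n \<omega>. \<bar>a n \<omega>\<bar> \<le> c * real n"
    and a_subadd: "\<And>n m \<omega>. a (n + m) \<omega> \<le> a n \<omega> + a m (path_shift n \<omega>)"
    and a_shift: "\<And>n \<omega>. a n (path_shift 1 \<omega>) \<le> a (Suc n) \<omega> + c"
begin

lemma c_nonneg: "0 \<le> c"
  using a_bound[of 1 undefined] abs_ge_zero[of "a 1 undefined"] by linarith

sublocale M: prob_space stationary_law
  by (rule prob_space_stationary_law)

definition rate :: real where
  "rate = lim (\<lambda>n. M.expectation (a n) / real n)"

lemma expectation_bounds:
  "integrable stationary_law (a n)" "\<bar>M.expectation (a n)\<bar> \<le> c * real n"
  using M.abs_integral_le[of "a n" "c * real n"] a_bound by auto

lemma
  shows rate_tendsto: "(\<lambda>n. M.expectation (a n) / real n) \<longlonglongrightarrow> rate"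
    and rate_le: "n \<ge> 1 \<Longrightarrow> rate \<le> M.expectation (a n) / real n"
proof -
  have "M.expectation (a (n + m)) \<le> M.expectation (a n) + M.expectation (a m)" for n m
  proof -
    have int: "integrable stationary_law (\<lambda>\<omega>. a m (path_shift n \<omega>))"
      by (rule M.abs_integral_le(1)[where b="c * real m"]) (auto simp: a_bound)
    have "M.expectation (a (n + m)) \<le> M.expectation (\<lambda>\<omega>. a n \<omega> + a m (path_shift n \<omega>))"
      by (rule integral_mono[OF expectation_bounds(1) Bochner_Integration.integrable_add])
         (auto intro: expectation_bounds int a_subadd)
    also have "\<dots> = M.expectation (a n) + M.expectation (\<lambda>\<omega>. a m (path_shift n \<omega>))"
      by (rule Bochner_Integration.integral_add[OF expectation_bounds(1) int])
    finally show ?thesis by (simp add: integral_shift_stationary_law)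
  qed
  then obtain L where L: "(\<lambda>n. M.expectation (a n) / real n) \<longlonglongrightarrow> L"
      "\<And>n. n \<ge> 1 \<Longrightarrow> L \<le> M.expectation (a n) / real n"
    using fekete[OF _ expectation_bounds(2)] by metis
  then have "rate = L" unfolding rate_def by (intro limI)
  then show "(\<lambda>n. M.expectation (a n) / real n) \<longlonglongrightarrow> rate"
    "n \<ge> 1 \<Longrightarrow> rate \<le> M.expectation (a n) / real n"
    using L by auto
qed

lemma rate_bounds: "\<bar>rate\<bar> \<le> c"
proof (rule LIMSEQ_le_const2[OF tendsto_rabs[OF rate_tendsto]])
  show "\<exists>N. \<forall>n\<ge>N. \<bar>M.expectation (a n) / real n\<bar> \<le> c"
    using expectation_bounds(2) by (intro exI[of _ 1]) (auto simp: abs_divide field_simps)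
qed

text \<open>Almost every path starts with a block of average at most \<open>l\<close>, so a position
  is bad only if all its cheap blocks are longer than \<open>m\<close>. By stationarity bad
  positions have frequency \<open>prob (bad m)\<close>. The covering bound is integrated, then
  \<open>N\<close> tends to infinity, and after it \<open>m\<close>.\<close>

lemma rate_le_if_recurrently_le:
  assumes l: "\<bar>l\<bar> \<le> c" and ae: "AE \<omega> in stationary_law. \<exists>n\<ge>1. a n \<omega> \<le> real n * l"
  shows "rate \<le> l"
proof -
  define bad where "bad m = {\<omega>. \<not> (\<exists>n\<ge>1. n \<le> m \<and> a n \<omega> \<le> real n * l)}" for m :: nat
  have bad [measurable]: "bad m \<in> sets path_space" for m
  proof -
    have "{\<omega> \<in> space path_space. \<not> (\<exists>n\<ge>1. n \<le> m \<and> a n \<omega> \<le> real n * l)} \<in> sets path_space"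
      by measurable
    then show ?thesis by (simp add: bad_def)
  qed
  have est: "rate \<le> l + 2 * c * (real m / real N + M.prob (bad m))" if N: "N \<ge> 1" for m N
  proof -
    have "a N \<omega> \<le> real N * l + 2 * c * (real m + (\<Sum>i<N. indicator (bad m) (path_shift i \<omega>)))" for \<omega>
    proof -
      have "a N (path_shift 0 \<omega>) \<le> real N * l + 2 * c * (real m + real (card ({i. path_shift i \<omega> \<in> bad m} \<inter> {0..<0+N})))"
        using a_subadd[of _ _ "path_shift _ \<omega>"] a_bound l
        by (intro subadditive_covering[where b="\<lambda>i n. a n (path_shift i \<omega>)"]) (auto simp: bad_def)
      also have "real (card ({i. path_shift i \<omega> \<in> bad m} \<inter> {0..<0+N})) = (\<Sum>i<N. indicator (bad m) (path_shift i \<omega>))"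
        by (simp add: indicator_def sum.If_cases Int_def lessThan_atLeast0 conj_commute)
      finally show ?thesis by simp
    qed
    then have "M.expectation (a N) \<le> M.expectation (\<lambda>\<omega>. real N * l + 2 * c * (real m + (\<Sum>i<N. indicator (bad m) (path_shift i \<omega>))))"
      by (intro integral_mono[OF expectation_bounds(1)] M.abs_integral_le(1)[where b="real N * \<bar>l\<bar> + 2 * c * (real m + real N)"])
         (auto simp: c_nonneg abs_mult intro!: order_trans[OF abs_triangle_ineq] add_mono mult_left_mono
            order_trans[OF sum_abs] order_trans[OF sum_bounded_above[where K=1]])
    also have "\<dots> = real N * l + 2 * c * (real m + (\<Sum>i<N. M.prob (path_shift i -` bad m)))"
    proof -
      have int: "integrable stationary_law (\<lambda>\<omega>. indicator (bad m) (path_shift i \<omega>) :: real)" for i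
        by (rule M.abs_integral_le(1)[where b=1]) auto
      have "M.expectation (\<lambda>\<omega>. indicat_real (bad m) (path_shift i \<omega>)) = M.prob (path_shift i -` bad m)" for i
      proof -
        have "M.expectation (\<lambda>\<omega>. indicat_real (bad m) (path_shift i \<omega>)) = M.expectation (indicat_real (path_shift i -` bad m))"
          by (rule Bochner_Integration.integral_cong) (auto simp: indicator_def)
        moreover have "path_shift i -` bad m \<in> sets path_space"
          using measurable_sets[OF measurable_path_shift bad, of i m] by simp
        ultimately show ?thesis by simp
      qed
      then show ?thesis using int M.prob_space
        by (simp add: Bochner_Integration.integral_add Bochner_Integration.integral_sum M.prob_space
            Bochner_Integration.integrable_sum)
    qed
    also have "\<dots> = real N * l + 2 * c * (real m + real N * M.prob (bad m))"
      by (simp add: measure_shift_stationary_law)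
    finally have "M.expectation (a N) / real N \<le> l + 2 * c * (real m / real N + M.prob (bad m))"
      using N by (simp add: field_simps)
    then show ?thesis using rate_le[OF N] by linarith
  qed
  have "rate \<le> l + 2 * c * (0 + M.prob (bad m))" for m
  proof (rule LIMSEQ_le_const)
    show "(\<lambda>N. l + 2 * c * (real m / real N + M.prob (bad m))) \<longlonglongrightarrow> l + 2 * c * (0 + M.prob (bad m))"
      by (intro tendsto_intros tendsto_divide_0[OF tendsto_const] filterlim_real_at_infinity_sequentially)
    show "\<exists>N0. \<forall>N\<ge>N0. rate \<le> l + 2 * c * (real m / real N + M.prob (bad m))"
      using est by blast
  qed
  moreover have "(\<lambda>m. l + 2 * c * (0 + M.prob (bad m))) \<longlonglongrightarrow> l + 2 * c * (0 + M.prob (\<Inter>m. bad m))"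
  proof (intro tendsto_intros M.finite_Lim_measure_decseq)
    show "range bad \<subseteq> M.events" using bad by auto
    show "decseq bad" by (auto simp: decseq_def bad_def)
  qed
  moreover have "M.prob (\<Inter>m. bad m) = 0"
  proof -
    have "AE \<omega> in stationary_law. \<omega> \<notin> (\<Inter>m. bad m)"
      using ae by eventually_elim (auto simp: bad_def)
    then show ?thesis by (subst M.prob_eq_0) auto
  qed
  ultimately show ?thesis
    using LIMSEQ_le_const[of "\<lambda>m. l + 2 * c * (0 + M.prob (bad m))" l rate] by auto
qed

text \<open>The event that the lower growth rate falls below a level \<open>t < rate\<close> is
  shift invariant. If it had probability one, almost every path would have blocks of average at most
  \<open>t\<close>, against \<open>rate_le_if_recurrently_le\<close>. The zero-one law then makes it
  null from every starting point.\<close>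

lemma eventually_ge:
  assumes "s < rate"
  shows "AE \<omega> in path_law x. \<forall>\<^sub>F n in sequentially. real n * s < a n \<omega>"
proof (cases "s < - c")
  \<comment> \<open>Set apart because \<open>rate_le_if_recurrently_le\<close> asks for a level
    between \<open>- c\<close> and \<open>c\<close>.\<close>
  case True
  have "\<forall>\<^sub>F n in sequentially. real n * s < a n \<omega>" for \<omega>
    using eventually_gt_at_top[of 0]
  proof eventually_elim
    case (elim n)
    have "real n * s < real n * (- c)" using True elim by (intro mult_strict_left_mono) auto
    then show ?case using a_bound[of n \<omega>] by (simp add: abs_le_iff mult.commute)
  qed
  then show ?thesis by simp
next
  case False
  define t where "t = (s + rate) / 2"
  have t: "s < t" "t < rate" "\<bar>t\<bar> \<le> c" using assms False rate_bounds by (auto simp: t_def)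
  \<comment> \<open>\<open>F\<close> says that the lower limit of \<open>a n / n\<close> is less
    than \<open>t\<close>. The union over \<open>k\<close> leaves room: a shift changes both sides
    by a bounded amount, which the passage from \<open>k\<close> to \<open>Suc k\<close> absorbs
    since it gains a fixed multiple of \<open>n\<close>.\<close>
  define F where "F = {\<omega>. \<exists>k. \<forall>m. \<exists>n\<ge>m. a n \<omega> \<le> real n * (t - 1 / real (Suc k))}"
  have F [measurable]: "F \<in> sets path_space"
  proof -
    have "{\<omega> \<in> space path_space. \<exists>k. \<forall>m. \<exists>n\<ge>m. a n \<omega> \<le> real n * (t - 1 / real (Suc k))} \<in> sets path_space"
      by measurable
    then show ?thesis by (simp add: F_def)
  qed
  have slack: "\<exists>m0. \<forall>n\<ge>m0. real n * (t - 1 / real (Suc k)) + 3 * c + \<bar>t\<bar> + 1 \<le> real n * (t - 1 / real (Suc (Suc k)))" for k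
  proof -
    have "0 < 1 / real (Suc k) - 1 / real (Suc (Suc k))" by (simp add: frac_less2)
    then obtain m0 :: nat where "(3 * c + \<bar>t\<bar> + 1) / (1 / real (Suc k) - 1 / real (Suc (Suc k))) \<le> real m0"
      using real_arch_simple by blast
    then have "3 * c + \<bar>t\<bar> + 1 \<le> real m0 * (1 / real (Suc k) - 1 / real (Suc (Suc k)))"
      using \<open>0 < _\<close> by (simp add: divide_le_eq)
    then have "3 * c + \<bar>t\<bar> + 1 \<le> real n * (1 / real (Suc k) - 1 / real (Suc (Suc k)))" if "n \<ge> m0" for n
      using \<open>0 < _\<close> that by (meson less_imp_le mult_right_mono of_nat_le_iff order_trans)
    then show ?thesis by (intro exI[of _ m0]) (auto simp: algebra_simps)
  qed
  have "path_shift 1 \<omega> \<in> F \<longleftrightarrow> \<omega> \<in> F" for \<omega>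
  proof
    assume "path_shift 1 \<omega> \<in> F"
    then obtain k where k: "\<And>m. \<exists>n\<ge>m. a n (path_shift 1 \<omega>) \<le> real n * (t - 1 / real (Suc k))"
      by (auto simp: F_def)
    obtain m0 where m0: "\<And>n. n \<ge> m0 \<Longrightarrow> real n * (t - 1 / real (Suc k)) + 3 * c + \<bar>t\<bar> + 1 \<le> real n * (t - 1 / real (Suc (Suc k)))"
      using slack by blast
    have "\<exists>n\<ge>m. a n \<omega> \<le> real n * (t - 1 / real (Suc (Suc k)))" for m
    proof -
      obtain n where n: "n \<ge> max m m0" "a n (path_shift 1 \<omega>) \<le> real n * (t - 1 / real (Suc k))"
        using k by blast
      have "a (Suc n) \<omega> \<le> a 1 \<omega> + a n (path_shift 1 \<omega>)" using a_subadd[of 1 n \<omega>] by simp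
      also have "\<dots> \<le> c + real n * (t - 1 / real (Suc k))" using a_bound[of 1 \<omega>] n by simp
      also have "\<dots> \<le> real n * (t - 1 / real (Suc (Suc k))) - \<bar>t\<bar> - 1" using m0[of n] n c_nonneg by simp
      also have "\<dots> \<le> real (Suc n) * (t - 1 / real (Suc (Suc k)))"
      proof -
        have "1 / real (Suc (Suc k)) \<le> 1" by simp
        then have "- \<bar>t\<bar> - 1 \<le> t - 1 / real (Suc (Suc k))" by linarith
        then show ?thesis unfolding of_nat_Suc distrib_right by simp
      qed
      finally show ?thesis using n by (intro exI[of _ "Suc n"]) auto
    qed
    then show "\<omega> \<in> F" unfolding F_def mem_Collect_eq by blast
  next
    assume "\<omega> \<in> F"
    then obtain k where k: "\<And>m. \<exists>n\<ge>m. a n \<omega> \<le> real n * (t - 1 / real (Suc k))"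
      by (auto simp: F_def)
    obtain m0 where m0: "\<And>n. n \<ge> m0 \<Longrightarrow> real n * (t - 1 / real (Suc k)) + 3 * c + \<bar>t\<bar> + 1 \<le> real n * (t - 1 / real (Suc (Suc k)))"
      using slack by blast
    have "\<exists>n\<ge>m. a n (path_shift 1 \<omega>) \<le> real n * (t - 1 / real (Suc (Suc k)))" for m
    proof -
      obtain n' where n': "n' \<ge> Suc (max m m0)" "a n' \<omega> \<le> real n' * (t - 1 / real (Suc k))"
        using k by blast
      then obtain n where n: "n' = Suc n" "n \<ge> max m m0" by (cases n') auto
      have "a n (path_shift 1 \<omega>) \<le> a (Suc n) \<omega> + c" by (rule a_shift)
      also have "\<dots> \<le> real (Suc n) * (t - 1 / real (Suc k)) + c" using n' n by simp
      also have "\<dots> \<le> real n * (t - 1 / real (Suc k)) + \<bar>t\<bar> + c"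
      proof -
        have "0 \<le> 1 / real (Suc k)" by simp
        then have "t - 1 / real (Suc k) \<le> \<bar>t\<bar>" by linarith
        then show ?thesis unfolding of_nat_Suc distrib_right by simp
      qed
      also have "\<dots> \<le> real n * (t - 1 / real (Suc (Suc k)))" using m0[of n] n c_nonneg by simp
      finally show ?thesis using n by (intro exI[of _ n]) auto
    qed
    then show "path_shift 1 \<omega> \<in> F" unfolding F_def mem_Collect_eq by blast
  qed
  from zero_one_law[OF F this]
  have "emeasure (path_law x) F = 0" for x
  proof
    assume one: "\<forall>x. emeasure (path_law x) F = 1"
    have "AE \<omega> in stationary_law. \<omega> \<in> F"
      using one by (simp add: AE_stationary_law prob_space.AE_iff_emeasure_eq_1[OF prob_space_path_law])
    then have "AE \<omega> in stationary_law. \<exists>n\<ge>1. a n \<omega> \<le> real n * t"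
    proof eventually_elim
      case (elim \<omega>)
      then obtain k n where "n \<ge> 1" "a n \<omega> \<le> real n * (t - 1 / real (Suc k))"
        unfolding F_def by blast
      moreover have "real n * (t - 1 / real (Suc k)) \<le> real n * t" by (intro mult_left_mono) auto
      ultimately show ?case using order_trans by blast
    qed
    then have "rate \<le> t" by (rule rate_le_if_recurrently_le[OF t(3)])
    then show ?thesis using t by simp
  qed auto
  then have "AE \<omega> in path_law x. \<omega> \<notin> F"
    by (intro AE_not_in) (auto simp: null_sets_def)
  then show ?thesis
  proof eventually_elim
    case (elim \<omega>)
    obtain k where k: "1 / real (Suc k) < t - s"
      using t(1) reals_Archimedean[of "t - s"] by (auto simp: inverse_eq_divide)
    from elim obtain m where m: "\<And>n. n \<ge> m \<Longrightarrow> real n * (t - 1 / real (Suc k)) < a n \<omega>"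
      unfolding F_def mem_Collect_eq by (meson not_le)
    show ?case
      using eventually_ge_at_top[of m]
    proof eventually_elim
      case (elim n)
      have "real n * s \<le> real n * (t - 1 / real (Suc k))" using k by (intro mult_left_mono) auto
      then show ?case using m[OF elim] by linarith
    qed
  qed
qed


end

section \<open>The pointwise ergodic theorem\<close>

context mixing_chain
begin

text \<open>The sums of \<open>f\<close> and of \<open>- f\<close> along the path are both
  subadditive processes, with rates plus and minus the integral, so \<open>eventually_ge\<close> for
  each gives the two halves of the limit.\<close>

lemma birkhoff:
  fixes f :: "(nat \<Rightarrow> 'a) \<Rightarrow> real"
  assumes f [measurable]: "f \<in> borel_measurable path_space" and b: "\<And>\<omega>. \<bar>f \<omega>\<bar> \<le> b"
  shows "AE \<omega> in path_law x. (\<lambda>n. (\<Sum>i<n. f (path_shift i \<omega>)) / real n) \<longlonglongrightarrow> (\<integral>\<omega>. f \<omega> \<partial>stationary_law)"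
proof -
  interpret M: prob_space stationary_law by (rule prob_space_stationary_law)
  have proc: "subadditive_process K \<mu> C \<rho> (\<lambda>n \<omega>. \<Sum>i<n. g (path_shift i \<omega>)) b"
    if [measurable]: "g \<in> borel_measurable path_space" and g: "\<And>\<omega>. \<bar>g \<omega>\<bar> \<le> b" for g
  proof
    fix n m \<omega>
    show "(\<lambda>\<omega>. \<Sum>i<n. g (path_shift i \<omega>)) \<in> borel_measurable path_space" by measurable
    show "\<bar>\<Sum>i<n. g (path_shift i \<omega>)\<bar> \<le> b * real n"
      using sum_norm_bound[of "{..<n}" "\<lambda>i. g (path_shift i \<omega>)" b] g by (simp add: mult.commute)
    have "(\<Sum>i<n + m. g (path_shift i \<omega>)) = (\<Sum>i<n. g (path_shift i \<omega>)) + (\<Sum>i<m. g (path_shift i (path_shift n \<omega>)))"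
      by (induction m) (simp_all add: add.assoc)
    then show "(\<Sum>i<n + m. g (path_shift i \<omega>)) \<le> (\<Sum>i<n. g (path_shift i \<omega>)) + (\<Sum>i<m. g (path_shift i (path_shift n \<omega>)))"
      by simp
    have "(\<Sum>i<Suc n. g (path_shift i \<omega>)) = g \<omega> + (\<Sum>i<n. g (path_shift i (path_shift 1 \<omega>)))"
      by (simp only: sum.lessThan_Suc_shift) simp
    then show "(\<Sum>i<n. g (path_shift i (path_shift 1 \<omega>))) \<le> (\<Sum>i<Suc n. g (path_shift i \<omega>)) + b"
      using g[of \<omega>] by (simp only: abs_le_iff) linarith
  qed
  have ge: "AE \<omega> in path_law x. \<forall>\<^sub>F n in sequentially. real n * s < (\<Sum>i<n. g (path_shift i \<omega>))"
    if [measurable]: "g \<in> borel_measurable path_space" and g: "\<And>\<omega>. \<bar>g \<omega>\<bar> \<le> b"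
      and s: "s < (\<integral>\<omega>. g \<omega> \<partial>stationary_law)" for g s
  proof -
    interpret S: subadditive_process K \<mu> C \<rho> "\<lambda>n \<omega>. \<Sum>i<n. g (path_shift i \<omega>)" b
      by (rule proc[OF that(1) g])
    have int: "integrable stationary_law (\<lambda>\<omega>. g (path_shift i \<omega>))" for i
      by (rule M.abs_integral_le(1)[where b=b]) (auto simp: g)
    have "M.expectation (\<lambda>\<omega>. \<Sum>i<n. g (path_shift i \<omega>)) / real n = M.expectation g" if "n \<ge> 1" for n
      using that by (simp add: Bochner_Integration.integral_sum int integral_shift_stationary_law)
    then have "(\<lambda>n. M.expectation (\<lambda>\<omega>. \<Sum>i<n. g (path_shift i \<omega>)) / real n) \<longlonglongrightarrow> M.expectation g"
      by (intro tendsto_eventually) (auto simp: eventually_at_top_linorder intro!: exI[of _ 1])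
    then have "S.rate = M.expectation g"
      using S.rate_tendsto LIMSEQ_unique by blast
    then show ?thesis using S.eventually_ge[of s x] s by simp
  qed
  let ?L = "\<integral>\<omega>. f \<omega> \<partial>stationary_law"
  have "AE \<omega> in path_law x. \<forall>k. \<forall>\<^sub>F n in sequentially. real n * (?L - 1 / real (Suc k)) < (\<Sum>i<n. f (path_shift i \<omega>))"
    unfolding AE_all_countable by (intro allI ge) (auto simp: b)
  moreover have "AE \<omega> in path_law x. \<forall>k. \<forall>\<^sub>F n in sequentially. real n * (- ?L - 1 / real (Suc k)) < (\<Sum>i<n. - f (path_shift i \<omega>))"
    unfolding AE_all_countable by (intro allI ge) (auto simp: b)
  ultimately show ?thesis
  proof eventually_elim
    case (elim \<omega>)
    show ?case
    proof (rule LIMSEQ_I)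
      fix r :: real assume "0 < r"
      then obtain k where k: "1 / real (Suc k) < r"
        using reals_Archimedean[of r] by (auto simp: inverse_eq_divide)
      have "\<forall>\<^sub>F n in sequentially. norm ((\<Sum>i<n. f (path_shift i \<omega>)) / real n - ?L) < r"
        using elim(1)[rule_format, of k] elim(2)[rule_format, of k] eventually_ge_at_top[of 1]
      proof eventually_elim
        case (elim n)
        then have "- 1 / real (Suc k) < (\<Sum>i<n. f (path_shift i \<omega>)) / real n - ?L"
          "(\<Sum>i<n. f (path_shift i \<omega>)) / real n - ?L < 1 / real (Suc k)"
          by (simp_all add: field_simps sum_negf del: of_nat_Suc)
        then show ?case using k by simp
      qed
      then show "\<exists>N. \<forall>n\<ge>N. norm ((\<Sum>i<n. f (path_shift i \<omega>)) / real n - ?L) < r"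
        by (simp add: eventually_at_top_linorder)
    qed
  qed
qed

end

section \<open>Kingman's theorem and uniform expected growth\<close>

context subadditive_process
begin

text \<open>For each phase \<open>r < N\<close> cut the first \<open>n\<close> steps into blocks of
  length \<open>N\<close> starting at \<open>r\<close>; summing over \<open>r\<close> turns the
  block sums into a sum over all starting positions. The error collects \<open>3 * c * N\<close>
  from the ends in each of the \<open>N\<close> phases and \<open>2 * c * N * N\<close> from the at
  most \<open>2 * N\<close> positions added to complete the sum.\<close>

lemma blockwise_upper_bound:
  assumes N: "N \<ge> 1" and n: "N \<le> n"
  shows "real N * a n \<omega> \<le> (\<Sum>i<n. a N (path_shift i \<omega>)) + 5 * c * real N * real N"
proof -
  \<comment> \<open>One block fewer than fits, so that \<open>r + q * N \<le> n\<close> for every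
    phase \<open>r < N\<close>.\<close>
  define q where "q = n div N - 1"
  have qN: "q * N + N \<le> n" "n \<le> q * N + 2 * N"
  proof -
    have "1 \<le> n div N" using N n by (simp add: div_greater_zero_iff Suc_le_eq)
    then have "q * N + N = n div N * N"
      unfolding q_def by (cases "n div N") auto
    moreover have "n div N * N + n mod N = n" "n mod N < N" using N by auto
    ultimately show "q * N + N \<le> n" "n \<le> q * N + 2 * N" by linarith+
  qed
  have blocks: "a (j * N) \<omega> \<le> (\<Sum>i<j. a N (path_shift (i * N) \<omega>))" for j \<omega>
  proof (induction j)
    case 0 then show ?case using a_bound[of 0 \<omega>] by simp
  next
    case (Suc j) then show ?case using a_subadd[of "j * N" N \<omega>] by (simp add: add.commute)
  qed
  have "a n \<omega> \<le> (\<Sum>i<q. a N (path_shift (r + i * N) \<omega>)) + 3 * c * real N" if r: "r < N" for r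
  proof -
    define m where "m = n - r - q * N"
    have m: "n = r + (q * N + m)" "m \<le> 2 * N" using qN r by (auto simp: m_def)
    have "a n \<omega> \<le> a r \<omega> + (a (q * N) (path_shift r \<omega>) + a m (path_shift (q * N) (path_shift r \<omega>)))"
      using a_subadd[of r "q * N + m" \<omega>] a_subadd[of "q * N" m "path_shift r \<omega>"] m(1) by simp
    moreover have "a r \<omega> \<le> c * real N"
      using a_bound[of r \<omega>] r c_nonneg mult_left_mono[of "real r" "real N" c] by simp
    moreover have "a m (path_shift (q * N) (path_shift r \<omega>)) \<le> c * (2 * real N)"
      using a_bound[of m "path_shift (q * N) (path_shift r \<omega>)"] m(2) c_nonneg mult_left_mono[of "real m" "2 * real N" c]
      by linarith
    moreover have "a (q * N) (path_shift r \<omega>) \<le> (\<Sum>i<q. a N (path_shift (r + i * N) \<omega>))"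
      using blocks[of q "path_shift r \<omega>"] by simp
    ultimately show ?thesis by simp
  qed
  then have "(\<Sum>r<N. a n \<omega>) \<le> (\<Sum>r<N. (\<Sum>i<q. a N (path_shift (r + i * N) \<omega>)) + 3 * c * real N)"
    by (intro sum_mono) auto
  then have 1: "real N * a n \<omega> \<le> (\<Sum>r<N. \<Sum>i<q. a N (path_shift (r + i * N) \<omega>)) + 3 * c * real N * real N"
    by (simp add: sum.distrib mult.commute mult.left_commute)
  have "(\<Sum>r<N. \<Sum>i<q. a N (path_shift (r + i * N) \<omega>)) = (\<Sum>i<q. \<Sum>j=i * N..<i * N + N. a N (path_shift j \<omega>))"
  proof (subst sum.swap, rule sum.cong[OF refl])
    fix i
    show "(\<Sum>r<N. a N (path_shift (r + i * N) \<omega>)) = (\<Sum>j=i * N..<i * N + N. a N (path_shift j \<omega>))"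
      by (rule sum.reindex_bij_witness[of _ "\<lambda>j. j - i * N" "\<lambda>r. r + i * N"]) auto
  qed
  also have "\<dots> = (\<Sum>j<q * N. a N (path_shift j \<omega>))"
    by (rule sum.nat_group)
  also have "\<dots> \<le> (\<Sum>j<n. a N (path_shift j \<omega>)) + 2 * c * real N * real N"
  proof -
    have "(\<Sum>j<n. a N (path_shift j \<omega>)) = (\<Sum>j<q * N. a N (path_shift j \<omega>)) + (\<Sum>j=q * N..<n. a N (path_shift j \<omega>))"
      using qN by (simp add: sum.atLeastLessThan_concat lessThan_atLeast0)
    moreover have "\<bar>\<Sum>j=q * N..<n. a N (path_shift j \<omega>)\<bar> \<le> real (n - q * N) * (c * real N)"
      using sum_norm_bound[of "{q * N..<n}" "\<lambda>j. a N (path_shift j \<omega>)" "c * real N"] a_bound by simp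
    moreover have "real (n - q * N) * (c * real N) \<le> (2 * real N) * (c * real N)"
    proof (intro mult_right_mono)
      have "n - q * N \<le> 2 * N" using qN by simp
      then have "real (n - q * N) \<le> real (2 * N)" by (simp only: of_nat_le_iff)
      then show "real (n - q * N) \<le> 2 * real N" by simp
    qed (use c_nonneg in simp)
    ultimately show ?thesis by (simp add: abs_le_iff algebra_simps)
  qed
  finally show ?thesis using 1 by simp
qed

text \<open>The lower bound is \<open>eventually_ge\<close>. For the upper one,
  \<open>blockwise_upper_bound\<close> compares \<open>a n\<close> with an ergodic average of
  \<open>a N / N\<close>, whose limit is close to \<open>rate\<close> for suitable
  \<open>N\<close>.\<close>

theorem kingman: "AE \<omega> in path_law x. (\<lambda>n. a n \<omega> / real n) \<longlonglongrightarrow> rate"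
proof -
  have "AE \<omega> in path_law x. \<forall>k. \<forall>\<^sub>F n in sequentially. real n * (rate - 1 / real (Suc k)) < a n \<omega>"
    unfolding AE_all_countable by (intro allI eventually_ge) auto
  moreover have "AE \<omega> in path_law x. \<forall>N. (\<lambda>n. (\<Sum>i<n. a N (path_shift i \<omega>)) / real n) \<longlonglongrightarrow> M.expectation (a N)"
    unfolding AE_all_countable
  proof
    show "AE \<omega> in path_law x. (\<lambda>n. (\<Sum>i<n. a N (path_shift i \<omega>)) / real n) \<longlonglongrightarrow> M.expectation (a N)" for N
      by (rule birkhoff[where b="c * real N"]) (auto simp: a_bound)
  qed
  ultimately show ?thesis
  proof eventually_elim
    case (elim \<omega>)
    show ?case
    proof (rule order_tendstoI)
      fix s assume "s < rate"
      then obtain k where k: "1 / real (Suc k) < rate - s"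
        using reals_Archimedean[of "rate - s"] by (auto simp: inverse_eq_divide)
      show "\<forall>\<^sub>F n in sequentially. s < a n \<omega> / real n"
        using elim(1)[rule_format, of k] eventually_ge_at_top[of 1]
      proof eventually_elim
        case (elim n)
        then have "rate - 1 / real (Suc k) < a n \<omega> / real n" by (simp add: field_simps del: of_nat_Suc)
        then show ?case using k by linarith
      qed
    next
      fix s assume "rate < s"
      then have "\<forall>\<^sub>F N in sequentially. M.expectation (a N) / real N < s"
        by (rule order_tendstoD(2)[OF rate_tendsto])
      then obtain N where N: "N \<ge> 1" "M.expectation (a N) / real N < s"
        using eventually_happens'[OF _ eventually_conj[OF _ eventually_ge_at_top[of 1]]] trivial_limit_sequentially by blast
      have "(\<lambda>n. (\<Sum>i<n. a N (path_shift i \<omega>)) / real n / real N + 5 * c * real N / real n) \<longlonglongrightarrow> M.expectation (a N) / real N + 0"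
        using elim(2) N
        by (intro tendsto_add tendsto_divide tendsto_const tendsto_divide_0[OF tendsto_const] filterlim_real_at_infinity_sequentially) auto
      then have "\<forall>\<^sub>F n in sequentially. (\<Sum>i<n. a N (path_shift i \<omega>)) / real n / real N + 5 * c * real N / real n < s"
        by (rule order_tendstoD(2)) (use N in simp)
      then show "\<forall>\<^sub>F n in sequentially. a n \<omega> / real n < s"
        using eventually_ge_at_top[of N]
      proof eventually_elim
        case (elim n)
        have "a n \<omega> / real n \<le> (\<Sum>i<n. a N (path_shift i \<omega>)) / real n / real N + 5 * c * real N / real n"
          using blockwise_upper_bound[OF N(1) elim(2), of \<omega>] N(1) elim(2) by (simp add: field_simps)
        then show ?case using elim(1) by linarith
      qed
    qed
  qed
qed

text \<open>The bound is uniform in \<open>x\<close> because the chain forgets its starting point.\<close>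

lemma eventually_expectation_le:
  assumes "rate < s"
  shows "\<forall>\<^sub>F n in sequentially. \<forall>x. (\<integral>\<omega>. a n \<omega> \<partial>path_law x) \<le> real n * s"
proof -
  define s' where "s' = (rate + s) / 2"
  have s': "rate < s'" "s' < s" using assms by (auto simp: s'_def)
  define d where "d = s - s'"
  have d: "d > 0" using s' by (simp add: d_def)
  have "(\<lambda>k. C * \<rho> ^ k * c) \<longlonglongrightarrow> C * 0 * c"
    using \<rho>_pos \<rho>_less_1 by (intro tendsto_intros LIMSEQ_power_zero) auto
  then have "\<forall>\<^sub>F k in sequentially. C * \<rho> ^ k * c < d / 2"
    using d by (intro order_tendstoD(2)) auto
  then obtain k where k: "C * \<rho> ^ k * c < d / 2"
    using eventually_happens' trivial_limit_sequentially by blast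
  \<comment> \<open>The first \<open>k\<close> steps are discarded at cost \<open>c * k\<close>. The
    process restarted at time \<open>k\<close> has expectation \<open>g (\<omega> k)\<close>, which
    mixing replaces by the stationary mean up to \<open>C * \<rho> ^ k * (c * n)\<close>; this error
    is linear in \<open>n\<close>, but with slope below \<open>d / 2\<close>.\<close>
  have est: "(\<integral>\<omega>. a (k + n) \<omega> \<partial>path_law x) \<le> c * real k + M.expectation (a n) + C * \<rho> ^ k * (c * real n)" for n x
  proof -
    interpret P: prob_space "path_law x" by (rule prob_space_path_law)
    define g where "g y = (\<integral>\<omega>. a n \<omega> \<partial>path_law y)" for y
    have g [measurable]: "g \<in> borel_measurable borel"
      unfolding g_def by (rule integral_measurable_subprob_algebra2[where N=path_space]) measurable
    have gb: "\<bar>g y\<bar> \<le> c * real n" for y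
      unfolding g_def by (rule prob_space.abs_integral_le(2)[OF prob_space_path_law]) (auto simp: a_bound)
    have "(\<integral>\<omega>. a (k + n) \<omega> \<partial>path_law x) \<le> (\<integral>\<omega>. c * real k + a n (path_shift k \<omega>) \<partial>path_law x)"
    proof (rule integral_mono)
      show "integrable (path_law x) (a (k + n))"
        by (rule P.abs_integral_le(1)) (auto intro: a_bound)
      have "integrable (path_law x) (\<lambda>\<omega>. a n (path_shift k \<omega>))"
        by (rule P.abs_integral_le(1)) (auto intro: a_bound)
      then show "integrable (path_law x) (\<lambda>\<omega>. c * real k + a n (path_shift k \<omega>))" by simp
      show "a (k + n) \<omega> \<le> c * real k + a n (path_shift k \<omega>)" for \<omega>
        using a_subadd[of k n \<omega>] a_bound[of k \<omega>] by simp
    qed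
    also have "\<dots> = c * real k + (\<integral>\<omega>. a n (path_shift k \<omega>) \<partial>path_law x)"
    proof -
      have "integrable (path_law x) (\<lambda>\<omega>. a n (path_shift k \<omega>))"
        by (rule P.abs_integral_le(1)) (auto intro: a_bound)
      then show ?thesis using P.prob_space by simp
    qed
    also have "(\<integral>\<omega>. a n (path_shift k \<omega>) \<partial>path_law x) = (\<integral>\<omega>. g (\<omega> k) \<partial>path_law x)"
      by (subst integral_markov[where n=k and b="c * real n"]) (auto simp: g_def a_bound)
    also have "\<dots> \<le> (\<integral>y. g y \<partial>\<mu>) + C * \<rho> ^ k * (c * real n)"
      using mixing[of g "c * real n" x k] gb g by (simp add: abs_le_iff)
    also have "(\<integral>y. g y \<partial>\<mu>) = M.expectation (a n)"
      unfolding g_def by (rule integral_stationary_law[symmetric]) (auto intro: a_bound)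
    finally show ?thesis by simp
  qed
  have "(\<lambda>n. c * real k / real n + M.expectation (a n) / real n + C * \<rho> ^ k * c) \<longlonglongrightarrow> 0 + rate + C * \<rho> ^ k * c"
    by (intro tendsto_add rate_tendsto tendsto_const tendsto_divide_0[OF tendsto_const] filterlim_real_at_infinity_sequentially)
  then have "\<forall>\<^sub>F n in sequentially. c * real k / real n + M.expectation (a n) / real n + C * \<rho> ^ k * c < s' + d / 2"
    by (rule order_tendstoD(2)) (use s' k in simp)
  moreover have "\<forall>\<^sub>F n in sequentially. real k * \<bar>s\<bar> / real n < d / 2"
    using d by (intro order_tendstoD(2)[OF tendsto_divide_0[OF tendsto_const filterlim_real_at_infinity_sequentially]]) auto
  ultimately have "\<forall>\<^sub>F n in sequentially. \<forall>x. (\<integral>\<omega>. a (n + k) \<omega> \<partial>path_law x) \<le> real (n + k) * s"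
    using eventually_ge_at_top[of 1]
  proof eventually_elim
    case (elim n)
    have "c * real k + M.expectation (a n) + C * \<rho> ^ k * (c * real n) \<le> real n * (s' + d / 2)"
      using elim(1,3) by (simp add: field_simps)
    also have "\<dots> \<le> real (n + k) * s"
    proof -
      have "real k * \<bar>s\<bar> \<le> real n * (d / 2)" using elim(2,3) by (simp add: field_simps)
      moreover have "- (real k * s) \<le> real k * \<bar>s\<bar>" by (simp add: abs_if zero_le_mult_iff)
      moreover have "real n * (s' + d / 2) = real n * s - real n * (d / 2)" by (simp add: d_def field_simps)
      ultimately show ?thesis by (simp add: distrib_right)
    qed
    finally show ?case using est[of _ n] by (metis add.commute order_trans)
  qed
  then show ?thesis
    by (subst (asm) eventually_sequentially_seg)
qed

end

section \<open>Matrices and the second exterior power\<close>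

lemma norm_vec_squared: "(norm (x :: 'b::real_normed_vector ^ 'n))\<^sup>2 = (\<Sum>i\<in>UNIV. (norm (x $ i))\<^sup>2)"
  by (simp add: norm_vec_def L2_set_def sum_nonneg)

lemma norm_matrix_vector_mult_le:
  fixes M :: "real^'n^'m"
  shows "norm (M *v x) \<le> norm M * norm x"
proof (rule power2_le_imp_le)
  have "(norm (M *v x))\<^sup>2 = (\<Sum>i\<in>UNIV. (M $ i \<bullet> x)\<^sup>2)"
    by (simp add: norm_vec_squared matrix_mult_dot)
  also have "\<dots> \<le> (\<Sum>i\<in>UNIV. (norm (M $ i))\<^sup>2 * (norm x)\<^sup>2)"
  proof (rule sum_mono)
    fix i
    have "(M $ i \<bullet> x)\<^sup>2 \<le> (M $ i \<bullet> M $ i) * (x \<bullet> x)" by (rule Cauchy_Schwarz_ineq)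
    then show "(M $ i \<bullet> x)\<^sup>2 \<le> (norm (M $ i))\<^sup>2 * (norm x)\<^sup>2"
      by (simp add: dot_square_norm)
  qed
  also have "\<dots> = (norm M * norm x)\<^sup>2"
    by (simp add: norm_vec_squared[of M] sum_distrib_right power_mult_distrib)
  finally show "(norm (M *v x))\<^sup>2 \<le> (norm M * norm x)\<^sup>2" .
qed simp

lemma norm_matrix_mult_le:
  fixes M :: "real^'n^'m" and N :: "real^'p^'n"
  shows "norm (M ** N) \<le> norm M * norm N"
proof (rule power2_le_imp_le)
  have tr: "(norm N)\<^sup>2 = (\<Sum>j\<in>UNIV. (norm (column j N))\<^sup>2)"
  proof -
    have "(norm N)\<^sup>2 = (\<Sum>i\<in>UNIV. \<Sum>j\<in>UNIV. (N $ i $ j)\<^sup>2)" by (simp add: norm_vec_squared)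
    also have "\<dots> = (\<Sum>j\<in>UNIV. \<Sum>i\<in>UNIV. (N $ i $ j)\<^sup>2)" by (rule sum.swap)
    finally show ?thesis by (simp add: norm_vec_squared column_def)
  qed
  have "(norm (M ** N))\<^sup>2 = (\<Sum>i\<in>UNIV. \<Sum>j\<in>UNIV. (M $ i \<bullet> column j N)\<^sup>2)"
    by (simp add: norm_vec_squared matrix_matrix_mult_def inner_vec_def column_def)
  also have "\<dots> \<le> (\<Sum>i\<in>UNIV. \<Sum>j\<in>UNIV. (norm (M $ i))\<^sup>2 * (norm (column j N))\<^sup>2)"
  proof (intro sum_mono)
    fix i j
    have "(M $ i \<bullet> column j N)\<^sup>2 \<le> (M $ i \<bullet> M $ i) * (column j N \<bullet> column j N)" by (rule Cauchy_Schwarz_ineq)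
    then show "(M $ i \<bullet> column j N)\<^sup>2 \<le> (norm (M $ i))\<^sup>2 * (norm (column j N))\<^sup>2"
      by (simp add: dot_square_norm)
  qed
  also have "\<dots> = (norm M)\<^sup>2 * (norm N)\<^sup>2"
    unfolding tr norm_vec_squared[of M] by (simp add: sum_product)
  finally show "(norm (M ** N))\<^sup>2 \<le> (norm M * norm N)\<^sup>2"
    by (simp add: power_mult_distrib)
qed simp

lemma borel_measurable_matrix_vector_mult [measurable (raw)]:
  fixes f :: "'x \<Rightarrow> real^'n^'m"
  assumes "f \<in> borel_measurable M" "g \<in> borel_measurable M"
  shows "(\<lambda>x. f x *v g x) \<in> borel_measurable M"
proof (rule borel_measurable_continuous_Pair[OF assms])
  show "continuous_on UNIV (\<lambda>x. fst x *v (snd x :: real^'n) :: real^'m)"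
    unfolding matrix_vector_mult_def by (intro continuous_intros)
qed

lemma borel_measurable_matrix_matrix_mult [measurable (raw)]:
  fixes f :: "'x \<Rightarrow> real^'n^'m" and g :: "'x \<Rightarrow> real^'p^'n"
  assumes "f \<in> borel_measurable M" "g \<in> borel_measurable M"
  shows "(\<lambda>x. f x ** g x) \<in> borel_measurable M"
proof (rule borel_measurable_continuous_Pair[OF assms])
  show "continuous_on UNIV (\<lambda>x. fst x ** (snd x :: real^'p^'n) :: real^'p^'m)"
    unfolding matrix_matrix_mult_def by (intro continuous_intros)
qed

lemma matrix_inv_mult:
  fixes M :: "real^'m^'m"
  assumes "invertible M"
  shows "matrix_inv M ** M = mat 1" "M ** matrix_inv M = mat 1"
  using someI_ex[OF assms[unfolded invertible_def]] by (simp_all add: matrix_inv_def)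

lemma sum_UNIV_pair: "(\<Sum>p\<in>UNIV. f p) = (\<Sum>i\<in>UNIV. \<Sum>j\<in>UNIV. f (i :: 'b::finite, j :: 'c::finite))"
  by (simp add: sum.cartesian_product case_prod_beta flip: UNIV_Times_UNIV)

text \<open>Coordinates run over all ordered pairs, so no order on the indices is required. Each
  coordinate of the usual wedge product appears twice, up to sign, and norms are larger by a factor
  \<open>sqrt 2\<close>.\<close>

definition wedge :: "real^'m \<Rightarrow> real^'m \<Rightarrow> real^('m \<times> 'm)" where
  "wedge v w = (\<chi> p. v $ fst p * w $ snd p - v $ snd p * w $ fst p)"

definition wedge_matrix :: "real^'m^'m \<Rightarrow> real^('m \<times> 'm)^('m \<times> 'm)" where
  "wedge_matrix g = (\<chi> p q. g $ fst p $ fst q * g $ snd p $ snd q - g $ fst p $ snd q * g $ snd p $ fst q)"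

text \<open>The factor \<open>1/2\<close> appears since every pair of indices is counted in both orders.\<close>

lemma wedge_matrix_vector_mult:
  "wedge (g *v v) (g *v w) = (1 / 2) *\<^sub>R (wedge_matrix g *v wedge v w)"
proof -
  have "(wedge_matrix g *v wedge v w) $ (i, j) = 2 * wedge (g *v v) (g *v w) $ (i, j)" for i j
  proof -
    have prod: "(\<Sum>k\<in>UNIV. \<Sum>l\<in>UNIV. g $ i' $ k * x $ k * (g $ j' $ l * y $ l)) = (g *v x) $ i' * (g *v y) $ j'"
      for i' j' x y
      by (simp add: matrix_vector_mult_def sum_product)
    have "(wedge_matrix g *v wedge v w) $ (i, j)
      = (\<Sum>k\<in>UNIV. \<Sum>l\<in>UNIV. (g $ i $ k * g $ j $ l - g $ i $ l * g $ j $ k) * (v $ k * w $ l - v $ l * w $ k))"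
      by (simp add: matrix_vector_mult_def wedge_matrix_def wedge_def sum_UNIV_pair)
    also have "\<dots> = (\<Sum>k\<in>UNIV. \<Sum>l\<in>UNIV. g $ i $ k * v $ k * (g $ j $ l * w $ l))
        - (\<Sum>k\<in>UNIV. \<Sum>l\<in>UNIV. g $ i $ k * w $ k * (g $ j $ l * v $ l))
        - (\<Sum>k\<in>UNIV. \<Sum>l\<in>UNIV. g $ j $ k * v $ k * (g $ i $ l * w $ l))
        + (\<Sum>k\<in>UNIV. \<Sum>l\<in>UNIV. g $ j $ k * w $ k * (g $ i $ l * v $ l))"
      by (simp add: algebra_simps sum.distrib sum_subtractf)
    finally show ?thesis
      unfolding prod by (simp add: wedge_def)
  qed
  then show ?thesis
    by (simp add: vec_eq_iff)
qed

lemma wedge_matrix_mult: "wedge_matrix (g ** h) = (1 / 2) *\<^sub>R (wedge_matrix g ** wedge_matrix h)"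
proof -
  have "wedge_matrix (g ** h) $ p $ (k, l) = wedge (g *v column k h) (g *v column l h) $ p" for p k l
    by (simp add: wedge_matrix_def wedge_def matrix_matrix_mult_def matrix_vector_mult_def column_def)
  moreover have "(wedge_matrix g *v wedge (column k h) (column l h)) $ p = (wedge_matrix g ** wedge_matrix h) $ p $ (k, l)" for p k l
    by (simp add: matrix_matrix_mult_def matrix_vector_mult_def wedge_def wedge_matrix_def column_def mult.commute)
  ultimately show ?thesis
    by (simp add: vec_eq_iff wedge_matrix_vector_mult)
qed

text \<open>The Hilbert-Schmidt norm of the second exterior power: each 2-by-2 minor occurs four
  times, up to sign, in \<open>wedge_matrix\<close>, so half of its norm is the usual one. This
  normalisation is submultiplicative without a constant.\<close>

definition wedge_norm :: "real^'m^'m \<Rightarrow> real" where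
  "wedge_norm g = norm (wedge_matrix g) / 2"

lemma wedge_norm_nonneg: "0 \<le> wedge_norm g"
  by (simp add: wedge_norm_def)

lemma wedge_norm_mult: "wedge_norm (g ** h) \<le> wedge_norm g * wedge_norm h"
  using norm_matrix_mult_le[of "wedge_matrix g" "wedge_matrix h"]
  by (simp add: wedge_norm_def wedge_matrix_mult)

lemma norm_wedge_le: "norm (wedge (g *v v) (g *v w)) \<le> wedge_norm g * norm (wedge v w)"
  using norm_matrix_vector_mult_le[of "wedge_matrix g" "wedge v w"]
  by (simp add: wedge_norm_def wedge_matrix_vector_mult)

text \<open>\<open>wedge_matrix g\<close> is a difference of two copies of the tensor square of
  \<open>g\<close>, one with permuted columns, and each has norm
  \<open>(norm g)\<^sup>2\<close>.\<close>

lemma wedge_norm_le: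
  fixes g :: "real^'m^'m"
  shows "wedge_norm g \<le> (norm g)\<^sup>2"
proof -
  let ?a = "(\<chi> p q. g $ fst p $ fst q * g $ snd p $ snd q) :: real^('m \<times> 'm)^('m \<times> 'm)"
  let ?b = "(\<chi> p q. g $ fst p $ snd q * g $ snd p $ fst q) :: real^('m \<times> 'm)^('m \<times> 'm)"
  have "((norm g)\<^sup>2)\<^sup>2 = (\<Sum>i\<in>UNIV. \<Sum>k\<in>UNIV. (g $ i $ k)\<^sup>2) * (\<Sum>j\<in>UNIV. \<Sum>l\<in>UNIV. (g $ j $ l)\<^sup>2)"
    by (simp add: norm_vec_squared) (simp only: power2_eq_square)
  also have "\<dots> = (\<Sum>i\<in>UNIV. \<Sum>j\<in>UNIV. \<Sum>k\<in>UNIV. \<Sum>l\<in>UNIV. (g $ i $ k)\<^sup>2 * (g $ j $ l)\<^sup>2)"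
    by (simp only: sum_product)
  finally have sq: "((norm g)\<^sup>2)\<^sup>2 = (\<Sum>i\<in>UNIV. \<Sum>j\<in>UNIV. \<Sum>k\<in>UNIV. \<Sum>l\<in>UNIV. (g $ i $ k)\<^sup>2 * (g $ j $ l)\<^sup>2)" .
  have "(norm ?a)\<^sup>2 = ((norm g)\<^sup>2)\<^sup>2"
    unfolding sq
    by (simp add: norm_vec_squared power_mult_distrib sum_UNIV_pair)
  then have a: "norm ?a = (norm g)\<^sup>2"
    by (rule power2_eq_imp_eq) auto
  have "(norm ?b)\<^sup>2
     = (\<Sum>i\<in>UNIV. \<Sum>j\<in>UNIV. \<Sum>k\<in>UNIV. \<Sum>l\<in>UNIV. (g $ i $ l)\<^sup>2 * (g $ j $ k)\<^sup>2)"
    by (simp add: norm_vec_squared power_mult_distrib sum_UNIV_pair)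
  also have "\<dots> = ((norm g)\<^sup>2)\<^sup>2"
    unfolding sq by (intro sum.cong refl sum.swap)
  finally have b: "norm ?b = (norm g)\<^sup>2"
    by (rule power2_eq_imp_eq) auto
  have "wedge_matrix g = ?a - ?b" by (simp add: vec_eq_iff wedge_matrix_def)
  then show ?thesis
    using norm_triangle_ineq4[of ?a ?b] a b by (simp add: wedge_norm_def)
qed

lemma wedge_norm_1_pos:
  assumes "CARD('m) \<ge> 2"
  shows "0 < wedge_norm (mat 1 :: real^'m^'m)"
proof -
  have "\<not> (\<forall>i\<in>(UNIV :: 'm set). \<forall>j\<in>UNIV. i = j)"
    using assms card_le_Suc0_iff_eq[of "UNIV :: 'm set"] by simp
  then obtain i j :: 'm where ij: "i \<noteq> j" by auto
  have "wedge_matrix (mat 1 :: real^'m^'m) $ (i, j) $ (i, j) = 1"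
    using ij by (simp add: wedge_matrix_def mat_def)
  then have "wedge_matrix (mat 1 :: real^'m^'m) \<noteq> 0" by auto
  then show ?thesis by (simp add: wedge_norm_def)
qed

lemma wedge_eq_0_card_1:
  fixes v w :: "real^'m"
  assumes "CARD('m) = 1"
  shows "wedge v w = 0"
proof -
  obtain k :: 'm where "UNIV = {k}" using assms by (rule card_1_singletonE)
  then have "i = k" for i :: 'm by (metis UNIV_I singletonD)
  then have "fst p = k" "snd p = k" for p :: "'m \<times> 'm" by auto
  then show ?thesis by (simp add: vec_eq_iff wedge_def)
qed

text \<open>Lagrange's identity, doubled because of the ordered pairs.\<close>

lemma norm_wedge_squared: "(norm (wedge v w))\<^sup>2 = 2 * ((norm v)\<^sup>2 * (norm w)\<^sup>2 - (v \<bullet> w)\<^sup>2)"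
proof -
  have "(norm (wedge v w))\<^sup>2 = (\<Sum>i\<in>UNIV. \<Sum>j\<in>UNIV. (v $ i * w $ j - v $ j * w $ i)\<^sup>2)"
    by (simp add: norm_vec_squared wedge_def sum_UNIV_pair)
  also have "\<dots> = (\<Sum>i\<in>UNIV. \<Sum>j\<in>UNIV. (v $ i)\<^sup>2 * (w $ j)\<^sup>2 + (w $ i)\<^sup>2 * (v $ j)\<^sup>2
      - 2 * ((v $ i * w $ i) * (v $ j * w $ j)))"
    by (intro sum.cong refl) (simp add: power2_eq_square algebra_simps)
  also have "\<dots> = (\<Sum>i\<in>UNIV. (v $ i)\<^sup>2) * (\<Sum>j\<in>UNIV. (w $ j)\<^sup>2) + (\<Sum>i\<in>UNIV. (w $ i)\<^sup>2) * (\<Sum>j\<in>UNIV. (v $ j)\<^sup>2)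
      - 2 * ((\<Sum>i\<in>UNIV. v $ i * w $ i) * (\<Sum>j\<in>UNIV. v $ j * w $ j))"
    by (simp only: sum.distrib sum_subtractf sum_distrib_left[symmetric] sum_distrib_right[symmetric])
  also have "\<dots> = 2 * ((norm v)\<^sup>2 * (norm w)\<^sup>2 - (v \<bullet> w)\<^sup>2)"
    by (simp add: norm_vec_squared inner_vec_def mult.commute) (simp only: power2_eq_square)
  finally show ?thesis .
qed

lemma norm_wedge_le_2: "norm (wedge v w) \<le> 2 * norm v * norm w"
proof (rule power2_le_imp_le)
  show "(norm (wedge v w))\<^sup>2 \<le> (2 * norm v * norm w)\<^sup>2"
  proof -
    have "2 * (x - y) \<le> 2\<^sup>2 * x" if "0 \<le> x" "0 \<le> y" for x y :: real
      using that by simp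
    from this[of "(norm v)\<^sup>2 * (norm w)\<^sup>2" "(v \<bullet> w)\<^sup>2"]
    show ?thesis unfolding norm_wedge_squared power_mult_distrib by (simp only: mult.assoc) simp
  qed
qed simp

lemma wedge_scaleR: "wedge (a *\<^sub>R v) (b *\<^sub>R w) = (a * b) *\<^sub>R wedge v w"
  by (simp add: vec_eq_iff wedge_def algebra_simps)

text \<open>The sign chooses the nearer of \<open>w\<close> and \<open>- w\<close>. Then the squared
  distance is \<open>2 - 2 * \<bar>v \<bullet> w\<bar>\<close>, and
  \<open>\<bar>v \<bullet> w\<bar> \<le> 1\<close> makes it at most
  \<open>2 - 2 * (v \<bullet> w)\<^sup>2\<close>, the squared norm of the wedge.\<close>

lemma sign_aligned_distance_le_wedge:
  assumes "norm v = 1" "norm w = 1"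
  obtains s where "\<bar>s\<bar> = (1::real)" "norm (v - s *\<^sub>R w) \<le> norm (wedge v w)"
proof -
  define s where "s = (if v \<bullet> w \<ge> 0 then 1 else - 1 :: real)"
  have s: "\<bar>s\<bar> = 1" "s * s = 1" "s * (v \<bullet> w) = \<bar>v \<bullet> w\<bar>" by (simp_all add: s_def)
  have vw: "v \<bullet> v = 1" "w \<bullet> w = 1" using assms by (simp_all add: dot_square_norm)
  have "\<bar>v \<bullet> w\<bar> \<le> 1" using Cauchy_Schwarz_ineq2[of v w] assms by simp
  then have "(v \<bullet> w)\<^sup>2 \<le> \<bar>v \<bullet> w\<bar>"
    using power_decreasing[of 1 2 "\<bar>v \<bullet> w\<bar>"] by simp
  moreover have "(norm (v - s *\<^sub>R w))\<^sup>2 = 2 - 2 * \<bar>v \<bullet> w\<bar>"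
  proof -
    have "(v - s *\<^sub>R w) \<bullet> (v - s *\<^sub>R w) = v \<bullet> v - 2 * (s * (v \<bullet> w)) + (s * s) * (w \<bullet> w)"
      by (simp add: inner_diff_left inner_diff_right inner_commute)
    then show ?thesis unfolding power2_norm_eq_inner s(2,3) vw by simp
  qed
  moreover have "(norm (wedge v w))\<^sup>2 = 2 - 2 * (v \<bullet> w)\<^sup>2"
    unfolding norm_wedge_squared assms by simp
  ultimately have "(norm (v - s *\<^sub>R w))\<^sup>2 \<le> (norm (wedge v w))\<^sup>2" by linarith
  then have "norm (v - s *\<^sub>R w) \<le> norm (wedge v w)"
    by (rule power2_le_imp_le) simp
  then show ?thesis using that s(1) by blast
qed

lemma borel_measurable_wedge_norm [measurable]: "wedge_norm \<in> borel_measurable borel"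
proof -
  have "continuous_on UNIV (wedge_norm :: real^'m^'m \<Rightarrow> real)"
    unfolding wedge_norm_def wedge_matrix_def by (intro continuous_intros) auto
  then show ?thesis by (rule borel_measurable_continuous_onI)
qed

section \<open>Bounded cocycles over a mixing chain\<close>

primrec path_iterate :: "('a \<times> 'a \<Rightarrow> real^'m^'m) \<Rightarrow> nat \<Rightarrow> (nat \<Rightarrow> 'a) \<Rightarrow> real^'m^'m" where
  "path_iterate A 0 \<omega> = mat 1"
| "path_iterate A (Suc n) \<omega> = A (\<omega> n, \<omega> (Suc n)) ** path_iterate A n \<omega>"

lemma path_iterate_add:
  "path_iterate A (n + m) \<omega> = path_iterate A m (path_shift n \<omega>) ** path_iterate A n \<omega>"
  by (induction m) (simp_all add: path_shift_apply matrix_mul_assoc)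

lemma path_iterate_cong:
  assumes "\<And>i. i \<le> n \<Longrightarrow> \<omega> i = \<omega>' i"
  shows "path_iterate A n \<omega> = path_iterate A n \<omega>'"
  using assms by (induction n) auto

lemma measurable_path_iterate [measurable]:
  fixes A :: "'a::second_countable_topology \<times> 'a \<Rightarrow> real^'m^'m"
  assumes A: "A \<in> borel_measurable borel"
  shows "path_iterate A n \<in> borel_measurable path_space"
proof (induction n)
  case (Suc n)
  note [measurable] = Suc
  have [measurable]: "(\<lambda>\<omega>. A (\<omega> n, \<omega> (Suc n))) \<in> borel_measurable path_space"
    by (rule measurable_compose[OF _ A]) (simp add: borel_prod[symmetric])
  show ?case unfolding path_iterate.simps by measurable
qed simp

text \<open>The matrix \<open>norm\<close> is the Hilbert-Schmidt norm. One \<open>b\<close> bounds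
  the matrices and their inverses, so the logarithmic length of any nonzero vector changes by at
  most \<open>b\<close> per step; the same \<open>b\<close> will serve all cocycles near a given
  one.\<close>

locale bounded_cocycle = mixing_chain K \<mu> C \<rho>
  for K :: "'a::polish_space \<Rightarrow> 'a measure" and \<mu> C \<rho> +
  fixes A :: "'a \<times> 'a \<Rightarrow> real^'m^'m" and b :: real
  assumes A_measurable: "A \<in> borel_measurable borel"
    and A_invertible: "\<And>z. invertible (A z)"
    and A_bound: "\<And>z. norm (A z) \<le> exp b" and A_inv_bound: "\<And>z. norm (matrix_inv (A z)) \<le> exp b"
    and b_nonneg: "0 \<le> b"
begin

lemma measurable_iterate [measurable]: "path_iterate A n \<in> borel_measurable path_space"
  by (rule measurable_path_iterate[OF A_measurable])

lemma matrix_inv_left: "matrix_inv (A z) ** A z = mat 1"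
  by (rule matrix_inv_mult(1)[OF A_invertible])

lemma matrix_inv_right: "A z ** matrix_inv (A z) = mat 1"
  by (rule matrix_inv_mult(2)[OF A_invertible])

lemma norm_A_le: "norm (A z *v v) \<le> exp b * norm v"
  using norm_matrix_vector_mult_le[of "A z" v] A_bound[of z]
  by (meson mult_right_mono norm_ge_zero order_trans)

lemma norm_le_norm_A: "norm v \<le> exp b * norm (A z *v v)"
proof -
  have "v = matrix_inv (A z) *v (A z *v v)"
    by (simp add: matrix_vector_mul_assoc matrix_inv_left)
  then have "norm v \<le> norm (matrix_inv (A z)) * norm (A z *v v)"
    by (metis norm_matrix_vector_mult_le)
  also have "\<dots> \<le> exp b * norm (A z *v v)"
    by (intro mult_right_mono A_inv_bound) simp
  finally show ?thesis .
qed

lemma norm_iterate_vector_le: "norm (path_iterate A n \<omega> *v v) \<le> exp (b * real n) * norm v"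
proof (induction n)
  case (Suc n)
  have "norm (path_iterate A (Suc n) \<omega> *v v) \<le> exp b * norm (path_iterate A n \<omega> *v v)"
    using norm_A_le by (simp flip: matrix_vector_mul_assoc)
  also have "\<dots> \<le> exp b * (exp (b * real n) * norm v)"
    by (intro mult_left_mono Suc) simp
  also have "\<dots> = exp (b * real (Suc n)) * norm v"
    by (simp add: distrib_left exp_add)
  finally show ?case .
qed simp

lemma norm_le_norm_iterate_vector: "norm v \<le> exp (b * real n) * norm (path_iterate A n \<omega> *v v)"
proof (induction n)
  case (Suc n)
  note Suc
  also have "exp (b * real n) * norm (path_iterate A n \<omega> *v v)
      \<le> exp (b * real n) * (exp b * norm (path_iterate A (Suc n) \<omega> *v v))"
    using norm_le_norm_A by (intro mult_left_mono) (simp_all flip: matrix_vector_mul_assoc)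
  also have "\<dots> = exp (b * real (Suc n)) * norm (path_iterate A (Suc n) \<omega> *v v)"
    by (simp add: distrib_left exp_add mult.commute mult.left_commute)
  finally show ?case .
qed simp

lemma iterate_vector_nonzero: "v \<noteq> 0 \<Longrightarrow> path_iterate A n \<omega> *v v \<noteq> 0"
  using norm_le_norm_iterate_vector[of v n \<omega>] by auto

text \<open>Time 0 is excluded because the Hilbert-Schmidt norm of the identity exceeds 1 in
  dimension at least 2.\<close>

lemma iterate_inverse:
  assumes "n \<ge> 1"
  shows "norm (path_iterate A n \<omega>) \<le> exp (b * real n)"
    and "\<exists>h. h ** path_iterate A n \<omega> = mat 1 \<and> norm h \<le> exp (b * real n)"
proof -
  have "norm (path_iterate A n \<omega>) \<le> exp (b * real n) \<and>
      (\<exists>h. h ** path_iterate A n \<omega> = mat 1 \<and> norm h \<le> exp (b * real n))"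
    using assms
  proof (induction n rule: nat_induct_at_least)
    case base
    show ?case
      using A_bound matrix_inv_left[of "(\<omega> 0, \<omega> 1)"] A_inv_bound[of "(\<omega> 0, \<omega> 1)"]
      by (auto intro!: exI[of _ "matrix_inv (A (\<omega> 0, \<omega> 1))"])
  next
    case (Suc n)
    let ?z = "(\<omega> n, \<omega> (Suc n))"
    from Suc obtain h where h: "h ** path_iterate A n \<omega> = mat 1" "norm h \<le> exp (b * real n)" by auto
    have "norm (path_iterate A (Suc n) \<omega>) \<le> norm (A ?z) * norm (path_iterate A n \<omega>)"
      using norm_matrix_mult_le by simp
    also have "\<dots> \<le> exp b * exp (b * real n)"
      using Suc A_bound by (intro mult_mono) auto
    finally have 1: "norm (path_iterate A (Suc n) \<omega>) \<le> exp (b * real (Suc n))"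
      by (simp add: distrib_left exp_add)
    have "norm (h ** matrix_inv (A ?z)) \<le> norm h * norm (matrix_inv (A ?z))"
      by (rule norm_matrix_mult_le)
    also have "\<dots> \<le> exp (b * real n) * exp b"
      using h A_inv_bound by (intro mult_mono) auto
    finally have 2: "norm (h ** matrix_inv (A ?z)) \<le> exp (b * real (Suc n))"
      by (simp add: distrib_left exp_add mult.commute)
    have "(h ** matrix_inv (A ?z)) ** path_iterate A (Suc n) \<omega>
        = h ** (matrix_inv (A ?z) ** A ?z) ** path_iterate A n \<omega>"
      by (simp add: matrix_mul_assoc)
    then have "(h ** matrix_inv (A ?z)) ** path_iterate A (Suc n) \<omega> = mat 1"
      by (simp add: matrix_inv_left h)
    then show ?case using 1 2 by blast
  qed
  then show "norm (path_iterate A n \<omega>) \<le> exp (b * real n)"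
    and "\<exists>h. h ** path_iterate A n \<omega> = mat 1 \<and> norm h \<le> exp (b * real n)" by auto
qed

text \<open>The value at time 0 is set by hand since \<open>F (mat 1)\<close> may exceed 1, while a
  subadditive process has to vanish there.\<close>

definition growth :: "(real^'m^'m \<Rightarrow> real) \<Rightarrow> nat \<Rightarrow> (nat \<Rightarrow> 'a) \<Rightarrow> real" where
  "growth F n \<omega> = (if n = 0 then 0 else ln (F (path_iterate A n \<omega>)))"

text \<open>Applied to the norm (\<open>d = 1\<close>) and to \<open>wedge_norm\<close>
  (\<open>d = 2\<close>). Lower bounds come from a left inverse \<open>h\<close> of the iterate:
  \<open>1 \<le> F (mat 1) \<le> F h * F (path_iterate A n \<omega>)\<close>, with
  \<open>F h \<le> norm h ^ d\<close>.\<close>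

lemma growth_subadditive_process:
  fixes F :: "real^'m^'m \<Rightarrow> real" and d :: nat
  assumes F [measurable]: "F \<in> borel_measurable borel" and nonneg: "\<And>g. 0 \<le> F g"
    and submult: "\<And>g h. F (g ** h) \<le> F g * F h" and one: "0 < F (mat 1)"
    and le: "\<And>g. F g \<le> norm g ^ d"
  shows "subadditive_process K \<mu> C \<rho> (growth F) (real d * b)"
    and "n \<ge> 1 \<Longrightarrow> 0 < F (path_iterate A n \<omega>)"
proof -
  have "1 * F (mat 1) \<le> F (mat 1) * F (mat 1)" using submult[of "mat 1" "mat 1"] by simp
  then have one': "1 \<le> F (mat 1)" using one by (simp only: mult_le_cancel_right_pos)
  have lower: "exp (- (real d * b * real n)) \<le> F (path_iterate A n \<omega>)" if n: "n \<ge> 1" for n \<omega>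
  proof -
    obtain h where h: "h ** path_iterate A n \<omega> = mat 1" "norm h \<le> exp (b * real n)"
      using iterate_inverse(2)[OF n] by blast
    have "F h \<le> exp (b * real n) ^ d"
      using le[of h] h(2) power_mono[of "norm h" "exp (b * real n)" d] by simp
    then have "F h * F (path_iterate A n \<omega>) \<le> exp (b * real n) ^ d * F (path_iterate A n \<omega>)"
      by (intro mult_right_mono nonneg)
    then have "1 \<le> exp (real d * b * real n) * F (path_iterate A n \<omega>)"
      using submult[of h "path_iterate A n \<omega>"] one' h(1)
      by (simp add: exp_of_nat_mult[symmetric] mult.assoc)
    then show ?thesis by (simp add: exp_minus field_simps)
  qed
  show pos: "0 < F (path_iterate A n \<omega>)" if "n \<ge> 1" for n \<omega>
    using lower[OF that, of \<omega>] exp_gt_zero less_le_trans by blast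
  have upper: "F (path_iterate A n \<omega>) \<le> exp (real d * b * real n)" if n: "n \<ge> 1" for n \<omega>
    using le[of "path_iterate A n \<omega>"] power_mono[OF iterate_inverse(1)[OF n, of \<omega>], of d]
    by (simp add: exp_of_nat_mult[symmetric] mult.assoc)
  show "subadditive_process K \<mu> C \<rho> (growth F) (real d * b)"
  proof
    fix n m :: nat and \<omega> :: "nat \<Rightarrow> 'a"
    show "growth F n \<in> borel_measurable path_space"
      unfolding growth_def by (cases "n = 0") simp_all
    show "\<bar>growth F n \<omega>\<bar> \<le> real d * b * real n"
    proof (cases "n = 0")
      case False
      then have n: "n \<ge> 1" by simp
      have "ln (F (path_iterate A n \<omega>)) \<le> real d * b * real n"
        using upper[OF n, of \<omega>] pos[OF n, of \<omega>] by (subst ln_exp[symmetric], subst ln_le_cancel_iff) auto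
      moreover have "- (real d * b * real n) \<le> ln (F (path_iterate A n \<omega>))"
        using lower[OF n, of \<omega>] pos[OF n, of \<omega>] by (subst ln_exp[symmetric], subst ln_le_cancel_iff) auto
      ultimately show ?thesis using False by (simp add: growth_def abs_le_iff)
    qed (simp add: growth_def)
    show "growth F (n + m) \<omega> \<le> growth F n \<omega> + growth F m (path_shift n \<omega>)"
    proof (cases "n = 0 \<or> m = 0")
      case True then show ?thesis by (auto simp: growth_def)
    next
      case False
      then have nm: "n \<ge> 1" "m \<ge> 1" by auto
      have "ln (F (path_iterate A (n + m) \<omega>)) \<le> ln (F (path_iterate A m (path_shift n \<omega>)) * F (path_iterate A n \<omega>))"
        unfolding path_iterate_add using pos[of "n + m" \<omega>] nm submult pos
        by (subst ln_le_cancel_iff) (simp_all add: path_iterate_add)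
      then show ?thesis using nm pos[OF nm(1), of \<omega>] pos[OF nm(2), of "path_shift n \<omega>"]
        by (simp add: growth_def ln_mult)
    qed
    show "growth F n (path_shift 1 \<omega>) \<le> growth F (Suc n) \<omega> + real d * b"
    proof (cases "n = 0")
      case True
      have "- (real d * b) \<le> ln (F (path_iterate A 1 \<omega>))"
        using lower[of 1 \<omega>] pos[of 1 \<omega>] by (subst ln_exp[symmetric], subst ln_le_cancel_iff) auto
      then show ?thesis using True by (simp add: growth_def del: path_iterate.simps)
    next
      case False
      then have n: "n \<ge> 1" by simp
      let ?h = "matrix_inv (A (\<omega> 0, \<omega> 1))"
      have "path_iterate A (Suc n) \<omega> = path_iterate A n (path_shift 1 \<omega>) ** A (\<omega> 0, \<omega> 1)"
        using path_iterate_add[of A 1 n \<omega>] by simp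
      moreover have "A (\<omega> 0, \<omega> 1) ** ?h = mat 1"
        by (rule matrix_inv_right)
      ultimately have eq: "path_iterate A n (path_shift 1 \<omega>) = path_iterate A (Suc n) \<omega> ** ?h"
        by (simp add: matrix_mul_assoc[symmetric])
      have "F ?h \<le> exp (real d * b)"
        using le[of ?h] power_mono[OF A_inv_bound, of "(\<omega> 0, \<omega> 1)" d] by (simp add: exp_of_nat_mult[symmetric])
      then have "F (path_iterate A n (path_shift 1 \<omega>)) \<le> F (path_iterate A (Suc n) \<omega>) * exp (real d * b)"
        unfolding eq using submult[of "path_iterate A (Suc n) \<omega>" ?h] nonneg
        by (meson mult_left_mono order_trans)
      then have "ln (F (path_iterate A n (path_shift 1 \<omega>))) \<le> ln (F (path_iterate A (Suc n) \<omega>) * exp (real d * b))"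
        using pos[OF n, of "path_shift 1 \<omega>"] pos[of "Suc n" \<omega>] by (subst ln_le_cancel_iff) (auto simp del: path_iterate.simps)
      also have "\<dots> = ln (F (path_iterate A (Suc n) \<omega>)) + real d * b"
        using pos[of "Suc n" \<omega>] by (subst ln_mult) (auto simp del: path_iterate.simps)
      finally show ?thesis using n by (simp add: growth_def del: path_iterate.simps)
    qed
  qed
qed

lemma norm_growth_process: "subadditive_process K \<mu> C \<rho> (growth norm) b"
  and norm_iterate_pos: "n \<ge> 1 \<Longrightarrow> 0 < norm (path_iterate A n \<omega>)"
proof -
  have one: "0 < norm (mat 1 :: real^'m^'m)"
    by (simp add: vec_eq_iff mat_def)
  show "subadditive_process K \<mu> C \<rho> (growth norm) b"
    using growth_subadditive_process(1)[of norm 1, OF _ _ norm_matrix_mult_le one] by simp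
  show "0 < norm (path_iterate A n \<omega>)" if "n \<ge> 1"
    using growth_subadditive_process(2)[of norm 1 n, OF _ _ norm_matrix_mult_le one] that by simp
qed

lemma wedge_growth_process:
  assumes "CARD('m) \<ge> 2"
  shows "subadditive_process K \<mu> C \<rho> (growth wedge_norm) (2 * b)"
    and "n \<ge> 1 \<Longrightarrow> 0 < wedge_norm (path_iterate A n \<omega>)"
  using growth_subadditive_process[of wedge_norm 2, OF _ wedge_norm_nonneg wedge_norm_mult
      wedge_norm_1_pos[OF assms] wedge_norm_le]
  by simp_all

end

section \<open>Suprema over the unit sphere\<close>

text \<open>Countability keeps suprema over directions measurable in the state; continuity in the
  direction makes them suprema over the whole sphere.\<close>

definition sphere_dense :: "(real^'m) set" where
  "sphere_dense = (SOME D. countable D \<and> D \<subseteq> sphere 0 1 \<and> sphere 0 1 \<subseteq> closure D)"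

lemma sphere_dense:
  "countable (sphere_dense :: (real^'m) set)" "sphere_dense \<subseteq> (sphere 0 1 :: (real^'m) set)"
  "(sphere 0 1 :: (real^'m) set) \<subseteq> closure sphere_dense"
proof -
  have "\<exists>D. countable D \<and> D \<subseteq> (sphere 0 1 :: (real^'m) set) \<and> sphere 0 1 \<subseteq> closure D"
    by (metis separable)
  from someI_ex[OF this] show "countable (sphere_dense :: (real^'m) set)"
    "sphere_dense \<subseteq> (sphere 0 1 :: (real^'m) set)" "(sphere 0 1 :: (real^'m) set) \<subseteq> closure sphere_dense"
    unfolding sphere_dense_def by auto
qed

lemma sphere_nonempty: "(sphere 0 1 :: (real^'m) set) \<noteq> {}"
proof -
  have "axis undefined 1 \<in> (sphere 0 1 :: (real^'m) set)" by (simp add: norm_axis_1)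
  then show ?thesis by blast
qed

text \<open>The setting occurs twice, for \<open>damped\<close> and for \<open>escape\<close>, where
  a limit in \<open>k\<close> has to be exchanged with a supremum over directions.\<close>

locale sphere_family = prob_space N for N :: "'x measure" +
  fixes f :: "nat \<Rightarrow> 'x \<Rightarrow> real^'m \<Rightarrow> real"
  assumes f_meas [measurable]: "\<And>k v. (\<lambda>\<omega>. f k \<omega> v) \<in> borel_measurable N"
    and f_range: "\<And>k \<omega> v. 0 \<le> f k \<omega> v" "\<And>k \<omega> v. f k \<omega> v \<le> 1"
    and f_cont: "\<And>k \<omega>. continuous_on (sphere 0 1) (f k \<omega>)"
    and f_dec: "\<And>k l \<omega> v. k \<le> l \<Longrightarrow> f l \<omega> v \<le> f k \<omega> v"
begin

definition mean :: "nat \<Rightarrow> real^'m \<Rightarrow> real" where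
  "mean k v = (\<integral>\<omega>. f k \<omega> v \<partial>N)"

lemma abs_f_le_1: "\<bar>f k \<omega> v\<bar> \<le> 1"
  using f_range by (simp add: abs_of_nonneg)

lemma f_integrable: "integrable N (\<lambda>\<omega>. f k \<omega> v)"
  by (rule abs_integral_le(1)[where b=1]) (simp_all add: abs_f_le_1)

lemma nn_integral_mean: "(\<integral>\<^sup>+\<omega>. ennreal (f k \<omega> v) \<partial>N) = ennreal (mean k v)"
  unfolding mean_def by (rule nn_integral_eq_integral[OF f_integrable]) (simp add: f_range)

lemma mean_dec: "k \<le> l \<Longrightarrow> mean l v \<le> mean k v"
  unfolding mean_def by (rule integral_mono) (auto simp: f_integrable f_dec)

lemma mean_cont: "continuous_on (sphere 0 1) (mean k)"
  unfolding continuous_on_sequentially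
proof (intro allI ballI impI)
  fix x :: "nat \<Rightarrow> real^'m" and a assume a: "a \<in> sphere 0 1" and x: "(\<forall>n. x n \<in> sphere 0 1) \<and> x \<longlonglongrightarrow> a"
  have "(\<lambda>n. f k \<omega> (x n)) \<longlonglongrightarrow> f k \<omega> a" for \<omega>
    using f_cont[of k \<omega>] a x unfolding continuous_on_sequentially by (auto simp: o_def)
  then have "(\<lambda>n. mean k (x n)) \<longlonglongrightarrow> mean k a"
    unfolding mean_def
    by (intro integral_dominated_convergence[where w="\<lambda>_. 1"]) (simp_all add: abs_f_le_1)
  then show "(mean k \<circ> x) \<longlonglongrightarrow> mean k a" by (simp add: o_def)
qed

lemma mean_tendsto:
  assumes "v \<in> sphere 0 1" "\<And>n. x n \<in> sphere 0 1" "x \<longlonglongrightarrow> v"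
  shows "(\<lambda>n. mean k (x n)) \<longlonglongrightarrow> mean k v"
  using mean_cont[of k, unfolded continuous_on_sequentially, rule_format, of v x] assms by (simp add: o_def)

definition sup_mean :: "nat \<Rightarrow> ennreal" where
  "sup_mean k = (SUP v\<in>sphere_dense. \<integral>\<^sup>+\<omega>. ennreal (f k \<omega> v) \<partial>N)"

lemma le_sup_mean:
  assumes "v \<in> sphere 0 1"
  shows "(\<integral>\<^sup>+\<omega>. ennreal (f k \<omega> v) \<partial>N) \<le> sup_mean k"
proof -
  from assms have "v \<in> closure sphere_dense" using sphere_dense(3) by blast
  then obtain x where x: "\<And>n. x n \<in> sphere_dense" "x \<longlonglongrightarrow> v"
    unfolding closure_sequential by auto
  have "(\<lambda>n. mean k (x n)) \<longlonglongrightarrow> mean k v"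
    using assms x sphere_dense(2) by (intro mean_tendsto) blast+
  then have "(\<lambda>n. ennreal (mean k (x n))) \<longlonglongrightarrow> ennreal (mean k v)"
    by (rule tendsto_ennrealI)
  moreover have "ennreal (mean k (x n)) \<le> sup_mean k" for n
    unfolding sup_mean_def nn_integral_mean by (rule SUP_upper) (rule x)
  ultimately show ?thesis
    unfolding nn_integral_mean by (intro LIMSEQ_le_const2) auto
qed

text \<open>A form of Dini's argument: take a maximiser for each \<open>k\<close> and a limit
  direction \<open>v\<close>. As the means decrease in \<open>k\<close>, the value for fixed
  \<open>k\<close> at later maximisers stays above the infimum, and continuity carries this over to
  \<open>v\<close>.\<close>

lemma inf_sup_mean_attained:
  obtains v where "v \<in> sphere 0 1" "\<And>k. (INF k. sup_mean k) \<le> (\<integral>\<^sup>+\<omega>. ennreal (f k \<omega> v) \<partial>N)"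
proof -
  have "\<exists>v\<in>sphere 0 1. \<forall>w\<in>sphere 0 1. mean k w \<le> mean k v" for k
    by (rule continuous_attains_sup[OF _ sphere_nonempty mean_cont]) simp
  then obtain x where x: "\<And>k. x k \<in> sphere 0 1" "\<And>k w. w \<in> sphere 0 1 \<Longrightarrow> mean k w \<le> mean k (x k)"
    by metis
  have le: "sup_mean k \<le> ennreal (mean k (x k))" for k
    unfolding sup_mean_def nn_integral_mean using x(2) sphere_dense(2) by (intro SUP_least ennreal_leI) auto
  have "compact (sphere 0 1 :: (real^'m) set)" by simp
  then obtain v r where v: "v \<in> sphere 0 1" "strict_mono r" "(x \<circ> r) \<longlonglongrightarrow> v"
    using x(1) unfolding compact_def by blast
  have "(INF k. sup_mean k) \<le> (\<integral>\<^sup>+\<omega>. ennreal (f k \<omega> v) \<partial>N)" for k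
  proof -
    have "(\<lambda>j. mean k ((x \<circ> r) j)) \<longlonglongrightarrow> mean k v"
      by (rule mean_tendsto[OF v(1) _ v(3)]) (simp only: o_def x(1))
    then have "(\<lambda>j. ennreal (mean k (x (r j)))) \<longlonglongrightarrow> ennreal (mean k v)"
      by (auto simp: o_def intro: tendsto_ennrealI)
    moreover have "(INF k. sup_mean k) \<le> ennreal (mean k (x (r j)))" if "j \<ge> k" for j
    proof -
      have "k \<le> r j" using that seq_suble[OF v(2), of j] by simp
      have "(INF k. sup_mean k) \<le> sup_mean (r j)" by (rule INF_lower) simp
      also have "\<dots> \<le> ennreal (mean (r j) (x (r j)))" by (rule le)
      also have "\<dots> \<le> ennreal (mean k (x (r j)))"
        by (rule ennreal_leI) (rule mean_dec[OF \<open>k \<le> r j\<close>])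
      finally show ?thesis .
    qed
    ultimately show ?thesis
      unfolding nn_integral_mean by (intro LIMSEQ_le_const) auto
  qed
  then show ?thesis using v(1) that by blast
qed

end

lemma AE_eq_of_nn_integral_eq:
  fixes c :: ennreal
  assumes "prob_space M" and [measurable]: "g \<in> borel_measurable M" and le: "AE x in M. g x \<le> c"
    and c: "c \<noteq> top" and eq: "(\<integral>\<^sup>+x. g x \<partial>M) = c"
  shows "AE x in M. g x = c"
proof -
  have "(\<integral>\<^sup>+x. c - g x \<partial>M) = (\<integral>\<^sup>+x. c \<partial>M) - (\<integral>\<^sup>+x. g x \<partial>M)"
    by (rule nn_integral_diff) (use le eq c in auto)
  also have "\<dots> = 0" using prob_space.emeasure_space_1[OF assms(1)] eq c by simp
  finally have "AE x in M. c - g x = 0" by (subst (asm) nn_integral_0_iff_AE) auto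
  then show ?thesis using le
    by eventually_elim (metis antisym diff_eq_0_iff_ennreal ennreal_minus_eq_0)
qed

section \<open>The residual growth seminorm\<close>

context bounded_cocycle
begin

definition ratio :: "(nat \<Rightarrow> 'a) \<Rightarrow> real^'m \<Rightarrow> nat \<Rightarrow> real" where
  "ratio \<omega> v n = norm (path_iterate A n \<omega> *v v) / norm (path_iterate A n \<omega>)"

definition tail_sup :: "(nat \<Rightarrow> 'a) \<Rightarrow> real^'m \<Rightarrow> nat \<Rightarrow> real" where
  "tail_sup \<omega> v k = (SUP n. ratio \<omega> v (n + k))"

text \<open>The kernel of this seminorm consists of the directions that grow slower than the cocycle.\<close>

definition residual :: "(nat \<Rightarrow> 'a) \<Rightarrow> real^'m \<Rightarrow> real" where
  "residual \<omega> v = lim (tail_sup \<omega> v)"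

lemma norm_iterate_gt_0: "0 < norm (path_iterate A n \<omega>)"
proof (cases "n = 0")
  case True
  then show ?thesis by (simp add: vec_eq_iff mat_def)
qed (use norm_iterate_pos[of n \<omega>] in simp)

lemma ratio_bounds: "0 \<le> ratio \<omega> v n" "ratio \<omega> v n \<le> norm v"
  using norm_matrix_vector_mult_le[of "path_iterate A n \<omega>" v] norm_iterate_gt_0[of n \<omega>]
  by (simp_all add: ratio_def divide_le_eq mult.commute)

lemma ratio_bdd: "bdd_above (range (\<lambda>n. ratio \<omega> v (n + k)))"
  using ratio_bounds(2) by (intro bdd_aboveI2) blast

lemma ratio_le_tail_sup: "k \<le> n \<Longrightarrow> ratio \<omega> v n \<le> tail_sup \<omega> v k"
  unfolding tail_sup_def using cSUP_upper[OF UNIV_I ratio_bdd[of \<omega> v k], of "n - k"] by simp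

lemma tail_sup_le: "(\<And>n. k \<le> n \<Longrightarrow> ratio \<omega> v n \<le> c) \<Longrightarrow> tail_sup \<omega> v k \<le> c"
  unfolding tail_sup_def by (rule cSUP_least) auto

lemma tail_sup_bounds: "0 \<le> tail_sup \<omega> v k" "tail_sup \<omega> v k \<le> norm v"
  using ratio_le_tail_sup[of k k \<omega> v] ratio_bounds(1)[of \<omega> v k] tail_sup_le[of k \<omega> v "norm v"] ratio_bounds(2)
  by auto

lemma tail_sup_dec: "k \<le> l \<Longrightarrow> tail_sup \<omega> v l \<le> tail_sup \<omega> v k"
  by (rule tail_sup_le) (rule ratio_le_tail_sup, simp)

lemma tail_sup_tendsto: "tail_sup \<omega> v \<longlonglongrightarrow> residual \<omega> v"
proof -
  have "convergent (tail_sup \<omega> v)"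
    using tail_sup_dec tail_sup_bounds(1)[of \<omega> v]
    by (metis decseq_convergent decseq_def convergentI)
  then show ?thesis unfolding residual_def by (simp add: convergent_LIMSEQ_iff)
qed

lemma residual_le_tail_sup: "residual \<omega> v \<le> tail_sup \<omega> v k"
  by (rule LIMSEQ_le_const2[OF tail_sup_tendsto]) (use tail_sup_dec in blast)

lemma residual_bounds: "0 \<le> residual \<omega> v" "residual \<omega> v \<le> norm v"
  using LIMSEQ_le_const[OF tail_sup_tendsto] tail_sup_bounds residual_le_tail_sup order_trans by blast+

lemma residual_triangle: "residual \<omega> (v + w) \<le> residual \<omega> v + residual \<omega> w"
proof (rule LIMSEQ_le[OF tail_sup_tendsto tendsto_add[OF tail_sup_tendsto tail_sup_tendsto]])
  have "tail_sup \<omega> (v + w) k \<le> tail_sup \<omega> v k + tail_sup \<omega> w k" for k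
  proof (rule tail_sup_le)
    fix n assume n: "k \<le> n"
    have "norm (path_iterate A n \<omega> *v (v + w)) \<le> norm (path_iterate A n \<omega> *v v) + norm (path_iterate A n \<omega> *v w)"
      unfolding matrix_vector_right_distrib by (rule norm_triangle_ineq)
    then have "ratio \<omega> (v + w) n \<le> ratio \<omega> v n + ratio \<omega> w n"
      unfolding ratio_def add_divide_distrib[symmetric] by (intro divide_right_mono) auto
    then show "ratio \<omega> (v + w) n \<le> tail_sup \<omega> v k + tail_sup \<omega> w k"
      using ratio_le_tail_sup[OF n, of \<omega> v] ratio_le_tail_sup[OF n, of \<omega> w] by linarith
  qed
  then show "\<exists>N. \<forall>n\<ge>N. tail_sup \<omega> (v + w) n \<le> tail_sup \<omega> v n + tail_sup \<omega> w n" by blast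
qed

text \<open>The offsets \<open>i\<close> and \<open>j\<close> serve to compare a path with its
  shift, whose times differ by one.\<close>

lemma residual_le_scaled:
  assumes "0 \<le> c" and le: "\<And>n. ratio \<omega> v (n + i) \<le> c * ratio \<omega>' w (n + j)"
  shows "residual \<omega> v \<le> c * residual \<omega>' w"
proof (rule LIMSEQ_le)
  show "(\<lambda>k. tail_sup \<omega> v (k + i)) \<longlonglongrightarrow> residual \<omega> v"
    using tail_sup_tendsto by (rule LIMSEQ_ignore_initial_segment)
  show "(\<lambda>k. c * tail_sup \<omega>' w (k + j)) \<longlonglongrightarrow> c * residual \<omega>' w"
    by (intro tendsto_mult tendsto_const LIMSEQ_ignore_initial_segment tail_sup_tendsto)
  have "tail_sup \<omega> v (k + i) \<le> c * tail_sup \<omega>' w (k + j)" for k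
  proof (rule tail_sup_le)
    fix n assume n: "k + i \<le> n"
    have "ratio \<omega> v n \<le> c * ratio \<omega>' w (n - i + j)" using le[of "n - i"] n by simp
    also have "\<dots> \<le> c * tail_sup \<omega>' w (k + j)"
      using n by (intro mult_left_mono ratio_le_tail_sup assms(1)) simp
    finally show "ratio \<omega> v n \<le> c * tail_sup \<omega>' w (k + j)" .
  qed
  then show "\<exists>N. \<forall>n\<ge>N. tail_sup \<omega> v (n + i) \<le> c * tail_sup \<omega>' w (n + j)" by blast
qed

lemma residual_scaleR_le: "residual \<omega> (c *\<^sub>R v) \<le> \<bar>c\<bar> * residual \<omega> v"
  by (rule residual_le_scaled[where i=0 and j=0])
     (simp_all add: ratio_def matrix_vector_mult_scaleR)

lemma residual_lipschitz: "\<bar>residual \<omega> v - residual \<omega> w\<bar> \<le> norm (v - w)"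
  using residual_triangle[of \<omega> "v - w" w] residual_triangle[of \<omega> "w - v" v]
    residual_bounds(2)[of \<omega> "v - w"] residual_bounds(2)[of \<omega> "w - v"]
  by (simp add: norm_minus_commute abs_le_iff)

text \<open>The iterates of \<open>\<omega>\<close> and of its shift differ by one factor on the
  right, so their norms agree up to \<open>exp b\<close>, while the images of the vectors coincide.
  Hence the cocycle carries the kernel of \<open>residual\<close> along the path.\<close>

lemma
  shows residual_shift_le: "residual (path_shift 1 \<omega>) (A (\<omega> 0, \<omega> 1) *v v) \<le> exp b * residual \<omega> v"
    and residual_le_shift: "residual \<omega> v \<le> exp b * residual (path_shift 1 \<omega>) (A (\<omega> 0, \<omega> 1) *v v)"
proof -
  let ?g = "A (\<omega> 0, \<omega> 1)"
  have it: "path_iterate A (n + 1) \<omega> = path_iterate A n (path_shift 1 \<omega>) ** ?g" for n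
    using path_iterate_add[of A 1 n \<omega>] by simp
  then have it': "path_iterate A n (path_shift 1 \<omega>) = path_iterate A (n + 1) \<omega> ** matrix_inv ?g" for n
    by (simp add: matrix_mul_assoc[symmetric] matrix_inv_right)
  have v: "path_iterate A n (path_shift 1 \<omega>) *v (?g *v v) = path_iterate A (n + 1) \<omega> *v v" for n
    unfolding it by (simp add: matrix_vector_mul_assoc)
  have "norm (path_iterate A (n + 1) \<omega>) \<le> exp b * norm (path_iterate A n (path_shift 1 \<omega>))" for n
    unfolding it using norm_matrix_mult_le[of "path_iterate A n (path_shift 1 \<omega>)" ?g]
      mult_left_mono[OF A_bound[of "(\<omega> 0, \<omega> 1)"], of "norm (path_iterate A n (path_shift 1 \<omega>))"]
    by (simp add: mult.commute)
  then have "ratio (path_shift 1 \<omega>) (?g *v v) (n + 0) \<le> exp b * ratio \<omega> v (n + 1)" for n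
    unfolding ratio_def add_0_right v using norm_iterate_gt_0[of n "path_shift 1 \<omega>"] norm_iterate_gt_0[of "n + 1" \<omega>]
      mult_left_mono[of "norm (path_iterate A (n + 1) \<omega>)" "exp b * norm (path_iterate A n (path_shift 1 \<omega>))" "norm (path_iterate A (n + 1) \<omega> *v v)"]
    by (simp add: field_simps del: path_iterate.simps)
  then show "residual (path_shift 1 \<omega>) (?g *v v) \<le> exp b * residual \<omega> v"
    by (intro residual_le_scaled[where i=0 and j=1]) simp_all
  have "norm (path_iterate A n (path_shift 1 \<omega>)) \<le> exp b * norm (path_iterate A (n + 1) \<omega>)" for n
    unfolding it' using norm_matrix_mult_le[of "path_iterate A (n + 1) \<omega>" "matrix_inv ?g"]
      mult_left_mono[OF A_inv_bound[of "(\<omega> 0, \<omega> 1)"], of "norm (path_iterate A (n + 1) \<omega>)"]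
    by (simp add: mult.commute)
  then have "ratio \<omega> v (n + 1) \<le> exp b * ratio (path_shift 1 \<omega>) (?g *v v) (n + 0)" for n
    unfolding ratio_def add_0_right v using norm_iterate_gt_0[of n "path_shift 1 \<omega>"] norm_iterate_gt_0[of "n + 1" \<omega>]
      mult_left_mono[of "norm (path_iterate A n (path_shift 1 \<omega>))" "exp b * norm (path_iterate A (n + 1) \<omega>)" "norm (path_iterate A (n + 1) \<omega> *v v)"]
    by (simp add: field_simps del: path_iterate.simps)
  then show "residual \<omega> v \<le> exp b * residual (path_shift 1 \<omega>) (?g *v v)"
    by (intro residual_le_scaled[where i=1 and j=0]) simp_all
qed

lemma residual_zero_shift_1:
  "residual (path_shift 1 \<omega>) (A (\<omega> 0, \<omega> 1) *v v) = 0 \<longleftrightarrow> residual \<omega> v = 0"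
  using residual_shift_le[of \<omega> v] residual_le_shift[of \<omega> v] residual_bounds(1) by (metis antisym mult_zero_right)

lemma residual_zero_shift:
  "residual (path_shift n \<omega>) (path_iterate A n \<omega> *v v) = 0 \<longleftrightarrow> residual \<omega> v = 0"
proof (induction n)
  case (Suc n)
  have "path_shift 1 (path_shift n \<omega>) = path_shift (Suc n) \<omega>" by simp
  moreover have "A (path_shift n \<omega> 0, path_shift n \<omega> 1) *v (path_iterate A n \<omega> *v v) = path_iterate A (Suc n) \<omega> *v v"
    by (simp add: path_shift_apply matrix_vector_mul_assoc)
  ultimately show ?case
    using residual_zero_shift_1[of "path_shift n \<omega>" "path_iterate A n \<omega> *v v"] Suc by metis
qed simp

lemma residual_zero_scaleR: "c \<noteq> 0 \<Longrightarrow> residual \<omega> (c *\<^sub>R v) = 0 \<longleftrightarrow> residual \<omega> v = 0"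
  using residual_scaleR_le[of \<omega> c v] residual_scaleR_le[of \<omega> "1 / c" "c *\<^sub>R v"] residual_bounds(1)
  by (auto intro!: antisym)

text \<open>The norm of a matrix is at most the sum of its column norms, so the ratios of the basis
  vectors add up to at least 1 at every time and cannot all tend to 0.\<close>

lemma residual_axis_nonzero: "\<exists>i. residual \<omega> (axis i 1) \<noteq> 0"
proof (rule ccontr)
  assume "\<not> ?thesis"
  then have "(\<lambda>k. \<Sum>i\<in>UNIV. tail_sup \<omega> (axis i 1) k) \<longlonglongrightarrow> (\<Sum>i\<in>(UNIV :: 'm set). 0)"
    by (intro tendsto_sum) (metis tail_sup_tendsto)
  moreover have "1 \<le> (\<Sum>i\<in>UNIV. tail_sup \<omega> (axis i 1) k)" for k
  proof -
    let ?M = "path_iterate A k \<omega>"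
    have "norm (transpose ?M) \<le> (\<Sum>i\<in>UNIV. norm (transpose ?M $ i))"
      unfolding norm_vec_def by (rule L2_set_le_sum) simp
    moreover have "norm (transpose ?M) = norm ?M"
      by (simp add: norm_vec_def L2_set_def transpose_def sum_nonneg) (rule sum.swap)
    moreover have "transpose ?M $ i = ?M *v axis i 1" for i
      by (simp add: matrix_vector_mult_basis column_def transpose_def)
    ultimately have "1 \<le> (\<Sum>i\<in>UNIV. ratio \<omega> (axis i 1) k)"
      using norm_iterate_gt_0[of k \<omega>] by (simp add: ratio_def sum_divide_distrib[symmetric])
    also have "\<dots> \<le> (\<Sum>i\<in>UNIV. tail_sup \<omega> (axis i 1) k)"
      by (intro sum_mono ratio_le_tail_sup) simp
    finally show ?thesis .
  qed
  ultimately have "1 \<le> (\<Sum>i\<in>(UNIV :: 'm set). 0 :: real)"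
    by (intro LIMSEQ_le_const) auto
  then show False by simp
qed

lemma measurable_residual [measurable]: "(\<lambda>\<omega>. residual \<omega> v) \<in> borel_measurable path_space"
proof (rule borel_measurable_LIMSEQ_real[where u="\<lambda>k \<omega>. tail_sup \<omega> v k"])
  have [measurable]: "(\<lambda>\<omega>. ratio \<omega> v n) \<in> borel_measurable path_space" for n
    unfolding ratio_def by measurable
  show "(\<lambda>\<omega>. tail_sup \<omega> v k) \<in> borel_measurable path_space" for k
    unfolding tail_sup_def by (rule borel_measurable_cSUP) (simp_all add: ratio_bdd)
qed (rule tail_sup_tendsto)

lemma residual_zero_sets [measurable]: "{\<omega>. residual \<omega> v = 0} \<in> sets path_space"
proof -
  have "{\<omega> \<in> space path_space. residual \<omega> v = 0} \<in> sets path_space" by measurable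
  then show ?thesis by simp
qed

end

section \<open>A zero-one law for slow growth\<close>

context bounded_cocycle
begin

text \<open>Continuous functions of \<open>v\<close> that decrease to the indicator of
  \<open>residual \<omega> v = 0\<close> as \<open>k\<close> grows; the indicator itself need not be
  continuous in \<open>v\<close>.\<close>

definition damped :: "nat \<Rightarrow> (nat \<Rightarrow> 'a) \<Rightarrow> real^'m \<Rightarrow> real" where
  "damped k \<omega> v = max 0 (1 - real k * residual \<omega> v)"

lemma sphere_family_damped: "sphere_family (path_law x) damped"
proof (intro sphere_family.intro sphere_family_axioms.intro)
  show "prob_space (path_law x)" by (rule prob_space_path_law)
  show "(\<lambda>\<omega>. damped k \<omega> v) \<in> borel_measurable (path_law x)" for k v
    unfolding damped_def by simp
  show "0 \<le> damped k \<omega> v" "damped k \<omega> v \<le> 1" for k \<omega> v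
    using residual_bounds(1)[of \<omega> v] by (simp_all add: damped_def)
  show "continuous_on (sphere 0 1) (damped k \<omega>)" for k \<omega>
  proof -
    have "continuous_on UNIV (residual \<omega>)"
    proof (rule continuous_onI)
      fix v e assume "0 < (e :: real)"
      then show "\<exists>d>0. \<forall>w\<in>UNIV. dist w v < d \<longrightarrow> dist (residual \<omega> w) (residual \<omega> v) \<le> e"
        by (intro exI[of _ e]) (auto simp: dist_norm, meson less_imp_le order_trans residual_lipschitz)
    qed
    then have "continuous_on (sphere 0 1) (residual \<omega>)" by (rule continuous_on_subset) simp
    then show ?thesis unfolding damped_def by (intro continuous_intros)
  qed
  show "damped l \<omega> v \<le> damped k \<omega> v" if "k \<le> l" for k l \<omega> v
    using mult_right_mono[of "real k" "real l" "residual \<omega> v"] that residual_bounds(1)[of \<omega> v]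
    by (simp add: damped_def)
qed

definition zero_prob :: "'a \<Rightarrow> real^'m \<Rightarrow> ennreal" where
  "zero_prob x v = emeasure (path_law x) {\<omega>. residual \<omega> v = 0}"

definition damped_sup :: "nat \<Rightarrow> 'a \<Rightarrow> ennreal" where
  "damped_sup k x = sphere_family.sup_mean (path_law x) damped k"

text \<open>The largest probability of slow growth over all nonzero directions, as
  \<open>zero_prob_le_zero_sup\<close> and \<open>zero_sup_attained\<close> show. Passing through
  \<open>damped_sup\<close> makes it measurable and provides the maximiser.\<close>

definition zero_sup :: "'a \<Rightarrow> ennreal" where
  "zero_sup x = (INF k. damped_sup k x)"

lemma damped_sup_eq: "damped_sup k x = (SUP v\<in>sphere_dense. \<integral>\<^sup>+\<omega>. ennreal (damped k \<omega> v) \<partial>path_law x)"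
proof -
  interpret sphere_family "path_law x" damped by (rule sphere_family_damped)
  show ?thesis by (simp add: damped_sup_def sup_mean_def)
qed

lemma measurable_damped_sup [measurable]: "damped_sup k \<in> borel_measurable borel"
proof -
  have "(\<lambda>x. \<integral>\<^sup>+\<omega>. ennreal (damped k \<omega> v) \<partial>path_law x) \<in> borel_measurable borel" for v
    by (rule nn_integral_measurable_subprob_algebra2[OF _ path_law_subprob]) (simp add: damped_def)
  then show ?thesis
    unfolding damped_sup_eq[abs_def] by (intro borel_measurable_SUP sphere_dense(1))
qed

lemma measurable_zero_sup [measurable]: "zero_sup \<in> borel_measurable borel"
  unfolding zero_sup_def[abs_def] by measurable

lemma damped_sup_le_1: "damped_sup k x \<le> 1"
proof -
  interpret sphere_family "path_law x" damped by (rule sphere_family_damped)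
  show ?thesis
    unfolding damped_sup_eq nn_integral_mean using abs_integral_le(2)[of "\<lambda>\<omega>. damped k \<omega> _" 1] abs_f_le_1 f_meas
    by (intro SUP_least) (simp add: mean_def abs_le_iff flip: ennreal_1)
qed

lemma zero_sup_le_1: "zero_sup x \<le> 1"
  unfolding zero_sup_def using damped_sup_le_1 by (rule INF_lower2[OF UNIV_I])

lemma zero_prob_scaleR: "c \<noteq> 0 \<Longrightarrow> zero_prob x (c *\<^sub>R v) = zero_prob x v"
  by (simp add: zero_prob_def residual_zero_scaleR)

lemma zero_prob_eq_INF: "zero_prob x v = (INF k. \<integral>\<^sup>+\<omega>. ennreal (damped k \<omega> v) \<partial>path_law x)"
proof -
  interpret sphere_family "path_law x" damped by (rule sphere_family_damped)
  have pw: "(INF k. ennreal (damped k \<omega> v)) = indicator {\<omega>. residual \<omega> v = 0} \<omega>" for \<omega>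
  proof (cases "residual \<omega> v = 0")
    case True then show ?thesis by (simp add: damped_def)
  next
    case False
    then have "0 < residual \<omega> v" using residual_bounds(1)[of \<omega> v] by simp
    then obtain k where "1 \<le> real k * residual \<omega> v"
      using reals_Archimedean3[of "residual \<omega> v"] by (metis less_imp_le)
    then have "ennreal (damped k \<omega> v) = 0" by (simp add: damped_def)
    then have "(INF k. ennreal (damped k \<omega> v)) \<le> 0" by (metis INF_lower UNIV_I)
    then show ?thesis using False by simp
  qed
  have "zero_prob x v = (\<integral>\<^sup>+\<omega>. indicator {\<omega>. residual \<omega> v = 0} \<omega> \<partial>path_law x)"
    by (simp add: zero_prob_def)
  also have "\<dots> = (\<integral>\<^sup>+\<omega>. (INF k. ennreal (damped k \<omega> v)) \<partial>path_law x)"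
    by (simp only: pw)
  also have "\<dots> = (INF k. \<integral>\<^sup>+\<omega>. ennreal (damped k \<omega> v) \<partial>path_law x)"
  proof (rule nn_integral_monotone_convergence_INF_decseq[where i=0])
    show "decseq (\<lambda>k \<omega>. ennreal (damped k \<omega> v))" by (intro antimonoI le_funI ennreal_leI f_dec)
  qed (simp_all add: nn_integral_mean)
  finally show ?thesis .
qed

lemma zero_prob_le_zero_sup:
  assumes "v \<noteq> 0"
  shows "zero_prob x v \<le> zero_sup x"
proof -
  interpret sphere_family "path_law x" damped by (rule sphere_family_damped)
  let ?u = "(1 / norm v) *\<^sub>R v"
  have "?u \<in> sphere 0 1" using assms by simp
  then have "(INF k. \<integral>\<^sup>+\<omega>. ennreal (damped k \<omega> ?u) \<partial>path_law x) \<le> zero_sup x"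
    unfolding zero_sup_def damped_sup_def by (intro INF_mono) (use le_sup_mean in blast)
  then show ?thesis
    using assms zero_prob_scaleR[of "1 / norm v" x v] by (simp add: zero_prob_eq_INF)
qed

lemma zero_sup_attained:
  obtains v where "v \<noteq> 0" "zero_sup x \<le> zero_prob x v"
proof -
  interpret sphere_family "path_law x" damped by (rule sphere_family_damped)
  obtain v where v: "v \<in> sphere 0 1" "\<And>k. (INF k. sup_mean k) \<le> (\<integral>\<^sup>+\<omega>. ennreal (damped k \<omega> v) \<partial>path_law x)"
    using inf_sup_mean_attained by blast
  have "zero_sup x \<le> zero_prob x v"
    unfolding zero_prob_eq_INF zero_sup_def damped_sup_def by (intro INF_greatest v)
  moreover have "v \<noteq> 0" using v(1) by auto
  ultimately show ?thesis using that by blast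
qed

text \<open>After one step the direction \<open>v\<close> becomes the normalised image
  \<open>?u\<close>. The residual changes by a factor of at most \<open>exp b\<close> under the
  shift and by another under normalisation; lowering the steepness from \<open>d * k\<close> to
  \<open>k\<close> absorbs the product.\<close>

lemma damped_sup_step:
  assumes d: "exp (2 * b) \<le> real d"
  shows "damped_sup (d * k) x \<le> (\<integral>\<^sup>+y. damped_sup k y \<partial>K x)"
  unfolding damped_sup_eq[of "d * k"]
proof (rule SUP_least)
  fix v :: "real^'m" assume "v \<in> sphere_dense"
  then have v: "norm v = 1" using sphere_dense(2) by auto
  have "(\<integral>\<^sup>+\<omega>. ennreal (damped (d * k) \<omega> v) \<partial>path_law x)
      = (\<integral>\<^sup>+y. \<integral>\<^sup>+\<omega>. ennreal (damped (d * k) (case_nat x \<omega>) v) \<partial>path_law y \<partial>K x)"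
    by (rule nn_integral_path_law_unfold) (simp add: damped_def)
  also have "\<dots> \<le> (\<integral>\<^sup>+y. damped_sup k y \<partial>K x)"
  proof (rule nn_integral_mono)
    fix y
    interpret sphere_family "path_law y" damped by (rule sphere_family_damped)
    let ?w = "A (x, y) *v v"
    let ?u = "(1 / norm ?w) *\<^sub>R ?w"
    have w: "1 \<le> exp b * norm ?w" using norm_le_norm_A[of v "(x, y)"] v by simp
    then have w0: "0 < norm ?w" by (metis exp_gt_zero mult_zero_right not_one_le_zero zero_less_norm_iff norm_zero)
    have "AE \<omega> in path_law y. ennreal (damped (d * k) (case_nat x \<omega>) v) \<le> ennreal (damped k \<omega> ?u)"
      using AE_path_law_0
    proof eventually_elim
      case (elim \<omega>)
      have "path_shift 1 (case_nat x \<omega>) = \<omega>" using path_shift_case_nat[of 0 x \<omega>] by simp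
      then have 1: "residual \<omega> ?w \<le> exp b * residual (case_nat x \<omega>) v"
        using residual_shift_le[of "case_nat x \<omega>" v] elim by simp
      have "residual \<omega> ?u \<le> \<bar>1 / norm ?w\<bar> * residual \<omega> ?w" by (rule residual_scaleR_le)
      also have "\<dots> \<le> exp b * residual \<omega> ?w"
        using w w0 residual_bounds(1) by (intro mult_right_mono) (simp_all add: field_simps)
      also have "\<dots> \<le> exp b * (exp b * residual (case_nat x \<omega>) v)"
        by (intro mult_left_mono 1) simp
      also have "\<dots> = exp (2 * b) * residual (case_nat x \<omega>) v"
        by (simp add: mult_exp_exp flip: mult.assoc)
      also have "\<dots> \<le> real d * residual (case_nat x \<omega>) v"
        by (intro mult_right_mono d residual_bounds)
      finally have "real k * residual \<omega> ?u \<le> real k * (real d * residual (case_nat x \<omega>) v)"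
        by (intro mult_left_mono) auto
      then have "real k * residual \<omega> ?u \<le> real (d * k) * residual (case_nat x \<omega>) v"
        by (simp add: mult.assoc mult.left_commute)
      then show ?case unfolding damped_def by (intro ennreal_leI) linarith
    qed
    then have "(\<integral>\<^sup>+\<omega>. ennreal (damped (d * k) (case_nat x \<omega>) v) \<partial>path_law y) \<le> (\<integral>\<^sup>+\<omega>. ennreal (damped k \<omega> ?u) \<partial>path_law y)"
      by (rule nn_integral_mono_AE)
    also have "\<dots> \<le> damped_sup k y"
      unfolding damped_sup_def using w0 by (intro le_sup_mean) simp
    finally show "(\<integral>\<^sup>+\<omega>. ennreal (damped (d * k) (case_nat x \<omega>) v) \<partial>path_law y) \<le> damped_sup k y" .
  qed
  finally show "(\<integral>\<^sup>+\<omega>. ennreal (damped (d * k) \<omega> v) \<partial>path_law x) \<le> (\<integral>\<^sup>+y. damped_sup k y \<partial>K x)" .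
qed

lemma damped_sup_dec: "k \<le> l \<Longrightarrow> damped_sup l x \<le> damped_sup k x"
proof -
  interpret sphere_family "path_law x" damped by (rule sphere_family_damped)
  show "k \<le> l \<Longrightarrow> damped_sup l x \<le> damped_sup k x"
    unfolding damped_sup_eq by (intro SUP_mono') (auto intro!: nn_integral_mono ennreal_leI f_dec)
qed

text \<open>The factor \<open>d\<close> lost in \<open>damped_sup_step\<close> disappears in the
  infimum over \<open>k\<close>, which monotone convergence moves inside the integral.\<close>

lemma zero_sup_subharmonic: "zero_sup x \<le> (\<integral>\<^sup>+y. zero_sup y \<partial>K x)"
proof -
  obtain d :: nat where d: "exp (2 * b) \<le> real d" using real_arch_simple by blast
  have "(\<integral>\<^sup>+y. zero_sup y \<partial>K x) = (INF k. \<integral>\<^sup>+y. damped_sup k y \<partial>K x)"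
    unfolding zero_sup_def
  proof (rule nn_integral_monotone_convergence_INF_decseq[where i=0])
    show "decseq damped_sup" by (intro antimonoI le_funI damped_sup_dec)
    have "(\<integral>\<^sup>+y. damped_sup 0 y \<partial>K x) \<le> (\<integral>\<^sup>+y. 1 \<partial>K x)"
      by (rule nn_integral_mono) (rule damped_sup_le_1)
    also have "\<dots> < \<infinity>"
      using prob_space.emeasure_space_1[OF prob_space_K[of x]] by simp
    finally show "(\<integral>\<^sup>+y. damped_sup 0 y \<partial>K x) < \<infinity>" .
  qed simp
  moreover have "zero_sup x \<le> (\<integral>\<^sup>+y. damped_sup k y \<partial>K x)" for k
    using INF_lower[of "d * k" UNIV "\<lambda>k. damped_sup k x"] damped_sup_step[OF d, of k x]
    unfolding zero_sup_def by (rule order_trans[OF _ _]) simp_all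
  ultimately show ?thesis by (simp add: INF_greatest)
qed

definition zero_level :: ennreal where
  "zero_level = (\<integral>\<^sup>+x. zero_sup x \<partial>\<mu>)"

lemma zero_sup_le_level: "zero_sup x \<le> zero_level"
  unfolding zero_level_def by (rule subharmonic_le_mean) (auto intro: zero_sup_le_1 zero_sup_subharmonic)

lemma zero_level_le_1: "zero_level \<le> 1"
proof -
  have "zero_level \<le> (\<integral>\<^sup>+x. 1 \<partial>\<mu>)"
    unfolding zero_level_def by (rule nn_integral_mono) (rule zero_sup_le_1)
  then show ?thesis using prob_space.emeasure_space_1[OF prob_space_\<mu>] by simp
qed

text \<open>A bounded function that nowhere exceeds its mean can differ from it only on a null
  set.\<close>

lemma AE_zero_sup_eq: "AE x in \<mu>. zero_sup x = zero_level"
proof (rule AE_eq_of_nn_integral_eq[OF prob_space_\<mu>])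
  show "AE x in \<mu>. zero_sup x \<le> zero_level" by (intro AE_I2 zero_sup_le_level)
  show "zero_level \<noteq> top" using zero_level_le_1 by (auto simp: top_unique)
qed (simp_all add: zero_level_def)

lemma emeasure_comb_seq_residual:
  "emeasure (path_law (\<omega> n)) (comb_seq n \<omega> -` {\<omega>. residual \<omega> v = 0}) = zero_prob (\<omega> n) (path_iterate A n \<omega> *v v)"
  unfolding zero_prob_def
proof (rule emeasure_eq_AE)
  show "AE \<omega>' in path_law (\<omega> n). \<omega>' \<in> comb_seq n \<omega> -` {\<omega>. residual \<omega> v = 0}
      \<longleftrightarrow> \<omega>' \<in> {\<omega>'. residual \<omega>' (path_iterate A n \<omega> *v v) = 0}"
    using AE_path_law_0
  proof eventually_elim
    case (elim \<omega>')
    have "path_iterate A n (comb_seq n \<omega> \<omega>') = path_iterate A n \<omega>"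
      by (rule path_iterate_cong) (use elim in \<open>auto simp: comb_seq_def\<close>)
    then show ?case
      using residual_zero_shift[of n "comb_seq n \<omega> \<omega>'" v] by simp
  qed
  show "comb_seq n \<omega> -` {\<omega>. residual \<omega> v = 0} \<in> sets (path_law (\<omega> n))"
    using measurable_sets[of "comb_seq n \<omega>" path_space path_space "{\<omega>. residual \<omega> v = 0}"] by simp
qed simp

text \<open>
  If \<open>(x, v)\<close> maximises the probability that \<open>v\<close> grows slower than the cocycle, then along almost
  every path \<open>(\<omega> n, A\<^sup>n v)\<close> does so too. Hence the event is independent of the past.
\<close>

lemma zero_level_0_or_1: "zero_level = 0 \<or> zero_level = 1"
proof -
  interpret \<mu>: prob_space \<mu> by (rule prob_space_\<mu>)
  obtain x where x: "zero_sup x = zero_level"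
    using AE_zero_sup_eq \<mu>.AE_contr by (metis (mono_tags, lifting) eventually_mono)
  obtain v where v: "v \<noteq> 0" "zero_sup x \<le> zero_prob x v" by (rule zero_sup_attained)
  then have p: "zero_prob x v = zero_level"
    using zero_prob_le_zero_sup[OF v(1), of x] x by simp
  \<comment> \<open>By the Markov property the conditional probabilities average to
    \<open>zero_prob x v = zero_level\<close>, while none exceeds \<open>zero_level\<close>; so they
    equal it almost surely.\<close>
  have "AE \<omega> in path_law x. emeasure (path_law (\<omega> n)) (comb_seq n \<omega> -` {\<omega>. residual \<omega> v = 0}) = zero_level" for n
  proof (rule AE_eq_of_nn_integral_eq[OF prob_space_path_law])
    have pre: "comb_seq n \<omega> -` {\<omega>. residual \<omega> v = 0} \<in> sets path_space" for n \<omega>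
      using measurable_sets[of "comb_seq n \<omega>" path_space path_space "{\<omega>. residual \<omega> v = 0}"] by simp
    have eq: "emeasure (path_law (\<omega> n)) (comb_seq n \<omega> -` {\<omega>. residual \<omega> v = 0})
        = (\<integral>\<^sup>+\<omega>'. indicator {\<omega>. residual \<omega> v = 0} (comb_seq n \<omega> \<omega>') \<partial>path_law (\<omega> n))" for \<omega>
    proof -
      have "(\<integral>\<^sup>+\<omega>'. indicator {\<omega>. residual \<omega> v = 0} (comb_seq n \<omega> \<omega>') \<partial>path_law (\<omega> n))
        = (\<integral>\<^sup>+\<omega>'. indicator (comb_seq n \<omega> -` {\<omega>. residual \<omega> v = 0}) \<omega>' \<partial>path_law (\<omega> n))"
        by (intro nn_integral_cong) (simp add: indicator_def)
      then show ?thesis using pre by simp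
    qed
    show "(\<lambda>\<omega>. emeasure (path_law (\<omega> n)) (comb_seq n \<omega> -` {\<omega>. residual \<omega> v = 0})) \<in> borel_measurable (path_law x)"
      unfolding eq measurable_path_law_eq
      by (rule nn_integral_measurable_subprob_algebra2[where N=path_space]) measurable
    show "AE \<omega> in path_law x. emeasure (path_law (\<omega> n)) (comb_seq n \<omega> -` {\<omega>. residual \<omega> v = 0}) \<le> zero_level"
      unfolding emeasure_comb_seq_residual
      by (intro AE_I2 order_trans[OF zero_prob_le_zero_sup[OF iterate_vector_nonzero[OF v(1)]] zero_sup_le_level])
    show "zero_level \<noteq> top" using zero_level_le_1 by (auto simp: top_unique)
    have "zero_level = (\<integral>\<^sup>+\<omega>. indicator {\<omega>. residual \<omega> v = 0} \<omega> \<partial>path_law x)"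
      using p by (simp add: zero_prob_def)
    also have "\<dots> = (\<integral>\<^sup>+\<omega>. \<integral>\<^sup>+\<omega>'. indicator {\<omega>. residual \<omega> v = 0} (comb_seq n \<omega> \<omega>') \<partial>path_law (\<omega> n) \<partial>path_law x)"
      by (rule nn_integral_markov) measurable
    finally show "(\<integral>\<^sup>+\<omega>. emeasure (path_law (\<omega> n)) (comb_seq n \<omega> -` {\<omega>. residual \<omega> v = 0}) \<partial>path_law x) = zero_level"
      unfolding eq ..
  qed
  then show ?thesis
    by (rule zero_one_if_independent_of_past(2)[OF residual_zero_sets])
qed

section \<open>The subspace of slowly growing directions\<close>

definition slow :: "'a \<Rightarrow> (real^'m) set" where
  "slow x = {v. AE \<omega> in path_law x. residual \<omega> v = 0}"

lemma slow_iff: "v \<in> slow x \<longleftrightarrow> zero_prob x v = 1"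
  unfolding slow_def zero_prob_def
  using prob_space.AE_iff_emeasure_eq_1[OF prob_space_path_law, of "\<lambda>\<omega>. residual \<omega> v = 0"] by simp

lemma subspace_slow: "subspace (slow x)"
proof (rule subspaceI)
  have "residual \<omega> 0 = 0" for \<omega> using residual_bounds[of \<omega> 0] by simp
  then show "0 \<in> slow x" by (simp add: slow_def)
  show "v + w \<in> slow x" if "v \<in> slow x" "w \<in> slow x" for v w
    using that unfolding slow_def mem_Collect_eq
  proof eventually_elim
    case (elim \<omega>)
    then show ?case using residual_triangle[of \<omega> v w] residual_bounds(1)[of \<omega> "v + w"] by simp
  qed
  show "c *\<^sub>R v \<in> slow x" if "v \<in> slow x" for c v
    using that unfolding slow_def mem_Collect_eq
  proof eventually_elim
    case (elim \<omega>)
    then show ?case using residual_scaleR_le[of \<omega> c v] residual_bounds(1)[of \<omega> "c *\<^sub>R v"] by simp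
  qed
qed

lemma slow_proper: "slow x \<noteq> UNIV"
proof
  assume "slow x = UNIV"
  then have "AE \<omega> in path_law x. residual \<omega> (axis i 1) = 0" for i by (auto simp: slow_def)
  then have "AE \<omega> in path_law x. \<forall>i. residual \<omega> (axis i 1) = 0" by (subst AE_all_countable) auto
  then have "AE \<omega> in path_law x. False"
    by eventually_elim (use residual_axis_nonzero in auto)
  then show False using prob_space.AE_False[OF prob_space_path_law] by simp
qed

lemma slow_step: "AE y in K x. (*v) (A (x, y)) ` slow x \<subseteq> slow y"
proof -
  \<comment> \<open>The exceptional null set of \<open>y\<close> depends on the vector, so only
    countably many vectors can be treated at once; a finite basis suffices by linearity.\<close>
  obtain B where B: "B \<subseteq> slow x" "finite B" "span B = slow x"
    using subspace_slow[of x] basis_exists[of "slow x"] by (metis finiteI_independent span_subspace)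
  have "AE y in K x. A (x, y) *v v \<in> slow y" if "v \<in> slow x" for v
  proof -
    have "AE y in K x. AE \<omega> in path_law y. residual (case_nat x \<omega>) v = 0"
      using that unfolding slow_def mem_Collect_eq by (subst (asm) AE_path_law_unfold) auto
    then show ?thesis
    proof eventually_elim
      case (elim y)
      show ?case
        unfolding slow_def mem_Collect_eq using elim AE_path_law_0
      proof eventually_elim
        case (elim \<omega>)
        have "path_shift 1 (case_nat x \<omega>) = \<omega>" using path_shift_case_nat[of 0 x \<omega>] by simp
        then show ?case using residual_zero_shift_1[of "case_nat x \<omega>" v] elim by simp
      qed
    qed
  qed
  then have "AE y in K x. \<forall>v\<in>B. A (x, y) *v v \<in> slow y"
    using B by (subst AE_ball_countable) (auto intro: countable_finite)
  then show ?thesis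
  proof eventually_elim
    case (elim y)
    have "(*v) (A (x, y)) ` slow x = span ((*v) (A (x, y)) ` B)"
      unfolding B(3)[symmetric] by (rule linear_span_image[symmetric]) simp
    also have "\<dots> \<subseteq> slow y"
      using elim by (intro span_minimal subspace_slow) auto
    finally show ?case .
  qed
qed

lemma inj_A: "inj ((*v) (A z))"
proof (subst linear_injective_0)
  show "\<forall>v. A z *v v = 0 \<longrightarrow> v = 0" using norm_le_norm_A[of _ z] by (metis mult_zero_right norm_le_zero_iff norm_zero)
qed simp

lemma dim_image_slow: "dim ((*v) (A z) ` slow x) = dim (slow x)"
  by (rule dim_image_eq) (auto intro: inj_on_subset[OF inj_A])

end

section \<open>Measurable subspaces\<close>

lemma closest_point_subspace_eqI:
  fixes V :: "(real^'m) set"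
  assumes V: "subspace V" and p: "p \<in> V" and orth: "\<And>w. w \<in> V \<Longrightarrow> (u - p) \<bullet> w = 0"
  shows "closest_point V u = p"
proof (rule closest_point_unique[symmetric])
  show "convex V" "closed V" using V by (auto simp: subspace_imp_convex closed_subspace)
  show "\<forall>z\<in>V. dist u p \<le> dist u z"
  proof
    fix z assume "z \<in> V"
    then have "(u - p) \<bullet> (p - z) = 0" using V p by (intro orth) (simp add: subspace_diff)
    moreover have "(x + y) \<bullet> (x + y) = x \<bullet> x + 2 * (x \<bullet> y) + y \<bullet> y" for x y :: "real^'m"
      by (simp add: inner_add_left inner_add_right inner_commute)
    from this[of "u - p" "p - z"]
    have "(dist u z)\<^sup>2 = (dist u p)\<^sup>2 + 2 * ((u - p) \<bullet> (p - z)) + (dist p z)\<^sup>2"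
      by (simp add: dist_norm power2_norm_eq_inner)
    ultimately have "(dist u p)\<^sup>2 \<le> (dist u z)\<^sup>2" by simp
    then show "dist u p \<le> dist u z"
      by (rule power2_le_imp_le) simp
  qed
qed (use p in simp)

text \<open>All four facts follow from the expansion in an orthonormal basis of \<open>V\<close>.
  The last one says that the trace of the orthogonal projection is the dimension; it makes
  dimensions measurable.\<close>

lemma
  fixes V :: "(real^'m) set"
  assumes V: "subspace V"
  shows closest_point_add: "closest_point V (u + w) = closest_point V u + closest_point V w"
    and inner_closest_point: "v \<bullet> closest_point V u = closest_point V v \<bullet> closest_point V u"
    and norm_closest_point: "(norm (closest_point V u))\<^sup>2 = (norm u)\<^sup>2 - (dist u (closest_point V u))\<^sup>2"
    and dim_eq_trace: "(\<Sum>i\<in>UNIV. (norm (closest_point V (axis i 1)))\<^sup>2) = real (dim V)"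
proof -
  obtain B where B: "B \<subseteq> V" "pairwise orthogonal B" "\<And>x. x \<in> B \<Longrightarrow> norm x = 1"
      "independent B" "card B = dim V" "span B = V"
    using orthonormal_basis_subspace[OF V] by blast
  have fin: "finite B" using B(4) by (rule independent_imp_finite)
  have on: "c \<bullet> d = (if c = d then 1 else 0)" if "c \<in> B" "d \<in> B" for c d
    using that B(2,3) by (auto simp: pairwise_def orthogonal_def dot_square_norm)
  define p where "p u = (\<Sum>c\<in>B. (c \<bullet> u) *\<^sub>R c)" for u
  have p: "p u \<in> V" for u
    unfolding p_def using B(1) V by (intro subspace_sum subspace_scale) auto
  have orth: "(u - p u) \<bullet> w = 0" if "w \<in> V" for u w
  proof -
    have oc: "(u - p u) \<bullet> c = 0" if "c \<in> B" for c
    proof -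
      have "p u \<bullet> c = (\<Sum>d\<in>B. (d \<bullet> u) * (d \<bullet> c))"
        by (simp only: p_def inner_sum_left inner_scaleR_left)
      also have "\<dots> = (\<Sum>d\<in>B. if d = c then c \<bullet> u else 0)"
        using that by (intro sum.cong refl) (simp only: on, simp)
      also have "\<dots> = c \<bullet> u" using that fin by simp
      finally show ?thesis using inner_diff_left[of u "p u" c] inner_commute[of u c] by linarith
    qed
    have "orthogonal (u - p u) w"
    proof (rule orthogonal_to_span[where S=B])
      show "w \<in> span B" unfolding B(6) by (rule that)
      show "orthogonal (u - p u) c" if "c \<in> B" for c unfolding orthogonal_def by (rule oc[OF that])
    qed
    then show ?thesis by (simp add: orthogonal_def)
  qed
  have cp: "closest_point V u = p u" for u
    by (rule closest_point_subspace_eqI[OF V p orth])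
  have pp: "v \<bullet> p u = p v \<bullet> p u" for v u
    using orth[OF p, of v u] by (simp add: inner_diff_left)
  show "closest_point V (u + w) = closest_point V u + closest_point V w"
    unfolding cp p_def by (simp add: inner_add_right scaleR_add_left sum.distrib)
  show "v \<bullet> closest_point V u = closest_point V v \<bullet> closest_point V u"
    unfolding cp by (rule pp)
  show "(norm (closest_point V u))\<^sup>2 = (norm u)\<^sup>2 - (dist u (closest_point V u))\<^sup>2"
  proof -
    have "(u - p u) \<bullet> (u - p u) = u \<bullet> u - u \<bullet> p u - (p u \<bullet> u - p u \<bullet> p u)"
      by (simp only: inner_diff_left inner_diff_right)
    then show ?thesis
      unfolding cp dist_norm power2_norm_eq_inner using pp[of u u] inner_commute[of "p u" u] by linarith
  qed
  have "(norm (p u))\<^sup>2 = (\<Sum>c\<in>B. (c \<bullet> u)\<^sup>2)" for u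
    unfolding power2_norm_eq_inner pp[symmetric]
    by (simp add: p_def inner_sum_right power2_eq_square inner_commute)
  then have "(\<Sum>i\<in>UNIV. (norm (p (axis i 1)))\<^sup>2) = (\<Sum>i\<in>UNIV. \<Sum>c\<in>B. (c $ i)\<^sup>2)"
    by (simp add: inner_axis)
  also have "\<dots> = (\<Sum>c\<in>B. \<Sum>i\<in>UNIV. (c $ i)\<^sup>2)" by (rule sum.swap)
  also have "\<dots> = (\<Sum>c\<in>B. (norm c)\<^sup>2)" by (simp add: norm_vec_squared)
  also have "\<dots> = real (card B)" by (simp add: B(3))
  finally show "(\<Sum>i\<in>UNIV. (norm (closest_point V (axis i 1)))\<^sup>2) = real (dim V)"
    by (simp add: cp B(5))
qed

text \<open>Distances to the subspace determine the lengths of projections by Pythagoras, and these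
  determine the matrix entries by polarisation. Hence measurable distances are enough.\<close>

lemma measurable_grassmannian:
  fixes V :: "'x \<Rightarrow> (real^'m) set"
  assumes sub: "\<And>x. subspace (V x)"
    and dist [measurable]: "\<And>u. (\<lambda>x. dist u (closest_point (V x) u)) \<in> borel_measurable M"
  shows "V \<in> M \<rightarrow>\<^sub>M grassmannian" and "(\<lambda>x. real (dim (V x))) \<in> borel_measurable M"
proof -
  have nm [measurable]: "(\<lambda>x. (norm (closest_point (V x) u))\<^sup>2) \<in> borel_measurable M" for u
    by (subst norm_closest_point[OF sub]) measurable
  have entry: "proj_matrix (V x) $ i $ j = ((norm (closest_point (V x) (axis i 1 + axis j 1)))\<^sup>2
      - (norm (closest_point (V x) (axis i 1)))\<^sup>2 - (norm (closest_point (V x) (axis j 1)))\<^sup>2) / 2" for x i j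
  proof -
    have "proj_matrix (V x) $ i $ j = axis i 1 \<bullet> closest_point (V x) (axis j 1)"
      by (simp add: proj_matrix_def matrix_def inner_axis')
    also have "\<dots> = closest_point (V x) (axis i 1) \<bullet> closest_point (V x) (axis j 1)"
      by (rule inner_closest_point[OF sub])
    finally show ?thesis
      by (simp add: closest_point_add[OF sub] power2_norm_eq_inner inner_add_left inner_add_right inner_commute)
  qed
  have "(\<lambda>x. proj_matrix (V x)) \<in> borel_measurable M"
  proof (rule borel_measurable_euclidean_space[THEN iffD2], rule ballI)
    fix c :: "real^'m^'m" assume "c \<in> Basis"
    then obtain i j where "c = axis i (axis j 1)" by (auto simp: Basis_vec_def)
    then have "(\<lambda>x. proj_matrix (V x) \<bullet> c) = (\<lambda>x. proj_matrix (V x) $ i $ j)"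
      by (simp add: inner_axis)
    then show "(\<lambda>x. proj_matrix (V x) \<bullet> c) \<in> borel_measurable M"
      unfolding entry by simp
  qed
  then show "V \<in> M \<rightarrow>\<^sub>M grassmannian"
    unfolding grassmannian_def by (intro measurable_vimage_algebra2) (use sub in auto)
  show "(\<lambda>x. real (dim (V x))) \<in> borel_measurable M"
    unfolding dim_eq_trace[OF sub, symmetric] by measurable
qed

definition dense_vectors :: "(real^'m) set" where
  "dense_vectors = (SOME D. countable D \<and> UNIV \<subseteq> closure D)"

lemma dense_vectors: "countable (dense_vectors :: (real^'m) set)" "closure dense_vectors = (UNIV :: (real^'m) set)"
proof -
  have "\<exists>D. countable D \<and> (UNIV :: (real^'m) set) \<subseteq> closure D"
    by (metis separable)
  from someI_ex[OF this] show "countable (dense_vectors :: (real^'m) set)"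
    "closure dense_vectors = (UNIV :: (real^'m) set)"
    unfolding dense_vectors_def by auto
qed

text \<open>For a seminorm with measurable parameters, this makes the distance to its kernel measurable.\<close>

lemma dist_kernel_eq_penalised:
  fixes N :: "real^'m \<Rightarrow> real"
  assumes nonneg: "\<And>v. 0 \<le> N v" and lip: "\<And>v w. \<bar>N v - N w\<bar> \<le> norm (v - w)"
    and sub: "subspace {v. N v = 0}"
  shows "dist u (closest_point {v. N v = 0} u) = (SUP k::nat. INF w\<in>dense_vectors. norm (u - w) + real k * N w)"
    and "bdd_below ((\<lambda>w. norm (u - w) + real k * N w) ` dense_vectors)"
    and "bdd_above (range (\<lambda>k::nat. INF w\<in>dense_vectors. norm (u - w) + real k * N w))"
proof -
  let ?V = "{v. N v = 0}"
  let ?d = "dist u (closest_point ?V u)"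
  let ?g = "\<lambda>k::nat. INF w\<in>dense_vectors. norm (u - w) + real k * N w"
  have V: "closed ?V" "?V \<noteq> {}" using closed_subspace[OF sub] subspace_0[OF sub] by auto
  have ne: "(dense_vectors :: (real^'m) set) \<noteq> {}" using dense_vectors(2) closure_empty UNIV_not_empty by metis
  show bdd: "bdd_below ((\<lambda>w. norm (u - w) + real k * N w) ` dense_vectors)" for k
    by (rule bdd_belowI2[of _ 0]) (simp add: nonneg)
  have upper: "?g k \<le> ?d" for k
  proof (rule field_le_epsilon)
    fix e :: real assume e: "e > 0"
    define p where "p = closest_point ?V u"
    have p: "N p = 0" using closest_point_in_set[OF V, of u] by (simp add: p_def)
    have "p \<in> closure dense_vectors" unfolding dense_vectors(2) by simp
    then obtain w where w: "w \<in> dense_vectors" "dist w p < e / (1 + real k)"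
      using e by (metis closure_approachable divide_pos_pos add_pos_nonneg of_nat_0_le_iff zero_less_one)
    have 1: "norm (u - w) + real k * N w \<le> norm (u - p) + norm (w - p) + real k * norm (w - p)"
    proof -
      have "norm (u - w) \<le> norm (u - p) + norm (w - p)"
        using norm_triangle_ineq4[of "u - p" "w - p"] by simp
      moreover have "N w \<le> norm (w - p)" using lip[of w p] p by simp
      then have "real k * N w \<le> real k * norm (w - p)" by (rule mult_left_mono) simp
      ultimately show ?thesis by simp
    qed
    have 2: "norm (w - p) + real k * norm (w - p) \<le> e"
      using w(2) by (simp add: dist_norm field_simps)
    have "?d = norm (u - p)" by (simp add: p_def dist_norm)
    then have "norm (u - w) + real k * N w \<le> ?d + e" using 1 2 by linarith
    then show "?g k \<le> ?d + e" by (rule cINF_lower2[OF bdd w(1)])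
  qed
  then show bdd': "bdd_above (range ?g)" by (intro bdd_aboveI2)
  show "?d = (SUP k. ?g k)"
  proof (rule antisym)
    show "(SUP k. ?g k) \<le> ?d" by (rule cSUP_least) (auto intro: upper)
    show "?d \<le> (SUP k. ?g k)"
    proof (rule ccontr)
      assume "\<not> ?thesis"
      then obtain r where r: "(SUP k. ?g k) < r" "r < ?d" using dense[of "SUP k. ?g k" ?d] by auto
      \<comment> \<open>If the supremum stayed below \<open>r < ?d\<close>, near minimisers
        \<open>w k\<close> would lie in the ball of radius \<open>r\<close> around \<open>u\<close>
        with \<open>N (w k) \<le> r / k\<close>. A limit point then lies in the kernel, closer to
        \<open>u\<close> than the closest point.\<close>
      have "\<exists>w\<in>dense_vectors. norm (u - w) + real k * N w < r" for k
      proof -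
        have "?g k < r" using cSUP_upper[OF _ bdd', of k] r(1) by simp
        then show ?thesis using cINF_less_iff[OF ne bdd] by blast
      qed
      then obtain w where w: "\<And>k. norm (u - w k) + real k * N (w k) < r" by metis
      have "w k \<in> cball u r" for k
      proof -
        have "0 \<le> real k * N (w k)" using nonneg by simp
        then show ?thesis using w[of k] by (simp add: dist_norm)
      qed
      moreover have "compact (cball u r)" by simp
      ultimately obtain z q where z: "z \<in> cball u r" "strict_mono q" "(w \<circ> q) \<longlonglongrightarrow> z"
        unfolding compact_def by blast
      have "N z = 0"
      proof -
        have "(\<lambda>j. r / real (q j)) \<longlonglongrightarrow> 0"
          using LIMSEQ_subseq_LIMSEQ[OF lim_const_over_n[of r] z(2)] by (simp add: o_def)
        moreover have "(\<lambda>j. norm (z - w (q j))) \<longlonglongrightarrow> 0"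
          using z(3) by (intro tendsto_norm_zero) (auto simp: o_def intro!: tendsto_eq_intros)
        ultimately have lim: "(\<lambda>j. norm (z - w (q j)) + r / real (q j)) \<longlonglongrightarrow> 0 + 0"
          by (intro tendsto_add)
        have "N z \<le> norm (z - w (q j)) + r / real (q j)" if "j \<ge> 1" for j
        proof -
          have "q j \<ge> 1" using that seq_suble[OF z(2), of j] by simp
          moreover have "real (q j) * N (w (q j)) \<le> r" using w[of "q j"] norm_ge_zero[of "u - w (q j)"] by linarith
          ultimately have "N (w (q j)) \<le> r / real (q j)" by (simp add: field_simps)
          then show ?thesis using lip[of z "w (q j)"] by linarith
        qed
        then have "N z \<le> 0 + 0" by (intro LIMSEQ_le_const[OF lim]) blast
        then show ?thesis using nonneg[of z] by simp
      qed
      then have "?d \<le> dist u z" using V by (intro closest_point_le) auto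
      then show False using z(1) r(2) by simp
    qed
  qed
qed

section \<open>The slow subspaces as a measurable invariant section\<close>

context bounded_cocycle
begin

text \<open>A seminorm with kernel \<open>slow x\<close>. Integration turns the almost sure
  condition in \<open>slow\<close> into the vanishing of a quantity that is measurable in
  \<open>x\<close> and Lipschitz in \<open>v\<close>, as \<open>dist_kernel_eq_penalised\<close>
  requires.\<close>

definition mean_residual :: "'a \<Rightarrow> real^'m \<Rightarrow> real" where
  "mean_residual x v = (\<integral>\<omega>. residual \<omega> v \<partial>path_law x)"

lemma integrable_residual: "integrable (path_law x) (\<lambda>\<omega>. residual \<omega> v)"
  using residual_bounds[of _ v]
  by (intro prob_space.abs_integral_le(1)[OF prob_space_path_law, where b="norm v"]) (auto simp: abs_of_nonneg)

lemma mean_residual_nonneg: "0 \<le> mean_residual x v"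
  unfolding mean_residual_def by (rule integral_nonneg_AE) (simp add: residual_bounds)

lemma mean_residual_lipschitz: "\<bar>mean_residual x v - mean_residual x w\<bar> \<le> norm (v - w)"
proof -
  have "mean_residual x v - mean_residual x w = (\<integral>\<omega>. residual \<omega> v - residual \<omega> w \<partial>path_law x)"
    unfolding mean_residual_def by (rule Bochner_Integration.integral_diff[symmetric]) (rule integrable_residual)+
  then show ?thesis
    using prob_space.abs_integral_le(2)[OF prob_space_path_law, of "\<lambda>\<omega>. residual \<omega> v - residual \<omega> w" x "norm (v - w)"]
      residual_lipschitz by simp
qed

lemma slow_eq_kernel: "slow x = {v. mean_residual x v = 0}"
  unfolding slow_def mean_residual_def
  by (subst integral_nonneg_eq_0_iff_AE[OF integrable_residual]) (auto simp: residual_bounds)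

lemma slow_measurable:
  shows "slow \<in> borel \<rightarrow>\<^sub>M grassmannian" and "(\<lambda>x. real (dim (slow x))) \<in> borel_measurable borel"
proof -
  have [measurable]: "(\<lambda>x. mean_residual x v) \<in> borel_measurable borel" for v
    unfolding mean_residual_def
    by (rule integral_measurable_subprob_algebra2[OF _ path_law_subprob]) simp
  note pen = dist_kernel_eq_penalised[OF mean_residual_nonneg mean_residual_lipschitz
      subspace_slow[unfolded slow_eq_kernel]]
  have "(\<lambda>x. dist u (closest_point (slow x) u)) \<in> borel_measurable borel" for u
    unfolding slow_eq_kernel pen(1)
    by (intro borel_measurable_cSUP borel_measurable_cINF)
       (simp_all add: dense_vectors(1) pen(2,3))
  from measurable_grassmannian[OF subspace_slow this]
  show "slow \<in> borel \<rightarrow>\<^sub>M grassmannian" and "(\<lambda>x. real (dim (slow x))) \<in> borel_measurable borel"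
    by auto
qed

text \<open>Along the chain the dimension of \<open>slow\<close> does not decrease, because the
  cocycle maps \<open>slow x\<close> injectively into \<open>slow y\<close>. The indicator of
  maximal dimension is thus subharmonic, so the maximum is taken almost everywhere, and there the
  inclusion is an equality.\<close>

lemma invariant_section_if_zero_level:
  assumes "zero_level = 1"
  shows "slow \<in> borel \<rightarrow>\<^sub>M grassmannian"
    and "AE x in \<mu>. AE y in K x. (*v) (A (x, y)) ` slow x = slow y"
    and "proper_section \<mu> slow"
proof -
  interpret \<mu>: prob_space \<mu> by (rule prob_space_\<mu>)
  show "slow \<in> borel \<rightarrow>\<^sub>M grassmannian" by (rule slow_measurable)
  have le: "dim (slow x) \<le> CARD('m)" for x using dim_subset_UNIV_cart[of "slow x"] by simp
  define d where "d = Max (range (\<lambda>x. dim (slow x)))"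
  have fin: "finite (range (\<lambda>x. dim (slow x)))"
    by (rule finite_subset[of _ "{..CARD('m)}"]) (use le in auto)
  have dmax: "dim (slow x) \<le> d" for x unfolding d_def by (rule Max_ge[OF fin]) simp
  obtain x0 where x0: "dim (slow x0) = d"
    using Max_in[OF fin] unfolding d_def by auto
  define h :: "'a \<Rightarrow> ennreal" where "h x = indicator {x. real d \<le> real (dim (slow x))} x" for x
  have S: "{x. real d \<le> real (dim (slow x))} \<in> sets borel"
    using slow_measurable(2) by measurable
  have [measurable]: "h \<in> borel_measurable borel" unfolding h_def[abs_def] using S by simp
  have mono: "AE y in K x. dim (slow x) \<le> dim (slow y)" for x
    using slow_step
  proof eventually_elim
    case (elim y)
    then show ?case using dim_subset[OF elim] dim_image_slow by simp
  qed
  have "h x0 \<le> (\<integral>\<^sup>+y. h y \<partial>\<mu>)"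
  proof (rule subharmonic_le_mean)
    fix x
    show "h x \<le> 1" by (simp add: h_def indicator_def)
    have "h x = (\<integral>\<^sup>+y. h x \<partial>K x)"
      using prob_space.emeasure_space_1[OF prob_space_K[of x]] by simp
    also have "\<dots> \<le> (\<integral>\<^sup>+y. h y \<partial>K x)"
    proof (rule nn_integral_mono_AE)
      show "AE y in K x. h x \<le> h y"
        using mono by eventually_elim (auto simp: h_def indicator_def)
    qed
    finally show "h x \<le> (\<integral>\<^sup>+y. h y \<partial>K x)" .
  qed simp
  then have "1 \<le> (\<integral>\<^sup>+y. h y \<partial>\<mu>)" using x0 by (simp add: h_def)
  also have "\<dots> = emeasure \<mu> {x. real d \<le> real (dim (slow x))}" unfolding h_def using S by simp
  finally have "emeasure \<mu> {x. real d \<le> real (dim (slow x))} = 1"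
    using \<mu>.measure_le_1 antisym by blast
  then have "\<mu>.prob {x. real d \<le> real (dim (slow x))} = 1" by (simp only: measure_def enn2real_1)
  then have "AE x in \<mu>. x \<in> {x. real d \<le> real (dim (slow x))}"
    using S by (subst \<mu>.AE_in_set_eq_1) simp_all
  then have AEd: "AE x in \<mu>. dim (slow x) = d"
    by eventually_elim (simp add: dmax order_antisym)
  show "AE x in \<mu>. AE y in K x. (*v) (A (x, y)) ` slow x = slow y"
    using AEd
  proof eventually_elim
    case (elim x)
    show ?case
      using slow_step[of x]
    proof eventually_elim
      case (elim y)
      show ?case
      proof (rule subspace_dim_equal)
        show "subspace ((*v) (A (x, y)) ` slow x)"
          by (rule linear_subspace_image) (simp_all add: subspace_slow)
        show "dim (slow y) \<le> dim ((*v) (A (x, y)) ` slow x)"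
          unfolding dim_image_slow using \<open>dim (slow x) = d\<close> dmax by simp
      qed (use elim subspace_slow in auto)
    qed
  qed
  \<comment> \<open>Since the level is 1 and is attained, some nonzero direction at \<open>x\<close>
    is slow with probability one.\<close>
  have "AE x in \<mu>. 0 < dim (slow x)"
    using AE_zero_sup_eq
  proof eventually_elim
    case (elim x)
    obtain v where v: "v \<noteq> 0" "zero_sup x \<le> zero_prob x v" by (rule zero_sup_attained)
    then have "zero_prob x v = 1"
      using elim assms zero_prob_le_zero_sup[OF v(1), of x] by simp
    then have "v \<in> slow x" by (simp add: slow_iff)
    then have "\<not> slow x \<subseteq> {0}" using v(1) by auto
    then show ?case using dim_eq_0[of "slow x"] by auto
  qed
  then have "AE x in \<mu>. 0 < d" using AEd by eventually_elim simp
  then have d0: "0 < d" by simp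
  have "d < CARD('m)"
  proof (rule ccontr)
    assume "\<not> ?thesis"
    then have "dim (slow x0) = DIM(real^'m)" using le[of x0] x0 by simp
    then have "slow x0 = UNIV" using subspace_slow[of x0] by (metis dim_eq_full span_eq_iff)
    then show False using slow_proper by simp
  qed
  then show "proper_section \<mu> slow"
    unfolding proper_section_def using d0 AEd by blast
qed

end

section \<open>Uniform growth of vectors\<close>

context bounded_cocycle
begin

sublocale norm_growth: subadditive_process K \<mu> C \<rho> "growth norm" b
  by (rule norm_growth_process)

text \<open>A continuous version of the indicator that \<open>v\<close> has not reached growth rate
  \<open>t\<close> up to time \<open>k\<close>: a factor is 1 if the length at time \<open>n\<close>
  is at most \<open>exp (n * t)\<close>, and 0 if it is at least twice that.\<close>

definition escape :: "real \<Rightarrow> nat \<Rightarrow> (nat \<Rightarrow> 'a) \<Rightarrow> real^'m \<Rightarrow> real" where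
  "escape t k \<omega> v = (\<Prod>n\<in>{1..k}. max 0 (min 1 (2 - norm (path_iterate A n \<omega> *v v) * exp (- (real n * t)))))"

lemma escape_bounds: "0 \<le> escape t k \<omega> v" "escape t k \<omega> v \<le> 1"
  unfolding escape_def by (auto intro!: prod_nonneg prod_le_1)

lemma escape_measurable [measurable]: "(\<lambda>\<omega>. escape t k \<omega> v) \<in> borel_measurable path_space"
  unfolding escape_def by measurable

lemma escape_dec: "k \<le> l \<Longrightarrow> escape t l \<omega> v \<le> escape t k \<omega> v"
proof (induction l rule: dec_induct)
  case (step l)
  have "escape t (Suc l) \<omega> v = escape t l \<omega> v * max 0 (min 1 (2 - norm (path_iterate A (Suc l) \<omega> *v v) * exp (- (real (Suc l) * t))))"
    unfolding escape_def by (subst prod.nat_ivl_Suc') (simp, rule mult.commute)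
  also have "\<dots> \<le> escape t l \<omega> v"
    by (rule mult_left_le[OF _ escape_bounds(1)]) (rule max.boundedI; simp)
  finally show ?case using step.IH by simp
qed simp

lemma sphere_family_escape: "sphere_family (path_law x) (escape t)"
proof (intro sphere_family.intro sphere_family_axioms.intro)
  show "continuous_on (sphere 0 1) (escape t k \<omega>)" for k \<omega>
    unfolding escape_def by (intro continuous_intros)
qed (auto simp: prob_space_path_law escape_bounds escape_dec)

definition escape_sup :: "real \<Rightarrow> nat \<Rightarrow> 'a \<Rightarrow> ennreal" where
  "escape_sup t k x = sphere_family.sup_mean (path_law x) (escape t) k"

lemma escape_sup_eq: "escape_sup t k x = (SUP v\<in>sphere_dense. \<integral>\<^sup>+\<omega>. ennreal (escape t k \<omega> v) \<partial>path_law x)"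
proof -
  interpret sphere_family "path_law x" "escape t" by (rule sphere_family_escape)
  show ?thesis by (simp add: escape_sup_def sup_mean_def)
qed

lemma measurable_escape_sup [measurable]: "escape_sup t k \<in> borel_measurable borel"
proof -
  have "(\<lambda>x. \<integral>\<^sup>+\<omega>. ennreal (escape t k \<omega> v) \<partial>path_law x) \<in> borel_measurable borel" for v
    by (rule nn_integral_measurable_subprob_algebra2[OF _ path_law_subprob]) simp
  then show ?thesis
    unfolding escape_sup_eq[abs_def] by (intro borel_measurable_SUP sphere_dense(1))
qed

lemma escape_sup_le_1: "escape_sup t k x \<le> 1"
proof -
  have "(\<integral>\<^sup>+\<omega>. ennreal (escape t k \<omega> v) \<partial>path_law x) \<le> 1" for v
  proof -
    have "(\<integral>\<^sup>+\<omega>. ennreal (escape t k \<omega> v) \<partial>path_law x) \<le> (\<integral>\<^sup>+\<omega>. 1 \<partial>path_law x)"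
      by (rule nn_integral_mono) (simp add: escape_bounds ennreal_le_1)
    then show ?thesis using prob_space.emeasure_space_1[OF prob_space_path_law[of x]] by simp
  qed
  then show ?thesis unfolding escape_sup_eq by (intro SUP_least)
qed

lemma escape_sup_dec: "k \<le> l \<Longrightarrow> escape_sup t l x \<le> escape_sup t k x"
  unfolding escape_sup_eq by (intro SUP_mono') (auto intro!: nn_integral_mono ennreal_leI escape_dec)

lemma AE_residual_nonzero:
  assumes zl: "zero_level = 0" and v: "v \<noteq> 0"
  shows "AE \<omega> in path_law x. residual \<omega> v \<noteq> 0"
proof -
  have "zero_prob x v \<le> 0"
    using zero_prob_le_zero_sup[OF v, of x] zero_sup_le_level[of x] zl by simp
  then have "{\<omega>. residual \<omega> v = 0} \<in> null_sets (path_law x)"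
    by (simp add: zero_prob_def null_sets_def)
  then show ?thesis by (rule AE_not_in[THEN AE_mp]) simp
qed

text \<open>A nonzero residual \<open>s\<close> makes the vector longer than \<open>s / 2\<close>
  times the norm of the iterate at arbitrarily late times, and this norm eventually exceeds
  \<open>exp (n * t')\<close>. As \<open>t < t'\<close>, late times absorb the factors
  \<open>s / 2\<close> and 2.\<close>

lemma AE_vector_growth:
  assumes zl: "zero_level = 0" and v: "v \<noteq> 0" and t: "t < norm_growth.rate"
  shows "AE \<omega> in path_law x. \<exists>n\<ge>1. 2 * exp (real n * t) \<le> norm (path_iterate A n \<omega> *v v)"
proof -
  define t' where "t' = (t + norm_growth.rate) / 2"
  have t': "t < t'" "t' < norm_growth.rate" using t by (auto simp: t'_def)
  show ?thesis
    using AE_residual_nonzero[OF zl v, of x] norm_growth.eventually_ge[OF t'(2), of x]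
  proof eventually_elim
    case (elim \<omega>)
    define s where "s = residual \<omega> v"
    have s: "0 < s" using elim residual_bounds(1)[of \<omega> v] by (simp add: s_def)
    obtain n0 where n0: "\<And>n. n \<ge> n0 \<Longrightarrow> real n * t' < growth norm n \<omega>"
      using elim(2) by (auto simp: eventually_at_top_linorder)
    obtain n1 :: nat where "(ln 2 - ln (s / 2)) / (t' - t) \<le> real n1" using real_arch_simple by blast
    then have n1: "ln 2 - ln (s / 2) \<le> real n1 * (t' - t)" using t' by (simp add: field_simps)
    define k where "k = max 1 (max n0 n1)"
    have "s / 2 < tail_sup \<omega> v k" using residual_le_tail_sup[of \<omega> v k] s by (simp add: s_def)
    then have "\<not> (\<forall>n. k \<le> n \<longrightarrow> ratio \<omega> v n \<le> s / 2)"
      using tail_sup_le[of k \<omega> v "s / 2"] by auto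
    then obtain n where n: "k \<le> n" "s / 2 < ratio \<omega> v n" by auto
    have nk: "n \<ge> 1" "n \<ge> n0" "n \<ge> n1" using n(1) by (auto simp: k_def)
    have pos: "0 < norm (path_iterate A n \<omega>)" by (rule norm_iterate_gt_0)
    have "real n * t' < ln (norm (path_iterate A n \<omega>))"
      using n0[OF nk(2)] nk(1) by (simp add: growth_def)
    then have "exp (real n * t') < norm (path_iterate A n \<omega>)"
      using pos by (metis exp_less_mono exp_ln)
    then have "s / 2 * exp (real n * t') \<le> s / 2 * norm (path_iterate A n \<omega>)"
      using s by (intro mult_left_mono) auto
    also have "\<dots> \<le> norm (path_iterate A n \<omega> *v v)"
      using n(2) pos by (simp add: ratio_def field_simps)
    finally have 1: "s / 2 * exp (real n * t') \<le> norm (path_iterate A n \<omega> *v v)" .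
    have "real n1 * (t' - t) \<le> real n * (t' - t)" using nk t' by (intro mult_right_mono) auto
    then have "ln 2 + real n * t \<le> ln (s / 2) + real n * t'" using n1 by (simp add: algebra_simps)
    then have "exp (ln 2 + real n * t) \<le> exp (ln (s / 2) + real n * t')" by simp
    then have "2 * exp (real n * t) \<le> s / 2 * exp (real n * t')"
      using s by (simp add: exp_add)
    then show ?case using 1 nk(1) by (intro exI[of _ n]) auto
  qed
qed

text \<open>By compactness the infimum is bounded by the limit of \<open>escape\<close> along a
  single direction, and this limit is almost surely 0 because that vector reaches the required
  growth.\<close>

lemma INF_escape_sup:
  assumes zl: "zero_level = 0" and t: "t < norm_growth.rate"
  shows "(INF k. escape_sup t k x) = 0"
proof -
  interpret sphere_family "path_law x" "escape t" by (rule sphere_family_escape)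
  obtain v where v: "v \<in> sphere 0 1" "\<And>k. (INF k. sup_mean k) \<le> (\<integral>\<^sup>+\<omega>. ennreal (escape t k \<omega> v) \<partial>path_law x)"
    using inf_sup_mean_attained by blast
  have v0: "v \<noteq> 0" using v(1) by auto
  have "(INF k. escape_sup t k x) \<le> (INF k. \<integral>\<^sup>+\<omega>. ennreal (escape t k \<omega> v) \<partial>path_law x)"
    unfolding escape_sup_def by (intro INF_greatest v)
  also have "\<dots> = (\<integral>\<^sup>+\<omega>. (INF k. ennreal (escape t k \<omega> v)) \<partial>path_law x)"
  proof (rule nn_integral_monotone_convergence_INF_decseq[symmetric, where i=0])
    show "decseq (\<lambda>k \<omega>. ennreal (escape t k \<omega> v))" by (intro antimonoI le_funI ennreal_leI escape_dec)
  qed (simp_all add: nn_integral_mean)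
  also have "\<dots> = (\<integral>\<^sup>+\<omega>. 0 \<partial>path_law x)"
  proof (rule nn_integral_cong_AE)
    show "AE \<omega> in path_law x. (INF k. ennreal (escape t k \<omega> v)) = 0"
      using AE_vector_growth[OF zl v0 t, of x]
    proof eventually_elim
      case (elim \<omega>)
      then obtain n where n: "n \<ge> 1" "2 * exp (real n * t) \<le> norm (path_iterate A n \<omega> *v v)" by blast
      have "2 = 2 * exp (real n * t) * exp (- (real n * t))" by (simp add: exp_minus)
      also have "\<dots> \<le> norm (path_iterate A n \<omega> *v v) * exp (- (real n * t))"
        by (intro mult_right_mono n) simp
      finally have "max 0 (min 1 (2 - norm (path_iterate A n \<omega> *v v) * exp (- (real n * t)))) = 0" by simp
      then have "escape t n \<omega> v = 0"
        unfolding escape_def using n(1) by (intro prod_zero) (auto intro!: bexI[of _ n])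
      then have "(INF k. ennreal (escape t k \<omega> v)) \<le> 0"
        by (intro INF_lower2[of n]) simp_all
      then show ?case by simp
    qed
  qed
  finally show ?thesis by simp
qed

lemma integral_escape_sup_small:
  assumes zl: "zero_level = 0" and t: "t < norm_growth.rate" and e: "0 < (e :: real)"
  obtains k where "(\<integral>\<^sup>+x. escape_sup t k x \<partial>\<mu>) < ennreal e"
proof -
  have "(INF k. \<integral>\<^sup>+x. escape_sup t k x \<partial>\<mu>) = (\<integral>\<^sup>+x. (INF k. escape_sup t k x) \<partial>\<mu>)"
  proof (rule nn_integral_monotone_convergence_INF_decseq[symmetric, where i=0])
    show "decseq (escape_sup t)" by (intro antimonoI le_funI escape_sup_dec)
    have "(\<integral>\<^sup>+x. escape_sup t 0 x \<partial>\<mu>) \<le> (\<integral>\<^sup>+x. 1 \<partial>\<mu>)"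
      by (rule nn_integral_mono) (rule escape_sup_le_1)
    also have "\<dots> < \<infinity>" using prob_space.emeasure_space_1[OF prob_space_\<mu>] by simp
    finally show "(\<integral>\<^sup>+x. escape_sup t 0 x \<partial>\<mu>) < \<infinity>" .
  qed simp
  also have "\<dots> = 0" by (simp add: INF_escape_sup[OF zl t])
  finally have "(INF k. \<integral>\<^sup>+x. escape_sup t k x \<partial>\<mu>) < ennreal e" using e by simp
  then show ?thesis using that by (auto simp: INF_less_iff)
qed

text \<open>Uniform in the starting point and the direction, although \<open>A\<close> is only measurable in the base.\<close>

lemma eventually_vector_growth:
  assumes zl: "zero_level = 0" and s: "s < norm_growth.rate"
  shows "\<forall>\<^sub>F N in sequentially. \<forall>x v. norm v = 1 \<longrightarrow>
    real N * s \<le> (\<integral>\<omega>. ln (norm (path_iterate A N \<omega> *v v)) \<partial>path_law x)"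
proof -
  have bound: "\<bar>ln (norm (path_iterate A n \<omega> *v v)) - ln (norm v)\<bar> \<le> b * real n" if "v \<noteq> 0" for n \<omega> v
  proof -
    have p: "0 < norm (path_iterate A n \<omega> *v v)" "0 < norm v"
      using that iterate_vector_nonzero by auto
    have "ln (norm (path_iterate A n \<omega> *v v)) \<le> ln (exp (b * real n) * norm v)"
      using p norm_iterate_vector_le by (subst ln_le_cancel_iff) auto
    moreover have "ln (norm v) \<le> ln (exp (b * real n) * norm (path_iterate A n \<omega> *v v))"
      using p norm_le_norm_iterate_vector by (subst ln_le_cancel_iff) auto
    ultimately show ?thesis using p by (simp add: ln_mult abs_le_iff)
  qed
  have meas: "(\<lambda>\<omega>. ln (norm (path_iterate A n \<omega> *v v))) \<in> borel_measurable path_space" for n v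
    by measurable
  show ?thesis
  proof (cases "s < - b")
    case True
    have "real N * s \<le> (\<integral>\<omega>. ln (norm (path_iterate A N \<omega> *v v)) \<partial>path_law x)" if "norm v = 1" for N x v
    proof -
      have "\<bar>ln (norm (path_iterate A N \<omega> *v v))\<bar> \<le> b * real N" for \<omega>
      proof -
        have "v \<noteq> 0" using that by auto
        then show ?thesis using bound[of v N \<omega>] that by simp
      qed
      then have "\<bar>\<integral>\<omega>. ln (norm (path_iterate A N \<omega> *v v)) \<partial>path_law x\<bar> \<le> b * real N"
        using meas by (intro prob_space.abs_integral_le(2)[OF prob_space_path_law]) simp_all
      moreover have "real N * s \<le> real N * (- b)" using True by (intro mult_left_mono) auto
      ultimately show ?thesis by (simp add: abs_le_iff mult.commute)
    qed
    then show ?thesis by simp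
  next
    case False
    define t where "t = (s + norm_growth.rate) / 2"
    have t: "s < t" "t < norm_growth.rate" "\<bar>t\<bar> \<le> b"
      using s False norm_growth.rate_bounds by (auto simp: t_def)
    \<comment> \<open>Small enough that bad times, of frequency about \<open>e\<close>, lose at most
      half of the gap \<open>t - s\<close>.\<close>
    define e where "e = (t - s) / (4 * b + 4)"
    have e: "0 < e" "2 * b * e \<le> (t - s) / 2"
      using t b_nonneg by (auto simp: e_def field_simps intro!: mult_nonneg_nonneg)
    obtain k where k: "(\<integral>\<^sup>+x. escape_sup t k x \<partial>\<mu>) < ennreal e"
      by (rule integral_escape_sup_small[OF zl t(2) e(1)])
    define R where "R = C / (1 - \<rho>)"
    have R: "0 \<le> R" using C_pos \<rho>_less_1 by (simp add: R_def)
    have main: "real N * t - 2 * b * (real k + (real N * e + R)) \<le> (\<integral>\<omega>. ln (norm (path_iterate A N \<omega> *v v)) \<partial>path_law x)"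
      if v: "norm v = 1" for N x v
    proof -
      interpret P: prob_space "path_law x" by (rule prob_space_path_law)
      have v0: "v \<noteq> 0" using v by auto
      define w where "w i \<omega> = path_iterate A i \<omega> *v v" for i \<omega>
      have w_add: "w (i + n) \<omega> = path_iterate A n (path_shift i \<omega>) *v w i \<omega>" for i n \<omega>
        by (simp add: w_def path_iterate_add matrix_vector_mul_assoc)
      have w0: "w i \<omega> \<noteq> 0" for i \<omega> unfolding w_def using v0 by (rule iterate_vector_nonzero)
      \<comment> \<open>Times from which the current vector does not grow at rate \<open>t\<close>
        over any window of length at most \<open>k\<close>. They are the bad positions for
        \<open>subadditive_covering\<close>, applied to minus the logarithmic growth.\<close>
      define Bad where "Bad i = {\<omega>. \<forall>n\<in>{1..k}. norm (w (i + n) \<omega>) < exp (real n * t) * norm (w i \<omega>)}" for i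
      have Bad [measurable]: "Bad i \<in> sets path_space" for i
      proof -
        have [measurable]: "w j \<in> borel_measurable path_space" for j unfolding w_def[abs_def] by measurable
        have "{\<omega> \<in> space path_space. \<forall>n\<in>{1..k}. norm (w (i + n) \<omega>) < exp (real n * t) * norm (w i \<omega>)} \<in> sets path_space"
          by measurable
        then show ?thesis by (simp add: Bad_def)
      qed
      have path: "- ln (norm (w N \<omega>)) \<le> real N * (- t) + 2 * b * (real k + (\<Sum>i<N. indicator (Bad i) \<omega>))" for \<omega>
      proof -
        let ?b = "\<lambda>i n. ln (norm (w i \<omega>)) - ln (norm (w (i + n) \<omega>))"
        have "?b 0 N \<le> real N * (- t) + 2 * b * (real k + real (card ({i. \<omega> \<in> Bad i} \<inter> {0..<0+N})))"
        proof (rule subadditive_covering[where b="?b"])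
          fix i n m
          show "?b i (n + m) \<le> ?b i n + ?b (i + n) m" by (simp add: add.assoc)
          show "\<bar>?b i n\<bar> \<le> b * real n"
            using bound[OF w0[of i \<omega>], of n "path_shift i \<omega>"] by (simp add: w_add abs_minus_commute)
          show "\<exists>n\<ge>1. n \<le> k \<and> ?b i n \<le> real n * - t" if "i \<notin> {i. \<omega> \<in> Bad i}"
          proof -
            have "\<exists>n\<in>{1..k}. \<not> norm (w (i + n) \<omega>) < exp (real n * t) * norm (w i \<omega>)"
              using that unfolding Bad_def by blast
            then obtain n where n: "n \<ge> 1" "n \<le> k" "exp (real n * t) * norm (w i \<omega>) \<le> norm (w (i + n) \<omega>)"
              by (metis atLeastAtMost_iff not_less)
            have "ln (exp (real n * t) * norm (w i \<omega>)) \<le> ln (norm (w (i + n) \<omega>))"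
              using n(3) w0 by (subst ln_le_cancel_iff) auto
            then have "?b i n \<le> real n * - t" using w0[of i \<omega>] by (simp add: ln_mult)
            then show ?thesis using n by blast
          qed
        qed (use t in simp)
        moreover have "real (card ({i. \<omega> \<in> Bad i} \<inter> {0..<0+N})) = (\<Sum>i<N. indicator (Bad i) \<omega>)"
          by (simp add: indicator_def sum.If_cases Int_def lessThan_atLeast0 conj_commute)
        moreover have "ln (norm (w 0 \<omega>)) = 0" using v by (simp add: w_def)
        ultimately show ?thesis by simp
      qed
      \<comment> \<open>Given the state at time \<open>i\<close>, the probability is at most
        \<open>escape_sup\<close> whatever the current direction. Mixing replaces the law of that
        state by \<open>\<mu>\<close>, where the mean of \<open>escape_sup\<close> is below
        \<open>e\<close>; the errors \<open>C * \<rho> ^ i\<close> add up to at most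
        \<open>R\<close>.\<close>
      have prob: "P.prob (Bad i) \<le> e + C * \<rho> ^ i" for i
      proof -
        have "emeasure (path_law x) (Bad i) = (\<integral>\<^sup>+\<omega>. indicator (Bad i) \<omega> \<partial>path_law x)" by simp
        also have "\<dots> = (\<integral>\<^sup>+\<omega>. \<integral>\<^sup>+\<omega>'. indicator (Bad i) (comb_seq i \<omega> \<omega>') \<partial>path_law (\<omega> i) \<partial>path_law x)"
          by (rule nn_integral_markov) measurable
        also have "\<dots> \<le> (\<integral>\<^sup>+\<omega>. escape_sup t k (\<omega> i) \<partial>path_law x)"
        proof (rule nn_integral_mono)
          fix \<omega>
          interpret F: sphere_family "path_law (\<omega> i)" "escape t" by (rule sphere_family_escape)
          let ?u = "(1 / norm (w i \<omega>)) *\<^sub>R w i \<omega>"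
          have "AE \<omega>' in path_law (\<omega> i). indicator (Bad i) (comb_seq i \<omega> \<omega>') \<le> ennreal (escape t k \<omega>' ?u)"
            using AE_path_law_0
          proof eventually_elim
            case (elim \<omega>')
            have wi: "w i (comb_seq i \<omega> \<omega>') = w i \<omega>"
            proof -
              have "path_iterate A i (comb_seq i \<omega> \<omega>') = path_iterate A i \<omega>"
                by (rule path_iterate_cong) (use elim in \<open>auto simp: comb_seq_def\<close>)
              then show ?thesis by (simp add: w_def)
            qed
            show ?case
            proof (cases "comb_seq i \<omega> \<omega>' \<in> Bad i")
              case True
              have "max 0 (min 1 (2 - norm (path_iterate A n \<omega>' *v ?u) * exp (- (real n * t)))) = 1" if "n \<in> {1..k}" for n
              proof -
                have "norm (path_iterate A n \<omega>' *v w i \<omega>) < exp (real n * t) * norm (w i \<omega>)"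
                  using True that unfolding Bad_def w_add by (auto simp: wi)
                then have "norm (path_iterate A n \<omega>' *v ?u) < exp (real n * t)"
                  using w0[of i \<omega>] by (simp add: matrix_vector_mult_scaleR field_simps)
                then have "norm (path_iterate A n \<omega>' *v ?u) * exp (- (real n * t)) \<le> exp (real n * t) * exp (- (real n * t))"
                  by (intro mult_right_mono) auto
                then show ?thesis by (simp add: exp_minus)
              qed
              then have "escape t k \<omega>' ?u = 1" unfolding escape_def by (simp only: prod.neutral_const cong: prod.cong)
              then show ?thesis using True by simp
            qed simp
          qed
          then have "(\<integral>\<^sup>+\<omega>'. indicator (Bad i) (comb_seq i \<omega> \<omega>') \<partial>path_law (\<omega> i)) \<le> (\<integral>\<^sup>+\<omega>'. ennreal (escape t k \<omega>' ?u) \<partial>path_law (\<omega> i))"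
            by (rule nn_integral_mono_AE)
          also have "\<dots> \<le> escape_sup t k (\<omega> i)"
            unfolding escape_sup_def using w0[of i \<omega>] by (intro F.le_sup_mean) simp
          finally show "(\<integral>\<^sup>+\<omega>'. indicator (Bad i) (comb_seq i \<omega> \<omega>') \<partial>path_law (\<omega> i)) \<le> escape_sup t k (\<omega> i)" .
        qed
        also have "\<dots> \<le> (\<integral>\<^sup>+y. escape_sup t k y \<partial>\<mu>) + ennreal (C * \<rho> ^ i)"
          by (rule integral_le_coordinate) (auto simp: escape_sup_le_1)
        also have "\<dots> \<le> ennreal e + ennreal (C * \<rho> ^ i)"
          using k by (intro add_right_mono) simp
        also have "\<dots> = ennreal (e + C * \<rho> ^ i)"
          using e C_pos \<rho>_pos by (intro ennreal_plus[symmetric]) auto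
        finally have "ennreal (P.prob (Bad i)) \<le> ennreal (e + C * \<rho> ^ i)"
          by (simp only: P.emeasure_eq_measure)
        moreover have "0 \<le> e + C * \<rho> ^ i" using e C_pos \<rho>_pos by simp
        ultimately show ?thesis by (simp only: ennreal_le_iff)
      qed
      have sum_prob: "(\<Sum>i<N. P.prob (Bad i)) \<le> real N * e + R"
      proof -
        have "(\<Sum>i<N. P.prob (Bad i)) \<le> (\<Sum>i<N. e + C * \<rho> ^ i)" by (rule sum_mono) (rule prob)
        also have "\<dots> = real N * e + C * (\<Sum>i<N. \<rho> ^ i)" by (simp add: sum.distrib sum_distrib_left)
        also have "(\<Sum>i<N. \<rho> ^ i) \<le> 1 / (1 - \<rho>)"
          using \<rho>_pos \<rho>_less_1 by (simp add: sum_gp_strict divide_right_mono)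
        finally show ?thesis using C_pos by (simp add: R_def mult_left_mono)
      qed
      have int: "integrable (path_law x) (\<lambda>\<omega>. ln (norm (w N \<omega>)))"
        unfolding w_def using bound[OF v0] v
        by (intro P.abs_integral_le(1)[where b="b * real N"]) (auto simp: meas)
      have "(\<integral>\<omega>. - ln (norm (w N \<omega>)) \<partial>path_law x)
          \<le> (\<integral>\<omega>. real N * (- t) + 2 * b * (real k + (\<Sum>i<N. indicator (Bad i) \<omega>)) \<partial>path_law x)"
      proof (rule integral_mono)
        show "integrable (path_law x) (\<lambda>\<omega>. - ln (norm (w N \<omega>)))" using int by simp
        have "integrable (path_law x) (\<lambda>\<omega>. indicat_real (Bad i) \<omega>)" for i
          by (rule P.abs_integral_le(1)[where b=1]) auto
        then show "integrable (path_law x) (\<lambda>\<omega>. real N * (- t) + 2 * b * (real k + (\<Sum>i<N. indicator (Bad i) \<omega>)))"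
          by (intro Bochner_Integration.integrable_add integrable_mult_right Bochner_Integration.integrable_sum) auto
      qed (rule path)
      also have "\<dots> = real N * (- t) + 2 * b * (real k + (\<Sum>i<N. P.prob (Bad i)))"
      proof -
        have "integrable (path_law x) (\<lambda>\<omega>. indicat_real (Bad i) \<omega>)" for i
          by (rule P.abs_integral_le(1)[where b=1]) auto
        then show ?thesis using P.prob_space
          by (simp add: Bochner_Integration.integral_sum)
      qed
      also have "\<dots> \<le> real N * (- t) + 2 * b * (real k + (real N * e + R))"
        using sum_prob b_nonneg by (intro add_left_mono mult_left_mono) auto
      finally show ?thesis using int by (simp add: w_def)
    qed
    obtain N0 :: nat where "2 * b * (real k + R) / ((t - s) / 2) \<le> real N0" using real_arch_simple by blast
    then have N0: "2 * b * (real k + R) \<le> real N0 * ((t - s) / 2)" using t by (simp add: field_simps)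
    show ?thesis
      using eventually_ge_at_top[of N0]
    proof eventually_elim
      case (elim N)
      show ?case
      proof (intro allI impI)
        fix x and v :: "real^'m" assume v: "norm v = 1"
        have "real N0 * ((t - s) / 2) \<le> real N * ((t - s) / 2)" using elim t by (intro mult_right_mono) auto
        moreover have "real N * (2 * b * e) \<le> real N * ((t - s) / 2)" using e by (intro mult_left_mono) auto
        moreover have "real N * ((t - s) / 2) + real N * ((t - s) / 2) = real N * t - real N * s" by (simp add: field_simps)
        moreover have "2 * b * (real k + (real N * e + R)) = 2 * b * (real k + R) + real N * (2 * b * e)" by (simp add: algebra_simps)
        ultimately have "real N * s \<le> real N * t - 2 * b * (real k + (real N * e + R))" using N0 by linarith
        then show "real N * s \<le> (\<integral>\<omega>. ln (norm (path_iterate A N \<omega> *v v)) \<partial>path_law x)"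
          using main[OF v, of N x] by linarith
      qed
    qed
  qed
qed

end

section \<open>Contraction on projective space\<close>

text \<open>\<open>sqrt 2\<close> times the sine of the angle between the two lines.\<close>

definition angle :: "real^'m \<Rightarrow> real^'m \<Rightarrow> real" where
  "angle v w = norm (wedge v w) / (norm v * norm w)"

lemma angle_nonneg: "0 \<le> angle v w"
  by (simp add: angle_def)

lemma angle_le_2: "angle v w \<le> 2"
proof (cases "v = 0 \<or> w = 0")
  case False
  then show ?thesis using norm_wedge_le_2[of v w] by (simp add: angle_def divide_le_eq mult.assoc)
qed (auto simp: angle_def)

lemma angle_scaleR: "a \<noteq> 0 \<Longrightarrow> c \<noteq> 0 \<Longrightarrow> angle (a *\<^sub>R v) (c *\<^sub>R w) = angle v w"
  by (simp add: angle_def wedge_scaleR abs_mult)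

lemma exp_le_quadratic:
  fixes y :: real
  assumes "\<bar>y\<bar> \<le> 1"
  shows "exp y \<le> 1 + y + y\<^sup>2"
proof (cases "0 \<le> y")
  case True
  then show ?thesis using exp_bound[of y] assms by simp
next
  case False
  define z where "z = - y"
  have z: "0 < z" "z \<le> 1" using False assms by (auto simp: z_def)
  have "1 \<le> (1 + z) * (1 - z + z\<^sup>2)"
    using z by (simp add: power2_eq_square algebra_simps)
  also have "\<dots> \<le> exp z * (1 - z + z\<^sup>2)"
    using z exp_ge_add_one_self[of z] by (intro mult_right_mono) auto
  finally have "exp (- z) \<le> 1 - z + z\<^sup>2"
    by (simp add: exp_minus field_simps)
  then show ?thesis by (simp add: z_def)
qed

lemma angle_le_powr:
  assumes "0 < \<alpha>" "\<alpha> \<le> 1"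
  shows "angle v w \<le> 2 * angle v w powr \<alpha>" "angle v w powr \<alpha> \<le> 2"
proof -
  define d where "d = angle v w"
  have d: "0 \<le> d" "d \<le> 2" by (simp_all add: d_def angle_nonneg angle_le_2)
  have "d powr \<alpha> \<le> 2 powr \<alpha>" using d assms by (intro powr_mono2) auto
  also have "2 powr \<alpha> \<le> 2 powr 1" using assms by (intro powr_mono) auto
  finally show "angle v w powr \<alpha> \<le> 2" by (simp add: d_def)
  show "angle v w \<le> 2 * angle v w powr \<alpha>"
  proof (cases "d = 0")
    case False
    then have "(d / 2) powr 1 \<le> (d / 2) powr \<alpha>"
      using d assms by (intro powr_mono') auto
    also have "\<dots> \<le> d powr \<alpha>" using d assms by (intro powr_mono2) auto
    finally show ?thesis using d False by (simp add: d_def)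
  qed (simp add: d_def)
qed

context bounded_cocycle
begin

lemma ln_norm_iterate_bound:
  assumes "v \<noteq> 0"
  shows "\<bar>ln (norm (path_iterate A n \<omega> *v v)) - ln (norm v)\<bar> \<le> b * real n"
proof -
  have p: "0 < norm (path_iterate A n \<omega> *v v)" "0 < norm v"
    using assms iterate_vector_nonzero by auto
  have "ln (norm (path_iterate A n \<omega> *v v)) \<le> ln (exp (b * real n) * norm v)"
    using p norm_iterate_vector_le by (subst ln_le_cancel_iff) auto
  moreover have "ln (norm v) \<le> ln (exp (b * real n) * norm (path_iterate A n \<omega> *v v))"
    using p norm_le_norm_iterate_vector by (subst ln_le_cancel_iff) auto
  ultimately show ?thesis using p by (simp add: ln_mult abs_le_iff)
qed

lemma ln_norm_iterate_measurable [measurable]: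
  "(\<lambda>\<omega>. ln (norm (path_iterate A n \<omega> *v v))) \<in> borel_measurable path_space"
  by measurable

lemma ln_norm_iterate_integrable:
  "integrable (path_law x) (\<lambda>\<omega>. ln (norm (path_iterate A n \<omega> *v v)))"
proof (cases "v = 0")
  case False
  have "\<bar>ln (norm (path_iterate A n \<omega> *v v))\<bar> \<le> b * real n + \<bar>ln (norm v)\<bar>" for \<omega>
    using ln_norm_iterate_bound[OF False, of n \<omega>] by linarith
  then show ?thesis by (intro prob_space.abs_integral_le(1)[OF prob_space_path_law]) simp_all
qed simp

text \<open>The integrand bounds the logarithmic change of the angle. Each of its three terms loses
  at most \<open>N * g / 4\<close> against its limiting value, which leaves a drift of at most
  \<open>- N * g / 4\<close>, uniformly in state and directions. An arbitrary \<open>c\<close> is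
  allowed because a perturbation will cost a fixed constant.\<close>

lemma wedge_growth_gap:
  assumes card: "CARD('m) \<ge> 2" and zl: "zero_level = 0"
    and gap: "subadditive_process.rate K \<mu> (growth wedge_norm) < 2 * norm_growth.rate"
  obtains N where "N \<ge> 1" "\<And>x v w. norm v = 1 \<Longrightarrow> norm w = 1 \<Longrightarrow>
    (\<integral>\<omega>. growth wedge_norm N \<omega> - ln (norm (path_iterate A N \<omega> *v v)) - ln (norm (path_iterate A N \<omega> *v w)) \<partial>path_law x) \<le> - c"
proof -
  interpret W: subadditive_process K \<mu> C \<rho> "growth wedge_norm" "2 * b"
    by (rule wedge_growth_process(1)[OF card])
  define g where "g = 2 * norm_growth.rate - W.rate"
  have g: "0 < g" using gap by (simp add: g_def)
  have "\<forall>\<^sub>F N in sequentially. \<forall>x. (\<integral>\<omega>. growth wedge_norm N \<omega> \<partial>path_law x) \<le> real N * (W.rate + g / 4)"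
    by (rule W.eventually_expectation_le) (use g in simp)
  moreover have "\<forall>\<^sub>F N in sequentially. \<forall>x v. norm v = 1 \<longrightarrow>
      real N * (norm_growth.rate - g / 4) \<le> (\<integral>\<omega>. ln (norm (path_iterate A N \<omega> *v v)) \<partial>path_law x)"
    by (rule eventually_vector_growth[OF zl]) (use g in simp)
  moreover have "\<forall>\<^sub>F N in sequentially. N \<ge> 1 \<and> c \<le> real N * (g / 4)"
  proof -
    obtain n0 :: nat where "c / (g / 4) \<le> real n0" using real_arch_simple by blast
    then have n0: "c \<le> real n0 * (g / 4)" using g by (simp add: field_simps)
    have "c \<le> real N * (g / 4)" if "N \<ge> n0" for N
    proof -
      have "real n0 * (g / 4) \<le> real N * (g / 4)" using that g by (intro mult_right_mono) auto
      then show ?thesis using n0 by linarith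
    qed
    then show ?thesis
      by (intro eventually_conj eventually_ge_at_top eventually_mono[OF eventually_ge_at_top[of n0]])
  qed
  ultimately have "\<forall>\<^sub>F N in sequentially. N \<ge> 1 \<and> (\<forall>x v w. norm v = 1 \<longrightarrow> norm w = 1 \<longrightarrow>
    (\<integral>\<omega>. growth wedge_norm N \<omega> - ln (norm (path_iterate A N \<omega> *v v)) - ln (norm (path_iterate A N \<omega> *v w)) \<partial>path_law x) \<le> - c)"
  proof eventually_elim
    case (elim N)
    show ?case
    proof (intro conjI allI impI)
      show "N \<ge> 1" using elim by simp
      fix x and v w :: "real^'m" assume vw: "norm v = 1" "norm w = 1"
      have int: "integrable (path_law x) (growth wedge_norm N)"
        by (rule prob_space.abs_integral_le(1)[OF prob_space_path_law]) (auto intro: W.a_bound)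
      have "(\<integral>\<omega>. growth wedge_norm N \<omega> - ln (norm (path_iterate A N \<omega> *v v)) - ln (norm (path_iterate A N \<omega> *v w)) \<partial>path_law x)
        = (\<integral>\<omega>. growth wedge_norm N \<omega> \<partial>path_law x) - (\<integral>\<omega>. ln (norm (path_iterate A N \<omega> *v v)) \<partial>path_law x)
          - (\<integral>\<omega>. ln (norm (path_iterate A N \<omega> *v w)) \<partial>path_law x)"
        by (simp add: int ln_norm_iterate_integrable)
      also have "\<dots> \<le> real N * (W.rate + g / 4) - real N * (norm_growth.rate - g / 4) - real N * (norm_growth.rate - g / 4)"
      proof -
        have 1: "real N * (norm_growth.rate - g / 4) \<le> (\<integral>\<omega>. ln (norm (path_iterate A N \<omega> *v v)) \<partial>path_law x)"
          "real N * (norm_growth.rate - g / 4) \<le> (\<integral>\<omega>. ln (norm (path_iterate A N \<omega> *v w)) \<partial>path_law x)"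
          using elim(2) vw by blast+
        have 2: "(\<integral>\<omega>. growth wedge_norm N \<omega> \<partial>path_law x) \<le> real N * (W.rate + g / 4)" using elim(1) by blast
        show ?thesis by (intro diff_mono 1 2)
      qed
      also have "\<dots> = - (real N * (g / 4))" by (simp add: g_def algebra_simps)
      also have "\<dots> \<le> - c" using elim(3) by simp
      finally show "(\<integral>\<omega>. growth wedge_norm N \<omega> - ln (norm (path_iterate A N \<omega> *v v)) - ln (norm (path_iterate A N \<omega> *v w)) \<partial>path_law x) \<le> - c" .
    qed
  qed
  then obtain N where "N \<ge> 1 \<and> (\<forall>x v w. norm v = 1 \<longrightarrow> norm w = 1 \<longrightarrow>
    (\<integral>\<omega>. growth wedge_norm N \<omega> - ln (norm (path_iterate A N \<omega> *v v)) - ln (norm (path_iterate A N \<omega> *v w)) \<partial>path_law x) \<le> - c)"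
    using eventually_happens' trivial_limit_sequentially by blast
  then show ?thesis using that by blast
qed

lemma wedge_growth_bound:
  assumes "CARD('m) \<ge> 2"
  shows "\<bar>growth wedge_norm n \<omega>\<bar> \<le> 2 * b * real n" "growth wedge_norm n \<in> borel_measurable path_space"
proof -
  interpret W: subadditive_process K \<mu> C \<rho> "growth wedge_norm" "2 * b"
    by (rule wedge_growth_process(1)[OF assms])
  show "\<bar>growth wedge_norm n \<omega>\<bar> \<le> 2 * b * real n" "growth wedge_norm n \<in> borel_measurable path_space"
    using W.a_bound W.a_measurable by auto
qed

text \<open>The angle is multiplied by at most \<open>exp R\<close>, with \<open>R\<close> bounded
  and of mean at most -1. For small \<alpha>, \<open>exp (\<alpha> * R) \<le> 1 + \<alpha> * R +
  (\<alpha> * R)\<^sup>2\<close>; the conditions on \<alpha> make the quadratic term at most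
  \<open>\<alpha> / 2\<close>, and the linear one contributes at most
  \<open>- \<alpha>\<close>.\<close>

lemma angle_contraction_if_negative_drift:
  assumes card: "CARD('m) \<ge> 2" and N: "N \<ge> 1"
    and drift: "\<And>v w. norm v = 1 \<Longrightarrow> norm w = 1 \<Longrightarrow>
      (\<integral>\<omega>. growth wedge_norm N \<omega> - ln (norm (path_iterate A N \<omega> *v v)) - ln (norm (path_iterate A N \<omega> *v w)) \<partial>path_law x) \<le> - 1"
    and \<alpha>: "0 < \<alpha>" "\<alpha> * (4 * b * real N) \<le> 1" "\<alpha> * (4 * b * real N)\<^sup>2 \<le> 1 / 2"
    and vw: "v \<noteq> 0" "w \<noteq> 0"
  shows "(\<integral>\<omega>. angle (path_iterate A N \<omega> *v v) (path_iterate A N \<omega> *v w) powr \<alpha> \<partial>path_law x)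
     \<le> (1 - \<alpha> / 2) * angle v w powr \<alpha>"
proof -
  interpret P: prob_space "path_law x" by (rule prob_space_path_law)
  define v' w' where "v' = (1 / norm v) *\<^sub>R v" and "w' = (1 / norm w) *\<^sub>R w"
  have u: "norm v' = 1" "norm w' = 1" "v' \<noteq> 0" "w' \<noteq> 0" using vw by (auto simp: v'_def w'_def)
  define R where "R \<omega> = growth wedge_norm N \<omega> - ln (norm (path_iterate A N \<omega> *v v')) - ln (norm (path_iterate A N \<omega> *v w'))" for \<omega>
  note wm [measurable] = wedge_growth_bound(2)[OF card]
  have R_meas [measurable]: "R \<in> borel_measurable path_space" unfolding R_def by measurable
  have R_bound: "\<bar>R \<omega>\<bar> \<le> 4 * b * real N" for \<omega>
    using wedge_growth_bound(1)[OF card, of N \<omega>] ln_norm_iterate_bound[OF u(3), of N \<omega>] ln_norm_iterate_bound[OF u(4), of N \<omega>] u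
    unfolding R_def by simp
  have R_int: "integrable (path_law x) R"
    by (rule P.abs_integral_le(1)[where b="4 * b * real N"]) (auto intro: R_bound)
  have pt: "angle (path_iterate A N \<omega> *v v) (path_iterate A N \<omega> *v w) powr \<alpha> \<le> (1 + \<alpha> * R \<omega> + 1 / 2 * \<alpha>) * angle v w powr \<alpha>" for \<omega>
  proof -
    let ?g = "path_iterate A N \<omega>"
    have pos: "0 < norm (?g *v v')" "0 < norm (?g *v w')" "0 < wedge_norm ?g"
      using iterate_vector_nonzero[OF u(3)] iterate_vector_nonzero[OF u(4)] wedge_growth_process(2)[OF card N] by auto
    have "angle (?g *v v) (?g *v w) = angle (?g *v v') (?g *v w')"
      using vw by (simp add: v'_def w'_def matrix_vector_mult_scaleR angle_scaleR)
    also have "\<dots> \<le> wedge_norm ?g * norm (wedge v' w') / (norm (?g *v v') * norm (?g *v w'))"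
      unfolding angle_def by (intro divide_right_mono norm_wedge_le) simp
    also have "\<dots> = exp (R \<omega>) * angle v' w'"
      using pos N u by (simp add: R_def growth_def exp_diff angle_def)
    also have "angle v' w' = angle v w" using vw by (simp add: v'_def w'_def angle_scaleR)
    finally have "angle (?g *v v) (?g *v w) powr \<alpha> \<le> (exp (R \<omega>) * angle v w) powr \<alpha>"
      using \<alpha> by (intro powr_mono2) (auto simp: angle_nonneg)
    also have "\<dots> = exp (\<alpha> * R \<omega>) * angle v w powr \<alpha>"
      by (simp add: powr_mult angle_nonneg exp_powr_real mult.commute)
    also have "\<dots> \<le> (1 + \<alpha> * R \<omega> + 1 / 2 * \<alpha>) * angle v w powr \<alpha>"
    proof (intro mult_right_mono)
      have "\<bar>\<alpha> * R \<omega>\<bar> \<le> \<alpha> * (4 * b * real N)"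
        using R_bound[of \<omega>] \<alpha>(1) by (simp add: abs_mult)
      then have "exp (\<alpha> * R \<omega>) \<le> 1 + \<alpha> * R \<omega> + (\<alpha> * R \<omega>)\<^sup>2"
        using \<alpha>(2) by (intro exp_le_quadratic) linarith
      moreover have "(\<alpha> * R \<omega>)\<^sup>2 \<le> \<alpha> * (1 / 2)"
      proof -
        have "(R \<omega>)\<^sup>2 \<le> (4 * b * real N)\<^sup>2"
          using R_bound[of \<omega>] power_mono[of "\<bar>R \<omega>\<bar>" "4 * b * real N" 2] by simp
        then have "\<alpha> * (R \<omega>)\<^sup>2 \<le> \<alpha> * (4 * b * real N)\<^sup>2" using \<alpha>(1) by (intro mult_left_mono) auto
        then have "\<alpha> * (R \<omega>)\<^sup>2 \<le> 1 / 2" using \<alpha>(3) by (rule order_trans)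
        then have "\<alpha> * (\<alpha> * (R \<omega>)\<^sup>2) \<le> \<alpha> * (1 / 2)" by (rule mult_left_mono) (use \<alpha> in simp)
        then show ?thesis by (simp add: power2_eq_square algebra_simps)
      qed
      ultimately show "exp (\<alpha> * R \<omega>) \<le> 1 + \<alpha> * R \<omega> + 1 / 2 * \<alpha>" by simp
    qed simp
    finally show ?thesis .
  qed
  have "(\<integral>\<omega>. angle (path_iterate A N \<omega> *v v) (path_iterate A N \<omega> *v w) powr \<alpha> \<partial>path_law x)
    \<le> (\<integral>\<omega>. (1 + \<alpha> * R \<omega> + 1 / 2 * \<alpha>) * angle v w powr \<alpha> \<partial>path_law x)"
  proof (rule integral_mono_AE')
    show "integrable (path_law x) (\<lambda>\<omega>. (1 + \<alpha> * R \<omega> + 1 / 2 * \<alpha>) * angle v w powr \<alpha>)"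
      using R_int by simp
    show "AE \<omega> in path_law x. angle (path_iterate A N \<omega> *v v) (path_iterate A N \<omega> *v w) powr \<alpha>
        \<le> (1 + \<alpha> * R \<omega> + 1 / 2 * \<alpha>) * angle v w powr \<alpha>"
      by (intro AE_I2 pt)
    show "AE \<omega> in path_law x. 0 \<le> (1 + \<alpha> * R \<omega> + 1 / 2 * \<alpha>) * angle v w powr \<alpha>"
      by (intro AE_I2 order_trans[OF _ pt]) simp
  qed
  also have "\<dots> = (1 + \<alpha> * (\<integral>\<omega>. R \<omega> \<partial>path_law x) + 1 / 2 * \<alpha>) * angle v w powr \<alpha>"
    using R_int P.prob_space by simp
  also have "\<dots> \<le> (1 - \<alpha> / 2) * angle v w powr \<alpha>"
  proof (intro mult_right_mono)
    have "(\<integral>\<omega>. R \<omega> \<partial>path_law x) \<le> - 1" unfolding R_def by (rule drift[OF u(1,2)])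
    then have "\<alpha> * (\<integral>\<omega>. R \<omega> \<partial>path_law x) \<le> \<alpha> * (- 1)" using \<alpha>(1) by (intro mult_left_mono) auto
    then show "1 + \<alpha> * (\<integral>\<omega>. R \<omega> \<partial>path_law x) + 1 / 2 * \<alpha> \<le> 1 - \<alpha> / 2" by simp
  qed simp
  finally show ?thesis .
qed

end

section \<open>Stability of the contraction under perturbation\<close>

locale two_cocycles = A: bounded_cocycle K \<mu> C \<rho> A b + B: bounded_cocycle K \<mu> C \<rho> B b
  for K :: "'a::polish_space \<Rightarrow> 'a measure" and \<mu> C \<rho> and A B :: "'a \<times> 'a \<Rightarrow> real^'m^'m" and b +
  fixes \<delta> :: real
  assumes close: "\<And>z. norm (B z - A z) \<le> \<delta>"
begin

lemma iterate_close: "norm (path_iterate B n \<omega> *v v - path_iterate A n \<omega> *v v) \<le> real n * exp (b * real n) * \<delta> * norm v"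
proof (induction n)
  case (Suc n)
  let ?z = "(\<omega> n, \<omega> (Suc n))"
  have \<delta>: "0 \<le> \<delta>" using order_trans[OF norm_ge_zero close] .
  have "path_iterate B (Suc n) \<omega> *v v - path_iterate A (Suc n) \<omega> *v v
    = (B ?z - A ?z) *v (path_iterate B n \<omega> *v v) + A ?z *v (path_iterate B n \<omega> *v v - path_iterate A n \<omega> *v v)"
    by (simp add: matrix_vector_mult_diff_distrib matrix_vector_mult_diff_rdistrib flip: matrix_vector_mul_assoc)
  then have "norm (path_iterate B (Suc n) \<omega> *v v - path_iterate A (Suc n) \<omega> *v v)
    \<le> norm ((B ?z - A ?z) *v (path_iterate B n \<omega> *v v)) + norm (A ?z *v (path_iterate B n \<omega> *v v - path_iterate A n \<omega> *v v))"
    by (metis norm_triangle_ineq)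
  also have "\<dots> \<le> \<delta> * (exp (b * real n) * norm v) + exp b * (real n * exp (b * real n) * \<delta> * norm v)"
  proof (intro add_mono)
    have "norm ((B ?z - A ?z) *v (path_iterate B n \<omega> *v v)) \<le> norm (B ?z - A ?z) * norm (path_iterate B n \<omega> *v v)"
      by (rule norm_matrix_vector_mult_le)
    also have "\<dots> \<le> \<delta> * (exp (b * real n) * norm v)"
      using close B.norm_iterate_vector_le \<delta> by (intro mult_mono) auto
    finally show "norm ((B ?z - A ?z) *v (path_iterate B n \<omega> *v v)) \<le> \<delta> * (exp (b * real n) * norm v)" .
    have "norm (A ?z *v (path_iterate B n \<omega> *v v - path_iterate A n \<omega> *v v)) \<le> exp b * norm (path_iterate B n \<omega> *v v - path_iterate A n \<omega> *v v)"
      by (rule A.norm_A_le)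
    also have "\<dots> \<le> exp b * (real n * exp (b * real n) * \<delta> * norm v)"
      using Suc by (intro mult_left_mono) auto
    finally show "norm (A ?z *v (path_iterate B n \<omega> *v v - path_iterate A n \<omega> *v v)) \<le> exp b * (real n * exp (b * real n) * \<delta> * norm v)" .
  qed
  also have "\<dots> \<le> exp (b * real (Suc n)) * \<delta> * norm v + real n * exp (b * real (Suc n)) * \<delta> * norm v"
  proof -
    have "b * real n \<le> b * real (Suc n)" using A.b_nonneg by (intro mult_left_mono) auto
    then have "exp (b * real n) \<le> exp (b * real (Suc n))" by simp
    then have "exp (b * real n) * (\<delta> * norm v) \<le> exp (b * real (Suc n)) * (\<delta> * norm v)"
      using \<delta> by (intro mult_right_mono) auto
    moreover have "exp (b * real (Suc n)) = exp b * exp (b * real n)" by (simp add: distrib_left exp_add)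
    ultimately show ?thesis by (simp add: algebra_simps)
  qed
  also have "\<dots> = real (Suc n) * exp (b * real (Suc n)) * \<delta> * norm v" by (simp add: algebra_simps)
  finally show ?case .
qed simp

text \<open>The loss is independent of \<open>n\<close>, at the price of a smallness condition that
  depends on \<open>n\<close>. That condition bounds lengths under \<open>A\<close> by twice those
  under \<open>B\<close>, and it makes the iterate of \<open>B\<close> that of \<open>A\<close>
  times a matrix \<open>u\<close> of norm at most \<open>norm (mat 1) + 1\<close>.\<close>

lemma drift_close:
  assumes card: "CARD('m) \<ge> 2" and n: "n \<ge> 1"
    and small: "real CARD('m) * (real n * exp (b * real n) * \<delta>) * exp (b * real n) \<le> 1"
    and v: "v \<noteq> 0" and w: "w \<noteq> 0"
  shows "B.growth wedge_norm n \<omega> - ln (norm (path_iterate B n \<omega> *v v)) - ln (norm (path_iterate B n \<omega> *v w))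
    \<le> A.growth wedge_norm n \<omega> - ln (norm (path_iterate A n \<omega> *v v)) - ln (norm (path_iterate A n \<omega> *v w))
      + (2 * ln (norm (mat 1 :: real^'m^'m) + 1) + 2 * ln 2)"
proof -
  let ?g = "path_iterate A n \<omega>" and ?h = "path_iterate B n \<omega>"
  let ?\<eta> = "real n * exp (b * real n) * \<delta>"
  have \<delta>: "0 \<le> \<delta>" using order_trans[OF norm_ge_zero close] .
  have small': "?\<eta> * exp (b * real n) \<le> 1"
  proof -
    have "1 * (?\<eta> * exp (b * real n)) \<le> real CARD('m) * (?\<eta> * exp (b * real n))"
      using card \<delta> by (intro mult_right_mono) auto
    then show ?thesis using small by (simp add: mult.assoc)
  qed
  have vec: "ln (norm (?g *v v)) \<le> ln (norm (?h *v v)) + ln 2" if v: "v \<noteq> 0" for v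
  proof -
    have "norm (?g *v v) \<le> norm (?h *v v) + norm (?h *v v - ?g *v v)"
      using norm_triangle_ineq4[of "?h *v v" "?h *v v - ?g *v v"] by simp
    also have "norm (?h *v v - ?g *v v) \<le> ?\<eta> * norm v" by (rule iterate_close)
    also have "?\<eta> * norm v \<le> ?\<eta> * (exp (b * real n) * norm (?h *v v))"
      using \<delta> by (intro mult_left_mono B.norm_le_norm_iterate_vector) auto
    also have "\<dots> = (?\<eta> * exp (b * real n)) * norm (?h *v v)" by (simp only: mult.assoc)
    also have "\<dots> \<le> 1 * norm (?h *v v)" by (intro mult_right_mono small') simp
    finally have le: "norm (?g *v v) \<le> norm (?h *v v) * 2" by simp
    have pos: "0 < norm (?g *v v)" "0 < norm (?h *v v)"
      using A.iterate_vector_nonzero[OF v] B.iterate_vector_nonzero[OF v] by auto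
    then have "ln (norm (?g *v v)) \<le> ln (norm (?h *v v) * 2)"
      using le by (subst ln_le_cancel_iff) auto
    also have "\<dots> = ln (norm (?h *v v)) + ln 2"
      by (rule ln_mult_pos) (use pos in auto)
    finally show ?thesis .
  qed
  obtain i where i: "i ** ?g = mat 1" "norm i \<le> exp (b * real n)"
    using A.iterate_inverse(2)[OF n] by blast
  then have i': "?g ** i = mat 1" by (simp add: matrix_left_right_inverse)
  have fro: "norm (?h - ?g) \<le> real CARD('m) * ?\<eta>"
  proof -
    let ?M = "?h - ?g"
    have "norm (transpose ?M) \<le> (\<Sum>j\<in>UNIV. norm (transpose ?M $ j))"
      unfolding norm_vec_def by (rule L2_set_le_sum) simp
    moreover have "norm (transpose ?M) = norm ?M"
      by (simp add: norm_vec_def L2_set_def transpose_def sum_nonneg) (rule sum.swap)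
    moreover have "norm (transpose ?M $ j) \<le> ?\<eta>" for j
    proof -
      have "transpose ?M $ j = ?h *v axis j 1 - ?g *v axis j 1"
        by (simp add: matrix_vector_mult_basis column_def transpose_def vec_eq_iff)
      then show ?thesis using iterate_close[of n \<omega> "axis j 1"] by (simp add: norm_axis_1)
    qed
    then have "(\<Sum>j\<in>(UNIV::'m set). norm (transpose ?M $ j)) \<le> (\<Sum>j\<in>(UNIV::'m set). ?\<eta>)"
      by (intro sum_mono) auto
    ultimately show ?thesis by simp
  qed
  define u where "u = i ** ?h"
  have h: "?h = ?g ** u" by (simp add: u_def matrix_mul_assoc i')
  have "i ** (?g + (?h - ?g)) = i ** ?g + i ** (?h - ?g)" by (rule matrix_add_ldistrib)
  then have "u = mat 1 + i ** (?h - ?g)" by (simp add: u_def i)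
  then have "norm u \<le> norm (mat 1 :: real^'m^'m) + norm i * norm (?h - ?g)"
    using norm_triangle_ineq[of "mat 1" "i ** (?h - ?g)"] norm_matrix_mult_le[of i "?h - ?g"] by simp
  also have "norm i * norm (?h - ?g) \<le> exp (b * real n) * (real CARD('m) * ?\<eta>)"
    using i fro by (intro mult_mono) auto
  also have "\<dots> \<le> 1" using small by (simp add: mult.commute)
  finally have u: "norm u \<le> norm (mat 1 :: real^'m^'m) + 1" by simp
  have pos: "0 < wedge_norm ?g" "0 < wedge_norm ?h"
    using A.wedge_growth_process(2)[OF card n] B.wedge_growth_process(2)[OF card n] by auto
  have "wedge_norm ?h \<le> wedge_norm ?g * wedge_norm u" unfolding h by (rule wedge_norm_mult)
  also have "\<dots> \<le> wedge_norm ?g * (norm (mat 1 :: real^'m^'m) + 1)\<^sup>2"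
    using order_trans[OF wedge_norm_le power_mono[OF u norm_ge_zero]] wedge_norm_nonneg[of ?g]
    by (intro mult_left_mono) auto
  finally have "ln (wedge_norm ?h) \<le> ln (wedge_norm ?g * (norm (mat 1 :: real^'m^'m) + 1)\<^sup>2)"
    using pos by (subst ln_le_cancel_iff) (auto simp: add_nonneg_pos)
  also have "\<dots> = ln (wedge_norm ?g) + 2 * ln (norm (mat 1 :: real^'m^'m) + 1)"
    using pos norm_ge_zero[of "mat 1 :: real^'m^'m"] by (simp add: ln_mult ln_realpow add_nonneg_pos add_nonneg_eq_0_iff)
  finally show ?thesis
    using vec[OF v] vec[OF w] n by (simp add: A.growth_def B.growth_def)
qed

end

context bounded_cocycle
begin

lemma uniform_contraction:
  assumes zl: "zero_level = 0"
    and gap: "CARD('m) = 1 \<or> CARD('m) \<ge> 2 \<and> subadditive_process.rate K \<mu> (growth wedge_norm) < 2 * norm_growth.rate"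
  obtains N \<alpha> \<kappa> \<delta> where "1 \<le> N" "0 < \<alpha>" "\<alpha> \<le> 1" "0 \<le> \<kappa>" "\<kappa> < 1" "0 < \<delta>"
    and "\<And>B x v w. bounded_cocycle K \<mu> C \<rho> B b \<Longrightarrow> (\<And>z. norm (B z - A z) \<le> \<delta>) \<Longrightarrow> v \<noteq> 0 \<Longrightarrow> w \<noteq> 0 \<Longrightarrow>
      (\<integral>\<omega>. angle (path_iterate B N \<omega> *v v) (path_iterate B N \<omega> *v w) powr \<alpha> \<partial>path_law x) \<le> \<kappa> * angle v w powr \<alpha>"
proof (cases "CARD('m) = 1")
  \<comment> \<open>In dimension 1 all angles vanish and any constants do.\<close>
  case True
  have "angle v w = 0" for v w :: "real^'m" by (simp add: angle_def wedge_eq_0_card_1[OF True])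
  then show ?thesis by (intro that[of 1 1 "1 / 2" 1]) auto
next
  case False
  then have card: "CARD('m) \<ge> 2" and gap': "subadditive_process.rate K \<mu> (growth wedge_norm) < 2 * norm_growth.rate"
    using gap by auto
  \<comment> \<open>The loss in \<open>drift_close\<close>. The drift of \<open>A\<close> at time
    \<open>N\<close> is taken below \<open>- (c + 1)\<close>, so that every nearby cocycle still has
    drift at most -1; only afterwards is \<delta> fixed in terms of \<open>N\<close>.\<close>
  define c where "c = 2 * ln (norm (mat 1 :: real^'m^'m) + 1) + 2 * ln 2"
  obtain N where N: "N \<ge> 1" and drift: "\<And>x v w. norm v = 1 \<Longrightarrow> norm w = 1 \<Longrightarrow>
    (\<integral>\<omega>. growth wedge_norm N \<omega> - ln (norm (path_iterate A N \<omega> *v v)) - ln (norm (path_iterate A N \<omega> *v w)) \<partial>path_law x) \<le> - (c + 1)"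
    using wedge_growth_gap[OF card zl gap', of "c + 1"] by blast
  define r where "r = 4 * b * real N"
  have r: "0 \<le> r" using b_nonneg by (simp add: r_def)
  \<comment> \<open>The three summands of the denominator yield \<open>\<alpha> \<le> 1\<close>,
    \<open>\<alpha> * r \<le> 1\<close> and \<open>\<alpha> * r\<^sup>2 \<le> 1 / 2\<close>.\<close>
  define \<alpha> where "\<alpha> = 1 / (1 + r + 2 * r\<^sup>2)"
  have den: "0 < 1 + r + 2 * r\<^sup>2" using r by (simp add: add_pos_nonneg)
  have \<alpha>: "0 < \<alpha>" "\<alpha> \<le> 1" "\<alpha> * r \<le> 1" "\<alpha> * r\<^sup>2 \<le> 1 / 2"
    using den r by (simp_all add: \<alpha>_def divide_le_eq)
  define \<delta> where "\<delta> = 1 / (real CARD('m) * real N * exp (b * real N) * exp (b * real N))"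
  have \<delta>: "0 < \<delta>" "real CARD('m) * (real N * exp (b * real N) * \<delta>) * exp (b * real N) \<le> 1"
    using N by (simp_all add: \<delta>_def)
  show ?thesis
  proof (rule that[of N \<alpha> "1 - \<alpha> / 2" \<delta>])
    fix B :: "'a \<times> 'a \<Rightarrow> real^'m^'m" and x and v w :: "real^'m"
    assume "bounded_cocycle K \<mu> C \<rho> B b" and close: "\<And>z. norm (B z - A z) \<le> \<delta>" and vw: "v \<noteq> 0" "w \<noteq> 0"
    then interpret T: two_cocycles K \<mu> C \<rho> A B b \<delta>
      by (intro two_cocycles.intro two_cocycles_axioms.intro bounded_cocycle_axioms) auto
    interpret P: prob_space "path_law x" by (rule prob_space_path_law)
    show "(\<integral>\<omega>. angle (path_iterate B N \<omega> *v v) (path_iterate B N \<omega> *v w) powr \<alpha> \<partial>path_law x) \<le> (1 - \<alpha> / 2) * angle v w powr \<alpha>"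
    proof (rule T.B.angle_contraction_if_negative_drift[OF card N _ \<alpha>(1) _ _ vw])
      fix v w :: "real^'m" assume u: "norm v = 1" "norm w = 1"
      then have u0: "v \<noteq> 0" "w \<noteq> 0" by auto
      have intA: "integrable (path_law x) (growth wedge_norm N)"
        by (rule P.abs_integral_le(1)[where b="2 * b * real N"]) (use wedge_growth_bound[OF card] in auto)
      have intB: "integrable (path_law x) (T.B.growth wedge_norm N)"
        by (rule P.abs_integral_le(1)[where b="2 * b * real N"]) (use T.B.wedge_growth_bound[OF card] in auto)
      have "(\<integral>\<omega>. T.B.growth wedge_norm N \<omega> - ln (norm (path_iterate B N \<omega> *v v)) - ln (norm (path_iterate B N \<omega> *v w)) \<partial>path_law x)
        \<le> (\<integral>\<omega>. (growth wedge_norm N \<omega> - ln (norm (path_iterate A N \<omega> *v v)) - ln (norm (path_iterate A N \<omega> *v w))) + c \<partial>path_law x)"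
      proof (rule integral_mono)
        show "T.B.growth wedge_norm N \<omega> - ln (norm (path_iterate B N \<omega> *v v)) - ln (norm (path_iterate B N \<omega> *v w))
          \<le> (growth wedge_norm N \<omega> - ln (norm (path_iterate A N \<omega> *v v)) - ln (norm (path_iterate A N \<omega> *v w))) + c" for \<omega>
          unfolding c_def by (rule T.drift_close[OF card N \<delta>(2) u0])
      qed (simp_all add: intA intB ln_norm_iterate_integrable T.B.ln_norm_iterate_integrable)
      also have "\<dots> = (\<integral>\<omega>. growth wedge_norm N \<omega> - ln (norm (path_iterate A N \<omega> *v v)) - ln (norm (path_iterate A N \<omega> *v w)) \<partial>path_law x) + c"
        using P.prob_space by (simp add: intA ln_norm_iterate_integrable)
      also have "\<dots> \<le> - 1" using drift[OF u, of x] by simp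
      finally show "(\<integral>\<omega>. T.B.growth wedge_norm N \<omega> - ln (norm (path_iterate B N \<omega> *v v)) - ln (norm (path_iterate B N \<omega> *v w)) \<partial>path_law x) \<le> - 1" .
    qed (use \<alpha> in \<open>simp_all add: r_def\<close>)
  qed (use \<alpha> \<delta> N in auto)
qed

end

text \<open>\<open>N\<close>, \<alpha>, \<kappa> and the mixing time \<open>k\<close> are
  parameters, to be shared by all cocycles near a given one. After \<open>k\<close> steps the laws
  from two starting points are so close that the oscillation of any bounded function is
  halved.\<close>

locale contracting_cocycle = bounded_cocycle K \<mu> C \<rho> A b
  for K :: "'a::polish_space \<Rightarrow> 'a measure" and \<mu> C \<rho> and A :: "'a \<times> 'a \<Rightarrow> real^'m^'m" and b +
  fixes N :: nat and \<alpha> \<kappa> :: real and k :: nat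
  assumes \<alpha>_pos: "0 < \<alpha>" and \<alpha>_le: "\<alpha> \<le> 1" and \<kappa>_nonneg: "0 \<le> \<kappa>" and \<kappa>_less: "\<kappa> < 1" and N_pos: "1 \<le> N"
    and contraction: "\<And>x v w. v \<noteq> 0 \<Longrightarrow> w \<noteq> 0 \<Longrightarrow>
      (\<integral>\<omega>. angle (path_iterate A N \<omega> *v v) (path_iterate A N \<omega> *v w) powr \<alpha> \<partial>path_law x) \<le> \<kappa> * angle v w powr \<alpha>"
    and k_pos: "1 \<le> k" and k: "2 * (C * \<rho> ^ k) \<le> 1 / 2"
begin

definition vec_mean :: "nat \<Rightarrow> 'a \<Rightarrow> real^'m \<Rightarrow> real" where
  "vec_mean n x v = (\<integral>\<omega>. ln (norm (path_iterate A n \<omega> *v v)) \<partial>path_law x) - ln (norm v)"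

lemma vec_mean_eq: "vec_mean n x v = (\<integral>\<omega>. ln (norm (path_iterate A n \<omega> *v v)) - ln (norm v) \<partial>path_law x)"
proof -
  interpret P: prob_space "path_law x" by (rule prob_space_path_law)
  show ?thesis using P.prob_space by (simp add: vec_mean_def ln_norm_iterate_integrable)
qed

lemma vec_mean_bound: "v \<noteq> 0 \<Longrightarrow> \<bar>vec_mean n x v\<bar> \<le> b * real n"
  unfolding vec_mean_eq
  by (rule prob_space.abs_integral_le(2)[OF prob_space_path_law]) (auto intro: ln_norm_iterate_bound)

lemma vec_mean_measurable [measurable]:
  "(\<lambda>\<omega>. vec_mean j (\<omega> n) (path_iterate A n \<omega> *v v)) \<in> borel_measurable path_space"
proof -
  have "(\<lambda>\<omega>. \<integral>\<omega>'. ln (norm (path_iterate A j \<omega>' *v (path_iterate A n \<omega> *v v))) \<partial>path_law (\<omega> n)) \<in> borel_measurable path_space"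
    by (rule integral_measurable_subprob_algebra2[where N=path_space]) measurable
  then show ?thesis unfolding vec_mean_def by measurable
qed

lemma vec_mean_measurable_point [measurable]: "(\<lambda>x. vec_mean j x v) \<in> borel_measurable borel"
proof -
  have "(\<lambda>x. \<integral>\<omega>'. ln (norm (path_iterate A j \<omega>' *v v)) \<partial>path_law x) \<in> borel_measurable borel"
    by (rule integral_measurable_subprob_algebra2[OF _ path_law_subprob]) measurable
  then show ?thesis unfolding vec_mean_def by measurable
qed

lemma vec_mean_integrable:
  assumes "v \<noteq> 0"
  shows "integrable (path_law x) (\<lambda>\<omega>. vec_mean j (\<omega> n) (path_iterate A n \<omega> *v v))"
  by (rule prob_space.abs_integral_le(1)[OF prob_space_path_law, where b="b * real j"])
     (use vec_mean_bound[OF iterate_vector_nonzero[OF assms]] in simp_all)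

lemma vec_mean_markov:
  assumes v: "v \<noteq> 0"
  shows "vec_mean (n + j) x v = (\<integral>\<omega>. (ln (norm (path_iterate A n \<omega> *v v)) - ln (norm v))
      + vec_mean j (\<omega> n) (path_iterate A n \<omega> *v v) \<partial>path_law x)"
proof -
  have "\<bar>ln (norm (path_iterate A (n + j) \<omega> *v v))\<bar> \<le> b * real (n + j) + \<bar>ln (norm v)\<bar>" for \<omega>
    using ln_norm_iterate_bound[OF v, of "n + j" \<omega>] by linarith
  then have "(\<integral>\<omega>. ln (norm (path_iterate A (n + j) \<omega> *v v)) \<partial>path_law x)
    = (\<integral>\<omega>. \<integral>\<omega>'. ln (norm (path_iterate A (n + j) (comb_seq n \<omega> \<omega>') *v v)) \<partial>path_law (\<omega> n) \<partial>path_law x)"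
    by (intro integral_markov) measurable
  also have "\<dots> = (\<integral>\<omega>. ln (norm (path_iterate A n \<omega> *v v)) + vec_mean j (\<omega> n) (path_iterate A n \<omega> *v v) \<partial>path_law x)"
  proof (rule Bochner_Integration.integral_cong[OF refl])
    fix \<omega>
    have "(\<integral>\<omega>'. ln (norm (path_iterate A (n + j) (comb_seq n \<omega> \<omega>') *v v)) \<partial>path_law (\<omega> n))
      = (\<integral>\<omega>'. ln (norm (path_iterate A j \<omega>' *v (path_iterate A n \<omega> *v v))) \<partial>path_law (\<omega> n))"
    proof (rule integral_cong_AE)
      show "AE \<omega>' in path_law (\<omega> n). ln (norm (path_iterate A (n + j) (comb_seq n \<omega> \<omega>') *v v))
          = ln (norm (path_iterate A j \<omega>' *v (path_iterate A n \<omega> *v v)))"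
        using AE_path_law_0
      proof eventually_elim
        case (elim \<omega>')
        have "path_iterate A n (comb_seq n \<omega> \<omega>') = path_iterate A n \<omega>"
          by (rule path_iterate_cong) (use elim in \<open>auto simp: comb_seq_def\<close>)
        then show ?case by (simp add: path_iterate_add matrix_vector_mul_assoc)
      qed
      have "comb_seq n \<omega> \<in> path_space \<rightarrow>\<^sub>M path_space" by measurable
      from measurable_compose[OF this ln_norm_iterate_measurable]
      show "(\<lambda>\<omega>'. ln (norm (path_iterate A (n + j) (comb_seq n \<omega> \<omega>') *v v))) \<in> borel_measurable (path_law (\<omega> n))"
        by simp
    qed simp
    then show "(\<integral>\<omega>'. ln (norm (path_iterate A (n + j) (comb_seq n \<omega> \<omega>') *v v)) \<partial>path_law (\<omega> n))
      = ln (norm (path_iterate A n \<omega> *v v)) + vec_mean j (\<omega> n) (path_iterate A n \<omega> *v v)"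
      by (simp add: vec_mean_def)
  qed
  finally have eq: "(\<integral>\<omega>. ln (norm (path_iterate A (n + j) \<omega> *v v)) \<partial>path_law x)
    = (\<integral>\<omega>. ln (norm (path_iterate A n \<omega> *v v)) + vec_mean j (\<omega> n) (path_iterate A n \<omega> *v v) \<partial>path_law x)" .
  interpret P: prob_space "path_law x" by (rule prob_space_path_law)
  show ?thesis
    unfolding vec_mean_def[of "n + j"] eq using P.prob_space
    by (simp add: ln_norm_iterate_integrable vec_mean_integrable[OF v])
qed

text \<open>The nearer of two opposite unit vectors is within the norm of the wedge; the iterate
  expands the difference by at most \<open>exp (b * n)\<close> and shrinks lengths by at most the
  same factor, hence \<open>exp (2 * b * n)\<close>. The power \<alpha> is the form that
  \<open>contraction\<close> controls; it costs a factor 2 as angles are at most 2.\<close>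

lemma ln_growth_lipschitz:
  assumes vw: "v \<noteq> 0" "w \<noteq> 0"
  shows "\<bar>(ln (norm (path_iterate A n \<omega> *v v)) - ln (norm v)) - (ln (norm (path_iterate A n \<omega> *v w)) - ln (norm w))\<bar>
    \<le> 2 * exp (2 * b * real n) * angle v w powr \<alpha>"
proof -
  let ?g = "path_iterate A n \<omega>"
  have unit: "ln (norm (?g *v v)) - ln (norm (?g *v w)) \<le> exp (2 * b * real n) * angle v w"
    if u: "norm v = 1" "norm w = 1" for v w
  proof -
    obtain s where s: "\<bar>s\<bar> = (1::real)" "norm (v - s *\<^sub>R w) \<le> norm (wedge v w)"
      by (rule sign_aligned_distance_le_wedge[OF u])
    have nz: "v \<noteq> 0" "w \<noteq> 0" using u by auto
    have pos: "0 < norm (?g *v v)" "0 < norm (?g *v w)"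
      using iterate_vector_nonzero[OF nz(1)] iterate_vector_nonzero[OF nz(2)] by auto
    have "?g *v v = ?g *v (v - s *\<^sub>R w) + s *\<^sub>R (?g *v w)"
      by (simp add: matrix_vector_mult_diff_distrib matrix_vector_mult_scaleR)
    then have "norm (?g *v v) \<le> norm (?g *v (v - s *\<^sub>R w)) + norm (s *\<^sub>R (?g *v w))"
      by (metis norm_triangle_ineq)
    also have "norm (s *\<^sub>R (?g *v w)) = norm (?g *v w)" using s by simp
    also have "norm (?g *v (v - s *\<^sub>R w)) \<le> exp (b * real n) * norm (v - s *\<^sub>R w)"
      by (rule norm_iterate_vector_le)
    finally have *: "norm (?g *v v) \<le> exp (b * real n) * norm (v - s *\<^sub>R w) + norm (?g *v w)"
      by simp
    have 1: "norm (?g *v v) \<le> exp (b * real n) * angle v w + norm (?g *v w)"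
    proof -
      have mono: "exp (b * real n) * norm (v - s *\<^sub>R w) \<le> exp (b * real n) * norm (wedge v w)"
        by (intro mult_left_mono s(2)) simp
      have ang: "angle v w = norm (wedge v w)" using u by (simp add: angle_def)
      show ?thesis unfolding ang using * mono by linarith
    qed
    have "ln (norm (?g *v v)) - ln (norm (?g *v w)) = ln (norm (?g *v v) / norm (?g *v w))"
      using pos by (simp add: ln_div)
    also have "\<dots> \<le> norm (?g *v v) / norm (?g *v w) - 1"
      using pos by (intro ln_le_minus_one) simp
    also have "\<dots> \<le> exp (b * real n) * angle v w / norm (?g *v w)"
      using divide_right_mono[OF 1, of "norm (?g *v w)"] pos by (simp add: add_divide_distrib)
    also have "\<dots> \<le> exp (b * real n) * angle v w * exp (b * real n)"
    proof -
      have "1 / norm (?g *v w) \<le> exp (b * real n)"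
        using norm_le_norm_iterate_vector[of w n \<omega>] pos u by (simp add: field_simps)
      then have "exp (b * real n) * angle v w * (1 / norm (?g *v w)) \<le> exp (b * real n) * angle v w * exp (b * real n)"
        by (intro mult_left_mono) (simp_all add: angle_nonneg)
      then show ?thesis by simp
    qed
    also have "\<dots> = exp (2 * b * real n) * angle v w"
    proof -
      have "exp (2 * b * real n) = exp (b * real n) * exp (b * real n)" by (simp add: exp_add[symmetric])
      then show ?thesis by simp
    qed
    finally show ?thesis .
  qed
  define v' w' where "v' = (1 / norm v) *\<^sub>R v" and "w' = (1 / norm w) *\<^sub>R w"
  have u: "norm v' = 1" "norm w' = 1" using vw by (auto simp: v'_def w'_def)
  have eq: "ln (norm (?g *v v')) = ln (norm (?g *v v)) - ln (norm v)" "ln (norm (?g *v w')) = ln (norm (?g *v w)) - ln (norm w)"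
    using vw iterate_vector_nonzero[OF vw(1), of n \<omega>] iterate_vector_nonzero[OF vw(2), of n \<omega>]
    by (simp_all add: v'_def w'_def matrix_vector_mult_scaleR ln_div)
  have ang: "angle v' w' = angle v w" "angle w' v' = angle v w"
  proof -
    show a: "angle v' w' = angle v w" using vw by (simp add: v'_def w'_def angle_scaleR)
    have "wedge w' v' = - wedge v' w'" by (simp add: wedge_def vec_eq_iff)
    then show "angle w' v' = angle v w" using a by (simp add: angle_def mult.commute)
  qed
  have "\<bar>ln (norm (?g *v v')) - ln (norm (?g *v w'))\<bar> \<le> exp (2 * b * real n) * angle v w"
    using unit[OF u] unit[OF u(2,1)] ang by (simp add: abs_le_iff)
  also have "\<dots> \<le> exp (2 * b * real n) * (2 * angle v w powr \<alpha>)"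
    by (intro mult_left_mono angle_le_powr(1) \<alpha>_pos \<alpha>_le) simp
  finally show ?thesis unfolding eq by (simp add: mult.assoc mult.left_commute)
qed

text \<open>The solution \<open>D\<close> of \<open>D = 2 * exp (2 * b * N) + \<kappa> * D\<close>,
  as the induction in \<open>vec_mean_blocks\<close> requires.\<close>

definition dir_const :: real where
  "dir_const = 2 * exp (2 * b * real N) / (1 - \<kappa>)"

lemma dir_const_nonneg: "0 \<le> dir_const"
  using \<kappa>_less by (simp add: dir_const_def)

text \<open>One block contributes its own Lipschitz error and hands over a new pair of directions,
  whose expected angle to the power \<alpha> is smaller by the factor \<kappa>. The errors form a
  geometric series, so the bound does not depend on the number of blocks.\<close>

lemma vec_mean_blocks:
  assumes "v \<noteq> 0" "w \<noteq> 0"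
  shows "\<bar>vec_mean (j * N) x v - vec_mean (j * N) x w\<bar> \<le> dir_const * angle v w powr \<alpha>"
  using assms
proof (induction j arbitrary: x v w)
  case 0
  then have "vec_mean 0 x v = 0" "vec_mean 0 x w = 0" using vec_mean_bound[of v 0 x] vec_mean_bound[of w 0 x] by auto
  then show ?case using dir_const_nonneg by simp
next
  case (Suc j)
  interpret P: prob_space "path_law x" by (rule prob_space_path_law)
  let ?a = "\<lambda>\<omega>. angle (path_iterate A N \<omega> *v v) (path_iterate A N \<omega> *v w) powr \<alpha>"
  let ?l = "\<lambda>v \<omega>. ln (norm (path_iterate A N \<omega> *v v)) - ln (norm v) + vec_mean (j * N) (\<omega> N) (path_iterate A N \<omega> *v v)"
  let ?e = "2 * exp (2 * b * real N) * angle v w powr \<alpha>"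
  have meas [measurable]: "?a \<in> borel_measurable path_space"
  proof -
    have "(\<lambda>\<omega>. wedge (path_iterate A N \<omega> *v v) (path_iterate A N \<omega> *v w)) \<in> borel_measurable path_space"
      unfolding wedge_matrix_vector_mult
    proof -
      have "continuous_on UNIV (wedge_matrix :: real^'m^'m \<Rightarrow> _)"
        unfolding wedge_matrix_def by (intro continuous_intros)
      from borel_measurable_continuous_onI[OF this]
      have [measurable]: "(wedge_matrix :: real^'m^'m \<Rightarrow> _) \<in> borel_measurable borel" .
      show "(\<lambda>\<omega>. (1 / 2) *\<^sub>R (wedge_matrix (path_iterate A N \<omega>) *v wedge v w)) \<in> borel_measurable path_space"
        by measurable
    qed
    then show ?thesis unfolding angle_def by measurable
  qed
  have a_int: "integrable (path_law x) ?a"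
    by (rule P.abs_integral_le(1)[where b=2]) (use angle_le_powr(2)[OF \<alpha>_pos \<alpha>_le] in simp_all)
  have int: "integrable (path_law x) (?l v)" if "v \<noteq> 0" for v
    using vec_mean_integrable[OF that] by (simp add: ln_norm_iterate_integrable)
  have pt: "\<bar>?l v \<omega> - ?l w \<omega>\<bar> \<le> ?e + dir_const * ?a \<omega>" for \<omega>
    using ln_growth_lipschitz[OF Suc.prems, of N \<omega>]
      Suc.IH[OF iterate_vector_nonzero[OF Suc.prems(1)] iterate_vector_nonzero[OF Suc.prems(2)], of "\<omega> N" N \<omega> N \<omega>]
    by linarith
  have "vec_mean (Suc j * N) x v - vec_mean (Suc j * N) x w = (\<integral>\<omega>. ?l v \<omega> - ?l w \<omega> \<partial>path_law x)"
    using vec_mean_markov[OF Suc.prems(1), of N "j * N" x] vec_mean_markov[OF Suc.prems(2), of N "j * N" x]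
    by (simp add: Bochner_Integration.integral_diff[OF int[OF Suc.prems(1)] int[OF Suc.prems(2)]])
  then have "\<bar>vec_mean (Suc j * N) x v - vec_mean (Suc j * N) x w\<bar> \<le> (\<integral>\<omega>. \<bar>?l v \<omega> - ?l w \<omega>\<bar> \<partial>path_law x)"
    by (simp only: integral_abs_bound)
  also have "\<dots> \<le> (\<integral>\<omega>. ?e + dir_const * ?a \<omega> \<partial>path_law x)"
    by (rule integral_mono) (use int[OF Suc.prems(1)] int[OF Suc.prems(2)] a_int pt in \<open>auto intro!: integrable_abs Bochner_Integration.integrable_diff\<close>)
  also have "\<dots> = ?e + dir_const * (\<integral>\<omega>. ?a \<omega> \<partial>path_law x)"
    using a_int P.prob_space by simp
  also have "\<dots> \<le> ?e + dir_const * (\<kappa> * angle v w powr \<alpha>)"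
    by (intro add_left_mono mult_left_mono contraction Suc.prems dir_const_nonneg)
  also have "\<dots> = dir_const * angle v w powr \<alpha>"
  proof -
    have "2 * exp (2 * b * real N) + dir_const * \<kappa> = dir_const"
      using \<kappa>_less by (simp add: dir_const_def field_simps)
    then show ?thesis by (metis distrib_right mult.assoc)
  qed
  finally show ?case .
qed

text \<open>The first term uses that angles to the power \<alpha> are at most 2; the second accounts
  for the incomplete last block of each of the two vectors.\<close>

definition dir_osc :: real where
  "dir_osc = 2 * dir_const + 2 * (b * real N)"

lemma vec_mean_direction:
  assumes vw: "v \<noteq> 0" "w \<noteq> 0"
  shows "\<bar>vec_mean n x v - vec_mean n x w\<bar> \<le> dir_osc"
proof -
  define j r where "j = n div N" and "r = n mod N"
  have n: "n = j * N + r" "r \<le> N" using N_pos by (auto simp: j_def r_def less_imp_le)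
  interpret P: prob_space "path_law x" by (rule prob_space_path_law)
  have tail: "\<bar>vec_mean n x v - vec_mean (j * N) x v\<bar> \<le> b * real N" if v: "v \<noteq> 0" for v
  proof -
    have "vec_mean n x v - vec_mean (j * N) x v = (\<integral>\<omega>. vec_mean r (\<omega> (j * N)) (path_iterate A (j * N) \<omega> *v v) \<partial>path_law x)"
      unfolding n(1) vec_mean_markov[OF v] vec_mean_eq[of "j * N"]
      by (subst Bochner_Integration.integral_add) (simp_all add: ln_norm_iterate_integrable vec_mean_integrable[OF v])
    moreover have "\<bar>\<integral>\<omega>. vec_mean r (\<omega> (j * N)) (path_iterate A (j * N) \<omega> *v v) \<partial>path_law x\<bar> \<le> b * real r"
      by (rule P.abs_integral_le(2)) (use vec_mean_bound[OF iterate_vector_nonzero[OF v]] in simp_all)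
    moreover have "b * real r \<le> b * real N" using n(2) b_nonneg by (intro mult_left_mono) auto
    ultimately show ?thesis by linarith
  qed
  have "\<bar>vec_mean (j * N) x v - vec_mean (j * N) x w\<bar> \<le> dir_const * 2"
    using vec_mean_blocks[OF vw, of j x] mult_left_mono[OF angle_le_powr(2)[OF \<alpha>_pos \<alpha>_le, of v w] dir_const_nonneg]
    by linarith
  then show ?thesis
    using tail[OF vw(1)] tail[OF vw(2)] unfolding dir_osc_def by linarith
qed

definition osc :: real where
  "osc = 4 * (b * real k + dir_osc) + dir_osc"

lemma dir_osc_nonneg: "0 \<le> dir_osc"
  using dir_const_nonneg b_nonneg by (simp add: dir_osc_def)

text \<open>With \<open>s = b * k + dir_osc\<close>, skipping \<open>k\<close> steps and resetting
  the direction to \<open>v\<close> costs \<open>s\<close> for each starting point, and mixing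
  halves the oscillation \<open>Q\<close> of the remaining mean. The requirement
  \<open>2 * s + Q / 2 \<le> Q\<close> leads to \<open>Q = 4 * s\<close>.\<close>

lemma vec_mean_start:
  assumes v: "v \<noteq> 0"
  shows "\<bar>vec_mean n x v - vec_mean n y v\<bar> \<le> 4 * (b * real k + dir_osc)"
proof (induction n arbitrary: x y rule: less_induct)
  case (less n)
  define Q where "Q = 4 * (b * real k + dir_osc)"
  have Q: "0 \<le> Q" using b_nonneg dir_osc_nonneg by (simp add: Q_def)
  show ?case
  proof (cases "n < k")
    case True
    have "b * real n \<le> b * real k" using True b_nonneg by (intro mult_left_mono) auto
    moreover have "0 \<le> b * real k" using b_nonneg by simp
    ultimately show ?thesis
      using vec_mean_bound[OF v, of n x] vec_mean_bound[OF v, of n y] dir_osc_nonneg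
        abs_triangle_ineq4[of "vec_mean n x v" "vec_mean n y v"]
      by (simp only: distrib_left)
  next
    case False
    define f where "f y = vec_mean (n - k) y v" for y
    have nk: "n = k + (n - k)" "n - k < n" using False k_pos by auto
    have step: "\<bar>vec_mean n x v - (\<integral>\<omega>. f (\<omega> k) \<partial>path_law x)\<bar> \<le> b * real k + dir_osc" for x
    proof -
      interpret P: prob_space "path_law x" by (rule prob_space_path_law)
      have [measurable]: "f \<in> borel_measurable borel" unfolding f_def[abs_def] by measurable
      have int: "integrable (path_law x) (\<lambda>\<omega>. f (\<omega> k))"
        unfolding f_def by (rule P.abs_integral_le(1)[where b="b * real (n - k)"]) (use vec_mean_bound[OF v] in simp_all)
      have "vec_mean n x v - (\<integral>\<omega>. f (\<omega> k) \<partial>path_law x)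
        = (\<integral>\<omega>. (ln (norm (path_iterate A k \<omega> *v v)) - ln (norm v)) + vec_mean (n - k) (\<omega> k) (path_iterate A k \<omega> *v v) - f (\<omega> k) \<partial>path_law x)"
        by (subst nk(1), subst vec_mean_markov[OF v], rule Bochner_Integration.integral_diff[symmetric])
           (simp_all add: int ln_norm_iterate_integrable vec_mean_integrable[OF v])
      moreover have "\<bar>\<dots>\<bar> \<le> b * real k + dir_osc"
      proof (rule P.abs_integral_le(2))
        show "\<bar>(ln (norm (path_iterate A k \<omega> *v v)) - ln (norm v)) + vec_mean (n - k) (\<omega> k) (path_iterate A k \<omega> *v v) - f (\<omega> k)\<bar>
            \<le> b * real k + dir_osc" for \<omega>
          using ln_norm_iterate_bound[OF v, of k \<omega>]
            vec_mean_direction[OF iterate_vector_nonzero[OF v] v, of "n - k" "\<omega> k" k \<omega>]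
          unfolding f_def by linarith
      qed simp
      ultimately show ?thesis by simp
    qed
    have close: "\<bar>(\<integral>\<omega>. f (\<omega> k) \<partial>path_law x) - (\<integral>\<omega>. f (\<omega> k) \<partial>path_law y)\<bar> \<le> Q / 2"
    proof -
      \<comment> \<open>Centring at \<open>x\<close> replaces the bound on \<open>f\<close>, which
        grows with \<open>n\<close>, by the oscillation \<open>Q\<close> from the induction
        hypothesis.\<close>
      define g where "g z = f z - f x" for z
      have [measurable]: "f \<in> borel_measurable borel" unfolding f_def[abs_def] by measurable
      have g: "g \<in> borel_measurable borel" unfolding g_def[abs_def] by measurable
      have gb: "\<bar>g z\<bar> \<le> Q" for z
        unfolding g_def f_def Q_def by (rule less.IH[OF nk(2)])
      have eq: "(\<integral>\<omega>. g (\<omega> k) \<partial>path_law z) = (\<integral>\<omega>. f (\<omega> k) \<partial>path_law z) - f x" for z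
      proof -
        interpret P: prob_space "path_law z" by (rule prob_space_path_law)
        have "integrable (path_law z) (\<lambda>\<omega>. f (\<omega> k))"
          unfolding f_def by (rule P.abs_integral_le(1)[where b="b * real (n - k)"]) (use vec_mean_bound[OF v] in simp_all)
        then show ?thesis using P.prob_space by (simp add: g_def)
      qed
      have "C * \<rho> ^ k * Q \<le> Q / 4"
        using mult_right_mono[OF k Q] by simp
      then show ?thesis
        using mixing[OF g gb, where n=k and x=x] mixing[OF g gb, where n=k and x=y] unfolding eq by linarith
    qed
    have "\<bar>vec_mean n x v - vec_mean n y v\<bar> \<le> Q"
    proof -
      have tri: "\<bar>a - c\<bar> \<le> 4 * s" if "\<bar>a - p\<bar> \<le> s" "\<bar>c - q\<bar> \<le> s" "\<bar>p - q\<bar> \<le> 4 * s / 2" for a c p q s :: real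
        using that by (auto simp: abs_le_iff)
      show ?thesis unfolding Q_def by (rule tri[OF step[of x] step[of y] close[unfolded Q_def]])
    qed
    then show ?thesis by (simp only: Q_def)
  qed
qed

lemma vec_mean_osc:
  assumes "v \<noteq> 0" "w \<noteq> 0"
  shows "\<bar>vec_mean n x v - vec_mean n y w\<bar> \<le> osc"
  using vec_mean_start[OF assms(1), of n x y] vec_mean_direction[OF assms, of n y] unfolding osc_def by linarith

lemma osc_nonneg: "0 \<le> osc"
  using dir_osc_nonneg b_nonneg by (simp add: osc_def)

end

section \<open>Large deviations\<close>

lemma norm_le_sum_columns:
  fixes M :: "real^'n^'m"
  shows "norm M \<le> (\<Sum>i\<in>UNIV. norm (M *v axis i 1))"
proof -
  have "norm (transpose M) \<le> (\<Sum>i\<in>UNIV. norm (transpose M $ i))"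
    unfolding norm_vec_def by (rule L2_set_le_sum) simp
  moreover have "norm (transpose M) = norm M"
    by (simp add: norm_vec_def L2_set_def transpose_def sum_nonneg) (rule sum.swap)
  moreover have "transpose M $ i = M *v axis i 1" for i
    by (simp add: matrix_vector_mult_basis column_def transpose_def)
  ultimately show ?thesis by simp
qed

text \<open>Both \<open>h + d\<close> and \<open>- h + d\<close> are subadditive, so Fekete's lemma
  bounds \<open>h\<close> from both sides by the same linear function up to
  \<open>d\<close>.\<close>

lemma quasi_additive_limit:
  fixes h :: "nat \<Rightarrow> real"
  assumes add: "\<And>n m. \<bar>h (n + m) - h n - h m\<bar> \<le> d" and bd: "\<And>n. \<bar>h n\<bar> \<le> c * real n"
  obtains L where "\<And>n. \<bar>h n - real n * L\<bar> \<le> d"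
proof -
  have d: "0 \<le> d" using add[of 0 0] by linarith
  have h0: "h 0 = 0" using bd[of 0] by simp
  have half: "\<exists>L. (\<lambda>n. g n / real n) \<longlonglongrightarrow> L \<and> (\<forall>n. real n * L \<le> g n + d)"
    if add: "\<And>n m. \<bar>g (n + m) - g n - g m\<bar> \<le> d" and bd: "\<And>n. \<bar>g n\<bar> \<le> c * real n" and g0: "g 0 = 0"
    for g :: "nat \<Rightarrow> real"
  proof -
    \<comment> \<open>The bound that \<open>fekete\<close> asks for forces the value 0 at time 0,
      hence the exception.\<close>
    define u where "u n = (if n = 0 then 0 else g n + d)" for n
    have sub: "u (n + m) \<le> u n + u m" for n m
      using add[of n m] d by (auto simp: u_def abs_le_iff)
    have ub: "\<bar>u n\<bar> \<le> (c + d) * real n" for n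
    proof (cases "n = 0")
      case False
      then have "d \<le> d * real n" using d by (simp add: mult_le_cancel_left1)
      then show ?thesis using bd[of n] d False by (simp add: u_def distrib_right abs_le_iff)
    qed (simp add: u_def)
    obtain L where L: "(\<lambda>n. u n / real n) \<longlonglongrightarrow> L" "\<And>n. n \<ge> 1 \<Longrightarrow> L \<le> u n / real n"
      using fekete[OF sub ub] by blast
    have "(\<lambda>n. u n / real n - d / real n) \<longlonglongrightarrow> L - 0"
      by (intro tendsto_diff L tendsto_divide_0[OF tendsto_const] filterlim_real_at_infinity_sequentially)
    moreover have "\<forall>\<^sub>F n in sequentially. u n / real n - d / real n = g n / real n"
      using eventually_gt_at_top[of 0] by eventually_elim (simp add: u_def diff_divide_distrib[symmetric])
    ultimately have "(\<lambda>n. g n / real n) \<longlonglongrightarrow> L" by (simp add: tendsto_cong)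
    moreover have "real n * L \<le> g n + d" for n
    proof (cases "n = 0")
      case False
      then show ?thesis using L(2)[of n] by (simp add: u_def field_simps)
    qed (use g0 d in simp)
    ultimately show ?thesis by blast
  qed
  obtain L where L: "(\<lambda>n. h n / real n) \<longlonglongrightarrow> L" "\<And>n. real n * L \<le> h n + d"
    using half[OF add bd h0] by blast
  have "\<bar>- h (n + m) - (- h n) - (- h m)\<bar> \<le> d" for n m
    using add[of n m] by linarith
  then obtain L' where L': "(\<lambda>n. - h n / real n) \<longlonglongrightarrow> L'" "\<And>n. real n * L' \<le> - h n + d"
    using half[of "\<lambda>n. - h n"] bd h0 by auto
  have "L' = - L"
    using LIMSEQ_unique[OF L'(1)] tendsto_minus[OF L(1)] by simp
  then have "h n - real n * L \<le> d" for n
    using L'(2)[of n] by simp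
  moreover have "- (h n - real n * L) \<le> d" for n
    using L(2)[of n] by simp
  ultimately have "\<bar>h n - real n * L\<bar> \<le> d" for n
    by (rule abs_leI)
  then show ?thesis by (rule that)
qed

section \<open>Concentration by exponential moments\<close>

context contracting_cocycle
begin

text \<open>The oscillation bound makes \<open>vec_mean\<close> almost additive in time for one
  fixed pair of state and direction; any other pair costs \<open>osc\<close> once more. The centre
  \<open>L\<close> is identified only in \<open>centre_eq_rate\<close>.\<close>

lemma vec_mean_quasi_linear:
  obtains L where "\<And>n x v. v \<noteq> 0 \<Longrightarrow> \<bar>vec_mean n x v - real n * L\<bar> \<le> 2 * osc"
proof -
  define v0 :: "real^'m" where "v0 = axis undefined 1"
  have v0: "v0 \<noteq> 0" by (simp add: v0_def axis_eq_0_iff)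
  define x0 :: 'a where "x0 = undefined"
  interpret P: prob_space "path_law x0" by (rule prob_space_path_law)
  have "\<bar>vec_mean (n + m) x0 v0 - vec_mean n x0 v0 - vec_mean m x0 v0\<bar> \<le> osc" for n m
  proof -
    have "vec_mean (n + m) x0 v0 - vec_mean n x0 v0 - vec_mean m x0 v0
      = (\<integral>\<omega>. vec_mean m (\<omega> n) (path_iterate A n \<omega> *v v0) - vec_mean m x0 v0 \<partial>path_law x0)"
      unfolding vec_mean_markov[OF v0, of n m] vec_mean_eq[of n] using P.prob_space
      by (simp add: ln_norm_iterate_integrable vec_mean_integrable[OF v0])
    moreover have "\<bar>\<dots>\<bar> \<le> osc"
      by (rule P.abs_integral_le(2)) (simp_all add: vec_mean_osc[OF iterate_vector_nonzero[OF v0] v0])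
    ultimately show ?thesis by simp
  qed
  then obtain L where L: "\<And>n. \<bar>vec_mean n x0 v0 - real n * L\<bar> \<le> osc"
    using quasi_additive_limit[of "\<lambda>n. vec_mean n x0 v0" osc b] vec_mean_bound[OF v0] by blast
  have "\<bar>vec_mean n x v - real n * L\<bar> \<le> 2 * osc" if "v \<noteq> 0" for n x v
    using L[of n] vec_mean_osc[OF that v0, of n x x0] by linarith
  then show ?thesis by (rule that)
qed

text \<open>An increment lies in an interval of length \<open>2 * (b + osc)\<close>; the summand 1
  makes positivity immediate.\<close>

definition width :: real where
  "width = 2 * (b + osc) + 1"

lemma width_pos: "0 < width"
  using b_nonneg osc_nonneg by (simp add: width_def)

text \<open>The induction splits off the first step, so that the remaining factor is the hypothesis
  for the new state and direction. The sign \<open>s\<close> treats both tails at once.\<close>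

lemma exponential_moment:
  assumes v: "v \<noteq> 0" and l: "0 < l" and s: "\<bar>s\<bar> = (1::real)"
  shows "(\<integral>\<^sup>+\<omega>. ennreal (exp (l * (s * (ln (norm (path_iterate A n \<omega> *v v)) - ln (norm v) - vec_mean n x v)))) \<partial>path_law x)
    \<le> ennreal (exp (real n * (l\<^sup>2 * width\<^sup>2 / 8)))"
  using v
proof (induction n arbitrary: x v)
  case 0
  then have "vec_mean 0 x v = 0" using vec_mean_bound[of v 0 x] by simp
  then show ?case using prob_space.emeasure_space_1[OF prob_space_path_law[of x]] by simp
next
  case (Suc n)
  interpret P: prob_space "path_law x" by (rule prob_space_path_law)
  let ?u = "\<lambda>\<omega>. path_iterate A 1 \<omega> *v v"
  \<comment> \<open>The martingale increment: \<open>vec_mean n\<close> at the new state and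
    direction is the conditional expectation of the remaining growth, so \<open>Z\<close> has mean 0
    by \<open>vec_mean_markov\<close>, while \<open>vec_mean_osc\<close> confines it to an interval
    about \<open>s * h\<close>.\<close>
  define Z where "Z \<omega> = s * ((ln (norm (?u \<omega>)) - ln (norm v)) + vec_mean n (\<omega> 1) (?u \<omega>) - vec_mean (1 + n) x v)" for \<omega>
  have Z_meas [measurable]: "Z \<in> borel_measurable path_space" unfolding Z_def by measurable
  have u0: "?u \<omega> \<noteq> 0" for \<omega> using iterate_vector_nonzero[OF Suc.prems] .
  define h where "h = vec_mean n x v - vec_mean (1 + n) x v"
  have raw: "\<bar>(ln (norm (?u \<omega>)) - ln (norm v)) + vec_mean n (\<omega> 1) (?u \<omega>) - vec_mean (1 + n) x v - h\<bar> \<le> b + osc" for \<omega>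
    using ln_norm_iterate_bound[OF Suc.prems, of 1 \<omega>] vec_mean_osc[OF u0[of \<omega>] Suc.prems, of n "\<omega> 1" x]
    unfolding h_def by (simp only: abs_le_iff) linarith
  have Z_range: "s * h - (b + osc) \<le> Z \<omega>" "Z \<omega> \<le> s * h + (b + osc)" for \<omega>
  proof -
    have "\<bar>Z \<omega> - s * h\<bar> \<le> b + osc"
      unfolding Z_def right_diff_distrib[symmetric] abs_mult s using raw[of \<omega>] by simp
    then show "s * h - (b + osc) \<le> Z \<omega>" "Z \<omega> \<le> s * h + (b + osc)" by (auto simp: abs_le_iff)
  qed
  have Z_mean: "P.expectation Z = 0"
    unfolding Z_def using vec_mean_markov[OF Suc.prems, of 1 n x] P.prob_space
    by (simp add: ln_norm_iterate_integrable vec_mean_integrable[OF Suc.prems] del: path_iterate.simps)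
  interpret I: interval_bounded_random_variable "path_law x" Z "s * h - (b + osc)" "s * h + (b + osc)"
    by unfold_locales (auto simp: Z_range)
  have hoeffding: "(\<integral>\<^sup>+\<omega>. ennreal (exp (l * Z \<omega>)) \<partial>path_law x) \<le> ennreal (exp (l\<^sup>2 * width\<^sup>2 / 8))"
  proof -
    have "(\<integral>\<^sup>+\<omega>. ennreal (exp (l * Z \<omega>)) \<partial>path_law x) \<le> ennreal (exp (l\<^sup>2 * ((s * h + (b + osc)) - (s * h - (b + osc)))\<^sup>2 / 8))"
      by (rule I.Hoeffdings_lemma_nn_integral_0[OF l Z_mean])
    also have "\<dots> \<le> ennreal (exp (l\<^sup>2 * width\<^sup>2 / 8))"
    proof -
      have "((s * h + (b + osc)) - (s * h - (b + osc)))\<^sup>2 \<le> width\<^sup>2"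
        unfolding width_def using b_nonneg osc_nonneg by (intro power_mono) auto
      then have "l\<^sup>2 * ((s * h + (b + osc)) - (s * h - (b + osc)))\<^sup>2 / 8 \<le> l\<^sup>2 * width\<^sup>2 / 8"
        by (intro divide_right_mono mult_left_mono) auto
      then show ?thesis by (intro ennreal_leI) simp
    qed
    finally show ?thesis .
  qed
  let ?F = "\<lambda>\<omega>. ennreal (exp (l * (s * (ln (norm (path_iterate A (1 + n) \<omega> *v v)) - ln (norm v) - vec_mean (1 + n) x v))))"
  let ?c = "ennreal (exp (real n * (l\<^sup>2 * width\<^sup>2 / 8)))"
  have "(\<integral>\<^sup>+\<omega>. ?F \<omega> \<partial>path_law x) = (\<integral>\<^sup>+\<omega>. \<integral>\<^sup>+\<omega>'. ?F (comb_seq 1 \<omega> \<omega>') \<partial>path_law (\<omega> 1) \<partial>path_law x)"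
    by (rule nn_integral_markov) measurable
  also have "\<dots> \<le> (\<integral>\<^sup>+\<omega>. ennreal (exp (l * Z \<omega>)) * ?c \<partial>path_law x)"
  proof (rule nn_integral_mono)
    fix \<omega>
    let ?G = "\<lambda>\<omega>'. ennreal (exp (l * (s * (ln (norm (path_iterate A n \<omega>' *v ?u \<omega>)) - ln (norm (?u \<omega>)) - vec_mean n (\<omega> 1) (?u \<omega>)))))"
    have "(\<integral>\<^sup>+\<omega>'. ?F (comb_seq 1 \<omega> \<omega>') \<partial>path_law (\<omega> 1)) = (\<integral>\<^sup>+\<omega>'. ennreal (exp (l * Z \<omega>)) * ?G \<omega>' \<partial>path_law (\<omega> 1))"
    proof (rule nn_integral_cong_AE)
      show "AE \<omega>' in path_law (\<omega> 1). ?F (comb_seq 1 \<omega> \<omega>') = ennreal (exp (l * Z \<omega>)) * ?G \<omega>'"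
        using AE_path_law_0
      proof eventually_elim
        case (elim \<omega>')
        have "comb_seq 1 \<omega> \<omega>' i = \<omega> i" if "i \<le> 1" for i
          using that elim by (cases i) auto
        then have "path_iterate A 1 (comb_seq 1 \<omega> \<omega>') = path_iterate A 1 \<omega>"
          by (rule path_iterate_cong)
        then have it: "path_iterate A (1 + n) (comb_seq 1 \<omega> \<omega>') *v v = path_iterate A n \<omega>' *v ?u \<omega>"
          unfolding path_iterate_add by (simp add: matrix_vector_mul_assoc del: path_iterate.simps One_nat_def)
        have "l * (s * (ln (norm (path_iterate A n \<omega>' *v ?u \<omega>)) - ln (norm v) - vec_mean (1 + n) x v))
          = l * Z \<omega> + l * (s * (ln (norm (path_iterate A n \<omega>' *v ?u \<omega>)) - ln (norm (?u \<omega>)) - vec_mean n (\<omega> 1) (?u \<omega>)))"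
          unfolding Z_def by (simp only: distrib_left[symmetric]) (rule arg_cong2[where f="(*)"], simp, rule arg_cong2[where f="(*)"], simp, simp)
        then show ?case unfolding it by (simp only: exp_add ennreal_mult exp_ge_zero)
      qed
    qed
    also have "\<dots> = ennreal (exp (l * Z \<omega>)) * (\<integral>\<^sup>+\<omega>'. ?G \<omega>' \<partial>path_law (\<omega> 1))"
      by (rule nn_integral_cmult) (simp only: measurable_path_law_eq, measurable)
    also have "\<dots> \<le> ennreal (exp (l * Z \<omega>)) * ?c"
      by (intro mult_left_mono Suc.IH u0) simp
    finally show "(\<integral>\<^sup>+\<omega>'. ?F (comb_seq 1 \<omega> \<omega>') \<partial>path_law (\<omega> 1)) \<le> ennreal (exp (l * Z \<omega>)) * ?c" .
  qed
  also have "\<dots> = (\<integral>\<^sup>+\<omega>. ennreal (exp (l * Z \<omega>)) \<partial>path_law x) * ?c"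
    by (rule nn_integral_multc) measurable
  also have "\<dots> \<le> ennreal (exp (l\<^sup>2 * width\<^sup>2 / 8)) * ?c"
    by (intro mult_right_mono hoeffding) simp
  also have "\<dots> = ennreal (exp (real (Suc n) * (l\<^sup>2 * width\<^sup>2 / 8)))"
    by (simp add: ennreal_mult[symmetric] exp_add[symmetric] distrib_right)
  finally show ?case by simp
qed

lemma one_sided_deviation:
  assumes v: "v \<noteq> 0" and n: "n \<ge> 1" and \<eta>: "0 < \<eta>" and s: "\<bar>s\<bar> = (1::real)"
  shows "measure (path_law x) {\<omega>. \<eta> \<le> s * (ln (norm (path_iterate A n \<omega> *v v)) - ln (norm v) - vec_mean n x v)}
    \<le> exp (- (2 * \<eta>\<^sup>2 / (real n * width\<^sup>2)))"
proof -
  interpret P: prob_space "path_law x" by (rule prob_space_path_law)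
  let ?f = "\<lambda>\<omega>. s * (ln (norm (path_iterate A n \<omega> *v v)) - ln (norm v) - vec_mean n x v)"
  \<comment> \<open>The minimiser of
    \<open>- l * \<eta> + n * l\<^sup>2 * width\<^sup>2 / 8\<close>, the exponent obtained from
    Markov's inequality.\<close>
  define l where "l = 4 * \<eta> / (real n * width\<^sup>2)"
  have w: "0 < real n * width\<^sup>2" using n width_pos by simp
  have l: "0 < l" using \<eta> w by (simp add: l_def)
  have meas: "{\<omega>. \<eta> \<le> ?f \<omega>} \<in> sets path_space"
  proof -
    have "{\<omega> \<in> space path_space. \<eta> \<le> ?f \<omega>} \<in> sets path_space" by measurable
    then show ?thesis by simp
  qed
  have "emeasure (path_law x) {\<omega>. \<eta> \<le> ?f \<omega>} = (\<integral>\<^sup>+\<omega>. indicator {\<omega>. \<eta> \<le> ?f \<omega>} \<omega> \<partial>path_law x)"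
    using meas by simp
  also have "\<dots> \<le> (\<integral>\<^sup>+\<omega>. ennreal (exp (- (l * \<eta>))) * ennreal (exp (l * ?f \<omega>)) \<partial>path_law x)"
  proof (rule nn_integral_mono)
    fix \<omega>
    show "indicator {\<omega>. \<eta> \<le> ?f \<omega>} \<omega> \<le> ennreal (exp (- (l * \<eta>))) * ennreal (exp (l * ?f \<omega>))"
    proof (cases "\<eta> \<le> ?f \<omega>")
      case True
      then have "l * \<eta> \<le> l * ?f \<omega>" using l by (intro mult_left_mono) auto
      then have "1 \<le> exp (- (l * \<eta>)) * exp (l * ?f \<omega>)" by (simp add: mult_exp_exp)
      then have "ennreal 1 \<le> ennreal (exp (- (l * \<eta>)) * exp (l * ?f \<omega>))" by (rule ennreal_leI)
      then show ?thesis using True by (simp add: ennreal_mult)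
    qed simp
  qed
  also have "\<dots> = ennreal (exp (- (l * \<eta>))) * (\<integral>\<^sup>+\<omega>. ennreal (exp (l * ?f \<omega>)) \<partial>path_law x)"
    by (rule nn_integral_cmult) (simp only: measurable_path_law_eq, measurable)
  also have "\<dots> \<le> ennreal (exp (- (l * \<eta>))) * ennreal (exp (real n * (l\<^sup>2 * width\<^sup>2 / 8)))"
    by (intro mult_left_mono exponential_moment[OF v l s]) simp
  also have "\<dots> = ennreal (exp (- (l * \<eta>) + real n * (l\<^sup>2 * width\<^sup>2 / 8)))"
    by (simp only: ennreal_mult[symmetric] exp_ge_zero exp_add)
  also have "- (l * \<eta>) + real n * (l\<^sup>2 * width\<^sup>2 / 8) = - (2 * \<eta>\<^sup>2 / (real n * width\<^sup>2))"
    using n width_pos by (simp add: l_def power2_eq_square field_simps)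
  finally show ?thesis
    by (simp add: P.emeasure_eq_measure)
qed

definition ldt_rate :: real where
  "ldt_rate = 2 / width\<^sup>2"

text \<open>Two tails for each of \<open>d\<close> basis vectors give \<open>2 * d\<close>. The
  exponential pays for the error \<open>ln d + 2 * osc\<close> made on replacing the norm by a
  column and the centre by the mean.\<close>

definition ldt_const :: "real \<Rightarrow> real" where
  "ldt_const d = 2 * d * exp (2 * ldt_rate * (ln d + 2 * osc))"

lemma ldt_rate_pos: "0 < ldt_rate"
  using width_pos by (simp add: ldt_rate_def)

text \<open>An event on basis vectors only, which contains the large deviations of every
  \<open>F\<close> between the largest column norm and the sum of the column norms;
  \<open>ln (real CARD('m))\<close> bounds the logarithmic gap between these. It serves the
  Hilbert-Schmidt norm in \<open>centre_eq_rate\<close> and the operator norm in the end.\<close>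

definition deviation_set :: "real \<Rightarrow> nat \<Rightarrow> real \<Rightarrow> (nat \<Rightarrow> 'a) set" where
  "deviation_set L n \<epsilon> = {\<omega>. \<exists>i. \<epsilon> * real n - ln (real CARD('m)) \<le> \<bar>ln (norm (path_iterate A n \<omega> *v axis i 1)) - real n * L\<bar>}"

lemma deviation_set_measurable [measurable]: "deviation_set L n \<epsilon> \<in> sets path_space"
proof -
  have "{\<omega> \<in> space path_space. \<exists>i. \<epsilon> * real n - ln (real CARD('m)) \<le> \<bar>ln (norm (path_iterate A n \<omega> *v axis i 1)) - real n * L\<bar>} \<in> sets path_space"
    by measurable
  then show ?thesis by (simp add: deviation_set_def)
qed

lemma deviation_set_prob:
  assumes L: "\<And>n x v. v \<noteq> 0 \<Longrightarrow> \<bar>vec_mean n x v - real n * L\<bar> \<le> 2 * osc"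
    and n: "n \<ge> 1" and \<epsilon>: "0 < \<epsilon>" "\<epsilon> < 1"
  shows "measure (path_law x) (deviation_set L n \<epsilon>) \<le> ldt_const (real CARD('m)) * exp (- ldt_rate * \<epsilon>\<^sup>2 * real n)"
proof -
  interpret P: prob_space "path_law x" by (rule prob_space_path_law)
  define E where "E = ln (real CARD('m)) + 2 * osc"
  have card: "1 \<le> real CARD('m)" by (simp add: Suc_le_eq)
  have E: "0 \<le> E" unfolding E_def using osc_nonneg card by simp
  have rate: "0 < ldt_rate" by (rule ldt_rate_pos)
  have const: "ldt_const (real CARD('m)) = 2 * real CARD('m) * exp (2 * ldt_rate * E)"
    by (simp add: ldt_const_def E_def)
  show ?thesis
  proof (cases "\<epsilon> * real n \<le> E")
    \<comment> \<open>For such \<open>n\<close> the right-hand side is at least 1.\<close>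
    case True
    have "ldt_rate * \<epsilon>\<^sup>2 * real n \<le> 2 * ldt_rate * E"
    proof -
      have "ldt_rate * \<epsilon> * (\<epsilon> * real n) \<le> ldt_rate * \<epsilon> * E" using rate \<epsilon> True by (intro mult_left_mono) auto
      also have "\<dots> \<le> ldt_rate * 2 * E" using rate \<epsilon> E by (intro mult_right_mono mult_left_mono) auto
      finally show ?thesis by (simp add: power2_eq_square mult.assoc mult.left_commute)
    qed
    then have "1 \<le> exp (2 * ldt_rate * E - ldt_rate * \<epsilon>\<^sup>2 * real n)" by simp
    also have "\<dots> = exp (2 * ldt_rate * E) * exp (- ldt_rate * \<epsilon>\<^sup>2 * real n)"
      by (simp add: exp_diff exp_minus field_simps)
    also have "\<dots> \<le> (2 * real CARD('m) * exp (2 * ldt_rate * E)) * exp (- ldt_rate * \<epsilon>\<^sup>2 * real n)"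
    proof (rule mult_right_mono)
      have "1 * exp (2 * ldt_rate * E) \<le> (2 * real CARD('m)) * exp (2 * ldt_rate * E)"
      proof (rule mult_right_mono)
        show "1 \<le> 2 * real CARD('m)" using card by linarith
      qed simp
      then show "exp (2 * ldt_rate * E) \<le> 2 * real CARD('m) * exp (2 * ldt_rate * E)" by simp
    qed simp
    finally show ?thesis unfolding const by (rule order_trans[OF P.prob_le_1])
  next
    case False
    define \<eta> where "\<eta> = \<epsilon> * real n - E"
    have \<eta>: "0 < \<eta>" using False by (simp add: \<eta>_def)
    define D where "D i s = {\<omega>. \<eta> \<le> s * (ln (norm (path_iterate A n \<omega> *v axis i 1)) - ln (norm (axis i 1 :: real^'m)) - vec_mean n x (axis i 1))}"
      for i :: 'm and s :: real
    have D_meas: "D i s \<in> sets path_space" for i s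
    proof -
      have "{\<omega> \<in> space path_space. \<eta> \<le> s * (ln (norm (path_iterate A n \<omega> *v axis i 1)) - ln (norm (axis i 1 :: real^'m)) - vec_mean n x (axis i 1))} \<in> sets path_space"
        by measurable
      then show ?thesis by (simp add: D_def)
    qed
    have ax: "axis i 1 \<noteq> (0 :: real^'m)" for i by (simp add: axis_eq_0_iff)
    have D_prob: "P.prob (D i s) \<le> exp (- (2 * \<eta>\<^sup>2 / (real n * width\<^sup>2)))" if "\<bar>s\<bar> = 1" for i s
      unfolding D_def by (rule one_sided_deviation[OF ax n \<eta> that])
    have "deviation_set L n \<epsilon> \<subseteq> (\<Union>i. D i 1 \<union> D i (- 1))"
    proof
      fix \<omega> assume "\<omega> \<in> deviation_set L n \<epsilon>"
      then obtain i where i: "\<epsilon> * real n - ln (real CARD('m)) \<le> \<bar>ln (norm (path_iterate A n \<omega> *v axis i 1)) - real n * L\<bar>"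
        by (auto simp: deviation_set_def)
      have "\<eta> \<le> \<bar>ln (norm (path_iterate A n \<omega> *v axis i 1)) - vec_mean n x (axis i 1)\<bar>"
        using i L[OF ax[of i], of n x] unfolding \<eta>_def E_def by linarith
      then have "\<omega> \<in> D i 1 \<or> \<omega> \<in> D i (- 1)" by (auto simp: D_def norm_axis_1 abs_if split: if_splits)
      then show "\<omega> \<in> (\<Union>i. D i 1 \<union> D i (- 1))" by blast
    qed
    then have "P.prob (deviation_set L n \<epsilon>) \<le> P.prob (\<Union>i. D i 1 \<union> D i (- 1))"
      by (rule P.finite_measure_mono) (use D_meas in \<open>auto intro!: sets.countable_UN'\<close>)
    also have "\<dots> \<le> (\<Sum>i\<in>(UNIV :: 'm set). P.prob (D i 1 \<union> D i (- 1)))"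
      by (rule P.finite_measure_subadditive_finite) (use D_meas in auto)
    also have "\<dots> \<le> (\<Sum>i\<in>(UNIV :: 'm set). 2 * exp (- (2 * \<eta>\<^sup>2 / (real n * width\<^sup>2))))"
    proof (rule sum_mono)
      fix i
      have "P.prob (D i 1 \<union> D i (- 1)) \<le> P.prob (D i 1) + P.prob (D i (- 1))"
        by (rule measure_Un_le) (use D_meas in auto)
      then show "P.prob (D i 1 \<union> D i (- 1)) \<le> 2 * exp (- (2 * \<eta>\<^sup>2 / (real n * width\<^sup>2)))"
        using D_prob[of 1 i] D_prob[of "- 1" i] by simp
    qed
    also have "\<dots> = 2 * real CARD('m) * exp (- (2 * \<eta>\<^sup>2 / (real n * width\<^sup>2)))" by simp
    also have "\<dots> \<le> 2 * real CARD('m) * exp (2 * ldt_rate * E - ldt_rate * \<epsilon>\<^sup>2 * real n)"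
    proof (intro mult_left_mono)
      \<comment> \<open>Dropping \<open>E\<^sup>2\<close> from the square gives
        \<open>\<eta>\<^sup>2 / n \<ge> \<epsilon>\<^sup>2 * n - 2 * \<epsilon> * E\<close>, and
        \<open>\<epsilon> < 1\<close> bounds the last term uniformly.\<close>
      have "(\<epsilon> * real n)\<^sup>2 - 2 * (\<epsilon> * real n) * E \<le> \<eta>\<^sup>2"
        unfolding \<eta>_def power2_diff by simp
      then have "((\<epsilon> * real n)\<^sup>2 - 2 * (\<epsilon> * real n) * E) / real n \<le> \<eta>\<^sup>2 / real n"
        by (rule divide_right_mono) simp
      moreover have "((\<epsilon> * real n)\<^sup>2 - 2 * (\<epsilon> * real n) * E) / real n = \<epsilon>\<^sup>2 * real n - 2 * \<epsilon> * E"
        using n by (simp add: power2_eq_square field_simps)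
      ultimately have "ldt_rate * (\<epsilon>\<^sup>2 * real n - 2 * \<epsilon> * E) \<le> ldt_rate * (\<eta>\<^sup>2 / real n)"
        using rate by (intro mult_left_mono) auto
      moreover have "ldt_rate * (\<eta>\<^sup>2 / real n) = 2 * \<eta>\<^sup>2 / (real n * width\<^sup>2)"
        by (simp add: ldt_rate_def)
      moreover have "ldt_rate * E * \<epsilon> \<le> ldt_rate * E * 1" using rate E \<epsilon> by (intro mult_left_mono) auto
      ultimately show "exp (- (2 * \<eta>\<^sup>2 / (real n * width\<^sup>2))) \<le> exp (2 * ldt_rate * E - ldt_rate * \<epsilon>\<^sup>2 * real n)"
        by (simp add: algebra_simps)
    qed simp
    also have "\<dots> = ldt_const (real CARD('m)) * exp (- ldt_rate * \<epsilon>\<^sup>2 * real n)"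
      unfolding const by (simp add: exp_diff exp_minus field_simps)
    finally show ?thesis .
  qed
qed

text \<open>The largest column, of index \<open>j\<close>, has logarithmic norm within
  \<open>ln (real CARD('m))\<close> of that of \<open>F\<close>, so this basis vector inherits a
  large deviation of \<open>F\<close>.\<close>

lemma deviation_setI:
  fixes F :: "real^'m^'m \<Rightarrow> real"
  assumes F_lower: "\<And>M i. norm (M *v axis i 1) \<le> F M" and F_upper: "\<And>M. F M \<le> (\<Sum>i\<in>UNIV. norm (M *v axis i 1))"
    and n: "n \<ge> 1" and dev: "\<epsilon> < \<bar>1 / real n * ln (F (path_iterate A n \<omega>)) - L\<bar>"
  shows "\<omega> \<in> deviation_set L n \<epsilon>"
proof -
  let ?M = "path_iterate A n \<omega>"
  have pos: "0 < norm (?M *v axis i 1)" for i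
    using iterate_vector_nonzero[of "axis i 1" n \<omega>] by (simp add: axis_eq_0_iff)
  have card: "1 \<le> real CARD('m)" by (simp add: Suc_le_eq)
  then have lnm: "0 \<le> ln (real CARD('m))" by simp
  have F_pos: "0 < F ?M" using pos F_lower less_le_trans by blast
  have "real n * \<epsilon> < real n * \<bar>1 / real n * ln (F ?M) - L\<bar>" using dev n by (intro mult_strict_left_mono) auto
  also have "\<dots> = \<bar>real n * (1 / real n * ln (F ?M) - L)\<bar>" by (simp add: abs_mult)
  also have "real n * (1 / real n * ln (F ?M) - L) = ln (F ?M) - real n * L" using n by (simp add: right_diff_distrib)
  finally have dev': "\<epsilon> * real n < \<bar>ln (F ?M) - real n * L\<bar>" by (simp add: mult.commute)
  have "finite (range (\<lambda>i. norm (?M *v axis i 1)))" by simp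
  then obtain j where j: "\<And>i. norm (?M *v axis i 1) \<le> norm (?M *v axis j 1)"
    using Max_in[of "range (\<lambda>i. norm (?M *v axis i 1))"] Max_ge[of "range (\<lambda>i. norm (?M *v axis i 1))"]
    by (metis (no_types, lifting) UNIV_not_empty empty_is_image imageE rangeI)
  have "F ?M \<le> (\<Sum>i\<in>(UNIV::'m set). norm (?M *v axis j 1))"
    by (rule order_trans[OF F_upper sum_mono]) (rule j)
  then have "ln (F ?M) \<le> ln (real CARD('m) * norm (?M *v axis j 1))"
    using F_pos pos[of j] by (subst ln_le_cancel_iff) auto
  also have "\<dots> = ln (real CARD('m)) + ln (norm (?M *v axis j 1))"
    by (rule ln_mult_pos) (use pos in auto)
  finally have 1: "ln (F ?M) - ln (real CARD('m)) \<le> ln (norm (?M *v axis j 1))" by simp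
  have 2: "ln (norm (?M *v axis j 1)) \<le> ln (F ?M)"
    using F_lower[of ?M j] pos[of j] F_pos by (subst ln_le_cancel_iff) auto
  have "\<epsilon> * real n - ln (real CARD('m)) \<le> \<bar>ln (norm (?M *v axis j 1)) - real n * L\<bar>"
    using dev' 1 2 lnm by linarith
  then show ?thesis by (auto simp: deviation_set_def)
qed

text \<open>The deviation bound about \<open>L\<close> is summable in \<open>n\<close>, so by
  Borel-Cantelli the growth of the norm almost surely stays within \<epsilon> of \<open>L\<close>
  from some time on, while by Kingman's theorem it tends to \<open>rate\<close>.\<close>

lemma centre_eq_rate:
  assumes L: "\<And>n x v. v \<noteq> 0 \<Longrightarrow> \<bar>vec_mean n x v - real n * L\<bar> \<le> 2 * osc"
  shows "L = norm_growth.rate"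
proof (rule ccontr)
  assume "L \<noteq> norm_growth.rate"
  \<comment> \<open>Less than 1, as \<open>deviation_set_prob\<close> requires, and at most half the
    distance, so that being within \<epsilon> of \<open>rate\<close> means being farther than
    \<epsilon> from \<open>L\<close>.\<close>
  define \<epsilon> where "\<epsilon> = min (1 / 2) (\<bar>norm_growth.rate - L\<bar> / 2)"
  have "\<epsilon> \<le> \<bar>norm_growth.rate - L\<bar> / 2" unfolding \<epsilon>_def by (rule min.cobounded2)
  then have \<epsilon>: "0 < \<epsilon>" "\<epsilon> < 1" "2 * \<epsilon> \<le> \<bar>norm_growth.rate - L\<bar>"
    using \<open>L \<noteq> norm_growth.rate\<close> by (auto simp: \<epsilon>_def)
  define x :: 'a where "x = undefined"
  interpret P: prob_space "path_law x" by (rule prob_space_path_law)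
  let ?q = "exp (- ldt_rate * \<epsilon>\<^sup>2)"
  have q: "0 < ?q" "?q < 1" using ldt_rate_pos \<epsilon> by auto
  have "summable (\<lambda>n. P.prob (deviation_set L (Suc n) \<epsilon>))"
  proof (rule summable_comparison_test')
    show "summable (\<lambda>n. ldt_const (real CARD('m)) * ?q ^ Suc n)"
      using q by (intro summable_mult) (simp add: summable_mult summable_geometric)
    fix n
    have "?q ^ Suc n = exp (- ldt_rate * \<epsilon>\<^sup>2 * real (Suc n))"
      by (simp only: exp_of_nat_mult[symmetric] mult.commute)
    then show "norm (P.prob (deviation_set L (Suc n) \<epsilon>)) \<le> ldt_const (real CARD('m)) * ?q ^ Suc n"
      using deviation_set_prob[OF L _ \<epsilon>(1,2), of "Suc n" x] by simp
  qed
  then have "AE \<omega> in path_law x. \<forall>\<^sub>F n in sequentially. \<omega> \<in> space (path_law x) - deviation_set L (Suc n) \<epsilon>"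
    by (intro borel_cantelli_AE1) (auto simp: P.emeasure_eq_measure)
  then have "AE \<omega> in path_law x. False"
    using norm_growth.kingman[of x]
  proof eventually_elim
    case (elim \<omega>)
    have "(\<lambda>n. growth norm (Suc n) \<omega> / real (Suc n)) \<longlonglongrightarrow> norm_growth.rate"
      using elim(2) by (rule LIMSEQ_Suc)
    then have "\<forall>\<^sub>F n in sequentially. dist (growth norm (Suc n) \<omega> / real (Suc n)) norm_growth.rate < \<epsilon>"
      using \<epsilon>(1) by (rule tendstoD)
    with elim(1) have "\<forall>\<^sub>F n in sequentially. False"
    proof eventually_elim
      case (elim n)
      have "\<epsilon> < \<bar>1 / real (Suc n) * ln (norm (path_iterate A (Suc n) \<omega>)) - L\<bar>"
        using elim(2) \<epsilon>(3) by (simp add: growth_def dist_real_def del: of_nat_Suc path_iterate.simps)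
      then have "\<omega> \<in> deviation_set L (Suc n) \<epsilon>"
      proof (rule deviation_setI[rotated 3])
        show "norm (M *v axis i 1) \<le> norm M" for M :: "real^'m^'m" and i
          using norm_matrix_vector_mult_le[of M "axis i 1"] by (simp add: norm_axis_1)
      qed (simp_all add: norm_le_sum_columns)
      then show ?case using elim(1) by simp
    qed
    then show ?case by simp
  qed
  then show False using P.AE_False by simp
qed

theorem large_deviations:
  fixes F :: "real^'m^'m \<Rightarrow> real"
  assumes "\<And>M i. norm (M *v axis i 1) \<le> F M" "\<And>M. F M \<le> (\<Sum>i\<in>UNIV. norm (M *v axis i 1))"
    and n: "n \<ge> 1" and \<epsilon>: "0 < \<epsilon>" "\<epsilon> < 1"
  shows "{\<omega>. \<epsilon> < \<bar>1 / real n * ln (F (path_iterate A n \<omega>)) - norm_growth.rate\<bar>} \<subseteq> deviation_set norm_growth.rate n \<epsilon>"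
    and "measure stationary_law (deviation_set norm_growth.rate n \<epsilon>)
      \<le> ldt_const (real CARD('m)) * exp (- ldt_rate * \<epsilon>\<^sup>2 * real n)"
proof -
  obtain L where L: "\<And>n x v. v \<noteq> 0 \<Longrightarrow> \<bar>vec_mean n x v - real n * L\<bar> \<le> 2 * osc"
    using vec_mean_quasi_linear by blast
  have eq: "norm_growth.rate = L" using centre_eq_rate[OF L] by simp
  show "{\<omega>. \<epsilon> < \<bar>1 / real n * ln (F (path_iterate A n \<omega>)) - norm_growth.rate\<bar>} \<subseteq> deviation_set norm_growth.rate n \<epsilon>"
    using deviation_setI[OF assms(1,2) n] by blast
  let ?c = "ldt_const (real CARD('m)) * exp (- ldt_rate * \<epsilon>\<^sup>2 * real n)"
  have c: "0 \<le> ?c" by (simp add: ldt_const_def)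
  have "emeasure stationary_law (deviation_set norm_growth.rate n \<epsilon>)
    = (\<integral>\<^sup>+\<omega>. indicator (deviation_set norm_growth.rate n \<epsilon>) \<omega> \<partial>stationary_law)" by simp
  also have "\<dots> = (\<integral>\<^sup>+x. \<integral>\<^sup>+\<omega>. indicator (deviation_set norm_growth.rate n \<epsilon>) \<omega> \<partial>path_law x \<partial>\<mu>)"
    by (rule nn_integral_stationary_law) measurable
  also have "\<dots> \<le> (\<integral>\<^sup>+x. ennreal ?c \<partial>\<mu>)"
  proof (rule nn_integral_mono)
    fix x
    interpret P: prob_space "path_law x" by (rule prob_space_path_law)
    show "(\<integral>\<^sup>+\<omega>. indicator (deviation_set norm_growth.rate n \<epsilon>) \<omega> \<partial>path_law x) \<le> ennreal ?c"
      unfolding eq using deviation_set_prob[OF L n \<epsilon>, of x] by (simp add: P.emeasure_eq_measure ennreal_leI)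
  qed
  also have "\<dots> = ennreal ?c"
    using prob_space.emeasure_space_1[OF prob_space_\<mu>] by simp
  finally show "measure stationary_law (deviation_set norm_growth.rate n \<epsilon>) \<le> ?c"
    using c by (simp only: norm_growth.M.emeasure_eq_measure ennreal_le_iff)
qed

end

section \<open>Exterior powers and Lyapunov exponents\<close>

lemma minor_empty: "minor g {} {} = 1"
  by (simp add: minor_def)

lemma minor_singleton: "minor g {i} {j} = g $ i $ j"
proof -
  have "{p. p permutes {..<Suc 0}} = {id}" by (simp add: lessThan_Suc)
  then show ?thesis by (simp add: minor_def sign_id)
qed

lemma minor_pair:
  assumes "i < j" "k < l"
  shows "minor g {i, j} {k, l} = g $ i $ k * g $ j $ l - g $ i $ l * g $ j $ k"
proof -
  have perm: "{p. p permutes {..<2::nat}} = {id, Transposition.transpose 0 1}"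
  proof -
    have "{..<2::nat} = {0, 1}" by auto
    then show ?thesis by (auto simp: permutes_doubleton_iff)
  qed
  have sl: "sorted_list_of_set {i, j} = [i, j]" "sorted_list_of_set {k, l} = [k, l]"
    using assms by (auto simp: sorted_list_of_set_unique[symmetric] sorted_list_of_set.sorted_key_list_of_set_insert insort_is_Cons)
  have card: "card {i, j} = 2" using assms by simp
  have "(id :: nat \<Rightarrow> nat) \<noteq> Transposition.transpose 0 1"
    by (metis id_apply transpose_apply_first zero_neq_one)
  moreover have "{..<2::nat} = {0, 1}" by auto
  ultimately show ?thesis
    unfolding minor_def card perm sl
    by (simp add: sign_id sign_swap_id transpose_apply_first transpose_apply_second)
qed

lemma opnorm_ge_entry: "\<bar>M $ i $ j\<bar> \<le> opnorm M"
  by (rule matrix_component_le_onorm)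

lemma opnorm_le_entries:
  fixes M :: "real^'n^'m"
  assumes "\<And>i j. \<bar>M $ i $ j\<bar> \<le> c"
  shows "opnorm M \<le> real CARD('m) * real CARD('n) * c"
  using assms by (rule onorm_le_matrix_component)

lemma norm_le_entries:
  fixes M :: "real^'n^'m"
  assumes "\<And>i j. \<bar>M $ i $ j\<bar> \<le> c"
  shows "norm M \<le> real CARD('m) * real CARD('n) * c"
proof -
  have "norm M \<le> (\<Sum>i\<in>UNIV. norm (M $ i))" unfolding norm_vec_def by (rule L2_set_le_sum) simp
  also have "\<dots> \<le> (\<Sum>i\<in>(UNIV::'m set). real CARD('n) * c)"
  proof (rule sum_mono)
    fix i
    have "norm (M $ i) \<le> (\<Sum>j\<in>UNIV. norm (M $ i $ j))" unfolding norm_vec_def by (rule L2_set_le_sum) simp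
    also have "\<dots> \<le> (\<Sum>j\<in>(UNIV::'n set). c)" by (rule sum_mono) (simp add: assms)
    finally show "norm (M $ i) \<le> real CARD('n) * c" by simp
  qed
  finally show ?thesis by simp
qed

lemma entry_le_norm: "\<bar>M $ i $ j\<bar> \<le> norm (M :: real^'n^'m)"
  using order_trans[OF component_le_norm_cart Finite_Cartesian_Product.norm_nth_le] by blast

text \<open>Entries bound both norms up to factors that depend on the dimension only, and such
  factors vanish in the limit of \<open>ln / n\<close>. This links the exponents, defined by
  operator norms of exterior powers, with the growth processes.\<close>

lemma opnorm_ext_power_1:
  obtains c where "0 < c"
    "\<And>g :: real^('m::{finite,linorder})^('m::{finite,linorder}). norm g \<le> c * opnorm (ext_power 1 g)"
    "\<And>g :: real^('m::{finite,linorder})^('m::{finite,linorder}). opnorm (ext_power 1 g) \<le> c * norm g"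
proof -
  define c where "c = real CARD('m) * real CARD('m) + real CARD('m set) * real CARD('m set)"
  have c: "real CARD('m) * real CARD('m) \<le> c" "real CARD('m set) * real CARD('m set) \<le> c" "0 < c"
    by (auto simp: c_def intro: add_pos_pos)
  have "norm g \<le> c * opnorm (ext_power 1 g)" for g :: "real^('m::{finite,linorder})^('m::{finite,linorder})"
  proof -
    have "\<bar>g $ i $ j\<bar> \<le> opnorm (ext_power 1 g)" for i j
    proof -
      have "ext_power 1 g $ {i} $ {j} = g $ i $ j" by (simp add: ext_power_def minor_singleton)
      then show ?thesis using opnorm_ge_entry[of "ext_power 1 g" "{i}" "{j}"] by simp
    qed
    then have "norm g \<le> real CARD('m) * real CARD('m) * opnorm (ext_power 1 g)" by (rule norm_le_entries)
    also have "\<dots> \<le> c * opnorm (ext_power 1 g)"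
      by (rule mult_right_mono[OF c(1)]) (rule order_trans[OF abs_ge_zero opnorm_ge_entry[of _ undefined undefined]])
    finally show ?thesis .
  qed
  moreover have "opnorm (ext_power 1 g) \<le> c * norm g" for g :: "real^('m::{finite,linorder})^('m::{finite,linorder})"
  proof -
    have "\<bar>ext_power 1 g $ I $ J\<bar> \<le> norm g" for I J
      by (auto simp: ext_power_def card_1_singleton_iff minor_singleton entry_le_norm)
    then have "opnorm (ext_power 1 g) \<le> real CARD('m set) * real CARD('m set) * norm g" by (rule opnorm_le_entries)
    also have "\<dots> \<le> c * norm g" by (rule mult_right_mono[OF c(2)]) simp
    finally show ?thesis .
  qed
  ultimately show ?thesis using c(3) that by blast
qed

lemma opnorm_ext_power_2:
  obtains c where "0 < c"
    "\<And>g :: real^('m::{finite,linorder})^('m::{finite,linorder}). wedge_norm g \<le> c * opnorm (ext_power 2 g)"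
    "\<And>g :: real^('m::{finite,linorder})^('m::{finite,linorder}). opnorm (ext_power 2 g) \<le> c * wedge_norm g"
proof -
  define m where "m = real CARD('m \<times> 'm)"
  define c where "c = m * m + 2 * (real CARD('m set) * real CARD('m set))"
  have c: "m * m \<le> c" "2 * (real CARD('m set) * real CARD('m set)) \<le> c" "0 < c"
    by (auto simp: c_def m_def intro: add_nonneg_pos)
  have "wedge_norm g \<le> c * opnorm (ext_power 2 g)" for g :: "real^('m::{finite,linorder})^('m::{finite,linorder})"
  proof -
    let ?N = "opnorm (ext_power 2 g)"
    have N0: "0 \<le> ?N" by (rule order_trans[OF abs_ge_zero opnorm_ge_entry[of _ undefined undefined]])
    have ord: "\<bar>g $ i $ k * g $ j $ l - g $ i $ l * g $ j $ k\<bar> \<le> ?N" if "i < j" "k < l" for i j k l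
    proof -
      have "ext_power 2 g $ {i, j} $ {k, l} = g $ i $ k * g $ j $ l - g $ i $ l * g $ j $ k"
        using that by (simp add: ext_power_def minor_pair)
      then show ?thesis using opnorm_ge_entry[of "ext_power 2 g" "{i, j}" "{k, l}"] by simp
    qed
    have "\<bar>g $ i $ k * g $ j $ l - g $ i $ l * g $ j $ k\<bar> \<le> ?N" for i j k l
    proof -
      \<comment> \<open>Minors change sign when two rows or two columns are exchanged and vanish
        when two coincide, so increasing index pairs suffice.\<close>
      consider "i = j" | "k = l" | "i < j" "k < l" | "i < j" "l < k" | "j < i" "k < l" | "j < i" "l < k"
        by (meson linorder_neqE)
      then show ?thesis
      proof cases
        case 3 then show ?thesis by (rule ord)
      next
        case 4 then show ?thesis using ord[of i j l k] by (simp add: abs_minus_commute)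
      next
        case 5 then show ?thesis using ord[of j i k l] by (simp add: abs_minus_commute mult.commute)
      next
        case 6 then show ?thesis using ord[of j i l k] by (simp add: mult.commute)
      qed (use N0 in \<open>simp_all add: mult.commute\<close>)
    qed
    then have "norm (wedge_matrix g) \<le> real CARD('m \<times> 'm) * real CARD('m \<times> 'm) * ?N"
      by (intro norm_le_entries) (simp add: wedge_matrix_def)
    then have "wedge_norm g \<le> m * m * ?N" using norm_ge_zero[of "wedge_matrix g"] unfolding wedge_norm_def m_def by linarith
    also have "\<dots> \<le> c * ?N" by (rule mult_right_mono[OF c(1) N0])
    finally show ?thesis .
  qed
  moreover have "opnorm (ext_power 2 g) \<le> c * wedge_norm g" for g :: "real^('m::{finite,linorder})^('m::{finite,linorder})"
  proof -
    have "\<bar>ext_power 2 g $ I $ J\<bar> \<le> norm (wedge_matrix g)" for I J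
    proof (cases "card I = 2 \<and> card J = 2")
      case True
      then obtain i j k l where I: "I = {i, j}" "i \<noteq> j" and J: "J = {k, l}" "k \<noteq> l"
        by (auto simp: card_2_iff)
      obtain i j k l where I: "I = {i, j}" "i < j" and J: "J = {k, l}" "k < l"
        using I J by (metis insert_commute linorder_neqE)
      have "ext_power 2 g $ I $ J = wedge_matrix g $ (i, j) $ (k, l)"
        using True I J by (simp add: ext_power_def minor_pair wedge_matrix_def)
      then show ?thesis using entry_le_norm[of "wedge_matrix g" "(i, j)" "(k, l)"] by simp
    next
      case False
      then have "ext_power 2 g $ I $ J = 0" by (auto simp: ext_power_def)
      then show ?thesis by simp
    qed
    then have "opnorm (ext_power 2 g) \<le> real CARD('m set) * real CARD('m set) * norm (wedge_matrix g)" by (rule opnorm_le_entries)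
    also have "\<dots> = 2 * (real CARD('m set) * real CARD('m set)) * wedge_norm g" by (simp add: wedge_norm_def)
    also have "\<dots> \<le> c * wedge_norm g" by (rule mult_right_mono[OF c(2) wedge_norm_nonneg])
    finally show ?thesis .
  qed
  ultimately show ?thesis using c(3) that by blast
qed

lemma Lyap_Lambda_eqI:
  assumes "prob_space P"
    and ae: "AE x in P. (\<lambda>n. elog (opnorm (ext_power j (iterate A n x))) / ereal (real n)) \<longlonglongrightarrow> l"
  shows "Lyap_Lambda P A j = l"
  unfolding Lyap_Lambda_def
proof (rule the_equality)
  show "AE x in P. (\<lambda>n. elog (opnorm (ext_power j (iterate A n x))) / ereal (real n)) \<longlonglongrightarrow> l" by (rule ae)
  fix l' assume "AE x in P. (\<lambda>n. elog (opnorm (ext_power j (iterate A n x))) / ereal (real n)) \<longlonglongrightarrow> l'"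
  with ae have "AE x in P. l' = l"
    by eventually_elim (rule LIMSEQ_unique)
  then show "l' = l" by (simp only: prob_space.AE_const[OF assms(1)])
qed

lemma elog_growth_tendsto:
  fixes F G :: "nat \<Rightarrow> real"
  assumes c: "0 < c" and FG: "\<And>n. n \<ge> 1 \<Longrightarrow> F n \<le> c * G n" "\<And>n. n \<ge> 1 \<Longrightarrow> G n \<le> c * F n"
    and pos: "\<And>n. n \<ge> 1 \<Longrightarrow> 0 < F n" and lim: "(\<lambda>n. ln (F n) / real n) \<longlonglongrightarrow> r"
  shows "(\<lambda>n. elog (G n) / ereal (real n)) \<longlonglongrightarrow> ereal r"
proof -
  have G: "0 < G n" if "n \<ge> 1" for n
    using pos[OF that] FG(1)[OF that] c by (metis less_le_trans zero_less_mult_pos)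
  have "(\<lambda>n. ln (G n) / real n - ln (F n) / real n) \<longlonglongrightarrow> 0"
  proof (rule tendsto_rabs_zero_cancel, rule tendsto_sandwich[OF _ _ tendsto_const])
    show "(\<lambda>n. \<bar>ln c\<bar> / real n) \<longlonglongrightarrow> 0" by (rule lim_const_over_n)
    have "\<bar>ln (G n) / real n - ln (F n) / real n\<bar> \<le> \<bar>ln c\<bar> / real n" if n: "n \<ge> 1" for n
    proof -
      have "ln (F n) \<le> ln c + ln (G n)"
        using FG(1)[OF n] pos[OF n] G[OF n] c by (simp flip: ln_mult_pos)
      moreover have "ln (G n) \<le> ln c + ln (F n)"
        using FG(2)[OF n] pos[OF n] G[OF n] c by (simp flip: ln_mult_pos)
      ultimately have "\<bar>ln (G n) - ln (F n)\<bar> \<le> \<bar>ln c\<bar>" by linarith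
      then have "\<bar>ln (G n) - ln (F n)\<bar> / real n \<le> \<bar>ln c\<bar> / real n" by (rule divide_right_mono) simp
      then show ?thesis by (simp add: abs_divide diff_divide_distrib[symmetric])
    qed
    then show "\<forall>\<^sub>F n in sequentially. \<bar>ln (G n) / real n - ln (F n) / real n\<bar> \<le> \<bar>ln c\<bar> / real n"
      by (intro eventually_sequentiallyI)
  qed simp
  from tendsto_add[OF this lim] have "(\<lambda>n. ln (G n) / real n) \<longlonglongrightarrow> r" by simp
  then have "(\<lambda>n. ereal (ln (G n) / real n)) \<longlonglongrightarrow> ereal r" by (rule tendsto_ereal)
  moreover have "\<forall>\<^sub>F n in sequentially. ereal (ln (G n) / real n) = elog (G n) / ereal (real n)"
    using eventually_ge_at_top[of 1]
  proof eventually_elim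
    case (elim n)
    then show ?case using G[of n] by (simp add: elog_def)
  qed
  ultimately show ?thesis by (rule Lim_transform_eventually)
qed

section \<open>The two-sided chain\<close>

lemma (in markov_kernel) cylinder_weight_eq_path_prob:
  "cylinder_weight n E (\<lambda>_. 1) x = path_prob K (map E [0..<Suc n]) x"
proof (induction n arbitrary: E x)
  case 0
  show ?case using prob_space.emeasure_space_1[OF prob_space_K[of x]] by simp
next
  case (Suc n)
  have "map E [0..<Suc (Suc n)] = E 0 # map (\<lambda>i. E (Suc i)) [0..<Suc n]"
    by (simp only: upt_conv_Cons[OF zero_less_Suc] list.map map_Suc_upt[symmetric] map_map o_def)
  then show ?case by (simp only: cylinder_weight.simps Suc.IH path_prob.simps)
qed

context mixing_chain
begin

context
  fixes P :: "(int \<Rightarrow> 'a) measure"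
  assumes P: "stationary_chain_law K \<mu> P"
begin

lemma prob_space_P: "prob_space P"
  and sets_P: "sets P = sets (Pi\<^sub>M UNIV (\<lambda>_::int. borel))"
  and cylinder_P: "set Ss \<subseteq> sets borel \<Longrightarrow>
    emeasure P {x \<in> space P. \<forall>i<length Ss. x (s + int i) \<in> Ss ! i} = (\<integral>\<^sup>+ x. path_prob K Ss x \<partial>\<mu>)"
  using P by (auto simp: stationary_chain_law_def)

lemma half_line_measurable: "(\<lambda>x i. x (s + int i)) \<in> P \<rightarrow>\<^sub>M path_space"
  unfolding measurable_cong_sets[OF sets_P refl]
  by (rule measurable_PiM_single') (auto intro: measurable_component_singleton)

text \<open>Carries almost sure statements about the one-sided chain over to \<open>P\<close>, from
  any integer starting time.\<close>

lemma distr_half_line: "distr P path_space (\<lambda>x i. x (s + int i)) = stationary_law"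
proof (rule path_measure_eqI)
  interpret P: prob_space P by (rule prob_space_P)
  show "finite_measure (distr P path_space (\<lambda>x i. x (s + int i)))"
    by (rule prob_space.finite_measure) (rule P.prob_space_distr[OF half_line_measurable])
  fix n and E :: "nat \<Rightarrow> 'a set" assume E: "\<And>i. E i \<in> sets borel"
  let ?S = "{\<omega>. \<forall>i<Suc n. \<omega> i \<in> E i}" and ?Ss = "map E [0..<Suc n]"
  have S: "?S \<in> sets path_space" by (rule cylinder_measurable[OF E])
  have "emeasure (distr P path_space (\<lambda>x i. x (s + int i))) ?S = emeasure P ((\<lambda>x i. x (s + int i)) -` ?S \<inter> space P)"
    by (rule emeasure_distr[OF half_line_measurable S])
  also have "(\<lambda>x i. x (s + int i)) -` ?S \<inter> space P = {x \<in> space P. \<forall>i<length ?Ss. x (s + int i) \<in> ?Ss ! i}"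
    by (auto simp: nth_append simp del: upt_Suc)
  also have "emeasure P \<dots> = (\<integral>\<^sup>+ x. path_prob K ?Ss x \<partial>\<mu>)"
    by (rule cylinder_P) (use E in auto)
  also have "\<dots> = (\<integral>\<^sup>+x. emeasure (path_law x) ?S \<partial>\<mu>)"
    by (simp only: emeasure_path_law_cylinder[OF E] cylinder_weight_eq_path_prob)
  also have "\<dots> = (\<integral>\<^sup>+x. \<integral>\<^sup>+\<omega>. indicator ?S \<omega> \<partial>path_law x \<partial>\<mu>)"
    using S by simp
  also have "\<dots> = (\<integral>\<^sup>+\<omega>. indicator ?S \<omega> \<partial>stationary_law)"
    by (rule nn_integral_stationary_law[symmetric]) (use S in simp)
  also have "\<dots> = emeasure stationary_law ?S" using S by simp
  finally show "emeasure (distr P path_space (\<lambda>x i. x (s + int i))) ?S = emeasure stationary_law ?S" .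
qed auto

lemma AE_half_line:
  assumes "AE \<omega> in stationary_law. Q \<omega>"
  shows "AE x in P. Q (\<lambda>i. x (s + int i))"
  by (rule AE_distrD[OF half_line_measurable]) (simp only: distr_half_line assms)

end

end

lemma iterate_eq_path_iterate: "iterate A n x = path_iterate A n (\<lambda>i. x (0 + int i))"
  by (induction n) (simp_all add: add.commute)

section \<open>From slow subspaces to a section over the two-sided chain\<close>

context bounded_cocycle
begin

lemma residual_joint_measurable: "(\<lambda>p. residual (fst p) (snd p)) \<in> borel_measurable (path_space \<Otimes>\<^sub>M borel)"
proof (rule borel_measurable_LIMSEQ_real[where u="\<lambda>k p. tail_sup (fst p) (snd p) k"])
  have [measurable]: "(\<lambda>p. path_iterate A n (fst p)) \<in> borel_measurable (path_space \<Otimes>\<^sub>M borel)" for n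
    by (rule measurable_compose[OF measurable_fst measurable_iterate])
  have [measurable]: "(\<lambda>p. ratio (fst p) (snd p) n) \<in> borel_measurable (path_space \<Otimes>\<^sub>M borel)" for n
    unfolding ratio_def by measurable
  show "(\<lambda>p. tail_sup (fst p) (snd p) k) \<in> borel_measurable (path_space \<Otimes>\<^sub>M borel)" for k
    unfolding tail_sup_def by (rule borel_measurable_cSUP) (simp_all add: ratio_bdd)
qed (rule tail_sup_tendsto)

lemma mean_residual_joint_measurable: "(\<lambda>p. mean_residual (fst p) (snd p)) \<in> borel_measurable (borel \<Otimes>\<^sub>M borel)"
  unfolding mean_residual_def
proof (rule integral_measurable_subprob_algebra2[where N=path_space])
  have "(\<lambda>q. (snd q, snd (fst q))) \<in> ((borel :: 'a measure) \<Otimes>\<^sub>M borel) \<Otimes>\<^sub>M path_space \<rightarrow>\<^sub>M path_space \<Otimes>\<^sub>M (borel :: (real^'m) measure)"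
    by measurable
  from measurable_compose[OF this residual_joint_measurable]
  show "(\<lambda>(p :: 'a \<times> (real^'m), \<omega>). residual \<omega> (snd p)) \<in> borel_measurable ((borel \<Otimes>\<^sub>M borel) \<Otimes>\<^sub>M path_space)"
    by (simp only: case_prod_beta' fst_conv snd_conv)
qed measurable

text \<open>A manifestly measurable form of the condition that \<open>A z\<close> maps the slow
  subspace of the first state onto that of the second: the dimensions agree, and the projected basis
  vectors, which span the first subspace, are sent into the second, written as the kernel of
  \<open>mean_residual\<close>.\<close>

definition aligned :: "'a \<times> 'a \<Rightarrow> bool" where
  "aligned z \<longleftrightarrow> real (dim (slow (fst z))) = real (dim (slow (snd z))) \<and>
    (\<forall>j. mean_residual (snd z) (A z *v (proj_matrix (slow (fst z)) *v axis j 1)) = 0)"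

lemma aligned_measurable: "Measurable.pred (borel \<Otimes>\<^sub>M borel) aligned"
proof -
  have [measurable]: "A \<in> borel_measurable (borel \<Otimes>\<^sub>M borel)"
    using A_measurable by (simp add: borel_prod)
  have proj: "(\<lambda>x. proj_matrix (slow x)) \<in> borel_measurable borel"
    using measurable_compose[OF slow_measurable(1)[unfolded grassmannian_def], of proj_matrix borel]
    by (simp add: measurable_vimage_algebra1)
  note [measurable] = measurable_compose[OF measurable_fst proj]
    measurable_compose[OF measurable_fst slow_measurable(2)] measurable_compose[OF measurable_snd slow_measurable(2)]
  have [measurable]: "(\<lambda>z. mean_residual (snd z) (A z *v (proj_matrix (slow (fst z)) *v axis j 1))) \<in> borel_measurable (borel \<Otimes>\<^sub>M borel)" for j
  proof -
    have "(\<lambda>z. (snd z, A z *v (proj_matrix (slow (fst z)) *v axis j 1))) \<in> borel \<Otimes>\<^sub>M borel \<rightarrow>\<^sub>M borel \<Otimes>\<^sub>M (borel :: (real^'m) measure)"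
      by measurable
    from measurable_compose[OF this mean_residual_joint_measurable] show ?thesis by simp
  qed
  show ?thesis unfolding aligned_def[abs_def] by measurable
qed

lemma proj_matrix_slow: "proj_matrix (slow x) *v v = closest_point (slow x) v"
proof -
  have "linear (closest_point (slow x))"
  proof (rule linearI)
    show "closest_point (slow x) (u + w) = closest_point (slow x) u + closest_point (slow x) w" for u w
      by (rule closest_point_add[OF subspace_slow])
    show "closest_point (slow x) (c *\<^sub>R u) = c *\<^sub>R closest_point (slow x) u" for c u
    proof (rule closest_point_subspace_eqI[OF subspace_slow])
      have cp: "closest_point (slow x) u \<in> slow x"
        using closed_subspace[OF subspace_slow] subspace_0[OF subspace_slow] by (intro closest_point_in_set) auto
      then show "c *\<^sub>R closest_point (slow x) u \<in> slow x" by (rule subspace_scale[OF subspace_slow])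
      fix w assume w: "w \<in> slow x"
      have "closest_point (slow x) w = w" by (rule closest_point_self[OF w])
      then have "u \<bullet> w = closest_point (slow x) u \<bullet> w"
        using inner_closest_point[OF subspace_slow, of u x w] by simp
      then show "(c *\<^sub>R u - c *\<^sub>R closest_point (slow x) u) \<bullet> w = 0"
        by (simp add: inner_diff_left)
    qed
  qed
  then show ?thesis unfolding proj_matrix_def by (simp add: matrix_vector_mul(2))
qed

lemma aligned_iff: "aligned (x, y) \<longleftrightarrow> (*v) (A (x, y)) ` slow x = slow y"
proof -
  have ne: "slow x \<noteq> {}" "closed (slow x)" for x
    using closed_subspace[OF subspace_slow] subspace_0[OF subspace_slow] by auto
  show ?thesis
  proof
    assume al: "aligned (x, y)"
    have "A (x, y) *v v \<in> slow y" if v: "v \<in> slow x" for v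
    proof -
      have "v = proj_matrix (slow x) *v v" using proj_matrix_slow closest_point_self[OF v] by simp
      also have "\<dots> = proj_matrix (slow x) *v (\<Sum>j\<in>UNIV. (v $ j) *\<^sub>R axis j 1)"
        by (simp flip: scalar_mult_eq_scaleR add: basis_expansion)
      also have "\<dots> = (\<Sum>j\<in>UNIV. (v $ j) *\<^sub>R (proj_matrix (slow x) *v axis j 1))"
        by (simp add: linear_sum[OF matrix_vector_mul_linear] linear_scale[OF matrix_vector_mul_linear])
      finally have v_eq: "v = (\<Sum>j\<in>UNIV. (v $ j) *\<^sub>R (proj_matrix (slow x) *v axis j 1))" .
      have "A (x, y) *v (\<Sum>j\<in>UNIV. (v $ j) *\<^sub>R (proj_matrix (slow x) *v axis j 1)) = (\<Sum>j\<in>UNIV. (v $ j) *\<^sub>R (A (x, y) *v (proj_matrix (slow x) *v axis j 1)))"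
        by (simp add: linear_sum[OF matrix_vector_mul_linear] linear_scale[OF matrix_vector_mul_linear])
      moreover have "A (x, y) *v (proj_matrix (slow x) *v axis j 1) \<in> slow y" for j
        using al by (simp add: aligned_def slow_eq_kernel)
      ultimately have "A (x, y) *v (\<Sum>j\<in>UNIV. (v $ j) *\<^sub>R (proj_matrix (slow x) *v axis j 1)) \<in> slow y"
        by (simp only:) (intro subspace_sum subspace_scale subspace_slow)
      then show ?thesis by (simp only: v_eq[symmetric])
    qed
    then have "(*v) (A (x, y)) ` slow x \<subseteq> slow y" by auto
    then show "(*v) (A (x, y)) ` slow x = slow y"
      using al by (intro subspace_dim_equal linear_subspace_image subspace_slow)
        (simp_all add: aligned_def dim_image_slow)
  next
    assume eq: "(*v) (A (x, y)) ` slow x = slow y"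
    have "proj_matrix (slow x) *v axis j 1 \<in> slow x" for j
      unfolding proj_matrix_slow using ne by (intro closest_point_in_set) auto
    then have "A (x, y) *v (proj_matrix (slow x) *v axis j 1) \<in> slow y" for j using eq by blast
    moreover have "dim (slow y) = dim (slow x)" using dim_image_slow[of "(x, y)" x] eq by simp
    ultimately show "aligned (x, y)" by (simp add: aligned_def slow_eq_kernel)
  qed
qed

lemma zero_level_if_irreducible:
  assumes P: "stationary_chain_law K \<mu> P" and irr: "irreducible_cocycle \<mu> P A"
  shows "zero_level = 0"
proof (rule ccontr)
  assume "zero_level \<noteq> 0"
  then have "zero_level = 1" using zero_level_0_or_1 by blast
  note sec = invariant_section_if_zero_level[OF this]
  have al: "AE x in \<mu>. AE y in K x. aligned (x, y)" using sec(2) by (simp only: aligned_iff)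
  have m: "Measurable.pred path_space (\<lambda>\<omega>. aligned (\<omega> 0, \<omega> 1))"
    by (rule measurable_compose[OF _ aligned_measurable]) measurable
  have "AE \<omega> in stationary_law. aligned (\<omega> 0, \<omega> 1)"
    unfolding AE_stationary_law[OF m] using al
  proof eventually_elim
    case (elim x)
    show ?case
      unfolding AE_path_law_unfold[OF m] using elim
    proof eventually_elim
      case (elim y)
      show ?case using AE_path_law_0 by eventually_elim (use elim in simp)
    qed
  qed
  \<comment> \<open>\<open>n\<close> ranges over all integers, so the half-line is started at time
    \<open>n - 1\<close>; countability then combines them.\<close>
  then have ae: "AE x in P. aligned (x (n - 1), x n)" for n
    using AE_half_line[OF P, of "\<lambda>\<omega>. aligned (\<omega> 0, \<omega> 1)" "n - 1"] by simp
  then have "AE x in P. \<forall>n. aligned (x (n - 1), x n)"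
    by (subst AE_all_countable) blast
  then have "invariant_section P A slow"
    unfolding invariant_section_def aligned_iff[symmetric] using sec(1) by blast
  then show False using irr sec(3) unfolding irreducible_cocycle_def by blast
qed

end

lemma (in mixing_chain) Lyap_Lambda_eq_rate:
  fixes A :: "'a \<times> 'a \<Rightarrow> real^('m::{finite,linorder})^('m::{finite,linorder})"
  assumes P: "stationary_chain_law K \<mu> P"
    and process: "subadditive_process K \<mu> C \<rho> a c"
    and a: "\<And>n \<omega>. n \<ge> 1 \<Longrightarrow> a n \<omega> = ln (F (path_iterate A n \<omega>))"
    and pos: "\<And>n \<omega>. n \<ge> 1 \<Longrightarrow> 0 < F (path_iterate A n \<omega>)"
    and d: "0 < d" "\<And>g. F g \<le> d * opnorm (ext_power j g)" "\<And>g. opnorm (ext_power j g) \<le> d * F g"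
  shows "Lyap_Lambda P A j = ereal (subadditive_process.rate K \<mu> a)"
proof (rule Lyap_Lambda_eqI[OF prob_space_P[OF P]])
  interpret subadditive_process K \<mu> C \<rho> a c by (rule process)
  have m: "Measurable.pred path_space (\<lambda>\<omega>. (\<lambda>n. a n \<omega> / real n) \<longlonglongrightarrow> rate)" by measurable
  have "AE \<omega> in stationary_law. (\<lambda>n. a n \<omega> / real n) \<longlonglongrightarrow> rate"
    unfolding AE_stationary_law[OF m] using kingman by simp
  from AE_half_line[OF P this, of 0]
  show "AE x in P. (\<lambda>n. elog (opnorm (ext_power j (iterate A n x))) / ereal (real n)) \<longlonglongrightarrow> ereal rate"
  proof eventually_elim
    case (elim x)
    let ?F = "\<lambda>n. F (iterate A n x)"
    have "\<forall>\<^sub>F n in sequentially. a n (\<lambda>i. x (0 + int i)) / real n = ln (?F n) / real n"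
      using eventually_ge_at_top[of 1] by eventually_elim (simp only: a iterate_eq_path_iterate)
    with elim have lim: "(\<lambda>n. ln (?F n) / real n) \<longlonglongrightarrow> rate" by (rule Lim_transform_eventually)
    have pos': "0 < ?F n" if "n \<ge> 1" for n
      unfolding iterate_eq_path_iterate by (rule pos[OF that])
    show ?case by (rule elog_growth_tendsto[OF d(1) d(2) d(3) pos' lim])
  qed
qed

lemma Lyap_Lambda_0:
  fixes A :: "'a \<times> 'a \<Rightarrow> real^('m::{finite,linorder})^('m::{finite,linorder})"
  assumes "prob_space P"
  shows "Lyap_Lambda P A 0 = 0"
proof -
  define I :: "real^('m::{finite,linorder})^('m::{finite,linorder})" where "I = mat 1"
  have ext: "ext_power 0 g = ext_power 0 I" for g :: "real^('m::{finite,linorder})^('m::{finite,linorder})"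
    by (auto simp: ext_power_def minor_empty vec_eq_iff)
  have "ext_power 0 I $ {} $ {} = 1" by (simp add: ext_power_def minor_empty)
  then have c: "1 \<le> opnorm (ext_power 0 I)" using opnorm_ge_entry[of "ext_power 0 I" "{}" "{}"] by simp
  have "(\<lambda>n. elog (opnorm (ext_power 0 I)) / ereal (real n)) \<longlonglongrightarrow> ereal 0"
    by (rule elog_growth_tendsto[where c="opnorm (ext_power 0 I)" and F="\<lambda>_. 1"])
      (use c mult_mono[OF c c] in auto)
  then have "AE x in P. (\<lambda>n. elog (opnorm (ext_power 0 (iterate A n x))) / ereal (real n)) \<longlonglongrightarrow> ereal 0"
    by (simp add: ext[of "iterate A n x" for n x])
  from Lyap_Lambda_eqI[OF assms this] show ?thesis by (simp add: zero_ereal_def)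
qed

section \<open>Lyapunov exponents as rates of growth processes\<close>

context
  fixes K :: "'a::polish_space \<Rightarrow> 'a measure" and \<mu> C \<rho> P
    and A :: "'a \<times> 'a \<Rightarrow> real^('m::{finite,linorder})^('m::{finite,linorder})" and b
  assumes P: "stationary_chain_law K \<mu> P" and bounded: "bounded_cocycle K \<mu> C \<rho> A b"
begin

interpretation bounded_cocycle K \<mu> C \<rho> A b by (rule bounded)

lemma Lyap_Lambda_1: "Lyap_Lambda P A 1 = ereal norm_growth.rate"
proof -
  obtain d where "0 < d" "\<And>g :: real^('m::{finite,linorder})^('m::{finite,linorder}). norm g \<le> d * opnorm (ext_power 1 g)"
    "\<And>g :: real^('m::{finite,linorder})^('m::{finite,linorder}). opnorm (ext_power 1 g) \<le> d * norm g"
    by (rule opnorm_ext_power_1) (rule that)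
  then show ?thesis
    by (intro Lyap_Lambda_eq_rate[OF P norm_growth_process, where F=norm and d=d] norm_iterate_pos)
      (simp_all add: growth_def)
qed

lemma Lyap_1: "Lyap P A 1 = ereal norm_growth.rate"
  unfolding Lyap_def Lyap_Lambda_1 by (simp add: Lyap_Lambda_0[OF prob_space_P[OF P]])

lemma Lyap_2:
  assumes "CARD('m) \<ge> 2"
  shows "Lyap P A 2 = ereal (subadditive_process.rate K \<mu> (growth wedge_norm) - norm_growth.rate)"
proof -
  obtain d where "0 < d" "\<And>g :: real^('m::{finite,linorder})^('m::{finite,linorder}). wedge_norm g \<le> d * opnorm (ext_power 2 g)"
    "\<And>g :: real^('m::{finite,linorder})^('m::{finite,linorder}). opnorm (ext_power 2 g) \<le> d * wedge_norm g"
    by (rule opnorm_ext_power_2) (rule that)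
  then have "Lyap_Lambda P A 2 = ereal (subadditive_process.rate K \<mu> (growth wedge_norm))"
    by (intro Lyap_Lambda_eq_rate[OF P wedge_growth_process(1)[OF assms], where F=wedge_norm and d=d]
        wedge_growth_process(2)[OF assms]) (simp_all add: growth_def)
  moreover have "Lyap P A 2 = Lyap_Lambda P A 2 - Lyap_Lambda P A 1"
    unfolding Lyap_def by simp
  ultimately show ?thesis by (simp only: Lyap_Lambda_1 ereal_minus(1))
qed

text \<open>In terms of exterior powers the gap reads \<Lambda>_2 - \<Lambda>_1 < \<Lambda>_1, which
  is what the drift of angles requires. Dimension 1 is set apart, since there
  \<open>wedge_norm\<close> is 0 and has no logarithmic growth.\<close>

lemma gap_of_Lyap_less:
  assumes "Lyap P A 2 < Lyap P A 1"
  shows "CARD('m) = 1 \<or> CARD('m) \<ge> 2 \<and> subadditive_process.rate K \<mu> (growth wedge_norm) < 2 * norm_growth.rate"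
proof (cases "CARD('m) = 1")
  case False
  then have "CARD('m) \<ge> 2" using zero_less_card_finite[where 'a='m] by linarith
  then show ?thesis using assms unfolding Lyap_1 by (simp add: Lyap_2)
qed simp

end

section \<open>Neighbourhoods of a cocycle\<close>

lemma norm_column_le_opnorm: "norm (M *v axis i 1) \<le> opnorm (M :: real^'n^'m)"
  using onorm[OF matrix_vector_mul_bounded_linear, of M "axis i 1"] by simp

lemma opnorm_le_norm: "opnorm M \<le> norm (M :: real^'n^'m)"
  by (rule onorm_bound) (simp_all add: norm_matrix_vector_mult_le)

lemma norm_le_opnorm: "norm M \<le> real CARD('n) * opnorm (M :: real^'n^'m)"
proof -
  have "norm M \<le> (\<Sum>i\<in>UNIV. norm (M *v axis i 1))" by (rule norm_le_sum_columns)
  also have "\<dots> \<le> (\<Sum>i\<in>(UNIV::'n set). opnorm M)" by (rule sum_mono) (rule norm_column_le_opnorm)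
  finally show ?thesis by simp
qed

lemma opnorm_diff_le_d_inf:
  assumes "A \<in> cocycles" "B \<in> cocycles"
  shows "opnorm (A z - B z) \<le> d_inf A B"
proof -
  obtain a where a: "\<And>z. norm (A z) \<le> a" using assms(1) unfolding cocycles_def bounded_iff by blast
  obtain b where b: "\<And>z. norm (B z) \<le> b" using assms(2) unfolding cocycles_def bounded_iff by blast
  have "opnorm (A z - B z) \<le> a + b" for z
    using opnorm_le_norm[of "A z - B z"] norm_triangle_ineq4[of "A z" "B z"] a[of z] b[of z] by linarith
  then have "bdd_above (range (\<lambda>z. opnorm (A z - B z)))" by (auto simp: bdd_above_def)
  then show ?thesis unfolding d_inf_def by (rule cSUP_upper[OF UNIV_I])
qed

lemma norm_diff_le_d_inf:
  fixes A B :: "'a::topological_space \<times> 'a \<Rightarrow> real^'m^'m"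
  assumes "A \<in> cocycles" "B \<in> cocycles"
  shows "norm (B z - A z) \<le> real CARD('m) * d_inf A B"
proof -
  have "norm (B z - A z) \<le> real CARD('m) * opnorm (A z - B z)"
    using norm_le_opnorm[of "A z - B z"] by (simp add: norm_minus_commute)
  also have "\<dots> \<le> real CARD('m) * d_inf A B"
    by (rule mult_left_mono[OF opnorm_diff_le_d_inf[OF assms]]) simp
  finally show ?thesis .
qed

text \<open>The bound on the inverse says that \<open>M\<close> shrinks no vector by more than a
  factor \<open>c\<close>. A perturbation of size \<open>1 / (2 * c)\<close> uses up half of this,
  so \<open>N\<close> shrinks no vector by more than \<open>2 * c\<close>; the dimension enters when
  the columns of the inverse are assembled.\<close>

lemma norm_matrix_inv_perturbation:
  fixes M N :: "real^'m^'m"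
  assumes inv: "invertible M" "invertible N" and c: "norm (matrix_inv M) \<le> c" "0 < c"
    and diff: "norm (N - M) \<le> 1 / (2 * c)"
  shows "norm (matrix_inv N) \<le> real CARD('m) * (2 * c)"
proof -
  have expand: "norm v \<le> 2 * c * norm (N *v v)" for v
  proof -
    have "norm v = norm (matrix_inv M *v (M *v v))"
      using inv(1) by (simp add: matrix_vector_mul_assoc matrix_inv_mult)
    also have "\<dots> \<le> c * norm (M *v v)"
      by (rule order_trans[OF norm_matrix_vector_mult_le mult_right_mono[OF c(1) norm_ge_zero]])
    also have "\<dots> = c * norm (N *v v - (N - M) *v v)" by (simp add: matrix_vector_mult_diff_rdistrib)
    also have "\<dots> \<le> c * (norm (N *v v) + 1 / (2 * c) * norm v)"
    proof (rule mult_left_mono)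
      have "norm ((N - M) *v v) \<le> 1 / (2 * c) * norm v"
        by (rule order_trans[OF norm_matrix_vector_mult_le mult_right_mono[OF diff norm_ge_zero]])
      then show "norm (N *v v - (N - M) *v v) \<le> norm (N *v v) + 1 / (2 * c) * norm v"
        using norm_triangle_ineq4[of "N *v v" "(N - M) *v v"] by linarith
    qed (use c in simp)
    also have "\<dots> = c * norm (N *v v) + norm v / 2" using c(2) by (simp add: field_simps)
    finally show ?thesis by simp
  qed
  have "norm (matrix_inv N *v axis i 1) \<le> 2 * c" for i
  proof -
    have "N *v (matrix_inv N *v axis i 1) = axis i 1"
      using inv(2) by (simp add: matrix_vector_mul_assoc matrix_inv_mult)
    then show ?thesis using expand[of "matrix_inv N *v axis i 1"] by simp
  qed
  then have "(\<Sum>i\<in>UNIV. norm (matrix_inv N *v axis i 1)) \<le> (\<Sum>i\<in>(UNIV :: 'm set). 2 * c)"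
    by (intro sum_mono)
  then show ?thesis using norm_le_sum_columns[of "matrix_inv N"] by simp
qed

lemma (in mixing_chain) bounded_cocycle_nearby:
  fixes A :: "'a \<times> 'a \<Rightarrow> real^'m^'m"
  assumes A: "A \<in> cocycles"
  obtains b \<delta> where "0 < \<delta>"
    "\<And>B. B \<in> cocycles \<Longrightarrow> (\<And>z. norm (B z - A z) \<le> \<delta>) \<Longrightarrow> bounded_cocycle K \<mu> C \<rho> B b"
proof -
  obtain r where r: "\<And>z. norm (A z) \<le> r" using A unfolding cocycles_def bounded_iff by blast
  obtain s where s: "\<And>z. norm (matrix_inv (A z)) \<le> s" using A unfolding cocycles_def bounded_iff by blast
  define r' s' where "r' = \<bar>r\<bar>" and "s' = \<bar>s\<bar> + 1"
  have r': "norm (A z) \<le> r'" "0 \<le> r'" and s': "norm (matrix_inv (A z)) \<le> s'" "0 < s'" for z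
    using r[of z] s[of z] by (auto simp: r'_def s'_def)
  \<comment> \<open>The argument of the logarithm dominates both the bound \<open>r' + 1\<close> for
    a perturbed matrix and the one for its inverse, and it is at least 1, so that \<open>b\<close>
    is nonnegative.\<close>
  define b where "b = ln (r' + 1 + real CARD('m) * (2 * s'))"
  have arg: "1 \<le> r' + 1 + real CARD('m) * (2 * s')" using r'(2) s'(2) by simp
  then have b: "exp b = r' + 1 + real CARD('m) * (2 * s')" "0 \<le> b" by (simp_all add: b_def)
  show ?thesis
  proof (rule that[of "min 1 (1 / (2 * s'))" b])
    show "0 < min 1 (1 / (2 * s'))" using s'(2) by simp
    fix B :: "'a \<times> 'a \<Rightarrow> real^'m^'m"
    assume B: "B \<in> cocycles" and near: "\<And>z. norm (B z - A z) \<le> min 1 (1 / (2 * s'))"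
    have inv: "invertible (A z)" "invertible (B z)" for z using A B by (simp_all add: cocycles_def del: split_paired_All)
    show "bounded_cocycle K \<mu> C \<rho> B b"
    proof
      fix z
      show "norm (B z) \<le> exp b"
        using near[of z] r'(1)[of z] norm_triangle_sub[of "B z" "A z"] s'(2) unfolding b(1) min.bounded_iff
        by (auto intro: order_trans[of _ "r' + 1"])
      have "norm (matrix_inv (B z)) \<le> real CARD('m) * (2 * s')"
        by (rule norm_matrix_inv_perturbation[OF inv s'(1)[of z] s'(2)]) (use near[of z] in simp)
      then show "norm (matrix_inv (B z)) \<le> exp b" using r'(2) unfolding b(1) by linarith
    qed (use B inv b(2) in \<open>simp_all add: cocycles_def del: split_paired_All\<close>)
  qed
qed

lemma (in mixing_chain) mixing_time_exists:
  obtains k where "1 \<le> k" "2 * (C * \<rho> ^ k) \<le> 1 / 2"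
proof -
  have "(\<lambda>k. 2 * (C * \<rho> ^ k)) \<longlonglongrightarrow> 2 * (C * 0)"
    using \<rho>_pos \<rho>_less_1 by (intro tendsto_intros LIMSEQ_power_zero) simp
  then have "\<forall>\<^sub>F k in sequentially. 2 * (C * \<rho> ^ k) < 1 / 2" by (rule order_tendstoD) simp
  then obtain k0 where "\<And>k. k \<ge> k0 \<Longrightarrow> 2 * (C * \<rho> ^ k) < 1 / 2" unfolding eventually_sequentially by blast
  then show ?thesis using that[of "max k0 1"] by (simp add: less_imp_le)
qed

lemma (in mixing_chain) measure_half_line_le:
  assumes P: "stationary_chain_law K \<mu> P" and D: "D \<in> sets path_space"
    and sub: "\<And>x. x \<in> S \<Longrightarrow> (\<lambda>i. x (0 + int i)) \<in> D" and S: "S \<subseteq> space P"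
  shows "measure P S \<le> measure stationary_law D"
proof -
  interpret P: prob_space P by (rule prob_space_P[OF P])
  have "measure P S \<le> measure P ((\<lambda>x i. x (0 + int i)) -` D \<inter> space P)"
    by (rule P.finite_measure_mono[OF _ measurable_sets[OF half_line_measurable[OF P] D]]) (use S sub in auto)
  also have "\<dots> = measure (distr P path_space (\<lambda>x i. x (0 + int i))) D"
    by (rule measure_distr[OF half_line_measurable[OF P] D, symmetric])
  finally show ?thesis unfolding distr_half_line[OF P] .
qed

theorem theorem1p3:
  fixes K :: "'a::polish_space \<Rightarrow> 'a measure"
    and \<mu> :: "'a measure"
    and P :: "(int \<Rightarrow> 'a) measure"
    and A :: "'a \<times> 'a \<Rightarrow> real^('m::{finite,linorder})^('m::{finite,linorder})"
  assumes "compact (UNIV :: 'a set)"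
    and "markov_system K \<mu>"
    and "stationary_chain_law K \<mu> P"
    and "A \<in> cocycles"
    and "strongly_mixing K \<mu>"
    and "irreducible_cocycle \<mu> P A"
    and "Lyap P A 1 > Lyap P A 2"
  shows "\<exists>\<V>. cocycle_nhd A \<V> \<and>
    (\<exists>C>0. \<exists>k>0. \<exists>\<epsilon>\<^sub>0>0. \<forall>\<epsilon> B. \<forall>n::nat. 0 < \<epsilon> \<longrightarrow> \<epsilon> < \<epsilon>\<^sub>0 \<longrightarrow> B \<in> \<V> \<longrightarrow> n \<ge> 1 \<longrightarrow>
       measure P {x \<in> space P.
           \<bar>ereal (1 / real n * ln (opnorm (iterate B n x))) - Lyap P B 1\<bar> > ereal \<epsilon>}
         \<le> C * exp (- k * \<epsilon>\<^sup>2 * real n))"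
proof -
  obtain C \<rho> where "mixing_chain K \<mu> C \<rho>"
    by (rule mixing_chain_exists[OF assms(2) assms(5)])
  then interpret mixing_chain K \<mu> C \<rho> .
  note P = assms(3) and A = assms(4)
  obtain b \<delta>1 where \<delta>1: "0 < \<delta>1" and
    bounded: "\<And>B. B \<in> cocycles \<Longrightarrow> (\<And>z. norm (B z - A z) \<le> \<delta>1) \<Longrightarrow> bounded_cocycle K \<mu> C \<rho> B b"
    using bounded_cocycle_nearby[OF A] by blast
  interpret A: bounded_cocycle K \<mu> C \<rho> A b
    by (rule bounded[OF A]) (use \<delta>1 in simp)
  obtain N \<alpha> \<kappa> \<delta>2 where N: "1 \<le> N" and \<alpha>: "0 < \<alpha>" "\<alpha> \<le> 1" and \<kappa>: "0 \<le> \<kappa>" "\<kappa> < 1" and \<delta>2: "0 < \<delta>2"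
    and contraction: "\<And>B x v w. bounded_cocycle K \<mu> C \<rho> B b \<Longrightarrow> (\<And>z. norm (B z - A z) \<le> \<delta>2) \<Longrightarrow> v \<noteq> 0 \<Longrightarrow> w \<noteq> 0 \<Longrightarrow>
      (\<integral>\<omega>. angle (path_iterate B N \<omega> *v v) (path_iterate B N \<omega> *v w) powr \<alpha> \<partial>path_law x) \<le> \<kappa> * angle v w powr \<alpha>"
    using A.uniform_contraction[OF A.zero_level_if_irreducible[OF P assms(6)]
        gap_of_Lyap_less[OF P A.bounded_cocycle_axioms assms(7)]] by blast
  obtain k where k: "1 \<le> k" "2 * (C * \<rho> ^ k) \<le> 1 / 2" by (rule mixing_time_exists)
  \<comment> \<open>\<open>d_inf\<close> is built from operator norms, while
    \<open>\<delta>1\<close> and \<open>\<delta>2\<close> refer to Hilbert-Schmidt norms, which are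
    larger by at most the factor \<open>CARD('m)\<close>.\<close>
  define \<delta> where "\<delta> = min \<delta>1 \<delta>2 / real CARD('m)"
  define \<V> where "\<V> = {B \<in> cocycles. d_inf A B < \<delta>}"
  have \<delta>: "0 < \<delta>" using \<delta>1 \<delta>2 by (simp add: \<delta>_def)
  have contracting: "contracting_cocycle K \<mu> C \<rho> B b N \<alpha> \<kappa> k"
    if B: "B \<in> cocycles" and near: "\<And>z. norm (B z - A z) \<le> min \<delta>1 \<delta>2" for B
  proof -
    interpret B: bounded_cocycle K \<mu> C \<rho> B b
      by (rule bounded[OF B]) (use near in simp)
    show ?thesis
    proof
      show "(\<integral>\<omega>. angle (path_iterate B N \<omega> *v v) (path_iterate B N \<omega> *v w) powr \<alpha> \<partial>path_law x) \<le> \<kappa> * angle v w powr \<alpha>"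
        if "v \<noteq> 0" "w \<noteq> 0" for x v w
        by (rule contraction[OF B.bounded_cocycle_axioms _ that]) (use near in simp)
    qed (fact \<alpha> \<kappa> N k)+
  qed
  \<comment> \<open>\<open>A\<close> belongs to its own neighbourhood. The constants
    \<open>A.ldt_const\<close> and \<open>A.ldt_rate\<close> depend on \<open>b\<close>,
    \<open>N\<close>, \<kappa> and \<open>k\<close> but not on the cocycle, so they coincide with
    those of every \<open>B\<close> in it.\<close>
  interpret A: contracting_cocycle K \<mu> C \<rho> A b N \<alpha> \<kappa> k
    by (rule contracting[OF A]) (use \<delta>1 \<delta>2 in simp)
  have bound: "measure P {x \<in> space P. \<bar>ereal (1 / real n * ln (opnorm (iterate B n x))) - Lyap P B 1\<bar> > ereal \<epsilon>}
      \<le> A.ldt_const (real CARD('m)) * exp (- A.ldt_rate * \<epsilon>\<^sup>2 * real n)"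
    if \<epsilon>: "0 < \<epsilon>" "\<epsilon> < 1" and B: "B \<in> \<V>" and n: "n \<ge> 1" for \<epsilon> n B
  proof -
    have near: "norm (B z - A z) \<le> min \<delta>1 \<delta>2" for z
    proof -
      have "norm (B z - A z) \<le> real CARD('m) * d_inf A B"
        by (rule norm_diff_le_d_inf[OF A]) (use B in \<open>simp add: \<V>_def\<close>)
      also have "\<dots> \<le> real CARD('m) * \<delta>" using B by (intro mult_left_mono) (simp_all add: \<V>_def)
      finally show ?thesis by (simp add: \<delta>_def)
    qed
    interpret B: contracting_cocycle K \<mu> C \<rho> B b N \<alpha> \<kappa> k
      by (rule contracting[OF _ near]) (use B in \<open>simp add: \<V>_def\<close>)
    let ?D = "B.deviation_set B.norm_growth.rate n \<epsilon>"
    have opnorm_le: "opnorm M \<le> (\<Sum>i\<in>UNIV. norm (M *v axis i 1))" for M :: "real^('m::{finite,linorder})^('m::{finite,linorder})"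
      by (rule order_trans[OF opnorm_le_norm norm_le_sum_columns])
    note ld = B.large_deviations[where F=opnorm, OF norm_column_le_opnorm opnorm_le n \<epsilon>]
    have "measure P {x \<in> space P. \<bar>ereal (1 / real n * ln (opnorm (iterate B n x))) - Lyap P B 1\<bar> > ereal \<epsilon>}
        \<le> measure stationary_law ?D"
    proof (rule measure_half_line_le[OF P B.deviation_set_measurable])
      fix x assume "x \<in> {x \<in> space P. \<bar>ereal (1 / real n * ln (opnorm (iterate B n x))) - Lyap P B 1\<bar> > ereal \<epsilon>}"
      then have "\<epsilon> < \<bar>1 / real n * ln (opnorm (path_iterate B n (\<lambda>i. x (0 + int i)))) - B.norm_growth.rate\<bar>"
        unfolding Lyap_1[OF P B.bounded_cocycle_axioms] iterate_eq_path_iterate by simp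
      with ld(1) show "(\<lambda>i. x (0 + int i)) \<in> ?D" by blast
    qed blast
    also note ld(2)
    finally show ?thesis .
  qed
  have "0 < A.ldt_const (real CARD('m))" by (simp add: A.ldt_const_def)
  moreover have "cocycle_nhd A \<V>" unfolding cocycle_nhd_def using \<delta> by (auto simp: \<V>_def)
  ultimately show ?thesis using bound A.ldt_rate_pos zero_less_one by blast
qed

end
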